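(* There exists a constant $C$ that depends on $\Omega$ and on the shape regularity of $\mathcal T_h$, but is independent of $h$, such that for every $v\in[H^2(\Omega,\mathcal T_h)]^2$, \[ \begin{aligned} \|v\|_{H_h^2}^2&\le C\bigg(\|\nabla_h\epsilon_h(v)\|_{L^2}^2+\|\epsilon_h(v)\|_{L^2}^2+\|v\|_{L^2}^2 +\sum_{e\in\mathcal S(\Omega,\mathcal T_h)}h_e^{-1}\|[\![\Pi_e v]\!]\|_{L^2(e)}^2\\ &\qquad\quad+\sum_{i=1}^2\sum_{e\in\mathcal S(\Omega,\mathcal T_h)}h_e^{-1}\|[\![\Pi_e(\partial_i v)]\!]\|_{L^2(e)}^2\bigg). \end{aligned} \]
   Context: $\Omega\subset\mathbb R^2$ is a bounded polygon and $\mathcal T_h$ is a (conforming) triangulation of $\Omega$ into triangles with maximum mesh size $h$, shape-regular in the sense of Ciarlet and Raviart. $\mathcal S(\Omega,\mathcal T_h)$ is the set of all edges of $\mathcal T_h$ and $h_e$ is the length of the edge $e$. $[H^m(\Omega,\mathcal T_h)]^2=\{v\in[L^2(\Omega)]^2 : v|_T\in[H^m(T)]^2\ \forall T\in\mathcal T_h\}$, with broken norm $\|v\|_{H_h^m}=\|v\|_{L^2}+\sum_{k=1}^m\|\nabla_h^k v\|_{L^2}$, where $(\nabla_h^k v)|_T=\nabla^k(v|_T)$ and $\|\nabla_h^k v\|_{L^2}^2=\sum_{T\in\mathcal T_h}\|\nabla^k v\|_{L^2(T)}^2$. $\nabla_h=\nabla_h^1$, $\epsilon_h(v)=\frac12(\nabla_h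 v+[\nabla_h v]^T)$, and $\partial_i v$ is the elementwise partial derivative with respect to $x_i$. $[\![\cdot]\!]$ denotes the jump across the edge $e$ (on an edge contained in $\partial\Omega$, the trace); $[\![\Pi_e w]\!]$ is the jump of the one-sided projected traces. For an edge $e$ with unit tangent $t$, $\Pi_e:[L^2(e)]^2\to[P_{1,-}(e)]^2$ is the $L^2(e)$-orthogonal projection onto $[P_{1,-}(e)]^2=\{v\in[P_1(e)]^2 : v\cdot t\in \mathrm{RM}(e)\}$, where $P_1(e)$ denotes affine functions on $e$ and $\mathrm{RM}(e)$ the infinitesimal rigid motions on $e$, which for an edge in two dimensions is $P_0(e)$, the constants. *)

theory Defs
  imports "HOL-Analysis.Analysis"
begin

section \<open>Square-integrable functions\<close>

text \<open>Functions, not classes: everything below is invariant under changes on null sets.\<close>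

definition L2 :: "'a measure \<Rightarrow> ('a \<Rightarrow> 'b::euclidean_space) set" where
  "L2 M = {u \<in> borel_measurable M. integrable M (\<lambda>x. (norm (u x))\<^sup>2)}"

text \<open>On \<open>'b ^ 'n\<close> the norm is the Euclidean norm of the component norms, so for matrix- and
  tensor-valued functions this is built on the Frobenius norm.\<close>

definition l2norm :: "'a measure \<Rightarrow> ('a \<Rightarrow> 'b::euclidean_space) \<Rightarrow> real" where
  "l2norm M u = sqrt (\<integral>x. (norm (u x))\<^sup>2 \<partial>M)"

section \<open>Weak derivatives and Sobolev spaces in the plane\<close>

definition cpartial :: "2 \<Rightarrow> (real^2 \<Rightarrow> 'b::real_normed_vector) \<Rightarrow> real^2 \<Rightarrow> 'b" where
  "cpartial i f x = frechet_derivative f (at x) (axis i 1)"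

fun Ck :: "nat \<Rightarrow> (real^2 \<Rightarrow> 'b::real_normed_vector) \<Rightarrow> bool" where
  "Ck 0 f \<longleftrightarrow> continuous_on UNIV f"
| "Ck (Suc k) f \<longleftrightarrow> (\<forall>x. f differentiable at x) \<and> (\<forall>i. Ck k (cpartial i f))"

definition smooth :: "(real^2 \<Rightarrow> 'b::real_normed_vector) \<Rightarrow> bool" where
  "smooth f \<longleftrightarrow> (\<forall>k. Ck k f)"

definition test_function :: "(real^2) set \<Rightarrow> (real^2 \<Rightarrow> real) \<Rightarrow> bool" where
  "test_function U \<phi> \<longleftrightarrow>
     smooth \<phi> \<and> compact (closure {x. \<phi> x \<noteq> 0}) \<and> closure {x. \<phi> x \<noteq> 0} \<subseteq> U"

text \<open>Only used for \<open>u\<close> and \<open>g\<close> in \<open>L2 (lebesgue_on U)\<close>, where all integrals exist.\<close>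

definition is_weak_partial ::
  "(real^2) set \<Rightarrow> 2 \<Rightarrow> (real^2 \<Rightarrow> 'b::euclidean_space) \<Rightarrow> (real^2 \<Rightarrow> 'b) \<Rightarrow> bool" where
  "is_weak_partial U i u g \<longleftrightarrow>
     (\<forall>\<phi>. test_function U \<phi> \<longrightarrow>
        (\<integral>x. cpartial i \<phi> x *\<^sub>R u x \<partial>lebesgue_on U) = - (\<integral>x. \<phi> x *\<^sub>R g x \<partial>lebesgue_on U))"

fun Hm :: "nat \<Rightarrow> (real^2) set \<Rightarrow> (real^2 \<Rightarrow> 'b::euclidean_space) set" where
  "Hm 0 U = L2 (lebesgue_on U)"
| "Hm (Suc m) U = {u \<in> L2 (lebesgue_on U). \<forall>i. \<exists>g \<in> Hm m U. is_weak_partial U i u g}"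

definition weak_partial ::
  "(real^2) set \<Rightarrow> 2 \<Rightarrow> (real^2 \<Rightarrow> 'b::euclidean_space) \<Rightarrow> real^2 \<Rightarrow> 'b" where
  "weak_partial U i u = (SOME g. g \<in> L2 (lebesgue_on U) \<and> is_weak_partial U i u g)"

section \<open>Polygons and triangulations\<close>

text \<open>The condition \<open>interior (closure \<Omega>) = \<Omega>\<close> excludes slits. The polygon need not be convex
  or simply connected.\<close>

definition bounded_polygon :: "(real^2) set \<Rightarrow> bool" where
  "bounded_polygon \<Omega> \<longleftrightarrow>
     open \<Omega> \<and> connected \<Omega> \<and> \<Omega> \<noteq> {} \<and> bounded \<Omega> \<and> interior (closure \<Omega>) = \<Omega> \<and>
     (\<exists>S. finite S \<and> frontier \<Omega> = (\<Union>(a, b)\<in>S. closed_segment a b))"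

text \<open>Elements are closed triangles; conformity is the face-to-face condition contained in
  \<^const>\<open>triangulation\<close>.\<close>

definition triangulation_of :: "(real^2) set \<Rightarrow> (real^2) set set \<Rightarrow> bool" where
  "triangulation_of \<Omega> \<T> \<longleftrightarrow>
     triangulation \<T> \<and> (\<forall>T\<in>\<T>. 2 simplex T) \<and> \<Union>\<T> = closure \<Omega>"

definition inball_diameter :: "(real^2) set \<Rightarrow> real" where
  "inball_diameter T = Sup {2 * r | r x. 0 \<le> r \<and> cball x r \<subseteq> T}"

text \<open>The Ciarlet--Raviart condition \<open>h\<^sub>T / \<rho>\<^sub>T \<le> \<sigma>\<close>.\<close>

definition shape_regular :: "real \<Rightarrow> (real^2) set set \<Rightarrow> bool" where
  "shape_regular \<sigma> \<T> \<longleftrightarrow> (\<forall>T\<in>\<T>. diameter T \<le> \<sigma> * inball_diameter T)"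

definition edges :: "(real^2) set set \<Rightarrow> (real^2) set set" where
  "edges \<T> = {e. \<exists>T\<in>\<T>. e edge_of T}"

section \<open>Broken spaces and elementwise differential operators\<close>

definition broken_H ::
  "nat \<Rightarrow> (real^2) set \<Rightarrow> (real^2) set set \<Rightarrow> (real^2 \<Rightarrow> 'b::euclidean_space) set" where
  "broken_H m \<Omega> \<T> = {v \<in> L2 (lebesgue_on \<Omega>). \<forall>T\<in>\<T>. v \<in> Hm m (interior T)}"

text \<open>The interiors of the elements are disjoint, so at most one summand is nonzero.\<close>

definition broken_partial ::
  "(real^2) set set \<Rightarrow> 2 \<Rightarrow> (real^2 \<Rightarrow> 'b::euclidean_space) \<Rightarrow> real^2 \<Rightarrow> 'b" where
  "broken_partial \<T> i v x =
     (\<Sum>T\<in>\<T>. if x \<in> interior T then weak_partial (interior T) i v x else 0)"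

text \<open>The index of the derivative comes first: for a vector field \<open>v\<close>,
  \<open>broken_grad \<T> v x $ j $ i\<close> is the \<open>j\<close>-th partial derivative of the \<open>i\<close>-th component.\<close>

definition broken_grad ::
  "(real^2) set set \<Rightarrow> (real^2 \<Rightarrow> 'b::euclidean_space) \<Rightarrow> real^2 \<Rightarrow> 'b^2" where
  "broken_grad \<T> v x = (\<chi> j. broken_partial \<T> j v x)"

definition broken_eps :: "(real^2) set set \<Rightarrow> (real^2 \<Rightarrow> real^2) \<Rightarrow> real^2 \<Rightarrow> real^2^2" where
  "broken_eps \<T> v x = (1/2) *\<^sub>R (broken_grad \<T> v x + transpose (broken_grad \<T> v x))"

definition broken_l2norm :: "(real^2) set set \<Rightarrow> (real^2 \<Rightarrow> 'b::euclidean_space) \<Rightarrow> real" where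
  "broken_l2norm \<T> w = sqrt (\<Sum>T\<in>\<T>. (l2norm (lebesgue_on (interior T)) w)\<^sup>2)"

definition broken_H2_norm ::
  "(real^2) set \<Rightarrow> (real^2) set set \<Rightarrow> (real^2 \<Rightarrow> 'b::euclidean_space) \<Rightarrow> real" where
  "broken_H2_norm \<Omega> \<T> v =
     l2norm (lebesgue_on \<Omega>) v + broken_l2norm \<T> (broken_grad \<T> v)
       + broken_l2norm \<T> (broken_grad \<T> (broken_grad \<T> v))"

section \<open>Edges: arc length, traces, projection and jumps\<close>

text \<open>The order of the two end points is arbitrary; it only affects the sign of the tangent.\<close>

definition edge_ends :: "(real^2) set \<Rightarrow> (real^2) \<times> (real^2)" where
  "edge_ends e = (SOME p. e = closed_segment (fst p) (snd p))"

definition tangent :: "(real^2) set \<Rightarrow> real^2" where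
  "tangent e = (case edge_ends e of (a, b) \<Rightarrow> (b - a) /\<^sub>R norm (b - a))"

text \<open>Arc length on \<open>e\<close>. The underlying space is \<open>e\<close> itself, so measurability and
  integrals do not see the values of a function off \<open>e\<close>.\<close>

definition edge_measure :: "(real^2) set \<Rightarrow> (real^2) measure" where
  "edge_measure e = (case edge_ends e of (a, b) \<Rightarrow>
     scale_measure (ennreal (dist a b))
       (distr (restrict_space lborel {0..1}) (restrict_space borel e)
          (\<lambda>s. a + s *\<^sub>R (b - a))))"

text \<open>The trace on \<open>e \<subseteq> T\<close> of a function in \<open>H\<^sup>1(T)\<close>, by density: smooth functions converge to
  \<open>w\<close> in \<open>H\<^sup>1(T)\<close>, and their restrictions to \<open>e\<close> converge to \<open>g\<close> in \<open>L\<^sup>2(e)\<close>.\<close>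

definition is_trace ::
  "(real^2) set \<Rightarrow> (real^2) set \<Rightarrow> (real^2 \<Rightarrow> 'b::euclidean_space) \<Rightarrow> (real^2 \<Rightarrow> 'b) \<Rightarrow> bool" where
  "is_trace T e w g \<longleftrightarrow> g \<in> L2 (edge_measure e) \<and>
     (\<exists>\<phi>. (\<forall>n::nat. smooth (\<phi> n)) \<and>
        (\<lambda>n. l2norm (lebesgue_on (interior T)) (\<lambda>x. \<phi> n x - w x)) \<longlonglongrightarrow> 0 \<and>
        (\<forall>i. (\<lambda>n. l2norm (lebesgue_on (interior T))
                (\<lambda>x. cpartial i (\<phi> n) x - weak_partial (interior T) i w x)) \<longlonglongrightarrow> 0) \<and>
        (\<lambda>n. l2norm (edge_measure e) (\<lambda>x. \<phi> n x - g x)) \<longlonglongrightarrow> 0)"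

definition edge_trace ::
  "(real^2) set \<Rightarrow> (real^2) set \<Rightarrow> (real^2 \<Rightarrow> 'b::euclidean_space) \<Rightarrow> real^2 \<Rightarrow> 'b" where
  "edge_trace T e w = (SOME g. is_trace T e w g)"

definition P0 :: "(real^2) set \<Rightarrow> (real^2 \<Rightarrow> 'b::real_vector) set" where
  "P0 e = {p. \<exists>c. \<forall>x\<in>e. p x = c}"

definition P1 :: "(real^2) set \<Rightarrow> (real^2 \<Rightarrow> 'b::real_vector) set" where
  "P1 e = {p. \<exists>A c. linear A \<and> (\<forall>x\<in>e. p x = A x + c)}"

text \<open>The infinitesimal rigid motions of an edge are the constants \<^term>\<open>P0 e\<close>.\<close>

definition P1_minus :: "(real^2) set \<Rightarrow> (real^2 \<Rightarrow> real^2) set" where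
  "P1_minus e = {p \<in> P1 e. (\<lambda>x. p x \<bullet> tangent e) \<in> P0 e}"

definition edge_proj :: "(real^2) set \<Rightarrow> (real^2 \<Rightarrow> real^2) \<Rightarrow> real^2 \<Rightarrow> real^2" where
  "edge_proj e w = (SOME p. p \<in> P1_minus e \<and>
     (\<forall>q\<in>P1_minus e. (\<integral>x. (w x - p x) \<bullet> q x \<partial>edge_measure e) = 0))"

text \<open>The jump of a family of one-sided traces, \<open>\<gamma> T\<close> being the trace from \<open>T\<close>. The order of the
  two elements sharing an interior edge is arbitrary; it only affects the sign of the jump.\<close>

definition jump ::
  "(real^2) set \<Rightarrow> (real^2) set set \<Rightarrow> (real^2) set \<Rightarrow>
   ((real^2) set \<Rightarrow> real^2 \<Rightarrow> 'b::real_vector) \<Rightarrow> real^2 \<Rightarrow> 'b" where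
  "jump \<Omega> \<T> e \<gamma> =
     (if e \<subseteq> frontier \<Omega> then \<gamma> (THE T. T \<in> \<T> \<and> e edge_of T)
      else (case (SOME (T, T'). T \<in> \<T> \<and> T' \<in> \<T> \<and> T \<noteq> T' \<and> e edge_of T \<and> e edge_of T')
            of (T, T') \<Rightarrow> \<lambda>x. \<gamma> T x - \<gamma> T' x))"

definition jump_proj ::
  "(real^2) set \<Rightarrow> (real^2) set set \<Rightarrow> (real^2) set \<Rightarrow> (real^2 \<Rightarrow> real^2) \<Rightarrow> real^2 \<Rightarrow> real^2" where
  "jump_proj \<Omega> \<T> e w = jump \<Omega> \<T> e (\<lambda>T. edge_proj e (edge_trace T e w))"

end

theory Submission
  imports Defs "HOL-Analysis.Analysis"
begin

text \<open>
  The second derivatives of a vector field are linear combinations of the first derivatives of its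
  strain, so elementwise \<open>\<nabla>\<^sup>2 v\<close> is controlled by \<open>\<nabla> \<epsilon>(v)\<close> and only \<open>\<nabla> v\<close> has to be bounded.
  Integration by parts on each triangle gives
  \<open>\<parallel>\<nabla> v\<parallel>\<^sup>2 = - (v, \<Delta> v) + \<close> boundary terms \<open>\<integral> v \<bullet> \<partial>\<^sub>n v\<close>. On an interior edge the two boundary terms
  have opposite normals and combine to products of a trace with a jump of \<open>v\<close> or of \<open>\<partial>\<^sub>i v\<close>. By Young's
  inequality with weight \<open>\<delta> h\<^sub>e\<close> and the trace inequality, the traces cost a small multiple of
  \<open>\<parallel>\<nabla> v\<parallel>\<^sup>2\<close>, which is absorbed. In the jumps, \<open>v\<close> may be replaced by \<open>\<Pi>\<^sub>e v\<close>: up to second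
  derivatives, \<open>v\<close> is on \<open>e\<close> at distance \<open>h\<^sub>e |\<epsilon>(v)|\<close> from the space \<open>P\<^sub>1\<^sub>,\<^sub>-\<close>, because the derivative of
  \<open>v \<bullet> t\<close> along \<open>e\<close> is \<open>t \<bullet> \<epsilon>(v) t\<close>; for \<open>\<partial>\<^sub>i v\<close> already constants suffice. No compactness argument
  is needed, and the constant is explicit in \<open>\<sigma>\<close> and the diameter of \<open>\<Omega>\<close>.

  Traces and weak derivatives are handled by density of smooth functions on a triangle, obtained by
  dilating towards an interior point and mollifying.
\<close>

section \<open>Square-integrable functions\<close>

text \<open>The weights in Young's inequality shape the proof. Jumps carry the factor 1/(\<delta>
  h_e) with a small \<delta>. Replacing v on e by a constant would cost h |\<nabla> v|^2, hence
  produce |\<nabla> v|^2 / \<delta>, which cannot be absorbed. Approximation in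
  \<open>P1_minus\<close> costs only h |\<epsilon>(v)|^2 + h^3 |\<nabla>^2 v|^2, and both parts are
  admissible with a large factor. For \<partial>_i v the error of constants is h |\<nabla>^2 v|^2,
  which is already under control. An element has at most three edges, and \<delta> is chosen so that
  each of them consumes one sixth of |\<nabla> v|^2 on the element. A boundary edge is treated as an
  interior one whose missing neighbour carries the function zero; this matches the convention that
  the jump there is the trace. \<open>weak_partial\<close>, \<open>edge_trace\<close>,
  \<open>edge_proj\<close> and the order of the two elements in \<open>jump\<close> are arbitrary
  choices. Each choice is first shown to exist and to have the property that determines its norms
  and integrals; nothing else about it is ever used.\<close>

lemma L2_D: "u \<in> L2 M \<Longrightarrow> u \<in> borel_measurable M" "u \<in> L2 M \<Longrightarrow> integrable M (\<lambda>x. (norm (u x))\<^sup>2)"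
  by (auto simp: L2_def)

lemma L2_bound:
  assumes "u \<in> borel_measurable M" "integrable M f" "\<And>x. x \<in> space M \<Longrightarrow> (norm (u x))\<^sup>2 \<le> f x"
  shows "u \<in> L2 M"
proof -
  have "integrable M (\<lambda>x. (norm (u x))\<^sup>2)"
    by (rule Bochner_Integration.integrable_bound[OF assms(2)])
      (use assms in \<open>auto intro!: AE_I2 order_trans[OF _ abs_ge_self]\<close>)
  then show ?thesis using assms(1) by (simp add: L2_def)
qed

lemma norm_add_sq_le: "(norm (x + y))\<^sup>2 \<le> 2 * (norm x)\<^sup>2 + 2 * (norm (y::'a::real_normed_vector))\<^sup>2"
proof -
  have "(norm (x + y))\<^sup>2 \<le> (norm x + norm y)\<^sup>2"
    by (intro power_mono norm_triangle_ineq norm_ge_zero)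
  also have "\<dots> \<le> 2 * (norm x)\<^sup>2 + 2 * (norm y)\<^sup>2"
    using sum_squares_bound[of "norm x" "norm y"] by (simp add: power2_sum)
  finally show ?thesis .
qed

lemma L2_add: "u \<in> L2 M \<Longrightarrow> w \<in> L2 M \<Longrightarrow> (\<lambda>x. u x + w x) \<in> L2 M"
  by (rule L2_bound[where f="\<lambda>x. 2 * (norm (u x))\<^sup>2 + 2 * (norm (w x))\<^sup>2"])
    (auto simp: L2_def norm_add_sq_le)

lemma L2_bounded_linear:
  assumes "bounded_linear L" "u \<in> L2 M"
  shows "(\<lambda>x. L (u x)) \<in> L2 M"
proof -
  obtain K where K: "\<And>x. norm (L x) \<le> norm x * K"
    using bounded_linear.bounded[OF assms(1)] by blast
  have "L \<in> borel_measurable borel"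
    using assms(1) by (simp add: borel_measurable_continuous_onI linear_continuous_on)
  then have m: "(\<lambda>x. L (u x)) \<in> borel_measurable M"
    using L2_D(1)[OF assms(2)] by measurable
  have b: "(norm (L y))\<^sup>2 \<le> K\<^sup>2 * (norm y)\<^sup>2" for y
    using power_mono[OF K[of y] norm_ge_zero, of 2] by (simp add: power_mult_distrib mult.commute)
  have i: "integrable M (\<lambda>x. K\<^sup>2 * (norm (u x))\<^sup>2)"
    using L2_D(2)[OF assms(2)] by simp
  show ?thesis
    by (rule L2_bound[OF m i b])
qed

lemma L2_uminus: "u \<in> L2 M \<Longrightarrow> (\<lambda>x. - u x) \<in> L2 M"
  by (simp add: L2_def)

lemma L2_diff: "u \<in> L2 M \<Longrightarrow> w \<in> L2 M \<Longrightarrow> (\<lambda>x. u x - w x) \<in> L2 M"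
  using L2_add[OF _ L2_uminus] by fastforce

lemma L2_scaleR: "u \<in> L2 M \<Longrightarrow> (\<lambda>x. c *\<^sub>R u x) \<in> L2 M"
  by (rule L2_bounded_linear[OF bounded_linear_scaleR_right])

lemma L2_zero [simp]: "(\<lambda>x. 0) \<in> L2 M"
  by (simp add: L2_def)

lemma L2_sum: "(\<And>i. i \<in> I \<Longrightarrow> u i \<in> L2 M) \<Longrightarrow> (\<lambda>x. \<Sum>i\<in>I. u i x) \<in> L2 M"
  by (induction I rule: infinite_finite_induct) (auto intro: L2_add)

lemma norm_sq_vec: "(norm (x::'b::euclidean_space^'n))\<^sup>2 = (\<Sum>i\<in>UNIV. (norm (x $ i))\<^sup>2)"
  by (simp add: norm_vec_def L2_set_def sum_nonneg)

lemma L2_vec: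
  fixes u :: "'a \<Rightarrow> 'b::euclidean_space^'c"
  assumes "\<And>i. (\<lambda>x. u x $ i) \<in> L2 M" shows "u \<in> L2 M"
proof (rule L2_bound)
  show "u \<in> borel_measurable M"
  proof (subst borel_measurable_euclidean_space, intro ballI)
    fix b :: "'b^'c" assume "b \<in> Basis"
    then obtain i c where b: "b = axis i c" by (auto simp: Basis_vec_def)
    have "(\<lambda>x. u x $ i) \<in> borel_measurable M" using assms by (simp add: L2_def)
    then show "(\<lambda>x. u x \<bullet> b) \<in> borel_measurable M" by (simp add: b inner_axis)
  qed
  show "integrable M (\<lambda>x. \<Sum>i\<in>UNIV. (norm (u x $ i))\<^sup>2)"
    using assms by (auto intro!: Bochner_Integration.integrable_sum simp: L2_def)
qed (simp add: norm_sq_vec)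

lemma L2_vec_nth: "u \<in> L2 M \<Longrightarrow> (\<lambda>x. u x $ i) \<in> L2 M"
  by (rule L2_bounded_linear[OF bounded_linear_vec_nth])

lemma L2_cong: "(\<And>x. x \<in> space M \<Longrightarrow> u x = w x) \<Longrightarrow> u \<in> L2 M \<longleftrightarrow> w \<in> L2 M"
  unfolding L2_def
  by (simp cong: measurable_cong) (metis (mono_tags, lifting) Bochner_Integration.integrable_cong)

lemma norm_mult_le_sq: "norm (x::'a::real_normed_vector) * norm (y::'b::real_normed_vector) \<le> (norm x)\<^sup>2 + (norm y)\<^sup>2"
  using sum_squares_bound[of "norm x" "norm y"] mult_nonneg_nonneg[OF norm_ge_zero[of x] norm_ge_zero[of y]]
  by linarith

lemma L2_inner_integrable:
  assumes "u \<in> L2 M" "w \<in> L2 M" shows "integrable M (\<lambda>x. u x \<bullet> w x)"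
proof (rule Bochner_Integration.integrable_bound[where f="\<lambda>x. (norm (u x))\<^sup>2 + (norm (w x))\<^sup>2"])
  show "AE x in M. norm (u x \<bullet> w x) \<le> norm ((norm (u x))\<^sup>2 + (norm (w x))\<^sup>2)"
    by (rule AE_I2) (auto intro: order_trans[OF Cauchy_Schwarz_ineq2 norm_mult_le_sq])
qed (use assms in \<open>auto simp: L2_def\<close>)

lemma L2_scaleR_integrable:
  assumes "u \<in> L2 M" "w \<in> L2 M" shows "integrable M (\<lambda>x. u x *\<^sub>R w x)"
proof (rule Bochner_Integration.integrable_bound[where f="\<lambda>x. (norm (u x))\<^sup>2 + (norm (w x))\<^sup>2"])
  show "AE x in M. norm (u x *\<^sub>R w x) \<le> norm ((norm (u x))\<^sup>2 + (norm (w x))\<^sup>2)"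
    by (rule AE_I2) (simp add: norm_mult_le_sq[of "u _" "w _", simplified])
qed (use assms in \<open>auto simp: L2_def\<close>)

section \<open>The L2 seminorm, Cauchy-Schwarz and convergence in L2\<close>

lemma l2norm_nonneg [simp]: "0 \<le> l2norm M u"
  by (simp add: l2norm_def)

lemma l2norm_sq: "(l2norm M u)\<^sup>2 = (\<integral>x. (norm (u x))\<^sup>2 \<partial>M)"
  by (simp add: l2norm_def)

lemma l2norm_cong: "(\<And>x. x \<in> space M \<Longrightarrow> u x = w x) \<Longrightarrow> l2norm M u = l2norm M w"
  unfolding l2norm_def by (metis (mono_tags, lifting) Bochner_Integration.integral_cong)

lemma l2norm_cong_AE:
  assumes "u \<in> L2 M" "w \<in> L2 M" "AE x in M. u x = w x" shows "l2norm M u = l2norm M w"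
proof -
  have "(\<integral>x. (norm (u x))\<^sup>2 \<partial>M) = (\<integral>x. (norm (w x))\<^sup>2 \<partial>M)"
    by (rule integral_cong_AE) (use assms in \<open>auto simp: L2_def\<close>)
  then show ?thesis by (simp add: l2norm_def)
qed

lemma l2norm_uminus: "l2norm M (\<lambda>x. - u x) = l2norm M u"
  by (simp add: l2norm_def)

lemma l2norm_minus_commute: "l2norm M (\<lambda>x. u x - w x) = l2norm M (\<lambda>x. w x - u x)"
  by (simp add: l2norm_def norm_minus_commute)

lemma l2norm_eq_0_AE: "u \<in> L2 M \<Longrightarrow> l2norm M u = 0 \<Longrightarrow> AE x in M. u x = 0"
  by (simp add: l2norm_def L2_def integral_nonneg_eq_0_iff_AE)

text \<open>The right-hand side is minimal at t = b/a, where it equals 2ab. If a or b vanishes, t is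
  taken very large or very small instead. This optimises a weighted Young inequality without
  dividing by a norm that may be zero.\<close>

lemma le_sqrt_mult_if_quadratic:
  fixes a b c :: real
  assumes "0 \<le> a" "0 \<le> b" "\<And>t. 0 < t \<Longrightarrow> 2 * c \<le> t * a\<^sup>2 + b\<^sup>2 / t"
  shows "c \<le> a * b"
proof (cases "a = 0 \<or> b = 0")
  case False
  then have "0 < a" "0 < b" using assms by auto
  then have "2 * c \<le> (b / a) * a\<^sup>2 + b\<^sup>2 / (b / a)" by (intro assms(3)) auto
  then show ?thesis using \<open>0 < a\<close> \<open>0 < b\<close> by (simp add: power2_eq_square)
next
  case True
  show ?thesis
  proof (rule ccontr)
    assume "\<not> c \<le> a * b"
    then have c: "c > 0" using True by auto
    \<comment> \<open>\<open>m\<close> dominates both squares, so in the degenerate cases the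
      weights \<open>m / c\<close> and \<open>c / m\<close> leave at most c on the right against 2c
      on the left.\<close>
    define m where "m = a\<^sup>2 + b\<^sup>2 + 1"
    have m: "m > 0" unfolding m_def by (simp add: add_nonneg_pos)
    have 1: "c * a\<^sup>2 / m \<le> c" "c * b\<^sup>2 / m \<le> c"
      using c m by (simp_all add: m_def divide_simps)
    have "2 * c \<le> (c / m) * a\<^sup>2 + b\<^sup>2 / (c / m)" "2 * c \<le> (m / c) * a\<^sup>2 + b\<^sup>2 / (m / c)"
      by (intro assms(3); use c m in simp)+
    then show False using True 1 c by (auto simp: mult.commute)
  qed
qed

text \<open>The pointwise Young inequality with a free weight t is integrated first; the weight is
  optimised afterwards.\<close>

lemma l2norm_Cauchy_Schwarz:
  assumes "u \<in> L2 M" "w \<in> L2 M"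
  shows "\<bar>\<integral>x. u x \<bullet> w x \<partial>M\<bar> \<le> l2norm M u * l2norm M w"
proof (rule le_sqrt_mult_if_quadratic)
  fix t :: real assume t: "0 < t"
  have *: "2 * \<bar>a \<bullet> b\<bar> \<le> t * (norm a)\<^sup>2 + (norm b)\<^sup>2 / t" for a b :: 'b
  proof -
    have "0 \<le> (t * norm a - norm b)\<^sup>2" by simp
    then have "2 * t * (norm a * norm b) \<le> t\<^sup>2 * (norm a)\<^sup>2 + (norm b)\<^sup>2"
      by (simp add: power2_diff power_mult_distrib)
    then have "2 * (norm a * norm b) \<le> t * (norm a)\<^sup>2 + (norm b)\<^sup>2 / t"
      using t by (simp add: field_simps power2_eq_square)
    then show ?thesis using Cauchy_Schwarz_ineq2[of a b] by linarith
  qed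
  have i: "integrable M (\<lambda>x. u x \<bullet> w x)" by (rule L2_inner_integrable[OF assms])
  have "2 * \<bar>\<integral>x. u x \<bullet> w x \<partial>M\<bar> \<le> 2 * (\<integral>x. \<bar>u x \<bullet> w x\<bar> \<partial>M)"
    by simp
  also have "\<dots> = (\<integral>x. 2 * \<bar>u x \<bullet> w x\<bar> \<partial>M)" by simp
  also have "\<dots> \<le> (\<integral>x. t * (norm (u x))\<^sup>2 + (norm (w x))\<^sup>2 / t \<partial>M)"
    by (rule integral_mono) (use i assms * in \<open>auto simp: L2_def\<close>)
  also have "\<dots> = t * (\<integral>x. (norm (u x))\<^sup>2 \<partial>M) + (\<integral>x. (norm (w x))\<^sup>2 \<partial>M) / t"
    using assms by (simp add: L2_def)
  finally show "2 * \<bar>\<integral>x. u x \<bullet> w x \<partial>M\<bar> \<le> t * (l2norm M u)\<^sup>2 + (l2norm M w)\<^sup>2 / t"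
    by (simp add: l2norm_sq)
qed auto

lemma l2norm_add_sq:
  assumes "u \<in> L2 M" "w \<in> L2 M"
  shows "(l2norm M (\<lambda>x. u x + w x))\<^sup>2 = (l2norm M u)\<^sup>2 + 2 * (\<integral>x. u x \<bullet> w x \<partial>M) + (l2norm M w)\<^sup>2"
proof -
  have "(\<integral>x. (norm (u x + w x))\<^sup>2 \<partial>M) = (\<integral>x. (norm (u x))\<^sup>2 + 2 * (u x \<bullet> w x) + (norm (w x))\<^sup>2 \<partial>M)"
    by (simp add: power2_norm_eq_inner inner_add_left inner_add_right inner_commute algebra_simps)
  also have "\<dots> = (\<integral>x. (norm (u x))\<^sup>2 \<partial>M) + 2 * (\<integral>x. u x \<bullet> w x \<partial>M) + (\<integral>x. (norm (w x))\<^sup>2 \<partial>M)"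
    using assms L2_inner_integrable[OF assms] by (simp add: L2_def)
  finally show ?thesis by (simp add: l2norm_sq)
qed

lemma l2norm_triangle:
  assumes "u \<in> L2 M" "w \<in> L2 M"
  shows "l2norm M (\<lambda>x. u x + w x) \<le> l2norm M u + l2norm M w"
proof (rule power2_le_imp_le)
  show "(l2norm M (\<lambda>x. u x + w x))\<^sup>2 \<le> (l2norm M u + l2norm M w)\<^sup>2"
    using l2norm_add_sq[OF assms] l2norm_Cauchy_Schwarz[OF assms] by (simp add: power2_sum)
qed simp

lemma l2norm_triangle_diff:
  assumes "u \<in> L2 M" "w \<in> L2 M" "z \<in> L2 M"
  shows "l2norm M (\<lambda>x. u x - z x) \<le> l2norm M (\<lambda>x. u x - w x) + l2norm M (\<lambda>x. w x - z x)"
  using l2norm_triangle[OF L2_diff[OF assms(1,2)] L2_diff[OF assms(2,3)]] by simp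

lemma l2norm_triangle2:
  assumes "u \<in> L2 M" "w \<in> L2 M"
  shows "\<bar>l2norm M u - l2norm M w\<bar> \<le> l2norm M (\<lambda>x. u x - w x)"
  using l2norm_triangle[OF L2_diff[OF assms] assms(2)] l2norm_triangle[OF L2_diff[OF assms(2,1)] assms(1)]
    l2norm_minus_commute[of M u w] by simp

lemma l2norm_mono:
  assumes "w \<in> L2 M" "\<And>x. x \<in> space M \<Longrightarrow> norm (u x) \<le> norm (w x)"
  shows "l2norm M u \<le> l2norm M w"
\<comment> \<open>If the square of u is not integrable, its Bochner integral is the default value 0
  and the claim is trivial.\<close>
proof (cases "integrable M (\<lambda>x. (norm (u x))\<^sup>2)")
  case True
  then have "(\<integral>x. (norm (u x))\<^sup>2 \<partial>M) \<le> (\<integral>x. (norm (w x))\<^sup>2 \<partial>M)"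
    using assms by (intro integral_mono) (auto simp: L2_def intro!: power_mono)
  then show ?thesis by (simp add: l2norm_def)
qed (simp add: l2norm_def not_integrable_integral_eq)

lemma l2norm_scaleR: "l2norm M (\<lambda>x. c *\<^sub>R u x) = \<bar>c\<bar> * l2norm M u"
  by (simp add: l2norm_def power_mult_distrib real_sqrt_mult)

lemma l2norm_linear_le:
  assumes "u \<in> L2 M" "bounded_linear L" "\<And>y. norm (L y) \<le> K * norm y" "0 \<le> K"
  shows "l2norm M (\<lambda>x. L (u x)) \<le> K * l2norm M u"
  using l2norm_mono[of "\<lambda>x. K *\<^sub>R u x" M "\<lambda>x. L (u x)"] assms by (simp add: l2norm_scaleR L2_scaleR)

text \<open>Membership in \<open>L2\<close> is part of the notion because \<open>l2norm\<close>
  takes the default value 0 on functions whose square is not integrable, so that smallness of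
  \<open>l2norm\<close> alone says nothing.\<close>

definition L2lim :: "'a measure \<Rightarrow> (nat \<Rightarrow> 'a \<Rightarrow> 'b::euclidean_space) \<Rightarrow> ('a \<Rightarrow> 'b) \<Rightarrow> bool" where
  "L2lim M f u \<longleftrightarrow> (\<forall>n. f n \<in> L2 M) \<and> u \<in> L2 M \<and> (\<lambda>n. l2norm M (\<lambda>x. f n x - u x)) \<longlonglongrightarrow> 0"

lemma L2lim_D:
  assumes "L2lim M f u"
  shows "f n \<in> L2 M" "u \<in> L2 M" "(\<lambda>n. l2norm M (\<lambda>x. f n x - u x)) \<longlonglongrightarrow> 0"
  using assms by (auto simp: L2lim_def)

lemma L2lim_norm:
  assumes "L2lim M f u" shows "(\<lambda>n. l2norm M (f n)) \<longlonglongrightarrow> l2norm M u"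
proof (subst Lim_null, rule Lim_null_comparison[OF always_eventually])
  show "\<forall>n. norm (l2norm M (f n) - l2norm M u) \<le> l2norm M (\<lambda>x. f n x - u x)"
    using l2norm_triangle2 L2lim_D[OF assms] by auto
qed (rule L2lim_D[OF assms])

lemma L2lim_linear:
  assumes "L2lim M f u" "bounded_linear L" shows "L2lim M (\<lambda>n x. L (f n x)) (\<lambda>x. L (u x))"
proof -
  obtain K where K: "K > 0" "\<And>x. norm (L x) \<le> K * norm x"
    using bounded_linear.pos_bounded[OF assms(2)] by (metis mult.commute)
  have "(\<lambda>n. l2norm M (\<lambda>x. L (f n x) - L (u x))) \<longlonglongrightarrow> 0"
  proof (rule Lim_null_comparison[OF always_eventually])
    show "\<forall>n. norm (l2norm M (\<lambda>x. L (f n x) - L (u x))) \<le> K * l2norm M (\<lambda>x. f n x - u x)"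
    proof
      fix n
      have "l2norm M (\<lambda>x. L (f n x - u x)) \<le> K * l2norm M (\<lambda>x. f n x - u x)"
        using assms K L2_diff[OF L2lim_D(1,2)[OF assms(1)]] by (intro l2norm_linear_le) auto
      then show "norm (l2norm M (\<lambda>x. L (f n x) - L (u x))) \<le> K * l2norm M (\<lambda>x. f n x - u x)"
        by (simp add: linear_diff[OF bounded_linear.linear[OF assms(2)]])
    qed
    show "(\<lambda>n. K * l2norm M (\<lambda>x. f n x - u x)) \<longlonglongrightarrow> 0"
      using tendsto_mult_left[OF L2lim_D(3)[OF assms(1)], of K] by simp
  qed
  then show ?thesis
    using assms L2lim_D[OF assms(1)] by (auto simp: L2lim_def intro: L2_bounded_linear)
qed

lemma L2lim_add:
  assumes "L2lim M f u" "L2lim M g w" shows "L2lim M (\<lambda>n x. f n x + g n x) (\<lambda>x. u x + w x)"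
proof -
  note D = L2lim_D[OF assms(1)] L2lim_D[OF assms(2)]
  have "(\<lambda>n. l2norm M (\<lambda>x. (f n x + g n x) - (u x + w x))) \<longlonglongrightarrow> 0"
  proof (rule Lim_null_comparison[OF always_eventually])
    show "\<forall>n. norm (l2norm M (\<lambda>x. (f n x + g n x) - (u x + w x)))
        \<le> l2norm M (\<lambda>x. f n x - u x) + l2norm M (\<lambda>x. g n x - w x)"
    proof
      fix n show "norm (l2norm M (\<lambda>x. (f n x + g n x) - (u x + w x)))
        \<le> l2norm M (\<lambda>x. f n x - u x) + l2norm M (\<lambda>x. g n x - w x)"
        using l2norm_triangle[OF L2_diff[OF D(1)[of n] D(2)] L2_diff[OF D(4)[of n] D(5)]]
        by (simp add: add_diff_add)
    qed
  qed (use tendsto_add[OF D(3) D(6)] in simp)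
  then show ?thesis using D by (auto simp: L2lim_def intro: L2_add)
qed

lemma L2lim_vec:
  fixes u :: "'a \<Rightarrow> 'b::euclidean_space^'c"
  assumes "\<And>i. L2lim M (\<lambda>n x. f n x $ i) (\<lambda>x. u x $ i)" shows "L2lim M f u"
proof -
  have L: "f n \<in> L2 M" "u \<in> L2 M" for n
    using assms by (auto intro!: L2_vec simp: L2lim_def)
  have eq: "(l2norm M (\<lambda>x. f n x - u x))\<^sup>2 = (\<Sum>i\<in>UNIV. (l2norm M (\<lambda>x. f n x $ i - u x $ i))\<^sup>2)" for n
    using L2_diff[OF L2_vec_nth[OF L(1)] L2_vec_nth[OF L(2)]]
    by (simp add: l2norm_sq norm_sq_vec L2_def Bochner_Integration.integral_sum)
  have "(\<lambda>n. (l2norm M (\<lambda>x. f n x - u x))\<^sup>2) \<longlonglongrightarrow> (\<Sum>i::'c\<in>UNIV. 0\<^sup>2)"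
    unfolding eq by (intro tendsto_sum tendsto_power L2lim_D(3)[OF assms])
  then have "(\<lambda>n. sqrt ((l2norm M (\<lambda>x. f n x - u x))\<^sup>2)) \<longlonglongrightarrow> sqrt 0"
    by (intro tendsto_real_sqrt) simp
  then show ?thesis using L by (simp add: L2lim_def)
qed

text \<open>Polarisation reduces the inner product to norms, which are continuous.\<close>

lemma L2lim_inner:
  assumes "L2lim M f u" "L2lim M g w"
  shows "(\<lambda>n. \<integral>x. f n x \<bullet> g n x \<partial>M) \<longlonglongrightarrow> (\<integral>x. u x \<bullet> w x \<partial>M)"
proof -
  have *: "(\<integral>x. a x \<bullet> b x \<partial>M) = ((l2norm M (\<lambda>x. a x + b x))\<^sup>2 - (l2norm M a)\<^sup>2 - (l2norm M b)\<^sup>2) / 2"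
    if "a \<in> L2 M" "b \<in> L2 M" for a b :: "'a \<Rightarrow> 'b"
    using l2norm_add_sq[OF that] by simp
  note D = L2lim_D[OF assms(1)] L2lim_D[OF assms(2)]
  show ?thesis
    unfolding *[OF D(1) D(4)] *[OF D(2) D(5)]
    by (intro tendsto_intros L2lim_norm L2lim_add assms) simp
qed

lemma L2lim_unique_AE:
  assumes "L2lim M f u" "L2lim M f w" shows "AE x in M. u x = w x"
proof -
  note D = L2lim_D[OF assms(1)] L2lim_D[OF assms(2)]
  have "(\<lambda>n. l2norm M (\<lambda>x. f n x - w x) + l2norm M (\<lambda>x. f n x - u x)) \<longlonglongrightarrow> 0 + 0"
    by (intro tendsto_add D)
  moreover have "l2norm M (\<lambda>x. u x - w x) \<le> l2norm M (\<lambda>x. f n x - w x) + l2norm M (\<lambda>x. f n x - u x)" for n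
    using l2norm_triangle_diff[OF D(2) D(1)[of n] D(5)] l2norm_minus_commute[of M "f n" u] by simp
  ultimately have "l2norm M (\<lambda>x. u x - w x) \<le> 0"
    by (intro LIMSEQ_le_const[of _ "0::real"]) auto
  then have "l2norm M (\<lambda>x. u x - w x) = 0" using l2norm_nonneg by (metis antisym)
  from l2norm_eq_0_AE[OF L2_diff[OF D(2) D(5)] this] show ?thesis by simp
qed

lemma L2lim_cong:
  assumes "\<And>n x. x \<in> space M \<Longrightarrow> f n x = g n x" "\<And>x. x \<in> space M \<Longrightarrow> u x = w x"
  shows "L2lim M f u \<longleftrightarrow> L2lim M g w"
proof -
  have "f n \<in> L2 M \<longleftrightarrow> g n \<in> L2 M" for n by (rule L2_cong) (use assms in auto)
  moreover have "u \<in> L2 M \<longleftrightarrow> w \<in> L2 M" by (rule L2_cong) (use assms in auto)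
  moreover have "l2norm M (\<lambda>x. f n x - u x) = l2norm M (\<lambda>x. g n x - w x)" for n
    by (rule l2norm_cong) (use assms in auto)
  ultimately show ?thesis by (simp add: L2lim_def)
qed

text \<open>Riesz-Fischer: a fast subsequence converges almost everywhere by a weighted
  Borel-Cantelli type argument, and Fatou's lemma turns its pointwise limit into an L2 limit of the
  whole sequence.\<close>

lemma L2_complete:
  fixes f :: "nat \<Rightarrow> 'a \<Rightarrow> 'b::euclidean_space"
  assumes L: "\<And>n. f n \<in> L2 M"
    and C: "\<And>e. 0 < e \<Longrightarrow> \<exists>N. \<forall>m\<ge>N. \<forall>n\<ge>N. l2norm M (\<lambda>x. f m x - f n x) < e"
  shows "\<exists>u. L2lim M f u"
proof -
  have "\<exists>N. \<forall>m\<ge>N. \<forall>n\<ge>N. l2norm M (\<lambda>x. f m x - f n x) < (1/2)^k" for k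
    by (rule C) simp
  then obtain N where N: "\<And>k m n. m \<ge> N k \<Longrightarrow> n \<ge> N k \<Longrightarrow> l2norm M (\<lambda>x. f m x - f n x) < (1/2)^k"
    by metis
  \<comment> \<open>The partial sum makes \<open>r\<close> monotone and at least \<open>N k\<close>;
    the summand k makes it tend to infinity.\<close>
  define r where "r k = (\<Sum>i\<le>k. N i) + k" for k
  have rN: "N k \<le> r k" for k
    using member_le_sum[of k "{..k}" N] by (simp add: r_def)
  have rS: "r k \<le> r (Suc k)" and rk: "k \<le> r k" for k by (auto simp: r_def)
  define d where "d k x = f (r (Suc k)) x - f (r k) x" for k x
  have dL: "d k \<in> L2 M" for k unfolding d_def by (intro L2_diff L)
  have [measurable]: "\<And>k. d k \<in> borel_measurable M" using dL by (simp add: L2_def)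
  have dn: "l2norm M (d k) < (1/2)^k" for k
    unfolding d_def using rN[of k] rS[of k] by (intro N) auto
  \<comment> \<open>The weights grow slower than the squared differences decay: (3/2)^k (1/4)^k =
    (3/8)^k is summable, while boundedness of \<open>w k * |d k x|^2\<close> still forces geometric
    decay of \<open>d k x\<close> with ratio sqrt (2/3).\<close>
  define w :: "nat \<Rightarrow> real" where "w k = (3/2)^k" for k
  have "(\<integral>\<^sup>+x. (\<Sum>k. ennreal (w k * (norm (d k x))\<^sup>2)) \<partial>M) = (\<Sum>k. \<integral>\<^sup>+x. ennreal (w k * (norm (d k x))\<^sup>2) \<partial>M)"
    by (intro nn_integral_suminf) measurable
  also have "\<dots> = (\<Sum>k. ennreal (w k * (l2norm M (d k))\<^sup>2))"
    using dL by (simp add: l2norm_sq L2_def nn_integral_eq_integral w_def)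
  also have "\<dots> < \<infinity>"
  proof -
    have "summable (\<lambda>k. w k * (l2norm M (d k))\<^sup>2)"
    proof (rule summable_comparison_test')
      show "summable (\<lambda>k. (3/8)^k::real)" by (simp add: summable_geometric)
      fix k
      have "(l2norm M (d k))\<^sup>2 \<le> ((1/2)^k)\<^sup>2" using dn[of k] by (intro power_mono) auto
      then have "w k * (l2norm M (d k))\<^sup>2 \<le> (3/2)^k * ((1/2)^k)\<^sup>2"
        unfolding w_def by (intro mult_left_mono) auto
      also have "\<dots> = (3/8)^k"
        by (simp add: power2_eq_square power_mult_distrib[symmetric])
      finally show "norm (w k * (l2norm M (d k))\<^sup>2) \<le> (3/8)^k" by (simp add: w_def)
    qed
    then show ?thesis by (simp add: suminf_ennreal2 w_def)
  qed
  finally have "AE x in M. (\<Sum>k. ennreal (w k * (norm (d k x))\<^sup>2)) \<noteq> \<infinity>"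
    using dL by (intro nn_integral_PInf_AE) (auto simp: L2_def)
  then have cv: "AE x in M. convergent (\<lambda>k. f (r k) x)"
  proof eventually_elim
    case (elim x)
    then have s: "summable (\<lambda>k. w k * (norm (d k x))\<^sup>2)"
      by (intro summable_suminf_not_top) (auto simp: w_def)
    have "(\<lambda>k. w k * (norm (d k x))\<^sup>2) \<longlonglongrightarrow> 0" by (rule summable_LIMSEQ_zero[OF s])
    then have ev: "\<forall>\<^sub>F k in sequentially. w k * (norm (d k x))\<^sup>2 < 1"
      by (rule order_tendstoD) simp
    have "summable (\<lambda>k. d k x)"
    proof (rule summable_comparison_test_ev)
      show "summable (\<lambda>k. (sqrt (2/3))^k)" by (simp add: summable_geometric)
      show "\<forall>\<^sub>F k in sequentially. norm (d k x) \<le> sqrt (2/3) ^ k"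
        using ev
      proof eventually_elim
        case (elim k)
        then have "(norm (d k x))\<^sup>2 \<le> (2/3)^k" by (simp add: w_def field_simps)
        then have "norm (d k x) \<le> sqrt ((2/3)^k)" by (simp add: real_le_rsqrt)
        then show ?case by (simp add: real_sqrt_power)
      qed
    qed
    then have "convergent (\<lambda>n. f (r 0) x + (\<Sum>k<n. d k x))"
      by (intro convergent_add convergent_const) (simp add: summable_iff_convergent)
    moreover have "(\<lambda>n. f (r 0) x + (\<Sum>k<n. d k x)) = (\<lambda>n. f (r n) x)"
      unfolding d_def sum_lessThan_telescope[of "\<lambda>k. f (r k) x"] by simp
    ultimately show ?case by simp
  qed
  \<comment> \<open>Where the subsequence diverges, \<open>lim\<close> is an unspecified value; this
    happens on a null set only.\<close>
  define u where "u x = lim (\<lambda>k. f (r k) x)" for x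
  have fm: "\<And>n. f n \<in> borel_measurable M" using L by (simp add: L2_def)
  have um: "u \<in> borel_measurable M" unfolding u_def using fm by measurable
  have est: "(\<integral>\<^sup>+x. ennreal ((norm (f m x - u x))\<^sup>2) \<partial>M) \<le> ennreal (e\<^sup>2)"
    if e: "0 < e" and m: "\<And>n. n \<ge> m \<Longrightarrow> l2norm M (\<lambda>x. f m x - f n x) < e" for m e
  proof -
    have "AE x in M. ennreal ((norm (f m x - u x))\<^sup>2) = liminf (\<lambda>k. ennreal ((norm (f m x - f (r k) x))\<^sup>2))"
      using cv
    proof eventually_elim
      case (elim x)
      then have "(\<lambda>k. f (r k) x) \<longlonglongrightarrow> u x" by (simp add: u_def convergent_LIMSEQ_iff)
      then have "(\<lambda>k. ennreal ((norm (f m x - f (r k) x))\<^sup>2)) \<longlonglongrightarrow> ennreal ((norm (f m x - u x))\<^sup>2)"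
        by (intro tendsto_intros)
      then show ?case by (rule lim_imp_Liminf[OF sequentially_bot, symmetric])
    qed
    then have "(\<integral>\<^sup>+x. ennreal ((norm (f m x - u x))\<^sup>2) \<partial>M) = (\<integral>\<^sup>+x. liminf (\<lambda>k. ennreal ((norm (f m x - f (r k) x))\<^sup>2)) \<partial>M)"
      by (rule nn_integral_cong_AE)
    \<comment> \<open>Fatou: the limit inherits the bound that holds for all late members of the
      subsequence.\<close>
    also have "\<dots> \<le> liminf (\<lambda>k. \<integral>\<^sup>+x. ennreal ((norm (f m x - f (r k) x))\<^sup>2) \<partial>M)"
      using fm by (intro nn_integral_liminf) measurable
    also have "\<dots> \<le> ennreal (e\<^sup>2)"
    proof (rule Liminf_le)
      show "\<forall>\<^sub>F k in sequentially. (\<integral>\<^sup>+x. ennreal ((norm (f m x - f (r k) x))\<^sup>2) \<partial>M) \<le> ennreal (e\<^sup>2)"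
        using eventually_ge_at_top[of m]
      proof eventually_elim
        case (elim k)
        have "(\<integral>\<^sup>+x. ennreal ((norm (f m x - f (r k) x))\<^sup>2) \<partial>M) = ennreal ((l2norm M (\<lambda>x. f m x - f (r k) x))\<^sup>2)"
          using L2_diff[OF L[of m] L[of "r k"]] by (simp add: l2norm_sq L2_def nn_integral_eq_integral)
        also have "\<dots> \<le> ennreal (e\<^sup>2)"
          using m[of "r k"] rk[of k] elim by (intro ennreal_leI power_mono) auto
        finally show ?case .
      qed
    qed simp
    finally show ?thesis .
  qed
  have dif: "(\<lambda>x. f m x - u x) \<in> L2 M \<and> l2norm M (\<lambda>x. f m x - u x) \<le> e"
    if e: "0 < e" and m: "\<And>n. n \<ge> m \<Longrightarrow> l2norm M (\<lambda>x. f m x - f n x) < e" for m e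
  proof -
    have mb: "(\<lambda>x. f m x - u x) \<in> borel_measurable M" using fm um by measurable
    have mb2: "(\<lambda>x. (norm (f m x - u x))\<^sup>2) \<in> borel_measurable M" using mb by measurable
    note E = est[OF e m]
    have fin: "(\<integral>\<^sup>+x. ennreal ((norm (f m x - u x))\<^sup>2) \<partial>M) < \<infinity>"
      by (rule le_less_trans[OF E]) simp_all
    have 1: "integrable M (\<lambda>x. (norm (f m x - u x))\<^sup>2)"
      by (rule integrableI_nonneg[OF mb2 _ fin]) simp
    have "ennreal ((l2norm M (\<lambda>x. f m x - u x))\<^sup>2) \<le> ennreal (e\<^sup>2)"
      using E unfolding l2norm_sq nn_integral_eq_integral[OF 1 AE_I2[OF zero_le_power2]] .
    then have "(l2norm M (\<lambda>x. f m x - u x))\<^sup>2 \<le> e\<^sup>2"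
      by (rule iffD1[OF ennreal_le_iff, rotated]) simp
    then have "l2norm M (\<lambda>x. f m x - u x) \<le> e" using e by (simp add: power2_le_iff_abs_le)
    then show ?thesis using 1 mb by (simp add: L2_def)
  qed
  obtain N0 where N0: "\<And>m n. m \<ge> N0 \<Longrightarrow> n \<ge> N0 \<Longrightarrow> l2norm M (\<lambda>x. f m x - f n x) < 1"
    using C[of 1] by auto
  have "(\<lambda>x. f N0 x - u x) \<in> L2 M"
    using dif[OF zero_less_one N0[OF order_refl]] by blast
  then have "(\<lambda>x. f N0 x - (f N0 x - u x)) \<in> L2 M" by (rule L2_diff[OF L])
  then have uL: "u \<in> L2 M" by simp
  have "(\<lambda>m. l2norm M (\<lambda>x. f m x - u x)) \<longlonglongrightarrow> 0"
  proof (rule LIMSEQ_I)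
    fix e :: real assume "0 < e"
    then obtain n0 where n0: "\<And>m n. m \<ge> n0 \<Longrightarrow> n \<ge> n0 \<Longrightarrow> l2norm M (\<lambda>x. f m x - f n x) < e/2"
      using C[of "e/2"] by auto
    have "norm (l2norm M (\<lambda>x. f m x - u x) - 0) < e" if "m \<ge> n0" for m
    proof -
      have "l2norm M (\<lambda>x. f m x - u x) \<le> e/2"
        using dif[OF half_gt_zero[OF \<open>0 < e\<close>] n0[OF that]] that by simp
      then show ?thesis using \<open>0 < e\<close> by simp
    qed
    then show "\<exists>no. \<forall>n\<ge>no. norm (l2norm M (\<lambda>x. f n x - u x) - 0) < e" by blast
  qed
  then show ?thesis using L uL unfolding L2lim_def by blast
qed

section \<open>Smooth functions in the plane\<close>

lemma cpartial_eq: "(f has_derivative f') (at x) \<Longrightarrow> cpartial i f x = f' (axis i 1)"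
  by (simp add: cpartial_def frechet_derivative_at[symmetric])

lemma vec2_eq: "(h::real^2) = (\<Sum>i\<in>UNIV. (h $ i) *\<^sub>R axis i 1)"
  by (simp add: vec_eq_iff axis_def if_distrib[of "\<lambda>x. _ * x"] cong: if_cong)

lemma linear_vec2: "linear L \<Longrightarrow> L (h::real^2) = (\<Sum>i\<in>UNIV. h $ i *\<^sub>R L (axis i 1))"
  by (subst vec2_eq) (simp add: linear_sum linear_cmul)

lemma differentiable_cpartial:
  assumes "f differentiable at x"
  shows "(f has_derivative (\<lambda>h. \<Sum>i\<in>UNIV. h $ i *\<^sub>R cpartial i f x)) (at x)"
proof -
  obtain f' where f': "(f has_derivative f') (at x)" using assms by (auto simp: differentiable_def)
  have "f' = (\<lambda>h. \<Sum>i\<in>UNIV. h $ i *\<^sub>R cpartial i f x)"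
    unfolding cpartial_eq[OF f'] using linear_vec2[OF has_derivative_linear[OF f']] by blast
  with f' show ?thesis by simp
qed

lemma cpartial_local:
  assumes "open U" "x \<in> U" "\<And>y. y \<in> U \<Longrightarrow> f y = g y"
  shows "cpartial i f x = cpartial i g x"
proof -
  have "(f has_derivative D) (at x) \<longleftrightarrow> (g has_derivative D) (at x)" for D
    using has_derivative_transform_within_open[of f D x UNIV U g]
      has_derivative_transform_within_open[of g D x UNIV U f] assms by auto
  then show ?thesis by (simp add: cpartial_def frechet_derivative_def)
qed

lemma Ck_continuous: "Ck k f \<Longrightarrow> continuous_on UNIV f"
  by (cases k) (auto intro!: continuous_at_imp_continuous_on differentiable_imp_continuous_within)

lemma smooth_cpartial: "smooth f \<Longrightarrow> smooth (cpartial i f)"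
  unfolding smooth_def by (metis Ck.simps(2))

lemma smooth_differentiable: "smooth f \<Longrightarrow> f differentiable at x"
  unfolding smooth_def by (metis Ck.simps(2))

lemma smooth_continuous: "smooth f \<Longrightarrow> continuous_on S f"
  unfolding smooth_def by (meson Ck_continuous continuous_on_subset top_greatest)

lemma smooth_has_derivative:
  "smooth f \<Longrightarrow> (f has_derivative (\<lambda>h. \<Sum>i\<in>UNIV. h $ i *\<^sub>R cpartial i f x)) (at x)"
  by (intro differentiable_cpartial smooth_differentiable)

lemma cpartial_add:
  assumes "f differentiable at x" "g differentiable at x"
  shows "cpartial i (\<lambda>x. f x + g x) x = cpartial i f x + cpartial i g x"
  by (subst cpartial_eq[OF has_derivative_add[OF assms[THEN differentiable_cpartial]]])
     (simp add: axis_def if_distrib[of "\<lambda>a. a *\<^sub>R _"] cong: if_cong)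

lemma cpartial_linear:
  assumes "f differentiable at x" "bounded_linear L"
  shows "cpartial i (\<lambda>x. L (f x)) x = L (cpartial i f x)"
  by (subst cpartial_eq[OF bounded_linear.has_derivative[OF assms(2) differentiable_cpartial[OF assms(1)]]])
     (simp add: axis_def if_distrib[of "\<lambda>a. a *\<^sub>R _"] cong: if_cong)

lemma Ck_add: "Ck k f \<Longrightarrow> Ck k g \<Longrightarrow> Ck k (\<lambda>x. f x + g x)"
proof (induction k arbitrary: f g)
  case (Suc k)
  have "cpartial i (\<lambda>x. f x + g x) = (\<lambda>x. cpartial i f x + cpartial i g x)" for i
    using Suc.prems cpartial_add by fastforce
  then show ?case using Suc by (auto intro!: differentiable_add)
qed (auto intro: continuous_intros)

lemma Ck_linear:
  assumes L: "bounded_linear L"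
  shows "Ck k f \<Longrightarrow> Ck k (\<lambda>x. L (f x))"
proof (induction k arbitrary: f)
  case 0 then show ?case using bounded_linear.continuous_on[OF L] by simp
next
  case (Suc k)
  have "cpartial i (\<lambda>x. L (f x)) = (\<lambda>x. L (cpartial i f x))" for i
    using Suc.prems cpartial_linear[OF _ L] by fastforce
  moreover have "(\<lambda>x. L (f x)) differentiable at x" for x
    using Suc.prems bounded_linear.has_derivative[OF L] by (auto simp: differentiable_def) blast
  ultimately show ?case using Suc by simp
qed

lemma smooth_linear: "bounded_linear L \<Longrightarrow> smooth f \<Longrightarrow> smooth (\<lambda>x. L (f x))"
  by (simp add: smooth_def Ck_linear)

lemma smooth_add: "smooth f \<Longrightarrow> smooth g \<Longrightarrow> smooth (\<lambda>x. f x + g x)"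
  by (simp add: smooth_def Ck_add)

lemma smooth_diff: "smooth f \<Longrightarrow> smooth g \<Longrightarrow> smooth (\<lambda>x. f x - g x)"
  using smooth_add[of f "\<lambda>x. - g x"] smooth_linear[OF bounded_linear_minus[OF bounded_linear_ident], of g] by simp

lemma Ck_const: "Ck k (\<lambda>x. c)"
proof (induction k arbitrary: c)
  case (Suc k)
  have "cpartial i (\<lambda>x. c) = (\<lambda>x. 0)" for i by (rule ext) (simp add: cpartial_def)
  then show ?case using Suc[of 0] by simp
qed simp

lemma smooth_const: "smooth (\<lambda>x. c)"
  by (simp add: smooth_def Ck_const)

lemma cpartial_affine:
  assumes "\<And>x. f differentiable at x"
  shows "cpartial i (\<lambda>x. f (a + c *\<^sub>R x)) x = c *\<^sub>R cpartial i f (a + c *\<^sub>R x)"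
    and "(\<lambda>x. f (a + c *\<^sub>R x)) differentiable at x"
proof -
  have 1: "((\<lambda>x. a + c *\<^sub>R x) has_derivative (\<lambda>h. c *\<^sub>R h)) (at x)"
    by (auto intro!: derivative_eq_intros)
  note 2 = diff_chain_at[OF 1 differentiable_cpartial[OF assms], unfolded o_def]
  show "cpartial i (\<lambda>x. f (a + c *\<^sub>R x)) x = c *\<^sub>R cpartial i f (a + c *\<^sub>R x)"
    by (subst cpartial_eq[OF 2]) (simp add: axis_def if_distrib[of "\<lambda>a. (_ * a) *\<^sub>R _"] cong: if_cong)
  show "(\<lambda>x. f (a + c *\<^sub>R x)) differentiable at x"
    using 2 by (auto simp: differentiable_def)
qed

lemma Ck_affine: "Ck k f \<Longrightarrow> Ck k (\<lambda>x. f (a + c *\<^sub>R x))"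
proof (induction k arbitrary: f)
  case 0 then show ?case
    by (auto intro!: continuous_on_compose2[of UNIV f UNIV "\<lambda>x. a + c *\<^sub>R x"] continuous_intros)
next
  case (Suc k)
  then have d: "\<And>x. f differentiable at x" by simp
  have "cpartial i (\<lambda>x. f (a + c *\<^sub>R x)) = (\<lambda>x. c *\<^sub>R cpartial i f (a + c *\<^sub>R x))" for i
    using cpartial_affine(1)[OF d] by blast
  moreover have "Ck k (\<lambda>x. c *\<^sub>R cpartial i f (a + c *\<^sub>R x))" for i
    by (rule Ck_linear[OF bounded_linear_scaleR_right Suc.IH]) (use Suc.prems in simp)
  ultimately show ?case using cpartial_affine(2)[OF d] by simp
qed

lemma smooth_affine: "smooth f \<Longrightarrow> smooth (\<lambda>x. f (a + c *\<^sub>R x))"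
  by (simp add: smooth_def Ck_affine)

lemma cpartial_eq_0:
  assumes "x \<notin> closure {x. f x \<noteq> 0}" shows "cpartial i f x = 0"
proof -
  have "cpartial i f x = cpartial i (\<lambda>x. 0) x"
    by (rule cpartial_local[of "- closure {x. f x \<noteq> 0}"])
      (use assms closure_subset[of "{x. f x \<noteq> 0}"] in auto)
  then show ?thesis by (simp add: cpartial_def)
qed

lemma test_function_cpartial:
  assumes "test_function U f" shows "test_function U (cpartial i f)"
proof -
  have *: "closure {x. cpartial i f x \<noteq> 0} \<subseteq> closure {x. f x \<noteq> 0}"
    by (rule closure_minimal) (use cpartial_eq_0 in auto)
  then show ?thesis
    using assms unfolding test_function_def
    by (meson closed_closure closed_subset compact_Int_closed smooth_cpartial subset_trans
        bounded_subset compact_eq_bounded_closed)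
qed

subsection \<open>A bump function\<close>

text \<open>The free power k is what the induction on the polynomial needs, since each coefficient
  step raises it by one. The limit yields differentiability of \<open>flat\<close> at 0.\<close>

lemma tendsto_power_poly_exp: "((\<lambda>y. y ^ k * poly p y * exp (- y)) \<longlongrightarrow> (0::real)) at_top"
proof (induction p arbitrary: k)
  case (pCons a p)
  have "((\<lambda>y. a * (y ^ k / exp y) + y ^ Suc k * poly p y * exp (- y)) \<longlongrightarrow> a * 0 + 0) at_top"
    by (intro tendsto_intros tendsto_power_div_exp_0 pCons)
  then show ?case by (simp add: algebra_simps exp_minus divide_inverse)
qed simp

text \<open>The functions p(1/t) exp(-1/t), extended by zero, form a class closed under
  differentiation, so smoothness follows by an induction that never leaves the class.\<close>

definition flat :: "real poly \<Rightarrow> real \<Rightarrow> real" where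
  "flat p t = (if t > 0 then poly p (1 / t) * exp (- (1 / t)) else 0)"

text \<open>The derivative of p(1/t) exp(-1/t) is t^(-2) (p - p')(1/t) exp(-1/t), and the first
  factor is the polynomial y^2 at y = 1/t.\<close>

definition flat_step :: "real poly \<Rightarrow> real poly" where
  "flat_step p = [:0, 0, 1:] * (p - pderiv p)"

lemma flat_deriv: "(flat p has_real_derivative flat (flat_step p) t) (at t)"
proof -
  consider "t > 0" | "t < 0" | "t = 0" by linarith
  then show ?thesis
  proof cases
    case 1
    have "((\<lambda>t. poly p (1 / t) * exp (- (1 / t))) has_real_derivative flat (flat_step p) t) (at t)"
      using 1 by (auto intro!: derivative_eq_intros DERIV_chain2[OF poly_DERIV]
          simp: flat_def flat_step_def field_simps power2_eq_square)
    then show ?thesis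
      by (rule has_field_derivative_transform_within_open[of _ _ _ "{0<..}"]) (use 1 in \<open>auto simp: flat_def\<close>)
  next
    case 2
    have "((\<lambda>t. 0::real) has_real_derivative flat (flat_step p) t) (at t)"
      using 2 by (simp add: flat_def)
    then show ?thesis
      by (rule has_field_derivative_transform_within_open[of _ _ _ "{..<0}"]) (use 2 in \<open>auto simp: flat_def\<close>)
  next
    case 3
    have "((\<lambda>h. flat p h / h) \<longlongrightarrow> 0) (at_right 0)"
    proof -
      \<comment> \<open>With y = 1/h the difference quotient at 0 becomes y p(y) exp(-y).\<close>
      have "((\<lambda>h::real. (1/h) ^ 1 * poly p (1/h) * exp (- (1/h))) \<longlongrightarrow> 0) (at_right 0)"
        by (rule filterlim_compose[OF tendsto_power_poly_exp])
          (simp add: filterlim_inverse_at_top_right inverse_eq_divide[symmetric])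
      then show ?thesis
        by (rule Lim_transform_eventually)
          (auto simp: flat_def eventually_at_right_less intro!: eventually_mono[OF eventually_at_right_less[of 0]])
    qed
    moreover have "((\<lambda>h. flat p h / h) \<longlongrightarrow> 0) (at_left 0)"
      by (rule Lim_transform_eventually[OF tendsto_const])
        (auto simp: flat_def eventually_at_filter)
    ultimately have "((\<lambda>h. flat p h / h) \<longlongrightarrow> 0) (at 0)"
      by (simp add: filterlim_at_split)
    then show ?thesis using 3 by (simp add: DERIV_def flat_def)
  qed
qed

text \<open>One-dimensional counterpart of \<open>Ck\<close>. The derivative is asserted to exist
  rather than computed, so that an induction can supply it from the explicit family
  \<open>bump1\<close>.\<close>

fun Dk :: "nat \<Rightarrow> (real \<Rightarrow> real) \<Rightarrow> bool" where
  "Dk 0 f \<longleftrightarrow> continuous_on UNIV f"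
| "Dk (Suc k) f \<longleftrightarrow> (\<exists>f'. (\<forall>t. (f has_real_derivative f' t) (at t)) \<and> Dk k f')"

lemma Dk_continuous: "Dk k f \<Longrightarrow> continuous_on UNIV f"
  by (cases k) (auto intro: DERIV_continuous_on)

lemma Dk_SucD: "Dk (Suc k) f \<Longrightarrow> Dk k f"
proof (induction k arbitrary: f)
  case 0 then show ?case using Dk_continuous[OF 0] by simp
next
  case (Suc k)
  then obtain f' where f': "\<forall>t. (f has_real_derivative f' t) (at t)" "Dk (Suc k) f'"
    using Dk.simps(2)[of "Suc k" f] by blast
  show ?case using f'(1) Suc.IH[OF f'(2)] by auto
qed

lemma Dk_diff: "Dk k f \<Longrightarrow> Dk k g \<Longrightarrow> Dk k (\<lambda>t. f t - g t)"
proof (induction k arbitrary: f g)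
  case (Suc k)
  then obtain f' g' where "\<forall>t. (f has_real_derivative f' t) (at t)" "Dk k f'"
    "\<forall>t. (g has_real_derivative g' t) (at t)" "Dk k g'" by auto
  then show ?case using Suc.IH[of f' g'] by (auto intro!: exI[of _ "\<lambda>t. f' t - g' t"] DERIV_diff)
qed (auto intro: continuous_intros)

definition bump1 :: "real poly \<Rightarrow> real poly \<Rightarrow> real \<Rightarrow> real" where
  "bump1 p q t = flat p (1 + t) * flat q (1 - t)"

lemma bump1_deriv:
  "(bump1 p q has_real_derivative bump1 (flat_step p) q t - bump1 p (flat_step q) t) (at t)"
  unfolding bump1_def
  by (auto intro!: derivative_eq_intros DERIV_chain2[OF flat_deriv])

lemma Dk_bump1: "Dk k (bump1 p q)"
proof (induction k arbitrary: p q)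
  case 0
  then show ?case using DERIV_continuous_on[of UNIV "bump1 p q", OF bump1_deriv] by simp
next
  case (Suc k)
  have "Dk k (\<lambda>t. bump1 (flat_step p) q t - bump1 p (flat_step q) t)"
    by (intro Dk_diff Suc.IH)
  then show ?case
    by (auto intro!: exI[of _ "\<lambda>t. bump1 (flat_step p) q t - bump1 p (flat_step q) t"] bump1_deriv)
qed

lemma prod2_has_derivative:
  assumes "\<And>t. (f has_real_derivative f' t) (at t)" "\<And>t. (g has_real_derivative g' t) (at t)"
  shows "((\<lambda>x::real^2. f (x $ 1) * g (x $ 2)) has_derivative
    (\<lambda>h. h $ 1 * (f' (x $ 1) * g (x $ 2)) + h $ 2 * (f (x $ 1) * g' (x $ 2)))) (at x)"
  using assms(1)[of "x$1"] assms(2)[of "x$2"]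
  by (auto intro!: derivative_eq_intros DERIV_compose_FDERIV[where f=f] DERIV_compose_FDERIV[where f=g]
      bounded_linear_imp_has_derivative bounded_linear_vec_nth simp: algebra_simps)

lemma prod2_cpartial:
  assumes "\<And>t. (f has_real_derivative f' t) (at t)" "\<And>t. (g has_real_derivative g' t) (at t)"
  shows "cpartial 1 (\<lambda>x::real^2. f (x $ 1) * g (x $ 2)) = (\<lambda>x. f' (x $ 1) * g (x $ 2))"
    "cpartial 2 (\<lambda>x::real^2. f (x $ 1) * g (x $ 2)) = (\<lambda>x. f (x $ 1) * g' (x $ 2))"
  by (rule ext, subst cpartial_eq[OF prod2_has_derivative[OF assms]], simp add: axis_def)+

lemma Ck_prod2: "Dk k f \<Longrightarrow> Dk k g \<Longrightarrow> Ck k (\<lambda>x::real^2. f (x $ 1) * g (x $ 2))"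
proof (induction k arbitrary: f g)
  case 0
  have "continuous_on UNIV (\<lambda>x::real^2. f (x $ 1))" "continuous_on UNIV (\<lambda>x::real^2. g (x $ 2))"
    using 0 by (auto intro!: continuous_on_compose2[of UNIV _ UNIV "\<lambda>x. x $ _"] continuous_intros)
  then show ?case by (auto intro: continuous_intros)
next
  case (Suc k)
  obtain f' g' where d: "\<And>t. (f has_real_derivative f' t) (at t)" "\<And>t. (g has_real_derivative g' t) (at t)"
    and k: "Dk k f'" "Dk k g'" using Suc.prems by auto
  have "\<forall>i. Ck k (cpartial i (\<lambda>x::real^2. f (x $ 1) * g (x $ 2)))"
    using Suc.IH[OF k(1) Dk_SucD[OF Suc.prems(2)]] Suc.IH[OF Dk_SucD[OF Suc.prems(1)] k(2)]
    by (simp add: forall_2 prod2_cpartial[OF d])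
  then show ?case using prod2_has_derivative[OF d] by (auto simp: differentiable_def)
qed

text \<open>All second derivatives of the product are explicit, and both mixed ones equal f'
  g'.\<close>

lemma prod2_cpartial_commute:
  assumes "Dk 2 f" "Dk 2 g"
  shows "cpartial i (cpartial j (\<lambda>x::real^2. f (x $ 1) * g (x $ 2))) = cpartial j (cpartial i (\<lambda>x. f (x $ 1) * g (x $ 2)))"
    (is "cpartial i (cpartial j ?f) = _")
proof -
  obtain f' g' f'' g'' where d: "\<And>t. (f has_real_derivative f' t) (at t)" "\<And>t. (g has_real_derivative g' t) (at t)"
    "\<And>t. (f' has_real_derivative f'' t) (at t)" "\<And>t. (g' has_real_derivative g'' t) (at t)"
    using assms by (auto simp: numeral_2_eq_2)
  have "\<forall>i j. cpartial i (cpartial j ?f) = cpartial j (cpartial i ?f)"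
    by (simp add: forall_2 prod2_cpartial[OF d(1,2)] prod2_cpartial[OF d(1,4)] prod2_cpartial[OF d(3,2)])
  then show ?thesis by blast
qed

text \<open>Commuting second derivatives are recorded because every later approximant is a
  convolution with a rescaled copy of this function and inherits the property; the symmetry of weak
  Hessians originates here. The support lies in the square with |x_1|, |x_2| \<le> 1, hence the
  radius 2.\<close>

lemma exists_bump:
  "\<exists>\<eta>::real^2 \<Rightarrow> real. smooth \<eta> \<and> (\<forall>x. 0 \<le> \<eta> x) \<and> (\<forall>x. 2 \<le> norm x \<longrightarrow> \<eta> x = 0) \<and> \<eta> 0 > 0 \<and>
    (\<forall>i j. cpartial i (cpartial j \<eta>) = cpartial j (cpartial i \<eta>))"
proof -
  define b where "b = bump1 1 1"
  define \<eta> where "\<eta> x = b (x $ 1) * b (x $ 2)" for x :: "real^2"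
  have b0: "0 \<le> b t" for t by (simp add: b_def bump1_def flat_def)
  have z: "\<eta> x = 0" if "2 \<le> norm x" for x
  proof (rule ccontr)
    assume "\<eta> x \<noteq> 0"
    then have "\<bar>x $ 1\<bar> < 1" "\<bar>x $ 2\<bar> < 1"
      by (auto simp: \<eta>_def b_def bump1_def flat_def abs_less_iff split: if_splits)
    moreover have "norm x \<le> \<bar>x $ 1\<bar> + \<bar>x $ 2\<bar>" using norm_le_l1_cart[of x] by (simp add: sum_2)
    ultimately show False using that by linarith
  qed
  have "smooth \<eta>" unfolding smooth_def \<eta>_def b_def by (simp add: Ck_prod2 Dk_bump1)
  moreover have "cpartial i (cpartial j \<eta>) = cpartial j (cpartial i \<eta>)" for i j
    unfolding \<eta>_def b_def by (intro prod2_cpartial_commute Dk_bump1)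
  moreover have "\<eta> 0 > 0" by (simp add: \<eta>_def b_def bump1_def flat_def)
  ultimately show ?thesis using b0 z by (intro exI[of _ \<eta>]) (auto simp: \<eta>_def)
qed

section \<open>Convolution and mollification\<close>

lemma test_function_smooth: "test_function U f \<Longrightarrow> smooth f"
  by (simp add: test_function_def)

lemma test_function_bounded:
  assumes "test_function U f" shows "\<exists>B\<ge>0. \<forall>x. \<bar>f x\<bar> \<le> B"
proof -
  have "compact (f ` closure {x. f x \<noteq> 0})"
    using assms by (auto simp: test_function_def intro!: compact_continuous_image smooth_continuous)
  then obtain B where B: "\<And>x. x \<in> closure {x. f x \<noteq> 0} \<Longrightarrow> \<bar>f x\<bar> \<le> B"
    by (force dest!: compact_imp_bounded simp: bounded_iff)
  have "\<bar>f x\<bar> \<le> \<bar>B\<bar>" for x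
  proof (cases "f x = 0")
    case False
    then show ?thesis using B[of x] closure_subset[of "{x. f x \<noteq> 0}"] by force
  qed simp
  then show ?thesis by (intro exI[of _ "\<bar>B\<bar>"]) auto
qed

lemma abs_sum_cart_le:
  fixes h :: "real^2" assumes "\<And>i. \<bar>c i\<bar> \<le> B"
  shows "\<bar>\<Sum>i\<in>UNIV. h $ i * c i\<bar> \<le> 2 * B * norm h"
proof -
  have "\<bar>\<Sum>i\<in>UNIV. h $ i * c i\<bar> \<le> (\<Sum>i\<in>(UNIV::2 set). norm h * B)"
    by (rule order_trans[OF sum_abs sum_mono])
      (use assms component_le_norm_cart in \<open>auto simp: abs_mult intro!: mult_mono\<close>)
  then show ?thesis by (simp add: algebra_simps)
qed

lemma test_function_Lipschitz:
  assumes "test_function U f" shows "\<exists>L\<ge>0. \<forall>x y. \<bar>f x - f y\<bar> \<le> L * norm (x - y)"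
proof -
  have "\<forall>i. \<exists>B\<ge>0. \<forall>x. \<bar>cpartial i f x\<bar> \<le> B"
    using test_function_bounded[OF test_function_cpartial[OF assms]] by blast
  then obtain B where B: "\<And>i. B i \<ge> 0" "\<And>i x. \<bar>cpartial i f x\<bar> \<le> B i" by metis
  define C where "C = B 1 + B 2"
  have C: "\<bar>cpartial i f x\<bar> \<le> C" for i x
    using B(2)[of i x] B(1)[of 1] B(1)[of 2] exhaust_2[of i] by (auto simp: C_def)
  have "norm (f x - f y) \<le> (2 * C) * norm (x - y)" for x y
  proof (rule differentiable_bound[OF convex_UNIV])
    fix z
    show "(f has_derivative (\<lambda>h. \<Sum>i\<in>UNIV. h $ i *\<^sub>R cpartial i f z)) (at z within UNIV)"
      using smooth_has_derivative[OF test_function_smooth[OF assms]] by simp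
    show "onorm (\<lambda>h. \<Sum>i\<in>UNIV. h $ i *\<^sub>R cpartial i f z) \<le> 2 * C"
      by (rule onorm_le) (use abs_sum_cart_le[OF C] in \<open>auto simp: algebra_simps\<close>)
  qed auto
  moreover have "C \<ge> 0" using B(1)[of 1] B(1)[of 2] by (simp add: C_def)
  ultimately show ?thesis by (intro exI[of _ "2 * C"]) auto
qed

text \<open>The remainder is uniform in z. Integrated against |u| it gives a quadratic error, so a
  convolution can be differentiated under the integral without any passage to the limit
  there.\<close>

lemma test_function_taylor:
  assumes "test_function U f"
  shows "\<exists>L\<ge>0. \<forall>z h. \<bar>f (z + h) - f z - (\<Sum>i\<in>UNIV. h $ i * cpartial i f z)\<bar> \<le> L * (norm h)\<^sup>2"
proof -
  have "\<forall>i. \<exists>L\<ge>0. \<forall>x y. \<bar>cpartial i f x - cpartial i f y\<bar> \<le> L * norm (x - y)"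
    using test_function_Lipschitz[OF test_function_cpartial[OF assms]] by blast
  then obtain B where B: "\<And>i. B i \<ge> 0" "\<And>i x y. \<bar>cpartial i f x - cpartial i f y\<bar> \<le> B i * norm (x - y)" by metis
  define C where "C = B 1 + B 2"
  have C0: "C \<ge> 0" using B(1)[of 1] B(1)[of 2] by (simp add: C_def)
  have C: "\<bar>cpartial i f x - cpartial i f y\<bar> \<le> C * norm (x - y)" for i x y
  proof -
    have "B i \<le> C" using exhaust_2[of i] B(1)[of 1] B(1)[of 2] by (auto simp: C_def)
    then show ?thesis by (rule order_trans[OF B(2) mult_right_mono]) simp
  qed
  have "\<bar>f (z + h) - f z - (\<Sum>i\<in>UNIV. h $ i * cpartial i f z)\<bar> \<le> (2 * C) * (norm h)\<^sup>2" for z h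
  proof -
    have "norm (f (z + h) - f z - (\<lambda>h. \<Sum>i\<in>UNIV. h $ i *\<^sub>R cpartial i f z) ((z + h) - z)) \<le> norm ((z + h) - z) * (2 * C * norm h)"
    proof (rule differentiable_bound_linearization[where S="closed_segment z (z + h)" and f'="\<lambda>x h. \<Sum>i\<in>UNIV. h $ i *\<^sub>R cpartial i f x"])
      show "z + t *\<^sub>R (z + h - z) \<in> closed_segment z (z + h)" if "t \<in> {0..1}" for t
        using that unfolding in_segment by (intro exI[of _ t]) (simp add: scaleR_diff_left scaleR_add_right)
      show "(f has_derivative (\<lambda>h. \<Sum>i\<in>UNIV. h $ i *\<^sub>R cpartial i f x)) (at x within closed_segment z (z + h))" for x
        by (rule has_derivative_at_withinI[OF smooth_has_derivative[OF test_function_smooth[OF assms]]])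
      show "onorm ((\<lambda>k. \<Sum>i\<in>UNIV. k $ i *\<^sub>R cpartial i f x) - (\<lambda>k. \<Sum>i\<in>UNIV. k $ i *\<^sub>R cpartial i f z)) \<le> 2 * C * norm h"
        if "x \<in> closed_segment z (z + h)" for x
        unfolding fun_diff_def
      proof (rule onorm_le)
        fix k
        have "norm (x - z) \<le> norm h" using segment_bound1[OF that] by simp
        then have "\<bar>cpartial i f x - cpartial i f z\<bar> \<le> C * norm h" for i
          by (rule order_trans[OF C mult_left_mono[OF _ C0]])
        note 1 = abs_sum_cart_le[OF this, of k]
        have 2: "(\<Sum>i\<in>UNIV. k $ i *\<^sub>R cpartial i f x) - (\<Sum>i\<in>UNIV. k $ i *\<^sub>R cpartial i f z)
            = (\<Sum>i\<in>UNIV. k $ i * (cpartial i f x - cpartial i f z))"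
          unfolding real_scaleR_def right_diff_distrib sum_subtractf ..
        show "norm ((\<Sum>i\<in>UNIV. k $ i *\<^sub>R cpartial i f x) - (\<Sum>i\<in>UNIV. k $ i *\<^sub>R cpartial i f z)) \<le> 2 * C * norm h * norm k"
          unfolding 2 real_norm_def using 1 by (simp add: mult.assoc)
      qed
    qed simp
    then show ?thesis by (simp add: power2_eq_square mult_ac)
  qed
  moreover have "0 \<le> 2 * C" using C0 by simp
  ultimately show ?thesis by blast
qed

definition conv :: "(real^2) measure \<Rightarrow> (real^2 \<Rightarrow> real) \<Rightarrow> (real^2 \<Rightarrow> 'b::euclidean_space) \<Rightarrow> real^2 \<Rightarrow> 'b" where
  "conv M \<psi> u x = (\<integral>y. \<psi> (x - y) *\<^sub>R u y \<partial>M)"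

text \<open>The one property of the measure that convolution relies on. It covers both measures in
  use: \<open>lborel\<close>, where Fubini applies, and \<open>lebesgue_on U\<close>, where weak
  derivatives live.\<close>

definition cont_meas :: "(real^2) measure \<Rightarrow> bool" where
  "cont_meas M \<longleftrightarrow> (\<forall>f::real^2 \<Rightarrow> real. continuous_on UNIV f \<longrightarrow> f \<in> borel_measurable M)"

lemma cont_meas_lborel: "cont_meas lborel"
  by (simp add: cont_meas_def borel_measurable_continuous_onI)

lemma cont_meas_lebesgue_on: "cont_meas (lebesgue_on U)"
  by (auto simp: cont_meas_def intro!: measurable_restrict_space1 borel_measurable_continuous_onI measurable_completion)

lemma conv_integrable:
  fixes u :: "real^2 \<Rightarrow> 'b::euclidean_space"
  assumes "test_function U \<psi>" "integrable M u" "cont_meas M"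
  shows "integrable M (\<lambda>y. \<psi> (x - y) *\<^sub>R u y)"
proof -
  obtain B where B: "B \<ge> 0" "\<And>x. \<bar>\<psi> x\<bar> \<le> B" using test_function_bounded[OF assms(1)] by auto
  have "continuous_on UNIV (\<lambda>y. \<psi> (x - y))"
    by (rule continuous_on_compose2[OF smooth_continuous[OF test_function_smooth[OF assms(1)], of UNIV]])
      (auto intro!: continuous_intros)
  then have m: "(\<lambda>y. \<psi> (x - y)) \<in> borel_measurable M" using assms(3) by (simp add: cont_meas_def)
  have i: "integrable M (\<lambda>y. B * norm (u y))" using integrable_norm[OF assms(2)] by simp
  show ?thesis
    by (rule Bochner_Integration.integrable_bound[OF i])
      (use m assms B in \<open>auto intro!: mult_right_mono\<close>)
qed

text \<open>Integrating the uniform Taylor remainder of the kernel bounds the error by K |h|^2,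
  where K is L times the L1 norm of u.\<close>

lemma conv_has_derivative:
  assumes t: "test_function U \<psi>" and u: "integrable M u" and M: "cont_meas M"
  shows "(conv M \<psi> u has_derivative (\<lambda>h. \<Sum>i\<in>UNIV. h $ i *\<^sub>R conv M (cpartial i \<psi>) u x)) (at x)"
proof -
  obtain L where L: "L \<ge> 0"
    "\<And>z h. \<bar>\<psi> (z + h) - \<psi> z - (\<Sum>i\<in>UNIV. h $ i * cpartial i \<psi> z)\<bar> \<le> L * (norm h)\<^sup>2"
    using test_function_taylor[OF t] by auto
  define K where "K = L * (\<integral>y. norm (u y) \<partial>M)"
  note ti = conv_integrable[OF t u M] conv_integrable[OF test_function_cpartial[OF t] u M]
  have bd: "norm (conv M \<psi> u (x + h) - conv M \<psi> u x - (\<Sum>i\<in>UNIV. h $ i *\<^sub>R conv M (cpartial i \<psi>) u x)) \<le> K * (norm h)\<^sup>2" for h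
  proof -
    define d where "d y = \<psi> ((x - y) + h) - \<psi> (x - y) - (\<Sum>i\<in>UNIV. h $ i * cpartial i \<psi> (x - y))" for y
    have e: "(\<lambda>y. d y *\<^sub>R u y) = (\<lambda>y. \<psi> (x + h - y) *\<^sub>R u y - \<psi> (x - y) *\<^sub>R u y
        - (\<Sum>i\<in>UNIV. h $ i *\<^sub>R (cpartial i \<psi> (x - y) *\<^sub>R u y)))"
      by (simp add: d_def algebra_simps scaleR_sum_left)
    have i: "integrable M (\<lambda>y. d y *\<^sub>R u y)" unfolding e
      by (intro Bochner_Integration.integrable_diff ti Bochner_Integration.integrable_sum integrable_scaleR_right)
    have "conv M \<psi> u (x + h) - conv M \<psi> u x - (\<Sum>i\<in>UNIV. h $ i *\<^sub>R conv M (cpartial i \<psi>) u x) = (\<integral>y. d y *\<^sub>R u y \<partial>M)"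
      unfolding e conv_def
      by (simp add: ti Bochner_Integration.integral_sum Bochner_Integration.integrable_sum del: scaleR_scaleR)
    also have "norm \<dots> \<le> (\<integral>y. norm (d y *\<^sub>R u y) \<partial>M)" by (rule integral_norm_bound)
    also have "\<dots> \<le> (\<integral>y. (L * (norm h)\<^sup>2) * norm (u y) \<partial>M)"
      by (rule integral_mono) (use integrable_norm[OF i] integrable_norm[OF u] L(2) in \<open>auto simp: d_def intro!: mult_right_mono\<close>)
    finally show ?thesis by (simp add: K_def algebra_simps)
  qed
  have bl: "bounded_linear (\<lambda>h::real^2. \<Sum>i\<in>UNIV. h $ i *\<^sub>R conv M (cpartial i \<psi>) u x)"
    by (intro bounded_linear_sum bounded_linear_compose[OF bounded_linear_scaleR_left bounded_linear_vec_nth])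
  show ?thesis
  proof (rule has_derivativeI[OF bl])
    define R where "R y = ((conv M \<psi> u y - conv M \<psi> u x) - (\<Sum>i\<in>UNIV. (y - x) $ i *\<^sub>R conv M (cpartial i \<psi>) u x)) /\<^sub>R norm (y - x)" for y
    have Rb: "norm (R y) \<le> K * norm (y - x)" for y
    proof (cases "y = x")
      case False
      then have p: "norm (y - x) > 0" by simp
      have "norm (conv M \<psi> u y - conv M \<psi> u x - (\<Sum>i\<in>UNIV. (y - x) $ i *\<^sub>R conv M (cpartial i \<psi>) u x)) \<le> K * (norm (y - x))\<^sup>2"
        using bd[of "y - x"] by simp
      then have "norm (conv M \<psi> u y - conv M \<psi> u x - (\<Sum>i\<in>UNIV. (y - x) $ i *\<^sub>R conv M (cpartial i \<psi>) u x)) / norm (y - x) \<le> K * norm (y - x)"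
        using p by (simp add: divide_le_eq power2_eq_square mult.assoc)
      then show ?thesis by (simp add: R_def divide_inverse mult.commute)
    qed (simp add: R_def)
    have "((\<lambda>y. K * norm (y - x)) \<longlongrightarrow> K * norm (x - x)) (at x)" by (intro tendsto_intros)
    then have "((\<lambda>y. K * norm (y - x)) \<longlongrightarrow> 0) (at x)" by simp
    then have "(R \<longlongrightarrow> 0) (at x)"
      by (rule Lim_null_comparison[OF always_eventually, OF allI[OF Rb]])
    then show "((\<lambda>y. ((conv M \<psi> u y - conv M \<psi> u x) - (\<Sum>i\<in>UNIV. (y - x) $ i *\<^sub>R conv M (cpartial i \<psi>) u x)) /\<^sub>R norm (y - x)) \<longlongrightarrow> 0) (at x)"
      unfolding R_def .
  qed
qed

lemma conv_cpartial:
  assumes "test_function U \<psi>" "integrable M u" "cont_meas M"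
  shows "cpartial i (conv M \<psi> u) = conv M (cpartial i \<psi>) u"
  by (rule ext, subst cpartial_eq[OF conv_has_derivative[OF assms]])
     (simp add: axis_def if_distrib[of "\<lambda>a. a *\<^sub>R _"] cong: if_cong)

lemma conv_smooth:
  assumes "test_function U \<psi>" "integrable M u" "cont_meas M"
  shows "smooth (conv M \<psi> u)"
proof -
  have df: "conv M \<psi> u differentiable at x" if "test_function U \<psi>" for x \<psi>
    using conv_has_derivative[OF that assms(2,3)] by (auto simp: differentiable_def)
  have "Ck k (conv M \<psi> u)" if "test_function U \<psi>" for k \<psi>
    using that
  proof (induction k arbitrary: \<psi>)
    case 0
    then show ?case using df by (auto intro!: continuous_at_imp_continuous_on differentiable_imp_continuous_within)
  next
    case (Suc k)
    then show ?case using df by (simp add: conv_cpartial[OF _ assms(2,3)] test_function_cpartial)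
  qed
  then show ?thesis using assms(1) by (simp add: smooth_def)
qed

subsection \<open>Mollifiers\<close>

lemma nn_integral_affine:
  fixes t :: "real^2"
  assumes [measurable]: "f \<in> borel_measurable borel" and c: "c \<noteq> 0"
  shows "(\<integral>\<^sup>+x. f x \<partial>lborel) = ennreal (c\<^sup>2) * (\<integral>\<^sup>+x. f (t + c *\<^sub>R x) \<partial>lborel)"
  by (subst lborel_affine[OF c, of t])
     (simp add: nn_integral_density nn_integral_distr nn_integral_cmult ennreal_power[symmetric])

lemma exists_mollifier:
  "\<exists>\<eta>::real^2 \<Rightarrow> real. smooth \<eta> \<and> (\<forall>x. 0 \<le> \<eta> x) \<and> (\<forall>x. 1 \<le> norm x \<longrightarrow> \<eta> x = 0) \<and>
    (\<integral>\<^sup>+x. ennreal (\<eta> x) \<partial>lborel) = 1 \<and> (\<forall>i j. cpartial i (cpartial j \<eta>) = cpartial j (cpartial i \<eta>))"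
proof -
  obtain b :: "real^2 \<Rightarrow> real" where b: "smooth b" "\<And>x. 0 \<le> b x" "\<And>x. 2 \<le> norm x \<Longrightarrow> b x = 0" "b 0 > 0"
    "\<And>i j. cpartial i (cpartial j b) = cpartial j (cpartial i b)" using exists_bump by auto
  have bc: "continuous_on UNIV b" by (rule smooth_continuous[OF b(1)])
  have bm[measurable]: "b \<in> borel_measurable borel" by (rule borel_measurable_continuous_onI[OF bc])
  define I where "I = (\<integral>\<^sup>+x. ennreal (b x) \<partial>lborel)"
  have "compact (b ` cball 0 2)" by (intro compact_continuous_image smooth_continuous b(1)) simp
  then obtain B where B: "\<And>x. x \<in> cball 0 2 \<Longrightarrow> \<bar>b x\<bar> \<le> B" by (force dest!: compact_imp_bounded simp: bounded_iff)
  have "I \<le> (\<integral>\<^sup>+x. ennreal B * indicator (cball 0 2) x \<partial>(lborel :: (real^2) measure))"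
    unfolding I_def
  proof (rule nn_integral_mono)
    fix x :: "real^2"
    show "ennreal (b x) \<le> ennreal B * indicator (cball 0 2) x"
      using B[of x] b(3)[of x] by (cases "x \<in> cball 0 2") (auto intro: ennreal_leI)
  qed
  also have "\<dots> = ennreal B * emeasure lborel (cball 0 2 :: (real^2) set)" by (simp add: nn_integral_cmult_indicator)
  also have "\<dots> < \<infinity>" using emeasure_lborel_cball_finite[of "0::real^2" 2] by (simp add: ennreal_mult_less_top)
  finally have I1: "I < \<infinity>" .
  have I2: "I > 0"
  proof -
    obtain r where r: "r > 0" "\<And>x. dist x 0 < r \<Longrightarrow> dist (b x) (b 0) < b 0 / 2"
      using bc b(4) unfolding continuous_on_iff by (metis UNIV_I half_gt_zero)
    have "0 < ennreal (b 0 / 2) * emeasure lborel (ball (0::real^2) r)"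
      using r(1) b(4) by (simp add: emeasure_ball ennreal_mult[symmetric] ennreal_zero_less_mult_iff)
    also have "\<dots> = (\<integral>\<^sup>+x. ennreal (b 0 / 2) * indicator (ball 0 r) x \<partial>(lborel :: (real^2) measure))" by (simp add: nn_integral_cmult_indicator)
    also have "\<dots> \<le> I" unfolding I_def
    proof (rule nn_integral_mono)
      fix x :: "real^2"
      show "ennreal (b 0 / 2) * indicator (ball 0 r) x \<le> ennreal (b x)"
      proof (cases "norm x < r")
        case True
        then have "\<bar>b x - b 0\<bar> < b 0 / 2" using r(2)[of x] by (simp add: dist_real_def)
        then have "b 0 / 2 \<le> b x" by linarith
        then show ?thesis using True by (simp add: ennreal_leI)
      qed simp
    qed
    finally show ?thesis .
  qed
  define J where "J = enn2real I"
  have J: "J > 0" "I = ennreal J" using I1 I2 by (auto simp: J_def enn2real_positive_iff)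
  \<comment> \<open>Doubling the argument halves the support radius from 2 to 1; the factor 4
    compensates the Jacobian and J normalises the mass.\<close>
  define \<eta> where "\<eta> x = (4 / J) *\<^sub>R b (0 + 2 *\<^sub>R x)" for x
  have "(\<integral>\<^sup>+x. ennreal (\<eta> x) \<partial>lborel) = ennreal (4 / J) * (\<integral>\<^sup>+x. ennreal (b (0 + 2 *\<^sub>R x)) \<partial>lborel)"
  proof -
    have "ennreal (\<eta> x) = ennreal (4 / J) * ennreal (b (0 + 2 *\<^sub>R x))" for x
      using J b(2) by (simp add: \<eta>_def ennreal_mult[symmetric])
    then show ?thesis by (simp add: nn_integral_cmult)
  qed
  also have "\<dots> = ennreal (1 / J) * (ennreal (2\<^sup>2) * (\<integral>\<^sup>+x. ennreal (b (0 + 2 *\<^sub>R x)) \<partial>lborel))"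
  proof -
    have "ennreal (4 / J) = ennreal (1 / J) * ennreal (2\<^sup>2)"
      by (subst ennreal_mult[symmetric]) (use J in simp_all)
    then show ?thesis by (simp only: mult.assoc)
  qed
  also have "\<dots> = ennreal (1 / J) * I"
    unfolding I_def using nn_integral_affine[of "\<lambda>x. ennreal (b x)" 2 0] by simp
  also have "\<dots> = 1" using J by (simp add: ennreal_mult[symmetric])
  finally have int: "(\<integral>\<^sup>+x. ennreal (\<eta> x) \<partial>lborel) = 1" .
  have d: "\<And>f x. smooth f \<Longrightarrow> f differentiable at x" by (rule smooth_differentiable)
  have cp: "cpartial i (\<lambda>x. c *\<^sub>R f (0 + 2 *\<^sub>R x)) = (\<lambda>x. (c * 2) *\<^sub>R cpartial i f (0 + 2 *\<^sub>R x))"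
    if "smooth f" for f :: "real^2 \<Rightarrow> real" and i c
  proof
    fix x
    show "cpartial i (\<lambda>x. c *\<^sub>R f (0 + 2 *\<^sub>R x)) x = (c * 2) *\<^sub>R cpartial i f (0 + 2 *\<^sub>R x)"
      using cpartial_linear[OF cpartial_affine(2)[OF smooth_differentiable[OF that]] bounded_linear_scaleR_right, of i c 0 2 x]
        cpartial_affine(1)[OF smooth_differentiable[OF that], of i 0 2 x] by simp
  qed
  have "smooth \<eta>" unfolding \<eta>_def by (intro smooth_linear[OF bounded_linear_scaleR_right] smooth_affine b)
  moreover have "cpartial i (cpartial j \<eta>) = cpartial j (cpartial i \<eta>)" for i j
    unfolding \<eta>_def cp[OF b(1)] cp[OF smooth_cpartial[OF b(1)]] b(5)[of i j] ..
  moreover have "\<forall>x. 0 \<le> \<eta> x" "\<forall>x. 1 \<le> norm x \<longrightarrow> \<eta> x = 0" using b J by (auto simp: \<eta>_def)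
  ultimately show ?thesis using int by blast
qed

definition mollifier :: "real^2 \<Rightarrow> real" where
  "mollifier = (SOME \<eta>. smooth \<eta> \<and> (\<forall>x. 0 \<le> \<eta> x) \<and> (\<forall>x. 1 \<le> norm x \<longrightarrow> \<eta> x = 0) \<and>
    (\<integral>\<^sup>+x. ennreal (\<eta> x) \<partial>lborel) = 1 \<and> (\<forall>i j. cpartial i (cpartial j \<eta>) = cpartial j (cpartial i \<eta>)))"

lemma mollifier:
  "smooth mollifier" "0 \<le> mollifier x" "1 \<le> norm x \<Longrightarrow> mollifier x = 0"
  "(\<integral>\<^sup>+x. ennreal (mollifier x) \<partial>lborel) = 1"
  "cpartial i (cpartial j mollifier) = cpartial j (cpartial i mollifier)"
  using someI_ex[OF exists_mollifier, folded mollifier_def] by blast+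

definition kern :: "real \<Rightarrow> real^2 \<Rightarrow> real" where
  "kern \<delta> z = (1 / \<delta>\<^sup>2) *\<^sub>R mollifier (0 + (1 / \<delta>) *\<^sub>R z)"

lemma kern_smooth: "smooth (kern \<delta>)"
  unfolding kern_def by (intro smooth_linear[OF bounded_linear_scaleR_right] smooth_affine mollifier)

lemma kern_measurable [measurable]: "kern \<delta> \<in> borel_measurable borel"
  by (rule borel_measurable_continuous_onI[OF smooth_continuous[OF kern_smooth]])

lemma kern_nonneg: "0 \<le> kern \<delta> z"
  by (simp add: kern_def mollifier)

lemma kern_eq_0: "0 < \<delta> \<Longrightarrow> \<delta> \<le> norm z \<Longrightarrow> kern \<delta> z = 0"
  by (simp add: kern_def mollifier)

lemma kern_support: "0 < \<delta> \<Longrightarrow> closure {z. kern \<delta> z \<noteq> 0} \<subseteq> cball 0 \<delta>"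
  by (rule closure_minimal) (use kern_eq_0 in force)+

lemma kern_test_function: "0 < \<delta> \<Longrightarrow> test_function UNIV (kern \<delta>)"
  unfolding test_function_def
  using kern_smooth kern_support bounded_subset[OF bounded_cball kern_support]
  by (auto simp: compact_eq_bounded_closed)

lemma kern_cpartial_commute: "cpartial i (cpartial j (kern \<delta>)) = cpartial j (cpartial i (kern \<delta>))"
proof -
  have cp: "cpartial i (\<lambda>x. c *\<^sub>R f (0 + (1/\<delta>) *\<^sub>R x)) = (\<lambda>x. (c * (1/\<delta>)) *\<^sub>R cpartial i f (0 + (1/\<delta>) *\<^sub>R x))"
    if "smooth f" for f :: "real^2 \<Rightarrow> real" and i c
  proof
    fix x
    show "cpartial i (\<lambda>x. c *\<^sub>R f (0 + (1/\<delta>) *\<^sub>R x)) x = (c * (1/\<delta>)) *\<^sub>R cpartial i f (0 + (1/\<delta>) *\<^sub>R x)"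
      using cpartial_linear[OF cpartial_affine(2)[OF smooth_differentiable[OF that]] bounded_linear_scaleR_right, of i c 0 "1/\<delta>" x]
        cpartial_affine(1)[OF smooth_differentiable[OF that], of i 0 "1/\<delta>" x] by simp
  qed
  show ?thesis
    unfolding kern_def[abs_def] cp[OF mollifier(1)] cp[OF smooth_cpartial[OF mollifier(1)]] mollifier(5)[of i j] ..
qed

text \<open>Used twice: c = -1 gives mass one for y \<mapsto> \<open>kern \<delta> (z - y)\<close>,
  and c = r gives the factor 1/r^2 paid for the contraction in \<open>mol\<close>.\<close>

lemma kern_nn_integral:
  assumes "0 < \<delta>" "c \<noteq> 0"
  shows "(\<integral>\<^sup>+x. ennreal (kern \<delta> (a + c *\<^sub>R x)) \<partial>lborel) = ennreal (1 / c\<^sup>2)"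
proof -
  have m [measurable]: "mollifier \<in> borel_measurable borel"
    by (rule borel_measurable_continuous_onI[OF smooth_continuous[OF mollifier(1)]])
  define c' where "c' = c / \<delta>"
  have c': "c' \<noteq> 0" using assms by (simp add: c'_def)
  have "ennreal (c'\<^sup>2) * (\<integral>\<^sup>+x. ennreal (mollifier (a /\<^sub>R \<delta> + c' *\<^sub>R x)) \<partial>lborel) = 1"
    using nn_integral_affine[of "\<lambda>x. ennreal (mollifier x)" c' "a /\<^sub>R \<delta>"] c' mollifier(4) by simp
  then have "ennreal (1 / c\<^sup>2) * (ennreal (c'\<^sup>2) * (\<integral>\<^sup>+x. ennreal (mollifier (a /\<^sub>R \<delta> + c' *\<^sub>R x)) \<partial>lborel)) = ennreal (1 / c\<^sup>2)"
    by simp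
  then have "ennreal (1 / \<delta>\<^sup>2) * (\<integral>\<^sup>+x. ennreal (mollifier (a /\<^sub>R \<delta> + c' *\<^sub>R x)) \<partial>lborel) = ennreal (1 / c\<^sup>2)"
    using assms by (simp add: mult.assoc[symmetric] ennreal_mult[symmetric] c'_def power_divide)
  moreover have "ennreal (kern \<delta> (a + c *\<^sub>R x)) = ennreal (1 / \<delta>\<^sup>2) * ennreal (mollifier (a /\<^sub>R \<delta> + c' *\<^sub>R x))" for x
    using mollifier(2) by (simp add: kern_def c'_def ennreal_mult[symmetric] scaleR_add_right divide_inverse mult.commute)
  ultimately show ?thesis by (simp add: nn_integral_cmult)
qed

lemma kern_shift:
  assumes "0 < \<delta>"
  shows "integrable lborel (\<lambda>y. kern \<delta> (z - y))" "(\<integral>y. kern \<delta> (z - y) \<partial>lborel) = 1"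
proof -
  have e: "(\<integral>\<^sup>+y. ennreal (kern \<delta> (z - y)) \<partial>lborel) = 1"
    using kern_nn_integral[OF assms, of "-1" z] by simp
  show 1: "integrable lborel (\<lambda>y. kern \<delta> (z - y))"
    by (rule integrableI_nonneg) (simp_all add: e kern_nonneg)
  show "(\<integral>y. kern \<delta> (z - y) \<partial>lborel) = 1"
    by (subst integral_eq_nn_integral) (simp_all add: e kern_nonneg)
qed

text \<open>Mollification evaluated at the contracted point p + r x. With r < 1 and a suitable p,
  the values at points of a convex set only use the function inside that set.\<close>

definition mol :: "real \<Rightarrow> real \<Rightarrow> real^2 \<Rightarrow> (real^2) measure \<Rightarrow> (real^2 \<Rightarrow> 'b::euclidean_space) \<Rightarrow> real^2 \<Rightarrow> 'b" where
  "mol \<delta> r p M u x = conv M (kern \<delta>) u (p + r *\<^sub>R x)"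

lemma mol_smooth: "0 < \<delta> \<Longrightarrow> integrable M u \<Longrightarrow> cont_meas M \<Longrightarrow> smooth (mol \<delta> r p M u)"
  unfolding mol_def by (rule smooth_affine[OF conv_smooth[OF kern_test_function]])

lemma mol_cpartial:
  assumes "0 < \<delta>" "integrable M u" "cont_meas M"
  shows "cpartial i (mol \<delta> r p M u) x = r *\<^sub>R conv M (cpartial i (kern \<delta>)) u (p + r *\<^sub>R x)"
  unfolding mol_def
  by (subst cpartial_affine(1)[OF smooth_differentiable[OF conv_smooth[OF kern_test_function[OF assms(1)] assms(2,3)]]])
    (simp add: conv_cpartial[OF kern_test_function[OF assms(1)] assms(2,3)])

lemma mol_cpartial_commute:
  assumes "0 < \<delta>" "integrable M u" "cont_meas M"
  shows "cpartial i (cpartial j (mol \<delta> r p M u)) x = cpartial j (cpartial i (mol \<delta> r p M u)) x"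
proof -
  note t = kern_test_function[OF assms(1)]
  have *: "cpartial i (cpartial j (mol \<delta> r p M u)) x = (r * r) *\<^sub>R conv M (cpartial i (cpartial j (kern \<delta>))) u (p + r *\<^sub>R x)" for i j
  proof -
    note sm = conv_smooth[OF test_function_cpartial[OF t] assms(2,3)]
    have "cpartial j (mol \<delta> r p M u) = (\<lambda>x. r *\<^sub>R conv M (cpartial j (kern \<delta>)) u (p + r *\<^sub>R x))"
      by (rule ext) (rule mol_cpartial[OF assms])
    moreover have "cpartial i (\<lambda>x. r *\<^sub>R conv M (cpartial j (kern \<delta>)) u (p + r *\<^sub>R x)) x
        = r *\<^sub>R (r *\<^sub>R cpartial i (conv M (cpartial j (kern \<delta>)) u) (p + r *\<^sub>R x))"
      by (subst cpartial_linear[OF smooth_differentiable[OF smooth_affine[OF sm]] bounded_linear_scaleR_right])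
        (simp add: cpartial_affine(1)[OF smooth_differentiable[OF sm]])
    ultimately show ?thesis
      by (simp add: conv_cpartial[OF test_function_cpartial[OF t] assms(2,3)])
  qed
  show ?thesis unfolding * by (simp add: kern_cpartial_commute[of i j])
qed

text \<open>Jensen's inequality for the probability density \<open>kern \<delta> (z - y)\<close>, in
  the form that the variance of u about its mean m is nonnegative.\<close>

lemma conv_norm_sq_le:
  assumes d: "0 < \<delta>" and u: "integrable lborel u" "u \<in> L2 lborel"
  shows "ennreal ((norm (conv lborel (kern \<delta>) u z))\<^sup>2) \<le> (\<integral>\<^sup>+y. ennreal (kern \<delta> (z - y) * (norm (u y))\<^sup>2) \<partial>lborel)"
proof -
  define m where "m = conv lborel (kern \<delta>) u z"
  define k where "k y = kern \<delta> (z - y)" for y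
  note t = kern_test_function[OF d]
  have i1: "integrable lborel (\<lambda>y. k y *\<^sub>R u y)" unfolding k_def by (rule conv_integrable[OF t u(1) cont_meas_lborel])
  have "integrable lborel (\<lambda>y. k y *\<^sub>R (norm (u y))\<^sup>2)"
    unfolding k_def by (rule conv_integrable[OF t L2_D(2)[OF u(2)] cont_meas_lborel])
  then have i2: "integrable lborel (\<lambda>y. k y * (norm (u y))\<^sup>2)" by simp
  have i3: "integrable lborel k" "(\<integral>y. k y \<partial>lborel) = 1" unfolding k_def by (rule kern_shift[OF d])+
  have i4: "integrable lborel (\<lambda>y. k y * (u y \<bullet> m))"
  proof -
    have "integrable lborel (\<lambda>y. (k y *\<^sub>R u y) \<bullet> m)" by (rule integrable_inner_left) (rule i1)
    then show ?thesis by simp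
  qed
  have "0 \<le> (\<integral>y. k y * (norm (u y - m))\<^sup>2 \<partial>lborel)"
    by (rule integral_nonneg_AE) (simp add: k_def kern_nonneg)
  also have "\<dots> = (\<integral>y. k y * (norm (u y))\<^sup>2 - 2 * (k y * (u y \<bullet> m)) + k y * (norm m)\<^sup>2 \<partial>lborel)"
    by (simp add: power2_norm_eq_inner inner_diff_left inner_diff_right inner_commute algebra_simps)
  also have "\<dots> = (\<integral>y. k y * (norm (u y))\<^sup>2 \<partial>lborel) - 2 * (\<integral>y. k y * (u y \<bullet> m) \<partial>lborel) + (norm m)\<^sup>2"
    using i2 i3 i4 by simp
  also have "(\<integral>y. k y * (u y \<bullet> m) \<partial>lborel) = (\<integral>y. k y *\<^sub>R u y \<partial>lborel) \<bullet> m"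
  proof -
    have "(\<integral>y. (k y *\<^sub>R u y) \<bullet> m \<partial>lborel) = (\<integral>y. k y *\<^sub>R u y \<partial>lborel) \<bullet> m" by (rule integral_inner_left) (rule i1)
    then show ?thesis by simp
  qed
  also have "(\<integral>y. k y *\<^sub>R u y \<partial>lborel) = m" by (simp add: m_def conv_def k_def)
  finally have "(norm m)\<^sup>2 \<le> (\<integral>y. k y * (norm (u y))\<^sup>2 \<partial>lborel)"
    by (simp add: power2_norm_eq_inner)
  then have "ennreal ((norm m)\<^sup>2) \<le> ennreal (\<integral>y. k y * (norm (u y))\<^sup>2 \<partial>lborel)" by (rule ennreal_leI)
  also have "\<dots> = (\<integral>\<^sup>+y. ennreal (k y * (norm (u y))\<^sup>2) \<partial>lborel)"
    by (rule nn_integral_eq_integral[symmetric, OF i2]) (simp add: k_def kern_nonneg)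
  finally show ?thesis by (simp add: m_def k_def)
qed

text \<open>After Jensen, Tonelli integrates the kernel over the evaluation point first, which
  yields 1/r^2 uniformly in y. For r bounded away from 0 the operators are uniformly
  bounded.\<close>

lemma mol_L2:
  assumes d: "0 < \<delta>" and r: "0 < r" and u: "integrable lborel u" "u \<in> L2 lborel"
  shows "mol \<delta> r p lborel u \<in> L2 lborel" "l2norm lborel (mol \<delta> r p lborel u) \<le> l2norm lborel u / r"
proof -
  have um [measurable]: "u \<in> borel_measurable borel" using u(1) by (simp add: borel_measurable_integrable[of lborel])
  have mm: "mol \<delta> r p lborel u \<in> borel_measurable lborel"
    using borel_measurable_continuous_onI[OF smooth_continuous[OF mol_smooth[OF d u(1) cont_meas_lborel]]] by simp
  have "(\<integral>\<^sup>+x. ennreal ((norm (mol \<delta> r p lborel u x))\<^sup>2) \<partial>lborel)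
      \<le> (\<integral>\<^sup>+x. \<integral>\<^sup>+y. ennreal (kern \<delta> ((p + r *\<^sub>R x) - y) * (norm (u y))\<^sup>2) \<partial>lborel \<partial>lborel)"
    unfolding mol_def by (intro nn_integral_mono conv_norm_sq_le d u)
  also have "\<dots> = (\<integral>\<^sup>+y. \<integral>\<^sup>+x. ennreal (kern \<delta> ((p + r *\<^sub>R x) - y) * (norm (u y))\<^sup>2) \<partial>lborel \<partial>lborel)"
    by (rule lborel_pair.Fubini'[symmetric]) measurable
  also have "\<dots> = (\<integral>\<^sup>+y. ennreal (1 / r\<^sup>2) * ennreal ((norm (u y))\<^sup>2) \<partial>lborel)"
  proof (rule nn_integral_cong)
    fix y
    have "(\<integral>\<^sup>+x. ennreal (kern \<delta> ((p + r *\<^sub>R x) - y) * (norm (u y))\<^sup>2) \<partial>lborel)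
        = (\<integral>\<^sup>+x. ennreal (kern \<delta> ((p - y) + r *\<^sub>R x)) * ennreal ((norm (u y))\<^sup>2) \<partial>lborel)"
      by (simp add: ennreal_mult' kern_nonneg algebra_simps)
    also have "\<dots> = ennreal (1 / r\<^sup>2) * ennreal ((norm (u y))\<^sup>2)"
      using kern_nn_integral[OF d, of r "p - y"] r by (subst nn_integral_multc) simp_all
    finally show "(\<integral>\<^sup>+x. ennreal (kern \<delta> ((p + r *\<^sub>R x) - y) * (norm (u y))\<^sup>2) \<partial>lborel) = ennreal (1 / r\<^sup>2) * ennreal ((norm (u y))\<^sup>2)" .
  qed
  also have "\<dots> = ennreal (1 / r\<^sup>2) * ennreal ((l2norm lborel u)\<^sup>2)"
    using u(2) by (subst nn_integral_cmult) (simp_all add: l2norm_sq L2_def nn_integral_eq_integral)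
  also have "\<dots> = ennreal ((l2norm lborel u / r)\<^sup>2)"
    using r by (simp add: ennreal_mult[symmetric] power_divide)
  finally have bd: "(\<integral>\<^sup>+x. ennreal ((norm (mol \<delta> r p lborel u x))\<^sup>2) \<partial>lborel) \<le> ennreal ((l2norm lborel u / r)\<^sup>2)" .
  have mm2: "(\<lambda>x. (norm (mol \<delta> r p lborel u x))\<^sup>2) \<in> borel_measurable lborel" using mm by measurable
  have fin: "(\<integral>\<^sup>+x. ennreal ((norm (mol \<delta> r p lborel u x))\<^sup>2) \<partial>lborel) < \<infinity>"
    by (rule le_less_trans[OF bd]) simp
  have int: "integrable lborel (\<lambda>x. (norm (mol \<delta> r p lborel u x))\<^sup>2)"
    by (rule integrableI_nonneg[OF mm2 _ fin]) simp
  show "mol \<delta> r p lborel u \<in> L2 lborel" using mm int by (simp add: L2_def)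
  have "ennreal ((l2norm lborel (mol \<delta> r p lborel u))\<^sup>2) \<le> ennreal ((l2norm lborel u / r)\<^sup>2)"
    using bd unfolding l2norm_sq nn_integral_eq_integral[OF int AE_I2[OF zero_le_power2]] .
  then have sq: "(l2norm lborel (mol \<delta> r p lborel u))\<^sup>2 \<le> (l2norm lborel u / r)\<^sup>2"
    by (rule iffD1[OF ennreal_le_iff, rotated]) simp
  show "l2norm lborel (mol \<delta> r p lborel u) \<le> l2norm lborel u / r"
    by (rule power2_le_imp_le[OF sq]) (use r in simp)
qed

text \<open>The dilation towards \<open>x\<^sub>0\<close> keeps the support of the shifted kernel inside a convex set
  containing a ball of radius \<open>r\<close> around \<open>x\<^sub>0\<close>.\<close>

definition eps_seq :: "nat \<Rightarrow> real" where "eps_seq n = 1 / (real n + 2)"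

lemma eps_seq: "0 < eps_seq n" "eps_seq n \<le> 1/2" "eps_seq \<longlonglongrightarrow> 0"
proof -
  show "0 < eps_seq n" "eps_seq n \<le> 1/2" by (auto simp: eps_seq_def field_simps)
  have "(\<lambda>n. 1 / real (n + 2)) \<longlonglongrightarrow> 0"
    by (rule LIMSEQ_ignore_initial_segment[OF lim_1_over_n])
  then show "eps_seq \<longlonglongrightarrow> 0" by (simp add: eps_seq_def[abs_def] add.commute)
qed

section \<open>Convergence of the dilated mollifications on the whole plane\<close>

definition mols :: "real^2 \<Rightarrow> real \<Rightarrow> nat \<Rightarrow> (real^2) measure \<Rightarrow> (real^2 \<Rightarrow> 'b::euclidean_space) \<Rightarrow> real^2 \<Rightarrow> 'b" where
  "mols x0 r n = mol (r * eps_seq n) (1 - eps_seq n) (eps_seq n *\<^sub>R x0)"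

text \<open>The class of functions on which the operators converge. It is shown to contain
  indicators of open sets, then of Borel sets of finite measure, then simple functions, and to be
  closed under L2 limits.\<close>

definition mconv :: "real^2 \<Rightarrow> real \<Rightarrow> (real^2 \<Rightarrow> 'b::euclidean_space) \<Rightarrow> bool" where
  "mconv x0 r u \<longleftrightarrow> integrable lborel u \<and> u \<in> L2 lborel \<and>
     (\<lambda>n. l2norm lborel (\<lambda>x. mols x0 r n lborel u x - u x)) \<longlonglongrightarrow> 0"

lemma mols_L2:
  assumes "0 < r" "integrable lborel u" "u \<in> L2 lborel"
  shows "mols x0 r n lborel u \<in> L2 lborel" "l2norm lborel (mols x0 r n lborel u) \<le> 2 * l2norm lborel u"
proof -
  have p: "0 < r * eps_seq n" "0 < 1 - eps_seq n" using assms eps_seq(1,2)[of n] by auto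
  show "mols x0 r n lborel u \<in> L2 lborel" unfolding mols_def by (rule mol_L2[OF p assms(2,3)])
  have "l2norm lborel (mols x0 r n lborel u) \<le> l2norm lborel u / (1 - eps_seq n)"
    unfolding mols_def by (rule mol_L2[OF p assms(2,3)])
  also have "\<dots> \<le> l2norm lborel u / (1/2)"
    using eps_seq(2)[of n] by (intro divide_left_mono) auto
  finally show "l2norm lborel (mols x0 r n lborel u) \<le> 2 * l2norm lborel u" by simp
qed

lemma mols_diff:
  assumes "0 < r" "integrable lborel u" "integrable lborel w"
  shows "mols x0 r n lborel (\<lambda>x. u x - w x) x = mols x0 r n lborel u x - mols x0 r n lborel w x"
    "mols x0 r n lborel (\<lambda>x. u x + w x) x = mols x0 r n lborel u x + mols x0 r n lborel w x"
proof -
  have t: "test_function UNIV (kern (r * eps_seq n))" using assms eps_seq(1,2)[of n] by (intro kern_test_function) simp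
  note c = conv_integrable[OF t _ cont_meas_lborel]
  show "mols x0 r n lborel (\<lambda>x. u x - w x) x = mols x0 r n lborel u x - mols x0 r n lborel w x"
    "mols x0 r n lborel (\<lambda>x. u x + w x) x = mols x0 r n lborel u x + mols x0 r n lborel w x"
    using c[OF assms(2)] c[OF assms(3)]
    by (simp_all add: mols_def mol_def conv_def scaleR_diff_right scaleR_add_right)
qed

lemma mconv_add:
  assumes "0 < r" "mconv x0 r u" "mconv x0 r w" shows "mconv x0 r (\<lambda>x. u x + w x)"
proof -
  have i: "integrable lborel u" "u \<in> L2 lborel" "integrable lborel w" "w \<in> L2 lborel"
    using assms by (auto simp: mconv_def)
  have "L2lim lborel (\<lambda>n. mols x0 r n lborel u) u" "L2lim lborel (\<lambda>n. mols x0 r n lborel w) w"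
    using assms i by (auto simp: mconv_def L2lim_def intro: mols_L2)
  from L2lim_add[OF this] show ?thesis
    using i by (auto simp: mconv_def L2lim_def mols_diff(2)[OF assms(1) i(1,3)])
qed

lemma mconv_zero: "mconv x0 r (\<lambda>x. 0)"
  by (simp add: mconv_def mols_def mol_def conv_def l2norm_def)

lemma mconv_sum:
  assumes "0 < r" "\<And>i. i \<in> I \<Longrightarrow> mconv x0 r (u i)" shows "mconv x0 r (\<lambda>x. \<Sum>i\<in>I. u i x)"
  using assms(2) by (induction I rule: infinite_finite_induct) (auto intro: mconv_add[OF assms(1)] mconv_zero)

text \<open>The operators are uniformly bounded by 2, so convergence extends from functions
  arbitrarily close to u: the error is at most 2 e/4 + e/4 + e/4.\<close>

lemma mconv_approx:
  assumes r: "0 < r" and u: "integrable lborel u" "u \<in> L2 lborel"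
    and ap: "\<And>e. 0 < e \<Longrightarrow> \<exists>w. mconv x0 r w \<and> l2norm lborel (\<lambda>x. u x - w x) < e"
  shows "mconv x0 r u"
proof -
  have "(\<lambda>n. l2norm lborel (\<lambda>x. mols x0 r n lborel u x - u x)) \<longlonglongrightarrow> 0"
  proof (rule LIMSEQ_I)
    fix e :: real assume e: "0 < e"
    then obtain w where w: "mconv x0 r w" "l2norm lborel (\<lambda>x. u x - w x) < e / 4"
      using ap[of "e/4"] by auto
    have wi: "integrable lborel w" "w \<in> L2 lborel" using w(1) by (auto simp: mconv_def)
    have uw: "integrable lborel (\<lambda>x. u x - w x)" "(\<lambda>x. u x - w x) \<in> L2 lborel"
      using u wi by (auto intro: L2_diff)
    obtain N where N: "\<And>n. n \<ge> N \<Longrightarrow> l2norm lborel (\<lambda>x. mols x0 r n lborel w x - w x) < e / 4"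
    proof -
      have "(\<lambda>n. l2norm lborel (\<lambda>x. mols x0 r n lborel w x - w x)) \<longlonglongrightarrow> 0"
        using w(1) by (simp add: mconv_def)
      from order_tendstoD(2)[OF this, of "e / 4"] show ?thesis
        using e that by (auto simp: eventually_sequentially)
    qed
    have "norm (l2norm lborel (\<lambda>x. mols x0 r n lborel u x - u x) - 0) < e" if n: "n \<ge> N" for n
    proof -
      note L = mols_L2(1)[OF r u, of x0 n] mols_L2(1)[OF r wi, of x0 n]
      have 1: "l2norm lborel (\<lambda>x. mols x0 r n lborel u x - mols x0 r n lborel w x) \<le> 2 * l2norm lborel (\<lambda>x. u x - w x)"
      proof -
        have "mols x0 r n lborel (\<lambda>x. u x - w x) = (\<lambda>x. mols x0 r n lborel u x - mols x0 r n lborel w x)"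
          by (rule ext) (rule mols_diff(1)[OF r u(1) wi(1)])
        then show ?thesis using mols_L2(2)[OF r uw, of x0 n] by simp
      qed
      have 2: "l2norm lborel (\<lambda>x. mols x0 r n lborel u x - u x) \<le> l2norm lborel (\<lambda>x. mols x0 r n lborel u x - mols x0 r n lborel w x)
          + l2norm lborel (\<lambda>x. mols x0 r n lborel w x - u x)"
        by (rule l2norm_triangle_diff[OF L u(2)])
      have 3: "l2norm lborel (\<lambda>x. mols x0 r n lborel w x - u x) \<le> l2norm lborel (\<lambda>x. mols x0 r n lborel w x - w x) + l2norm lborel (\<lambda>x. w x - u x)"
        by (rule l2norm_triangle_diff[OF L(2) wi(2) u(2)])
      have "l2norm lborel (\<lambda>x. mols x0 r n lborel u x - u x) < e"
        using 1 2 3 N[OF n] w(2) l2norm_minus_commute[of lborel u w] e by linarith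
      then show ?thesis by simp
    qed
    then show "\<exists>no. \<forall>n\<ge>no. norm (l2norm lborel (\<lambda>x. mols x0 r n lborel u x - u x) - 0) < e" by blast
  qed
  then show ?thesis using u by (simp add: mconv_def)
qed

lemma mols_bounded_support:
  assumes r: "0 < r" and y: "kern (r * eps_seq n) (eps_seq n *\<^sub>R x0 + (1 - eps_seq n) *\<^sub>R x - y) \<noteq> 0"
  shows "dist x y \<le> eps_seq n * (r + norm (x0 - x))"
proof -
  have "norm (eps_seq n *\<^sub>R x0 + (1 - eps_seq n) *\<^sub>R x - y) \<le> r * eps_seq n"
    using kern_eq_0[of "r * eps_seq n" "eps_seq n *\<^sub>R x0 + (1 - eps_seq n) *\<^sub>R x - y"] y r eps_seq(1)[of n]
    by (meson linorder_linear mult_pos_pos)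
  moreover have "x - y = (eps_seq n *\<^sub>R x0 + (1 - eps_seq n) *\<^sub>R x - y) - eps_seq n *\<^sub>R (x0 - x)"
    by (simp add: algebra_simps)
  then have "norm (x - y) \<le> norm (eps_seq n *\<^sub>R x0 + (1 - eps_seq n) *\<^sub>R x - y) + norm (eps_seq n *\<^sub>R (x0 - x))"
    by (metis norm_triangle_ineq4)
  moreover have "norm (eps_seq n *\<^sub>R (x0 - x)) = eps_seq n * norm (x0 - x)" using eps_seq(1)[of n] by simp
  ultimately show ?thesis unfolding dist_norm distrib_left mult.commute[of _ r] by linarith
qed

text \<open>Pointwise convergence is only checked inside the open set, where the kernel eventually
  sees the value 1 alone. Outside, nothing is needed: the inner products with u converge to |u|^2
  and the norms are asymptotically at most |u|, and together these force norm convergence.\<close>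

lemma mconv_open:
  fixes v :: "'b::euclidean_space"
  assumes r: "0 < r" and W: "open W" "emeasure lborel W < \<infinity>"
  shows "mconv x0 r (\<lambda>x. indicator W x *\<^sub>R v)"
proof -
  have Wm [measurable]: "W \<in> sets borel" using W(1) by simp
  define u :: "real^2 \<Rightarrow> real" where "u = indicator W"
  have ui: "integrable lborel u" unfolding u_def using W(2) by (intro integrable_real_indicator) auto
  have usq: "(norm (u x))\<^sup>2 = u x" for x by (simp add: u_def indicator_def)
  have uL: "u \<in> L2 lborel" using ui usq by (simp add: L2_def)
  define a where "a n = mols x0 r n lborel u" for n
  have pn: "0 < r * eps_seq n" "0 < 1 - eps_seq n" for n using r eps_seq(1,2)[of n] by auto
  have aL: "a n \<in> L2 lborel" for n unfolding a_def by (rule mols_L2(1)[OF r ui uL])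
  have a01: "0 \<le> a n x" "a n x \<le> 1" for n x
  proof -
    let ?z = "eps_seq n *\<^sub>R x0 + (1 - eps_seq n) *\<^sub>R x"
    have i: "integrable lborel (\<lambda>y. kern (r * eps_seq n) (?z - y) *\<^sub>R u y)"
      by (rule conv_integrable[OF kern_test_function[OF pn(1)] ui cont_meas_lborel])
    show "0 \<le> a n x" unfolding a_def mols_def mol_def conv_def
      by (rule integral_nonneg_AE) (simp add: kern_nonneg u_def)
    have "a n x \<le> (\<integral>y. kern (r * eps_seq n) (?z - y) \<partial>lborel)"
      unfolding a_def mols_def mol_def conv_def
      by (rule integral_mono[OF i kern_shift(1)[OF pn(1)]]) (simp add: u_def indicator_def kern_nonneg)
    then show "a n x \<le> 1" by (simp add: kern_shift(2)[OF pn(1)])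
  qed
  have a1: "(\<lambda>n. a n x * u x) \<longlonglongrightarrow> u x" for x
  proof (cases "x \<in> W")
    case True
    then obtain e where e: "e > 0" "cball x e \<subseteq> W" using W(1) open_contains_cball by blast
    have "(\<lambda>n. eps_seq n * (r + norm (x0 - x))) \<longlonglongrightarrow> 0 * (r + norm (x0 - x))"
      by (intro tendsto_intros eps_seq)
    then have "\<forall>\<^sub>F n in sequentially. eps_seq n * (r + norm (x0 - x)) < e"
      using e(1) by (intro order_tendstoD(2)) auto
    then have "\<forall>\<^sub>F n in sequentially. a n x = 1"
    proof eventually_elim
      case (elim n)
      let ?z = "eps_seq n *\<^sub>R x0 + (1 - eps_seq n) *\<^sub>R x"
      have keq: "kern (r * eps_seq n) (?z - y) *\<^sub>R u y = kern (r * eps_seq n) (?z - y)" for y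
      proof (cases "kern (r * eps_seq n) (?z - y) = 0")
        case False
        then have "dist x y \<le> e" using mols_bounded_support[OF r False] elim by simp
        then have "y \<in> W" using e(2) by auto
        then show ?thesis by (simp add: u_def)
      qed simp
      show ?case unfolding a_def mols_def mol_def conv_def keq by (rule kern_shift(2)[OF pn(1)])
    qed
    then have "\<forall>\<^sub>F n in sequentially. u x = a n x * u x" by eventually_elim simp
    then show ?thesis by (rule Lim_transform_eventually[OF tendsto_const])
  qed (simp add: u_def)
  have m: "(\<integral>x. u x \<partial>lborel) = (l2norm lborel u)\<^sup>2" unfolding l2norm_sq usq ..
  have am [measurable]: "a n \<in> borel_measurable borel" for n using aL[of n] by (simp add: L2_def)
  have um [measurable]: "u \<in> borel_measurable borel" by (simp add: u_def)
  have "(\<lambda>n. \<integral>x. a n x * u x \<partial>lborel) \<longlonglongrightarrow> (\<integral>x. u x \<partial>lborel)"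
  proof (rule integral_dominated_convergence[where w=u])
    show "AE x in lborel. (\<lambda>n. a n x * u x) \<longlonglongrightarrow> u x" using a1 by simp
    show "\<And>n. AE x in lborel. norm (a n x * u x) \<le> u x"
      using a01 by (auto simp: u_def indicator_def abs_mult)
  qed (use ui in simp_all)
  then have ip: "(\<lambda>n. \<integral>x. a n x \<bullet> (- u x) \<partial>lborel) \<longlonglongrightarrow> - (l2norm lborel u)\<^sup>2"
    using tendsto_minus m by fastforce
  \<comment> \<open>The square is expanded; the right-hand side tends to |u|^2 - 2 |u|^2 + |u|^2 =
    0.\<close>
  have up: "(l2norm lborel (\<lambda>x. a n x - u x))\<^sup>2 \<le> (l2norm lborel u / (1 - eps_seq n))\<^sup>2 + 2 * (\<integral>x. a n x \<bullet> (- u x) \<partial>lborel) + (l2norm lborel u)\<^sup>2" for n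
  proof -
    have "(l2norm lborel (\<lambda>x. a n x + (- u x)))\<^sup>2 = (l2norm lborel (a n))\<^sup>2 + 2 * (\<integral>x. a n x \<bullet> (- u x) \<partial>lborel) + (l2norm lborel (\<lambda>x. - u x))\<^sup>2"
      by (rule l2norm_add_sq[OF aL L2_uminus[OF uL]])
    moreover have "(l2norm lborel (a n))\<^sup>2 \<le> (l2norm lborel u / (1 - eps_seq n))\<^sup>2"
      by (rule power_mono) (unfold a_def mols_def, rule mol_L2(2)[OF pn ui uL], simp)
    ultimately show ?thesis by (simp add: l2norm_uminus)
  qed
  have "(\<lambda>n. (l2norm lborel u / (1 - eps_seq n))\<^sup>2 + 2 * (\<integral>x. a n x \<bullet> (- u x) \<partial>lborel) + (l2norm lborel u)\<^sup>2)
      \<longlonglongrightarrow> (l2norm lborel u / (1 - 0))\<^sup>2 + 2 * (- (l2norm lborel u)\<^sup>2) + (l2norm lborel u)\<^sup>2"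
    by (intro tendsto_intros ip eps_seq) simp
  then have "(\<lambda>n. (l2norm lborel u / (1 - eps_seq n))\<^sup>2 + 2 * (\<integral>x. a n x \<bullet> (- u x) \<partial>lborel) + (l2norm lborel u)\<^sup>2) \<longlonglongrightarrow> 0"
    by simp
  then have "(\<lambda>n. (l2norm lborel (\<lambda>x. a n x - u x))\<^sup>2) \<longlonglongrightarrow> 0"
  proof (rule Lim_null_comparison[rotated], intro always_eventually allI)
    fix n
    show "norm ((l2norm lborel (\<lambda>x. a n x - u x))\<^sup>2) \<le> (l2norm lborel u / (1 - eps_seq n))\<^sup>2 + 2 * (\<integral>x. a n x \<bullet> (- u x) \<partial>lborel) + (l2norm lborel u)\<^sup>2"
      unfolding real_norm_def abs_of_nonneg[OF zero_le_power2] by (rule up)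
  qed
  then have "(\<lambda>n. sqrt ((l2norm lborel (\<lambda>x. a n x - u x))\<^sup>2)) \<longlonglongrightarrow> sqrt 0" by (intro tendsto_real_sqrt)
  then have lim: "L2lim lborel a u" using aL uL by (simp add: L2lim_def)
  have bl: "bounded_linear (\<lambda>t::real. t *\<^sub>R v)" by (rule bounded_linear_scaleR_left)
  have "mols x0 r n lborel (\<lambda>x. u x *\<^sub>R v) = (\<lambda>x. a n x *\<^sub>R v)" for n
  proof
    fix x
    let ?z = "eps_seq n *\<^sub>R x0 + (1 - eps_seq n) *\<^sub>R x"
    have i: "integrable lborel (\<lambda>y. kern (r * eps_seq n) (?z - y) *\<^sub>R u y)"
      by (rule conv_integrable[OF kern_test_function[OF pn(1)] ui cont_meas_lborel])
    have "(\<integral>y. (kern (r * eps_seq n) (?z - y) *\<^sub>R u y) *\<^sub>R v \<partial>lborel) = (\<integral>y. kern (r * eps_seq n) (?z - y) *\<^sub>R u y \<partial>lborel) *\<^sub>R v"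
      by (rule integral_scaleR_left) (rule i)
    then show "mols x0 r n lborel (\<lambda>x. u x *\<^sub>R v) x = a n x *\<^sub>R v"
      by (simp add: a_def mols_def mol_def conv_def)
  qed
  with L2lim_linear[OF lim bl] have "L2lim lborel (\<lambda>n. mols x0 r n lborel (\<lambda>x. u x *\<^sub>R v)) (\<lambda>x. u x *\<^sub>R v)"
    by (simp add: L2lim_def)
  moreover have "integrable lborel (\<lambda>x. u x *\<^sub>R v)" using ui by simp
  ultimately show ?thesis by (simp add: mconv_def L2lim_def u_def)
qed

lemma mconv_indicator:
  fixes v :: "'b::euclidean_space"
  assumes r: "0 < r" and A: "A \<in> sets borel" "emeasure lborel A < \<infinity>"
  shows "mconv x0 r (\<lambda>x. indicator A x *\<^sub>R v)"
proof (rule mconv_approx[OF r])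
  have Am [measurable]: "A \<in> sets borel" by (rule A(1))
  have i: "integrable lborel (indicator A :: _ \<Rightarrow> real)" using A by (intro integrable_real_indicator) auto
  then show "integrable lborel (\<lambda>x. indicator A x *\<^sub>R v)" by simp
  show "(\<lambda>x. indicator A x *\<^sub>R v) \<in> L2 lborel"
  proof (rule L2_bounded_linear[OF bounded_linear_scaleR_left])
    have "(norm (indicator A x :: real))\<^sup>2 = indicator A x" for x by (simp add: indicator_def)
    then show "(indicator A :: _ \<Rightarrow> real) \<in> L2 lborel" using i by (simp add: L2_def)
  qed
  fix e :: real assume e: "0 < e"
  \<comment> \<open>The choice makes (1 + |v|)^2 e' equal to e^2 / 2, strictly below e^2; the
    summand 1 covers v = 0.\<close>
  define e' where "e' = (e / (1 + norm v))\<^sup>2 / 2"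
  have nv: "1 + norm v > 0" by (simp add: add_pos_nonneg)
  have e': "e' > 0" using e nv by (simp add: e'_def)
  have "A \<in> sets lebesgue" using A(1) by simp
  from sets_lebesgue_outer_open[OF this e'] obtain W where
    W: "open W" "A \<subseteq> W" "W - A \<in> lmeasurable" "emeasure lebesgue (W - A) < ennreal e'" by blast
  have Wm [measurable]: "W \<in> sets borel" using W(1) by simp
  have WA: "emeasure lborel (W - A) < ennreal e'" using W(4) A(1) Wm by simp
  have "emeasure lborel W = emeasure lborel (A \<union> (W - A))" using W(2) by (simp add: Un_absorb1)
  also have "\<dots> \<le> emeasure lborel A + emeasure lborel (W - A)" by (rule emeasure_subadditive) auto
  also have "\<dots> < \<infinity>" using A(2) WA by (simp add: less_top[symmetric] ennreal_add_eq_top) (metis ennreal_less_top less_trans order_less_irrefl)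
  finally have Wf: "emeasure lborel W < \<infinity>" .
  have "(l2norm lborel (\<lambda>x. indicator A x *\<^sub>R v - indicator W x *\<^sub>R v))\<^sup>2 = (\<integral>x. (norm v)\<^sup>2 * indicator (W - A) x \<partial>lborel)"
    unfolding l2norm_sq using W(2) by (intro Bochner_Integration.integral_cong) (auto simp: indicator_def)
  also have "\<dots> = (norm v)\<^sup>2 * measure lborel (W - A)" by simp
  also have "\<dots> \<le> (1 + norm v)\<^sup>2 * e'"
  proof (rule mult_mono)
    show "measure lborel (W - A) \<le> e'" using WA e' unfolding measure_def
      by (metis enn2real_mono enn2real_ennreal ennreal_less_top less_imp_le)
    show "(norm v)\<^sup>2 \<le> (1 + norm v)\<^sup>2" by (rule power_mono) auto
  qed auto
  also have "\<dots> < e\<^sup>2" using e nv by (simp add: e'_def power_divide)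
  finally have "l2norm lborel (\<lambda>x. indicator A x *\<^sub>R v - indicator W x *\<^sub>R v) < e"
    by (rule power2_less_imp_less) (use e in simp)
  then show "\<exists>w. mconv x0 r w \<and> l2norm lborel (\<lambda>x. indicator A x *\<^sub>R v - w x) < e"
    using mconv_open[OF r W(1) Wf, of x0 v] by blast
qed

text \<open>Simple functions dominated by 2 |u| are L2-dense enough. Their nonzero level sets have
  finite measure by Chebyshev's inequality applied to 4 |u|^2.\<close>

lemma mconv_all:
  fixes u :: "real^2 \<Rightarrow> 'b::euclidean_space"
  assumes r: "0 < r" and u: "integrable lborel u" "u \<in> L2 lborel"
  shows "mconv x0 r u"
proof (rule mconv_approx[OF r u])
  have um [measurable]: "u \<in> borel_measurable borel" using u(1) by (simp add: borel_measurable_integrable[of lborel])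
  obtain F where F: "\<And>i. simple_function borel (F i)" "\<And>x. (\<lambda>i. F i x) \<longlonglongrightarrow> u x" "\<And>i x. norm (F i x) \<le> 2 * norm (u x)"
    using borel_measurable_implies_sequence_metric[OF um, of 0] by auto
  have Fm [measurable]: "F i \<in> borel_measurable borel" for i by (rule borel_measurable_simple_function[OF F(1)])
  have u2: "integrable lborel (\<lambda>x. (norm (u x))\<^sup>2)" using u(2) by (simp add: L2_def)
  have mF: "mconv x0 r (F i)" for i
  proof -
    have fin: "finite (range (F i))" using F(1)[of i] by (simp add: simple_function_def)
    have eq: "F i = (\<lambda>x. \<Sum>y\<in>range (F i) - {0}. indicator (F i -` {y}) x *\<^sub>R y)"
    proof
      fix x
      have "(\<Sum>y\<in>range (F i) - {0}. indicator (F i -` {y}) x *\<^sub>R y) = (\<Sum>y\<in>range (F i) - {0}. if y = F i x then y else 0)"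
        by (intro sum.cong) (auto simp: indicator_def)
      also have "\<dots> = F i x" using fin by (simp add: sum.delta')
      finally show "F i x = (\<Sum>y\<in>range (F i) - {0}. indicator (F i -` {y}) x *\<^sub>R y)" ..
    qed
    have "mconv x0 r (\<lambda>x. indicator (F i -` {y}) x *\<^sub>R y)" if y: "y \<noteq> 0" for y
    proof (rule mconv_indicator[OF r])
      show s: "F i -` {y} \<in> sets borel" using measurable_sets[OF Fm[of i], of "{y}"] by simp
      have "ennreal ((norm y)\<^sup>2) * emeasure lborel (F i -` {y}) = (\<integral>\<^sup>+x. ennreal ((norm y)\<^sup>2) * indicator (F i -` {y}) x \<partial>lborel)"
        using s by (simp add: nn_integral_cmult_indicator)
      also have "\<dots> \<le> (\<integral>\<^sup>+x. ennreal (4 * (norm (u x))\<^sup>2) \<partial>lborel)"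
      proof (rule nn_integral_mono)
        fix x
        have "(norm (F i x))\<^sup>2 \<le> (2 * norm (u x))\<^sup>2" by (rule power_mono[OF F(3)]) simp
        then show "ennreal ((norm y)\<^sup>2) * indicator (F i -` {y}) x \<le> ennreal (4 * (norm (u x))\<^sup>2)"
          by (cases "F i x = y") (auto simp: power_mult_distrib intro: ennreal_leI)
      qed
      also have "\<dots> < \<infinity>" using u2 by (subst nn_integral_eq_integral) simp_all
      finally show "emeasure lborel (F i -` {y}) < \<infinity>" using y by (auto simp: ennreal_mult_less_top)
    qed
    then show ?thesis by (subst eq) (rule mconv_sum[OF r], auto)
  qed
  have lim: "(\<lambda>i. \<integral>x. (norm (u x - F i x))\<^sup>2 \<partial>lborel) \<longlonglongrightarrow> (\<integral>x. (0::real) \<partial>(lborel :: (real^2) measure))"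
  \<comment> \<open>The factor 9 comes from |u - F i| \<le> |u| + 2 |u|.\<close>
  proof (rule integral_dominated_convergence[where w="\<lambda>x. 9 * (norm (u x))\<^sup>2"])
    show "AE x in lborel. (\<lambda>i. (norm (u x - F i x))\<^sup>2) \<longlonglongrightarrow> 0"
    proof (rule AE_I2)
      fix x
      have "(\<lambda>i. (norm (u x - F i x))\<^sup>2) \<longlonglongrightarrow> (norm (u x - u x))\<^sup>2" by (intro tendsto_intros F)
      then show "(\<lambda>i. (norm (u x - F i x))\<^sup>2) \<longlonglongrightarrow> 0" by simp
    qed
    show "AE x in lborel. norm ((norm (u x - F i x))\<^sup>2) \<le> 9 * (norm (u x))\<^sup>2" for i
    proof (rule AE_I2)
      fix x
      have "norm (u x - F i x) \<le> 3 * norm (u x)" using norm_triangle_ineq4[of "u x" "F i x"] F(3)[of i x] by linarith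
      then have "(norm (u x - F i x))\<^sup>2 \<le> (3 * norm (u x))\<^sup>2" by (rule power_mono) simp
      then show "norm ((norm (u x - F i x))\<^sup>2) \<le> 9 * (norm (u x))\<^sup>2" by (simp add: power_mult_distrib)
    qed
  qed (use u2 in simp_all)
  fix e :: real assume e: "0 < e"
  have "\<forall>\<^sub>F i in sequentially. (\<integral>x. (norm (u x - F i x))\<^sup>2 \<partial>lborel) < e\<^sup>2"
    using lim e by (intro order_tendstoD(2)[OF lim]) simp
  then obtain i where "(l2norm lborel (\<lambda>x. u x - F i x))\<^sup>2 < e\<^sup>2"
    by (auto simp: l2norm_sq eventually_sequentially)
  then have "l2norm lborel (\<lambda>x. u x - F i x) < e" by (rule power2_less_imp_less) (use e in simp)
  then show "\<exists>w. mconv x0 r w \<and> l2norm lborel (\<lambda>x. u x - w x) < e" using mF by blast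
qed

subsection \<open>Approximation on convex domains\<close>

lemma lebesgue_on_lborel:
  fixes f :: "'a::euclidean_space \<Rightarrow> 'b::euclidean_space"
  assumes U: "U \<in> sets borel" and f: "f \<in> borel_measurable (lebesgue_on U)" and g: "g \<in> borel_measurable borel"
    and ae: "AE x in lborel. g x = (if x \<in> U then f x else 0)"
  shows "integral\<^sup>L (lebesgue_on U) f = integral\<^sup>L lborel g" "integrable (lebesgue_on U) f \<longleftrightarrow> integrable lborel g"
proof -
  have UL: "U \<inter> space lebesgue \<in> sets lebesgue" using U by simp
  have e: "(\<lambda>x. indicator U x *\<^sub>R f x) = (\<lambda>x. if x \<in> U then f x else 0)" by (auto simp: indicator_def)
  have m: "(\<lambda>x. if x \<in> U then f x else 0) \<in> borel_measurable lebesgue"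
    using f U by (subst borel_measurable_if) auto
  have gm: "g \<in> borel_measurable lebesgue" using g by (simp add: measurable_completion)
  have ae': "AE x in lebesgue. (if x \<in> U then f x else 0) = g x"
    using AE_completion[OF ae] by eventually_elim simp
  have gl: "g \<in> borel_measurable lborel" using g by simp
  show "integral\<^sup>L (lebesgue_on U) f = integral\<^sup>L lborel g"
    unfolding integral_restrict_space[OF UL] e integral_cong_AE[OF m gm ae'] by (rule integral_completion[OF gl])
  show "integrable (lebesgue_on U) f \<longleftrightarrow> integrable lborel g"
    unfolding integrable_restrict_space[OF UL] e integrable_cong_AE[OF m gm ae'] by (rule integrable_completion[OF gl])
qed

text \<open>The Fubini arguments require Borel functions, while \<open>L2 (lebesgue_on U)\<close>
  refers to the completed measure. Borel versions of the coordinates of the zero extension are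
  reassembled over the basis.\<close>

lemma borel_extension:
  fixes f :: "'a::euclidean_space \<Rightarrow> 'b::euclidean_space"
  assumes U: "U \<in> sets borel" and f: "f \<in> borel_measurable (lebesgue_on U)"
  shows "\<exists>g\<in>borel_measurable borel. AE x in lborel. g x = (if x \<in> U then f x else 0)"
proof -
  define F where "F x = (if x \<in> U then f x else 0)" for x
  have m: "F \<in> borel_measurable lebesgue" unfolding F_def using f U by (subst borel_measurable_if) auto
  have "\<exists>h\<in>borel_measurable lborel. AE x in lborel. F x \<bullet> b = h x" for b
    by (rule completion_ex_borel_measurable_real) (use m in measurable)
  then obtain h where h: "\<And>b. h b \<in> borel_measurable lborel" "\<And>b. AE x in lborel. F x \<bullet> b = h b x" by metis
  have hm [measurable]: "h b \<in> borel_measurable borel" for b using h(1)[of b] by simp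
  have "AE x in lborel. \<forall>b\<in>Basis. F x \<bullet> b = h b x" by (rule AE_finite_allI) (use h(2) in auto)
  then have "AE x in lborel. (\<Sum>b\<in>Basis. h b x *\<^sub>R b) = F x"
  proof eventually_elim
    case (elim x)
    then have "(\<Sum>b\<in>Basis. h b x *\<^sub>R b) = (\<Sum>b\<in>Basis. (F x \<bullet> b) *\<^sub>R b)" by simp
    then show ?case by (simp add: euclidean_representation)
  qed
  moreover have "(\<lambda>x. \<Sum>b\<in>Basis. h b x *\<^sub>R b) \<in> borel_measurable borel" by measurable
  ultimately show ?thesis unfolding F_def[symmetric] by (intro bexI[of _ "\<lambda>x. \<Sum>b\<in>Basis. h b x *\<^sub>R b"])
qed

lemma finite_measure_lebesgue_on: "bounded U \<Longrightarrow> U \<in> sets borel \<Longrightarrow> finite_measure (lebesgue_on U)"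
  using emeasure_bounded_finite[of U]
  by (intro finite_measureI) (simp add: emeasure_restrict_space less_top)

lemma L2_integrable:
  fixes u :: "'a \<Rightarrow> 'b::euclidean_space"
  assumes "finite_measure M" "u \<in> L2 M" shows "integrable M u"
proof -
  interpret finite_measure M by fact
  have i: "integrable M (\<lambda>x. 1 + (norm (u x))\<^sup>2)" using assms(2) by (simp add: L2_def)
  have b: "norm (u x) \<le> norm (1 + (norm (u x))\<^sup>2)" for x
    using norm_mult_le_sq[of "u x" "1::real"] by simp
  show ?thesis
    by (rule Bochner_Integration.integrable_bound[OF i L2_D(1)[OF assms(2)] AE_I2[OF b]])
qed

lemma continuous_L2:
  fixes f :: "real^2 \<Rightarrow> 'b::euclidean_space"
  assumes "continuous_on UNIV f" "bounded U" "U \<in> sets borel" shows "f \<in> L2 (lebesgue_on U)"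
proof -
  interpret finite_measure "lebesgue_on U" by (rule finite_measure_lebesgue_on[OF assms(2,3)])
  have "compact (f ` closure U)"
    using assms by (intro compact_continuous_image continuous_on_subset[OF assms(1)]) (auto simp: compact_closure)
  then obtain B where B: "\<And>x. x \<in> U \<Longrightarrow> norm (f x) \<le> B"
    using closure_subset[of U] by (force dest!: compact_imp_bounded simp: bounded_iff)
  have fm: "f \<in> borel_measurable (lebesgue_on U)"
    using borel_measurable_continuous_onI[OF assms(1)] by (intro measurable_restrict_space1 measurable_completion) simp
  show ?thesis
    by (rule L2_bound[OF fm, of "\<lambda>x. B\<^sup>2"]) (use B in \<open>auto intro!: power_mono\<close>)
qed

lemma smooth_L2:
  fixes f :: "real^2 \<Rightarrow> 'b::euclidean_space"
  shows "smooth f \<Longrightarrow> bounded U \<Longrightarrow> U \<in> sets borel \<Longrightarrow> f \<in> L2 (lebesgue_on U)"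
  by (intro continuous_L2 smooth_continuous)

text \<open>The function is extended by zero and replaced by a Borel version; on the whole plane
  \<open>mconv_all\<close> applies, and restricting to U only decreases the norm of the
  error.\<close>

lemma mols_L2lim:
  fixes u :: "real^2 \<Rightarrow> 'b::euclidean_space"
  assumes U: "open U" "bounded U" and r: "0 < r" and u: "u \<in> L2 (lebesgue_on U)"
  shows "L2lim (lebesgue_on U) (\<lambda>n. mols x0 r n (lebesgue_on U) u) u"
proof -
  have Um [measurable]: "U \<in> sets borel" using U by simp
  note um = L2_D(1)[OF u]
  obtain g where g [measurable]: "g \<in> borel_measurable borel" and ae: "AE x in lborel. g x = (if x \<in> U then u x else 0)"
    using borel_extension[OF Um um] by blast
  have ui: "integrable (lebesgue_on U) u" by (rule L2_integrable[OF finite_measure_lebesgue_on[OF U(2) Um] u])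
  have gi: "integrable lborel g" using lebesgue_on_lborel(2)[OF Um um g ae] ui by simp
  have gL: "g \<in> L2 lborel"
  proof -
    have "integrable (lebesgue_on U) (\<lambda>x. (norm (u x))\<^sup>2) = integrable lborel (\<lambda>x. (norm (g x))\<^sup>2)"
      by (rule lebesgue_on_lborel(2)[OF Um]) (use um ae in \<open>auto elim: eventually_mono\<close>)
    then show ?thesis using u by (simp add: L2_def)
  qed
  have pn: "0 < r * eps_seq n" for n using r eps_seq(1)[of n] by simp
  have cv: "conv (lebesgue_on U) \<psi> u x = conv lborel \<psi> g x" if "smooth \<psi>" for \<psi> x
  proof -
    have p: "continuous_on UNIV (\<lambda>y. \<psi> (x - y))"
      by (rule continuous_on_compose2[OF smooth_continuous[OF that, of UNIV]]) (auto intro!: continuous_intros)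
    then have [measurable]: "(\<lambda>y. \<psi> (x - y)) \<in> borel_measurable borel" by (rule borel_measurable_continuous_onI)
    have "(\<lambda>y. \<psi> (x - y)) \<in> borel_measurable (lebesgue_on U)" using p cont_meas_lebesgue_on by (simp add: cont_meas_def)
    then show ?thesis unfolding conv_def
      by (intro lebesgue_on_lborel(1)[OF Um]) (use um ae in \<open>auto elim: eventually_mono\<close>)
  qed
  have meq: "mols x0 r n (lebesgue_on U) u = mols x0 r n lborel g" for n
    by (rule ext) (simp add: mols_def mol_def cv[OF kern_smooth])
  have sm: "smooth (mols x0 r n (lebesgue_on U) u)" for n
    unfolding mols_def by (rule mol_smooth[OF pn ui cont_meas_lebesgue_on])
  have mL: "mols x0 r n (lebesgue_on U) u \<in> L2 (lebesgue_on U)" for n by (rule smooth_L2[OF sm U(2) Um])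
  have mL2: "mols x0 r n lborel g \<in> L2 lborel" for n by (rule mols_L2(1)[OF r gi gL])
  have "l2norm (lebesgue_on U) (\<lambda>x. mols x0 r n (lebesgue_on U) u x - u x) \<le> l2norm lborel (\<lambda>x. mols x0 r n lborel g x - g x)" for n
  proof -
    let ?d = "\<lambda>x. mols x0 r n lborel g x - g x"
    have dL: "?d \<in> L2 lborel" by (rule L2_diff[OF mL2 gL])
    have dm [measurable]: "?d \<in> borel_measurable borel" using L2_D(1)[OF dL] by simp
    have d2: "integrable lborel (\<lambda>x. (norm (?d x))\<^sup>2)" by (rule L2_D(2)[OF dL])
    have i: "integrable lborel (\<lambda>x. indicator U x *\<^sub>R (norm (?d x))\<^sup>2)"
      by (rule integrable_mult_indicator[OF _ d2]) simp
    have "(\<integral>x. (norm (mols x0 r n (lebesgue_on U) u x - u x))\<^sup>2 \<partial>lebesgue_on U) = (\<integral>x. indicator U x *\<^sub>R (norm (?d x))\<^sup>2 \<partial>lborel)"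
    proof (rule lebesgue_on_lborel(1)[OF Um])
      show "(\<lambda>x. (norm (mols x0 r n (lebesgue_on U) u x - u x))\<^sup>2) \<in> borel_measurable (lebesgue_on U)"
        using L2_D(2)[OF L2_diff[OF mL u]] by (rule borel_measurable_integrable)
      show "AE x in lborel. indicator U x *\<^sub>R (norm (?d x))\<^sup>2 = (if x \<in> U then (norm (mols x0 r n (lebesgue_on U) u x - u x))\<^sup>2 else 0)"
        using ae by eventually_elim (simp add: meq)
    qed measurable
    also have "\<dots> \<le> (\<integral>x. (norm (?d x))\<^sup>2 \<partial>lborel)"
      by (rule integral_mono[OF i d2]) (simp add: indicator_def)
    finally show ?thesis unfolding l2norm_def by (rule real_sqrt_le_mono)
  qed
  then have le: "norm (l2norm (lebesgue_on U) (\<lambda>x. mols x0 r n (lebesgue_on U) u x - u x)) \<le> l2norm lborel (\<lambda>x. mols x0 r n lborel g x - g x)" for n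
    by simp
  have "(\<lambda>n. l2norm lborel (\<lambda>x. mols x0 r n lborel g x - g x)) \<longlonglongrightarrow> 0"
    using mconv_all[OF r gi gL, of x0] by (simp add: mconv_def)
  then have "(\<lambda>n. l2norm (lebesgue_on U) (\<lambda>x. mols x0 r n (lebesgue_on U) u x - u x)) \<longlonglongrightarrow> 0"
    by (rule Lim_null_comparison[OF always_eventually[OF allI[OF le]]])
  then show ?thesis using mL u by (simp add: L2lim_def)
qed

text \<open>For x in U the reflected kernel y \<mapsto> k(z - y) is itself a test function of U, so
  the definition of the weak derivative applies to it directly. The factor 1 -
  \<open>eps_seq n\<close> is the inner derivative of the contraction.\<close>

lemma mols_weak_partial:
  fixes u :: "real^2 \<Rightarrow> 'b::euclidean_space"
  assumes U: "open U" "bounded U" "convex U" and r: "0 < r" "r < R" "ball x0 R \<subseteq> U"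
    and u: "u \<in> L2 (lebesgue_on U)" and w: "is_weak_partial U i u g" and x: "x \<in> U"
  shows "cpartial i (mols x0 r n (lebesgue_on U) u) x = (1 - eps_seq n) *\<^sub>R mols x0 r n (lebesgue_on U) g x"
proof -
  have Um: "U \<in> sets borel" using U by simp
  have ui: "integrable (lebesgue_on U) u" by (rule L2_integrable[OF finite_measure_lebesgue_on[OF U(2) Um] u])
  define e where "e = eps_seq n"
  have e: "0 < e" "e \<le> 1/2" using eps_seq(1,2)[of n] by (auto simp: e_def)
  define z where "z = e *\<^sub>R x0 + (1 - e) *\<^sub>R x"
  define k where "k = kern (r * e)"
  have pn: "0 < r * e" using r e by simp
  \<comment> \<open>Every point of the ball is e times a point of \<open>ball x0 R\<close> plus (1 -
    e) times x, so convexity keeps it in U.\<close>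
  have ball: "cball z (r * e) \<subseteq> U"
  proof
    fix y assume "y \<in> cball z (r * e)"
    then have "norm (y - z) \<le> r * e" by (simp add: dist_norm norm_minus_commute)
    then have "norm ((1/e) *\<^sub>R (y - z)) \<le> r" using e by (simp only: norm_scaleR) (simp add: divide_le_eq)
    then have "x0 + (1/e) *\<^sub>R (y - z) \<in> ball x0 R" using r by (simp add: dist_norm)
    then have "x0 + (1/e) *\<^sub>R (y - z) \<in> U" using r by blast
    then have "e *\<^sub>R (x0 + (1/e) *\<^sub>R (y - z)) + (1 - e) *\<^sub>R x \<in> U"
      using U(3) x e by (intro convexD) auto
    moreover have "e *\<^sub>R (x0 + (1/e) *\<^sub>R (y - z)) + (1 - e) *\<^sub>R x = y"
      using e by (simp add: z_def scaleR_add_right)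
    ultimately show "y \<in> U" by simp
  qed
  have tf: "test_function U (\<lambda>y. k (z + (-1) *\<^sub>R y))"
  proof -
    have sup: "closure {y. k (z + (-1) *\<^sub>R y) \<noteq> 0} \<subseteq> cball z (r * e)"
    proof (rule closure_minimal)
      show "{y. k (z + (-1) *\<^sub>R y) \<noteq> 0} \<subseteq> cball z (r * e)"
        using kern_eq_0[OF pn] by (force simp: k_def dist_norm)
    qed simp
    have "smooth (\<lambda>y. k (z + (-1) *\<^sub>R y))" unfolding k_def by (rule smooth_affine[OF kern_smooth])
    moreover have "compact (closure {y. k (z + (-1) *\<^sub>R y) \<noteq> 0})"
      using bounded_subset[OF bounded_cball sup] by (simp add: compact_eq_bounded_closed)
    ultimately show ?thesis unfolding test_function_def using sup ball by blast
  qed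
  have cp: "cpartial i (\<lambda>y. k (z + (-1) *\<^sub>R y)) y = - cpartial i k (z - y)" for y
    unfolding k_def using cpartial_affine(1)[OF smooth_differentiable[OF kern_smooth], of i "r * e" z "-1" y] by simp
  have "(\<integral>y. cpartial i (\<lambda>y. k (z + (-1) *\<^sub>R y)) y *\<^sub>R u y \<partial>lebesgue_on U) = - (\<integral>y. k (z + (-1) *\<^sub>R y) *\<^sub>R g y \<partial>lebesgue_on U)"
    using w tf unfolding is_weak_partial_def by blast
  then have eq: "(\<integral>y. cpartial i k (z - y) *\<^sub>R u y \<partial>lebesgue_on U) = (\<integral>y. k (z - y) *\<^sub>R g y \<partial>lebesgue_on U)"
    unfolding cp by simp
  have "cpartial i (mols x0 r n (lebesgue_on U) u) x = (1 - e) *\<^sub>R conv (lebesgue_on U) (cpartial i k) u z"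
    unfolding mols_def e_def[symmetric] k_def z_def by (rule mol_cpartial[OF pn ui cont_meas_lebesgue_on])
  also have "conv (lebesgue_on U) (cpartial i k) u z = conv (lebesgue_on U) k g z"
    unfolding conv_def by (rule eq)
  also have "\<dots> = mols x0 r n (lebesgue_on U) g x"
    by (simp add: mols_def mol_def e_def[symmetric] k_def z_def)
  finally show ?thesis by (simp add: e_def)
qed

text \<open>One sequence of operators serves u and its weak derivatives at once: derivatives of the
  approximants of u are, up to the factor c, approximants of the weak derivatives. Applied
  repeatedly this reaches the Hessian.\<close>

theorem mollification:
  fixes U :: "(real^2) set"
  assumes U: "open U" "bounded U" "convex U" "U \<noteq> {}"
  obtains A :: "nat \<Rightarrow> (real^2 \<Rightarrow> 'b::euclidean_space) \<Rightarrow> real^2 \<Rightarrow> 'b" and c :: "nat \<Rightarrow> real"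
  where "c \<longlonglongrightarrow> 1"
    and "\<And>n u. u \<in> L2 (lebesgue_on U) \<Longrightarrow> smooth (A n u)"
    and "\<And>u. u \<in> L2 (lebesgue_on U) \<Longrightarrow> L2lim (lebesgue_on U) (\<lambda>n. A n u) u"
    and "\<And>n u i j x. u \<in> L2 (lebesgue_on U) \<Longrightarrow> cpartial i (cpartial j (A n u)) x = cpartial j (cpartial i (A n u)) x"
    and "\<And>n u g i x. u \<in> L2 (lebesgue_on U) \<Longrightarrow> is_weak_partial U i u g \<Longrightarrow> x \<in> U \<Longrightarrow>
      cpartial i (A n u) x = c n *\<^sub>R A n g x"
proof -
  obtain x0 R where R: "0 < R" "ball x0 R \<subseteq> U" using U openE by blast
  define r where "r = R / 2"
  have r: "0 < r" "r < R" using R by (auto simp: r_def)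
  have Um: "U \<in> sets borel" using U by simp
  have ui: "integrable (lebesgue_on U) u" if "u \<in> L2 (lebesgue_on U)" for u :: "real^2 \<Rightarrow> 'b"
    by (rule L2_integrable[OF finite_measure_lebesgue_on[OF U(2) Um] that])
  have pn: "0 < r * eps_seq n" for n using r eps_seq(1)[of n] by simp
  have "(\<lambda>n. 1 - eps_seq n) \<longlonglongrightarrow> 1 - 0" by (intro tendsto_intros eps_seq)
  then have c: "(\<lambda>n. 1 - eps_seq n) \<longlonglongrightarrow> 1" by simp
  show ?thesis
  proof (rule that[of "\<lambda>n. 1 - eps_seq n" "\<lambda>n. mols x0 r n (lebesgue_on U)"])
    fix n i j x and u :: "real^2 \<Rightarrow> 'b" assume u: "u \<in> L2 (lebesgue_on U)"
    show "smooth (mols x0 r n (lebesgue_on U) u)"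
      unfolding mols_def by (rule mol_smooth[OF pn ui[OF u] cont_meas_lebesgue_on])
    show "cpartial i (cpartial j (mols x0 r n (lebesgue_on U) u)) x = cpartial j (cpartial i (mols x0 r n (lebesgue_on U) u)) x"
      unfolding mols_def by (rule mol_cpartial_commute[OF pn ui[OF u] cont_meas_lebesgue_on])
    show "L2lim (lebesgue_on U) (\<lambda>n. mols x0 r n (lebesgue_on U) u) u"
      by (rule mols_L2lim[OF U(1,2) r(1) u])
  qed (use c mols_weak_partial[OF U(1-3) r R(2)] in auto)
qed

section \<open>Integration over triangles\<close>

text \<open>The planar determinant det(x, y); \<open>crossp (b - a) (c - b)\<close> is twice the
  signed area of the triangle a, b, c.\<close>

definition crossp :: "real^2 \<Rightarrow> real^2 \<Rightarrow> real" where
  "crossp x y = x $ 1 * y $ 2 - x $ 2 * y $ 1"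

definition pt :: "real \<Rightarrow> real \<Rightarrow> real^2" where "pt s t = vector [s, t]"

lemma pt_nth [simp]: "pt s t $ 1 = s" "pt s t $ 2 = t"
  by (simp_all add: pt_def)

lemma continuous_pt: "continuous_on S (\<lambda>x. pt (fst x) (snd x))"
proof -
  have e: "pt s t = s *\<^sub>R axis 1 1 + t *\<^sub>R axis 2 1" for s t
    by (simp add: vec_eq_iff forall_2 axis_def)
  show ?thesis unfolding e by (intro continuous_intros)
qed

lemma pt_measurable: "(\<lambda>x. pt (fst x) (snd x)) \<in> borel_measurable borel"
  by (rule borel_measurable_continuous_onI[OF continuous_pt])

section \<open>Fubini on the plane and on the reference triangle\<close>

lemma lborel_vec2: "lborel = distr (lborel \<Otimes>\<^sub>M lborel) borel (\<lambda>x. pt (fst x) (snd x))"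
proof (rule lborel_eqI)
  have m: "(\<lambda>x. pt (fst x) (snd x)) \<in> measurable (lborel \<Otimes>\<^sub>M lborel) borel"
    using pt_measurable by (simp add: lborel_prod)
  fix l u :: "real^2" assume le: "\<And>b. b \<in> Basis \<Longrightarrow> l \<bullet> b \<le> u \<bullet> b"
  have le1: "l $ i \<le> u $ i" for i using le[of "axis i 1"] by (auto simp: inner_axis Basis_vec_def)
  have "(\<lambda>x. pt (fst x) (snd x)) -` box l u \<inter> space (lborel \<Otimes>\<^sub>M lborel) = {l$1<..<u$1} \<times> {l$2<..<u$2}"
    by (auto simp: mem_box_cart forall_2 space_pair_measure)
  then have "emeasure (distr (lborel \<Otimes>\<^sub>M lborel) borel (\<lambda>x. pt (fst x) (snd x))) (box l u)
      = emeasure (lborel \<Otimes>\<^sub>M lborel) ({l$1<..<u$1} \<times> {l$2<..<u$2})"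
    by (simp add: emeasure_distr[OF m])
  also have "\<dots> = ennreal (u$1 - l$1) * ennreal (u$2 - l$2)"
    by (subst lborel.emeasure_pair_measure_Times) (use le1 in simp_all)
  also have "\<dots> = ennreal ((u$1 - l$1) * (u$2 - l$2))" using le1 by (simp add: ennreal_mult)
  also have "(u$1 - l$1) * (u$2 - l$2) = (\<Prod>b\<in>Basis. (u - l) \<bullet> b)"
  proof -
    have B: "(Basis :: (real^2) set) = (\<lambda>i. axis i 1) ` UNIV" by (auto simp: Basis_vec_def)
    have inj: "inj (\<lambda>i::2. axis i (1::real))" by (simp add: inj_on_def axis_eq_axis)
    show ?thesis unfolding B prod.reindex[OF inj] by (simp add: UNIV_2 inner_axis)
  qed
  finally show "emeasure (distr (lborel \<Otimes>\<^sub>M lborel) borel (\<lambda>x. pt (fst x) (snd x))) (box l u) = ennreal (\<Prod>b\<in>Basis. (u - l) \<bullet> b)" .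
qed simp

text \<open>In the parametrisation a + x_1 (b - a) + x_2 (c - b) the origin is the vertex a and the
  side x_1 = 1 is the edge from b to c. Dilations about a thus become dilations about the
  origin.\<close>

definition reftri :: "(real^2) set" where
  "reftri = {x. 0 \<le> x $ 2 \<and> x $ 2 \<le> x $ 1 \<and> x $ 1 \<le> 1}"

lemma compact_reftri: "compact reftri"
proof -
  have e: "reftri = {x. 0 \<le> x $ 2} \<inter> {x. x $ 2 \<le> x $ 1} \<inter> {x. x $ 1 \<le> 1}" by (auto simp: reftri_def)
  have "closed reftri" unfolding e by (intro closed_Int closed_Collect_le continuous_intros)
  moreover have "bounded reftri"
  proof (rule bounded_subset[OF bounded_cbox[of "pt 0 0" "pt 1 1"]])
    show "reftri \<subseteq> cbox (pt 0 0) (pt 1 1)" by (auto simp: reftri_def mem_box_cart forall_2)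
  qed
  ultimately show ?thesis by (simp add: compact_eq_bounded_closed)
qed

lemma compact_integrable:
  fixes h :: "'a::euclidean_space \<Rightarrow> 'b::euclidean_space"
  assumes "compact K" "continuous_on UNIV h"
  shows "integrable lborel (\<lambda>x. indicator K x *\<^sub>R h x)" "integrable (lebesgue_on K) h" "h absolutely_integrable_on K"
proof -
  show 1: "integrable lborel (\<lambda>x. indicator K x *\<^sub>R h x)"
    using borel_integrable_compact[OF assms(1) continuous_on_subset[OF assms(2)]]
    by (simp add: indicator_scaleR_eq_if)
  then have "integrable lebesgue (\<lambda>x. indicator K x *\<^sub>R h x)"
    by (subst integrable_completion) (auto dest: borel_measurable_integrable)
  then show "h absolutely_integrable_on K" by (simp add: set_integrable_def)
  then show "integrable (lebesgue_on K) h"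
    using fmeasurableD[OF lmeasurable_compact[OF assms(1)]] by (simp add: set_integrable_def integrable_restrict_space)
qed

text \<open>Integrability of the inner integrals is recorded as well, because
  \<open>reftri_poincare\<close> treats them as functions in their own right.\<close>

lemma reftri_Fubini:
  fixes h :: "real^2 \<Rightarrow> real"
  assumes h: "integrable lborel (\<lambda>x. indicator reftri x *\<^sub>R h x)"
  shows "(\<integral>x. indicator reftri x *\<^sub>R h x \<partial>lborel) = (\<integral>t. indicator {0..1} t *\<^sub>R (\<integral>s. indicator {t..1} s *\<^sub>R h (pt s t) \<partial>lborel) \<partial>lborel)" (is "?I = ?A")
    and "(\<integral>x. indicator reftri x *\<^sub>R h x \<partial>lborel) = (\<integral>s. indicator {0..1} s *\<^sub>R (\<integral>t. indicator {0..s} t *\<^sub>R h (pt s t) \<partial>lborel) \<partial>lborel)" (is "_ = ?B")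
    and "integrable lborel (\<lambda>t. indicator {0..1} t *\<^sub>R (\<integral>s. indicator {t..1} s *\<^sub>R h (pt s t) \<partial>lborel))"
    and "integrable lborel (\<lambda>s. indicator {0..1} s *\<^sub>R (\<integral>t. indicator {0..s} t *\<^sub>R h (pt s t) \<partial>lborel))"
proof -
  have m: "(\<lambda>x. pt (fst x) (snd x)) \<in> measurable (lborel \<Otimes>\<^sub>M lborel) borel"
    using pt_measurable by (simp add: lborel_prod)
  define H where "H x = indicator reftri x *\<^sub>R h x" for x
  have i: "integrable lborel H" unfolding H_def by (rule h)
  then have Hm: "H \<in> borel_measurable borel" by (simp add: borel_measurable_integrable[of lborel])
  have i2: "integrable (lborel \<Otimes>\<^sub>M lborel) (\<lambda>x. H (pt (fst x) (snd x)))"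
    using i unfolding lborel_vec2 by (subst (asm) integrable_distr_eq[OF m Hm])
  have I: "?I = (\<integral>x. H (pt (fst x) (snd x)) \<partial>(lborel \<Otimes>\<^sub>M lborel))"
    unfolding H_def[symmetric] by (subst lborel_vec2) (rule integral_distr[OF m Hm])
  have e1: "(\<integral>s. H (pt s t) \<partial>lborel) = indicator {0..1} t *\<^sub>R (\<integral>s. indicator {t..1} s *\<^sub>R h (pt s t) \<partial>lborel)" for t
  proof -
    have "H (pt s t) = indicator {0..1} t *\<^sub>R (indicator {t..1} s *\<^sub>R h (pt s t))" for s
      by (auto simp: H_def reftri_def indicator_def)
    then show ?thesis by simp
  qed
  have e2: "(\<integral>t. H (pt s t) \<partial>lborel) = indicator {0..1} s *\<^sub>R (\<integral>t. indicator {0..s} t *\<^sub>R h (pt s t) \<partial>lborel)" for s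
  proof -
    have "H (pt s t) = indicator {0..1} s *\<^sub>R (indicator {0..s} t *\<^sub>R h (pt s t))" for t
      by (auto simp: H_def reftri_def indicator_def)
    then show ?thesis by simp
  qed
  have i3: "integrable (lborel \<Otimes>\<^sub>M lborel) (\<lambda>(s, t). H (pt s t))" using i2 by (simp add: case_prod_beta')
  show "?I = ?A" unfolding I e1[symmetric]
    using lborel_pair.integral_snd[OF i3] by (simp add: case_prod_beta')
  show "?I = ?B" unfolding I e2[symmetric]
    using lborel_pair.integral_fst[OF i3] by (simp add: case_prod_beta')
  show "integrable lborel (\<lambda>t. indicator {0..1} t *\<^sub>R (\<integral>s. indicator {t..1} s *\<^sub>R h (pt s t) \<partial>lborel))"
    unfolding e1[symmetric] by (rule lborel_pair.integrable_snd[OF i3])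
  show "integrable lborel (\<lambda>s. indicator {0..1} s *\<^sub>R (\<integral>t. indicator {0..s} t *\<^sub>R h (pt s t) \<partial>lborel))"
    unfolding e2[symmetric] by (rule lborel_pair.integrable_fst[OF i3])
qed

lemma pt_split: "pt s t = pt 0 t + s *\<^sub>R axis 1 1" "pt s t = pt s 0 + t *\<^sub>R axis 2 1"
  by (simp_all add: vec_eq_iff forall_2 axis_def)

lemma continuous_pt_comp:
  fixes h :: "real^2 \<Rightarrow> 'b::topological_space"
  assumes "continuous_on UNIV h"
  shows "continuous_on S (\<lambda>s. h (pt s t))" "continuous_on S (\<lambda>t. h (pt s t))"
proof -
  have "continuous_on S (\<lambda>s. pt s t)" "continuous_on S (\<lambda>t. pt s t)"
    using continuous_on_compose2[OF continuous_pt[of UNIV], of S "\<lambda>s. (s, t)"]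
      continuous_on_compose2[OF continuous_pt[of UNIV], of S "\<lambda>t. (s, t)"]
    by (simp_all add: continuous_on_Pair)
  then show "continuous_on S (\<lambda>s. h (pt s t))" "continuous_on S (\<lambda>t. h (pt s t))"
    by (auto intro: continuous_on_compose2[OF assms])
qed

lemma has_vector_derivative_line:
  assumes d: "\<And>x. F differentiable at x"
  shows "((\<lambda>r. F (p + r *\<^sub>R z)) has_vector_derivative (\<Sum>j\<in>UNIV. z $ j *\<^sub>R cpartial j F (p + r *\<^sub>R z))) (at r within S)"
proof -
  have "((\<lambda>r. p + r *\<^sub>R z) has_derivative (\<lambda>h. h *\<^sub>R z)) (at r within S)"
    by (auto intro!: derivative_eq_intros)
  from has_derivative_compose[OF this differentiable_cpartial[OF d]]
  show ?thesis by (simp add: has_vector_derivative_def scaleR_sum_right)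
qed

lemma has_vector_derivative_pt:
  assumes d: "\<And>x. F differentiable at x"
  shows "((\<lambda>s. F (pt s t)) has_vector_derivative cpartial 1 F (pt s t)) (at s within S)"
    "((\<lambda>t. F (pt s t)) has_vector_derivative cpartial 2 F (pt s t)) (at t within S)"
proof -
  have "((\<lambda>r. F (p + r *\<^sub>R axis i 1)) has_vector_derivative cpartial i F (p + r *\<^sub>R axis i 1)) (at r within S)" for p r and i :: 2
  proof -
    have "(\<Sum>j\<in>UNIV. axis i 1 $ j *\<^sub>R cpartial j F x) = cpartial i F x" for x
      by (simp add: axis_def if_distrib[of "\<lambda>a. a *\<^sub>R _"] cong: if_cong)
    then show ?thesis using has_vector_derivative_line[OF d, of p "axis i 1" r S] by simp
  qed
  from this[of "pt 0 t" 1 s] this[of "pt s 0" 2 t]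
  show "((\<lambda>s. F (pt s t)) has_vector_derivative cpartial 1 F (pt s t)) (at s within S)"
    "((\<lambda>t. F (pt s t)) has_vector_derivative cpartial 2 F (pt s t)) (at t within S)"
    unfolding pt_split(1)[of _ t, symmetric] pt_split(2)[of s, symmetric] .
qed

text \<open>The integrand is \<partial>_1 (x_1 F) + \<partial>_2 (x_2 F). Each part is integrated in
  its own direction: the two contributions of the diagonal cancel, the side x_2 = 0 contributes
  nothing, and only x_1 = 1 remains.\<close>

lemma reftri_identity:
  fixes F :: "real^2 \<Rightarrow> real"
  assumes F: "Ck 1 F"
  shows "(\<integral>x. indicator reftri x *\<^sub>R (2 * F x + x $ 1 * cpartial 1 F x + x $ 2 * cpartial 2 F x) \<partial>lborel)
    = (\<integral>t. indicator {0..1} t *\<^sub>R F (pt 1 t) \<partial>lborel)"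
proof -
  have d: "\<And>x. F differentiable at x" and c: "continuous_on UNIV (cpartial i F)" for i using F by auto
  have cF: "continuous_on UNIV F" by (rule Ck_continuous[OF F])
  define P where "P x = F x + x $ 1 * cpartial 1 F x" for x
  define Q where "Q x = F x + x $ 2 * cpartial 2 F x" for x
  have cP: "continuous_on UNIV P" "continuous_on UNIV Q" unfolding P_def Q_def by (intro continuous_intros cF c)+
  have D1: "((\<lambda>s. s * F (pt s t)) has_vector_derivative P (pt s t)) (at s within S)" for s t S
    using has_vector_derivative_pt(1)[OF d, of t s S]
    by (auto intro!: derivative_eq_intros simp: P_def has_real_derivative_iff_has_vector_derivative[symmetric])
  have D2: "((\<lambda>t. t * F (pt s t)) has_vector_derivative Q (pt s t)) (at t within S)" for s t S
    using has_vector_derivative_pt(2)[OF d, of s t S]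
    by (auto intro!: derivative_eq_intros simp: Q_def has_real_derivative_iff_has_vector_derivative[symmetric])
  note cs = continuous_pt_comp
  have i1: "(\<integral>s. indicator {t..1} s *\<^sub>R P (pt s t) \<partial>lborel) = F (pt 1 t) - t * F (pt t t)" if "t \<in> {0..1}" for t
    using integral_FTC_atLeastAtMost[of t 1 "\<lambda>s. s * F (pt s t)" "\<lambda>s. P (pt s t)", OF _ D1 cs(1)[OF cP(1)]] that by simp
  have i2: "(\<integral>t. indicator {0..s} t *\<^sub>R Q (pt s t) \<partial>lborel) = s * F (pt s s)" if "s \<in> {0..1}" for s
    using integral_FTC_atLeastAtMost[of 0 s "\<lambda>t. t * F (pt s t)" "\<lambda>t. Q (pt s t)", OF _ D2 cs(2)[OF cP(2)]] that by simp
  have "(\<integral>x. indicator reftri x *\<^sub>R P x \<partial>lborel) = (\<integral>t. indicator {0..1} t *\<^sub>R (F (pt 1 t) - t * F (pt t t)) \<partial>lborel)"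
    unfolding reftri_Fubini(1)[OF compact_integrable(1)[OF compact_reftri cP(1)]] using i1 by (intro Bochner_Integration.integral_cong) (auto simp: indicator_def)
  moreover have "(\<integral>x. indicator reftri x *\<^sub>R Q x \<partial>lborel) = (\<integral>s. indicator {0..1} s *\<^sub>R (s * F (pt s s)) \<partial>lborel)"
    unfolding reftri_Fubini(2)[OF compact_integrable(1)[OF compact_reftri cP(2)]] using i2 by (intro Bochner_Integration.integral_cong) (auto simp: indicator_def)
  moreover have j1: "integrable lborel (\<lambda>t. indicator {0..1} t *\<^sub>R (t * F (pt t t)))"
  proof -
    have "continuous_on UNIV (\<lambda>t. pt t t)"
      using continuous_on_compose2[OF continuous_pt[of UNIV], of UNIV "\<lambda>t. (t, t)"] by (simp add: continuous_on_Pair)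
    then have "continuous_on UNIV (\<lambda>t. t * F (pt t t))"
      by (intro continuous_intros continuous_on_compose2[OF cF]) auto
    then show ?thesis by (rule compact_integrable(1)[OF compact_Icc])
  qed
  moreover have j2: "integrable lborel (\<lambda>t. indicator {0..1} t *\<^sub>R F (pt 1 t))"
    by (rule compact_integrable(1)[OF compact_Icc cs(2)[OF cF]])
  moreover have "(\<integral>t. indicator {0..1} t *\<^sub>R (F (pt 1 t) - t * F (pt t t)) \<partial>lborel)
      = (\<integral>t. indicator {0..1} t *\<^sub>R F (pt 1 t) \<partial>lborel) - (\<integral>t. indicator {0..1} t *\<^sub>R (t * F (pt t t)) \<partial>lborel)"
    using j1 j2 by (simp add: right_diff_distrib)
  moreover have "(\<integral>x. indicator reftri x *\<^sub>R (2 * F x + x $ 1 * cpartial 1 F x + x $ 2 * cpartial 2 F x) \<partial>lborel)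
      = (\<integral>x. indicator reftri x *\<^sub>R P x + indicator reftri x *\<^sub>R Q x \<partial>lborel)"
    by (simp add: P_def Q_def algebra_simps)
  moreover have "\<dots> = (\<integral>x. indicator reftri x *\<^sub>R P x \<partial>lborel) + (\<integral>x. indicator reftri x *\<^sub>R Q x \<partial>lborel)"
    by (intro Bochner_Integration.integral_add compact_integrable(1)[OF compact_reftri] cP)
  ultimately show ?thesis by simp
qed

lemma integral_interior_convex:
  fixes h :: "real^2 \<Rightarrow> real"
  assumes T: "convex T" "compact T" and h: "continuous_on UNIV h"
  shows "(\<integral>x. h x \<partial>lebesgue_on (interior T)) = integral T h"
proof -
  have "integrable (lebesgue_on (interior T)) h"
  proof -
    have "h absolutely_integrable_on interior T"
      by (rule set_integrable_subset[OF compact_integrable(3)[OF T(2) h]]) (auto simp: interior_subset)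
    then show ?thesis by (simp add: set_integrable_def integrable_restrict_space)
  qed
  then have "(\<integral>x. h x \<partial>lebesgue_on (interior T)) = integral (interior T) h"
    by (rule lebesgue_integral_eq_integral) simp
  also have "\<dots> = integral T h"
  proof (rule integral_spike_set)
    have n: "negligible (frontier T)" by (rule negligible_convex_frontier[OF T(1)])
    show "negligible {x \<in> interior T - T. h x \<noteq> 0}" using interior_subset[of T] by (auto intro: negligible_subset[OF negligible_empty])
    show "negligible {x \<in> T - interior T. h x \<noteq> 0}"
      by (rule negligible_subset[OF n]) (use closure_subset[of T] in \<open>auto simp: frontier_def\<close>)
  qed
  finally show ?thesis .
qed

lemma triangle_image:
  fixes a b c :: "real^2"
  shows "convex hull {a, b, c} = (\<lambda>x. a + (x $ 1 *\<^sub>R (b - a) + x $ 2 *\<^sub>R (c - b))) ` reftri"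
proof -
  have "(\<lambda>x. a + (x $ 1 *\<^sub>R (b - a) + x $ 2 *\<^sub>R (c - b))) ` reftri
      = {u *\<^sub>R a + v *\<^sub>R b + w *\<^sub>R c | u v w. 0 \<le> u \<and> 0 \<le> v \<and> 0 \<le> w \<and> u + v + w = 1}" (is "?L = ?R")
  proof
    show "?L \<subseteq> ?R"
    proof
      fix y assume "y \<in> ?L"
      then obtain x where x: "x \<in> reftri" "y = a + (x $ 1 *\<^sub>R (b - a) + x $ 2 *\<^sub>R (c - b))" by auto
      have "y = (1 - x $ 1) *\<^sub>R a + (x $ 1 - x $ 2) *\<^sub>R b + x $ 2 *\<^sub>R c" by (simp add: x(2) algebra_simps)
      with x(1) show "y \<in> ?R" unfolding reftri_def by (intro CollectI exI[of _ "1 - x$1"] exI[of _ "x$1 - x$2"] exI[of _ "x$2"]) auto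
    qed
    show "?R \<subseteq> ?L"
    proof
      fix y assume "y \<in> ?R"
      then obtain u v w where u: "0 \<le> u" "0 \<le> v" "0 \<le> w" "u + v + w = 1" "y = u *\<^sub>R a + v *\<^sub>R b + w *\<^sub>R c" by auto
      have u1: "u = 1 - v - w" using u by simp
      have "y = a + (pt (v + w) w $ 1 *\<^sub>R (b - a) + pt (v + w) w $ 2 *\<^sub>R (c - b))"
        unfolding u(5) u1 by (simp add: algebra_simps)
      moreover have "pt (v + w) w \<in> reftri" using u by (simp add: reftri_def)
      ultimately show "y \<in> ?L" by blast
    qed
  qed
  then show ?thesis by (simp add: convex_hull_3)
qed

lemma triangle_integral:
  fixes h :: "real^2 \<Rightarrow> real"
  assumes ch: "continuous_on UNIV h" and D: "crossp (b - a) (c - b) \<noteq> 0" and T: "T = convex hull {a, b, c}"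
  shows "(\<integral>x. h x \<partial>lebesgue_on (interior T)) = \<bar>crossp (b - a) (c - b)\<bar> *
    (\<integral>x. indicator reftri x *\<^sub>R h (a + (x $ 1 *\<^sub>R (b - a) + x $ 2 *\<^sub>R (c - b))) \<partial>lborel)"
proof -
  define g where "g x = x $ 1 *\<^sub>R (b - a) + x $ 2 *\<^sub>R (c - b)" for x :: "real^2"
  have lg: "linear g" unfolding g_def by (auto simp: linear_iff algebra_simps)
  have gd: "(g has_derivative g) (at x within S)" for x S by (rule linear_imp_has_derivative[OF lg])
  have agd: "((\<lambda>x. a + g x) has_derivative g) (at x within S)" for x S
    using has_derivative_add[OF has_derivative_const gd] by simp
  have det: "det (matrix g) = crossp (b - a) (c - b)"
    by (simp add: det_2 matrix_def g_def axis_def crossp_def)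
  have inj: "inj (\<lambda>x. a + g x)"
  proof -
    have "inj g" using det D det_nz_iff_inj[OF lg] by simp
    then show ?thesis by (simp add: inj_def)
  qed
  have Ti: "T = (\<lambda>x. a + g x) ` reftri" unfolding T g_def by (rule triangle_image)
  have cT: "compact T" "convex T" unfolding T by (auto simp: finite_imp_compact_convex_hull)
  have cag: "continuous_on UNIV (\<lambda>x. a + g x)" unfolding g_def by (intro continuous_intros)
  have chg: "continuous_on UNIV (\<lambda>x. h (a + g x))" by (rule continuous_on_compose2[OF ch cag]) simp
  \<comment> \<open>The change of variables is applied to functions with values in
    \<open>real^1\<close>; v and its coordinate translate in both directions.\<close>
  define v :: "real \<Rightarrow> real^1" where "v = vec"
  have vv: "v x $ 1 = x" for x by (simp add: v_def)
  have blv: "bounded_linear v" unfolding v_def by (rule linear_conv_bounded_linear[THEN iffD1]) (auto simp: linear_iff vec_eq_iff)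
  have cv: "continuous_on UNIV (\<lambda>x. v (h x))"
    using linear_continuous_on_compose[OF ch, of v] blv by (simp add: bounded_linear.linear)
  have "integral ((\<lambda>x. a + g x) ` reftri) (\<lambda>x. v (h x)) = integral reftri (\<lambda>x. \<bar>det (matrix g)\<bar> *\<^sub>R v (h (a + g x)))"
  proof (rule integral_change_of_variables)
    show "reftri \<in> sets lebesgue" using compact_reftri by (simp add: borel_compact sets_completionI_sets)
    show "((\<lambda>x. a + g x) has_derivative g) (at x within reftri)" for x by (rule agd)
    show "inj_on (\<lambda>x. a + g x) reftri" using inj by (rule inj_on_subset) simp
    show "(\<lambda>x. v (h x)) absolutely_integrable_on (\<lambda>x. a + g x) ` reftri \<or> (\<lambda>x. \<bar>det (matrix g)\<bar> *\<^sub>R v (h (a + g x))) absolutely_integrable_on reftri"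
      using compact_integrable(3)[OF cT(1) cv] Ti by simp
  qed
  then have "integral T (\<lambda>x. v (h x)) $ 1 = integral reftri (\<lambda>x. \<bar>det (matrix g)\<bar> *\<^sub>R v (h (a + g x))) $ 1" by (simp add: Ti)
  moreover have "integral T (\<lambda>x. v (h x)) $ 1 = integral T h"
    using integral_linear[OF set_lebesgue_integral_eq_integral(1)[OF compact_integrable(3)[OF cT(1) cv]] bounded_linear_vec_nth[of 1]]
    by (simp add: o_def vv)
  moreover have "integral reftri (\<lambda>x. \<bar>det (matrix g)\<bar> *\<^sub>R v (h (a + g x))) $ 1 = integral reftri (\<lambda>x. \<bar>det (matrix g)\<bar> * h (a + g x))"
  proof -
    have "continuous_on UNIV (\<lambda>x. \<bar>det (matrix g)\<bar> *\<^sub>R v (h (a + g x)))"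
      by (intro continuous_intros continuous_on_compose2[OF cv cag]) simp
    from integral_linear[OF set_lebesgue_integral_eq_integral(1)[OF compact_integrable(3)[OF compact_reftri this]] bounded_linear_vec_nth[of 1], symmetric]
    show ?thesis by (simp only: o_def vector_scaleR_component vv real_scaleR_def)
  qed
  moreover have "integral reftri (\<lambda>x. \<bar>det (matrix g)\<bar> * h (a + g x)) = \<bar>det (matrix g)\<bar> * integral reftri (\<lambda>x. h (a + g x))"
    by simp
  moreover have "integral reftri (\<lambda>x. h (a + g x)) = (\<integral>x. indicator reftri x *\<^sub>R h (a + g x) \<partial>lborel)"
  proof -
    have si: "set_integrable lborel reftri (\<lambda>x. h (a + g x))"
      using compact_integrable(1)[OF compact_reftri chg] by (simp add: set_integrable_def)
    show ?thesis using set_borel_integral_eq_integral(2)[OF si] by (simp add: set_lebesgue_integral_def)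
  qed
  ultimately have "integral T h = \<bar>crossp (b - a) (c - b)\<bar> * (\<integral>x. indicator reftri x *\<^sub>R h (a + g x) \<partial>lborel)"
    by (simp add: det)
  then show ?thesis unfolding g_def[symmetric] integral_interior_convex[OF cT(2,1) ch] .
qed

text \<open>Integrating \<open>div ((x - a) f)\<close> over a triangle only sees the edge opposite to the vertex \<open>a\<close>.
  Both the trace inequality and the divergence theorem are read off from this identity.\<close>

lemma triangle_edge_identity:
  fixes f :: "real^2 \<Rightarrow> real"
  assumes f: "Ck 1 f" and D: "crossp (b - a) (c - b) \<noteq> 0" and T: "T = convex hull {a, b, c}"
  shows "\<bar>crossp (b - a) (c - b)\<bar> * (\<integral>s. indicator {0..1} s *\<^sub>R f (b + s *\<^sub>R (c - b)) \<partial>lborel)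
    = (\<integral>x. 2 * f x + (\<Sum>j\<in>UNIV. (x - a) $ j * cpartial j f x) \<partial>lebesgue_on (interior T))"
proof -
  define g where "g x = x $ 1 *\<^sub>R (b - a) + x $ 2 *\<^sub>R (c - b)" for x :: "real^2"
  define h where "h x = 2 * f x + (\<Sum>j\<in>UNIV. (x - a) $ j * cpartial j f x)" for x
  have d: "\<And>x. f differentiable at x" and c: "continuous_on UNIV (cpartial i f)" for i using f by auto
  have ch: "continuous_on UNIV h" unfolding h_def
    by (intro continuous_intros c Ck_continuous[OF f])
  have agd: "((\<lambda>x. a + g x) has_derivative g) (at x)" for x
    unfolding g_def by (auto intro!: derivative_eq_intros bounded_linear_imp_has_derivative bounded_linear_vec_nth)
  have cag: "continuous_on UNIV (\<lambda>x. a + g x)" unfolding g_def by (intro continuous_intros)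
  have "(\<integral>x. indicator reftri x *\<^sub>R h (a + g x) \<partial>lborel) = (\<integral>t. indicator {0..1} t *\<^sub>R f (b + t *\<^sub>R (c - b)) \<partial>lborel)"
  proof -
    \<comment> \<open>Since the affine map sends the origin to a, the field x pulls back from x - a,
      and the Euler operators on both sides correspond.\<close>
    define F where "F x = f (a + g x)" for x
    have Fd: "(F has_derivative (\<lambda>k. \<Sum>j\<in>UNIV. (g k) $ j *\<^sub>R cpartial j f (a + g x))) (at x)" for x
      unfolding F_def by (rule has_derivative_compose[OF agd differentiable_cpartial[OF d]])
    have cp: "cpartial 1 F x = (\<Sum>j\<in>UNIV. (b - a) $ j * cpartial j f (a + g x))"
      "cpartial 2 F x = (\<Sum>j\<in>UNIV. (c - b) $ j * cpartial j f (a + g x))" for x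
      unfolding cpartial_eq[OF Fd] by (simp_all add: g_def axis_def)
    have cc: "continuous_on UNIV (\<lambda>x. \<Sum>j\<in>UNIV. q $ j * cpartial j f (a + g x))" for q :: "real^2"
      by (intro continuous_intros continuous_on_compose2[OF c cag]) simp
    have "continuous_on UNIV (cpartial 1 F)" "continuous_on UNIV (cpartial 2 F)"
      using cc[of "b - a"] cc[of "c - b"] unfolding cp[symmetric] .
    then have "Ck 1 F" using Fd by (auto simp: forall_2 differentiable_def)
    from reftri_identity[OF this]
    have "(\<integral>x. indicator reftri x *\<^sub>R (2 * F x + x $ 1 * cpartial 1 F x + x $ 2 * cpartial 2 F x) \<partial>lborel)
      = (\<integral>t. indicator {0..1} t *\<^sub>R F (pt 1 t) \<partial>lborel)" .
    moreover have "2 * F x + x $ 1 * cpartial 1 F x + x $ 2 * cpartial 2 F x = h (a + g x)" for x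
      unfolding cp h_def F_def by (simp add: g_def sum_2 algebra_simps)
    moreover have "F (pt 1 t) = f (b + t *\<^sub>R (c - b))" for t by (simp add: F_def g_def)
    ultimately show ?thesis by simp
  qed
  then show ?thesis
    unfolding h_def[symmetric] triangle_integral[OF ch D T] g_def[symmetric] by simp
qed

section \<open>Triangles and their edges\<close>

lemma crossp_eq_0_collinear:
  assumes "crossp (b - a) (c - b) = 0" shows "collinear {a, b, c}"
proof -
  define x y where "x = a - b" and "y = c - b"
  have 0: "x $ 1 * y $ 2 = x $ 2 * y $ 1" using assms by (simp add: crossp_def x_def y_def algebra_simps)
  have "collinear {0, x, y}"
  proof (cases "x = 0")
    case False
    then consider "x $ 1 \<noteq> 0" | "x $ 2 \<noteq> 0" by (auto simp: vec_eq_iff forall_2)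
    then have "\<exists>k. y = k *\<^sub>R x"
    proof cases
      case 1 then show ?thesis using 0 by (intro exI[of _ "y $ 1 / x $ 1"]) (simp add: vec_eq_iff forall_2 field_simps)
    next
      case 2 then show ?thesis using 0 by (intro exI[of _ "y $ 2 / x $ 2"]) (simp add: vec_eq_iff forall_2 field_simps)
    qed
    then show ?thesis by (simp add: collinear_lemma)
  qed (simp add: collinear_lemma)
  then show ?thesis unfolding x_def y_def by (simp add: collinear_3[of a b c])
qed

lemma simplex2_crossp:
  assumes "\<not> affine_dependent {a, b, c}" "a \<noteq> b" "b \<noteq> c" "a \<noteq> c"
  shows "crossp (b - a) (c - b) \<noteq> 0"
  using assms crossp_eq_0_collinear[of b a c] collinear_3_eq_affine_dependent[of a b c] by auto

lemma simplex2_vertices: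
  fixes T :: "(real^2) set"
  assumes "2 simplex T"
  obtains a b c where "T = convex hull {a, b, c}" "\<not> affine_dependent {a, b, c}" "a \<noteq> b" "b \<noteq> c" "a \<noteq> c"
    "crossp (b - a) (c - b) \<noteq> 0"
proof -
  obtain C where C: "\<not> affine_dependent C" "int (card C) = 2 + 1" "T = convex hull C" using assms by (auto simp: simplex_def)
  then have "card C = 3" by simp
  then obtain a b c where abc: "C = {a, b, c}" "a \<noteq> b" "b \<noteq> c" "a \<noteq> c" by (auto simp: card_3_iff)
  show ?thesis using that[of a b c] C abc simplex2_crossp[of a b c] by simp
qed

text \<open>The barycentric coordinate of x belonging to the vertex a, as a ratio of signed areas.
  The other two coordinates arise by cyclic permutation of the vertices.\<close>

definition bary :: "real^2 \<Rightarrow> real^2 \<Rightarrow> real^2 \<Rightarrow> real^2 \<Rightarrow> real" where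
  "bary a b c x = crossp (b - x) (c - b) / crossp (b - a) (c - b)"

lemma crossp_cyclic: "crossp (c - b) (a - c) = crossp (b - a) (c - b)"
  by (simp add: crossp_def algebra_simps)

lemma crossp_swap: "crossp (c - a) (b - c) = - crossp (b - a) (c - b)"
  by (simp add: crossp_def algebra_simps)

lemma crossp_linear_comb:
  assumes "u + v + w = 1"
  shows "crossp (b - (u *\<^sub>R a + v *\<^sub>R b + w *\<^sub>R c)) (c - b) = u * crossp (b - a) (c - b)"
proof -
  have u: "v = 1 - u - w" using assms by simp
  show ?thesis unfolding u by (simp add: crossp_def algebra_simps)
qed

lemma bary_comb:
  assumes D: "crossp (b - a) (c - b) \<noteq> 0" and s: "u + v + w = 1"
  shows "bary a b c (u *\<^sub>R a + v *\<^sub>R b + w *\<^sub>R c) = u" "bary b c a (u *\<^sub>R a + v *\<^sub>R b + w *\<^sub>R c) = v"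
    "bary c a b (u *\<^sub>R a + v *\<^sub>R b + w *\<^sub>R c) = w"
proof -
  have D2: "crossp (c - b) (a - c) \<noteq> 0" "crossp (a - c) (b - a) \<noteq> 0"
    using D crossp_cyclic[of c b a] crossp_cyclic[of a c b] by auto
  show "bary a b c (u *\<^sub>R a + v *\<^sub>R b + w *\<^sub>R c) = u"
    using D by (simp add: bary_def crossp_linear_comb[OF s])
  show "bary b c a (u *\<^sub>R a + v *\<^sub>R b + w *\<^sub>R c) = v"
    using D2 crossp_linear_comb[of v w u c b a] s by (simp add: bary_def add_ac)
  show "bary c a b (u *\<^sub>R a + v *\<^sub>R b + w *\<^sub>R c) = w"
    using D2 crossp_linear_comb[of w u v a c b] s by (simp add: bary_def add_ac)
qed

lemma bary_repr:
  assumes D: "crossp (b - a) (c - b) \<noteq> 0"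
  shows "bary a b c x + bary b c a x + bary c a b x = 1"
    "x = bary a b c x *\<^sub>R a + bary b c a x *\<^sub>R b + bary c a b x *\<^sub>R c"
proof -
  have D2: "crossp (c - b) (a - c) = crossp (b - a) (c - b)" "crossp (a - c) (b - a) = crossp (b - a) (c - b)"
    using crossp_cyclic[of c b a] crossp_cyclic[of a c b] by auto
  have "crossp (b - x) (c - b) + crossp (c - x) (a - c) + crossp (a - x) (b - a) = crossp (b - a) (c - b)"
    by (simp add: crossp_def algebra_simps)
  then show 1: "bary a b c x + bary b c a x + bary c a b x = 1"
    using D by (simp add: bary_def D2 add_divide_distrib[symmetric])
  have "crossp (b - a) (c - b) *\<^sub>R x = crossp (b - x) (c - b) *\<^sub>R a + crossp (c - x) (a - c) *\<^sub>R b + crossp (a - x) (b - a) *\<^sub>R c"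
    by (simp add: vec_eq_iff forall_2 crossp_def algebra_simps)
  then have "(1 / crossp (b - a) (c - b)) *\<^sub>R (crossp (b - a) (c - b) *\<^sub>R x)
      = (1 / crossp (b - a) (c - b)) *\<^sub>R (crossp (b - x) (c - b) *\<^sub>R a + crossp (c - x) (a - c) *\<^sub>R b + crossp (a - x) (b - a) *\<^sub>R c)" by simp
  then show "x = bary a b c x *\<^sub>R a + bary b c a x *\<^sub>R b + bary c a b x *\<^sub>R c"
    using D by (simp add: bary_def D2 scaleR_add_right)
qed

lemma triangle_mem_iff:
  assumes D: "crossp (b - a) (c - b) \<noteq> 0"
  shows "x \<in> convex hull {a, b, c} \<longleftrightarrow> 0 \<le> bary a b c x \<and> 0 \<le> bary b c a x \<and> 0 \<le> bary c a b x"
proof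
  assume "x \<in> convex hull {a, b, c}"
  then obtain u v w where "0 \<le> u" "0 \<le> v" "0 \<le> w" "u + v + w = 1" "x = u *\<^sub>R a + v *\<^sub>R b + w *\<^sub>R c"
    by (auto simp: convex_hull_3)
  then show "0 \<le> bary a b c x \<and> 0 \<le> bary b c a x \<and> 0 \<le> bary c a b x" using bary_comb[OF D] by simp
next
  assume "0 \<le> bary a b c x \<and> 0 \<le> bary b c a x \<and> 0 \<le> bary c a b x"
  then show "x \<in> convex hull {a, b, c}"
    unfolding convex_hull_3 using bary_repr[OF D, of x] by blast
qed

lemma continuous_bary: "continuous_on S (bary a b c)"
  unfolding bary_def crossp_def divide_inverse by (intro continuous_intros)

lemma triangle_interior:
  assumes D: "crossp (b - a) (c - b) \<noteq> 0" and p: "0 < bary a b c x" "0 < bary b c a x" "0 < bary c a b x"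
  shows "x \<in> interior (convex hull {a, b, c})"
proof (rule interiorI)
  let ?S = "{x. 0 < bary a b c x} \<inter> {x. 0 < bary b c a x} \<inter> {x. 0 < bary c a b x}"
  show "open ?S" by (intro open_Int open_Collect_less continuous_bary continuous_on_const)
  show "x \<in> ?S" using p by simp
  show "?S \<subseteq> convex hull {a, b, c}" using triangle_mem_iff[OF D] by fastforce
qed

lemma triangle_interior_nonempty:
  assumes D: "crossp (b - a) (c - b) \<noteq> 0" shows "interior (convex hull {a, b, c}) \<noteq> {}"
proof -
  have "(1/3) *\<^sub>R a + (1/3) *\<^sub>R b + (1/3) *\<^sub>R c \<in> interior (convex hull {a, b, c})"
    by (rule triangle_interior[OF D]) (subst bary_comb[OF D], simp_all)+
  then show ?thesis by blast
qed

lemma simplex2_facts: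
  fixes T :: "(real^2) set"
  assumes "2 simplex T"
  shows "convex T" "compact T" "interior T \<noteq> {}" "open (interior T)" "bounded (interior T)" "convex (interior T)"
    "interior T \<in> sets borel"
proof -
  obtain a b c where T: "T = convex hull {a, b, c}" "crossp (b - a) (c - b) \<noteq> 0" using simplex2_vertices[OF assms] by metis
  show c: "convex T" "compact T" unfolding T by (auto simp: finite_imp_compact_convex_hull)
  show "interior T \<noteq> {}" unfolding T(1) by (rule triangle_interior_nonempty[OF T(2)])
  show "open (interior T)" "bounded (interior T)" "convex (interior T)" "interior T \<in> sets borel"
    using c by (auto simp: bounded_interior compact_imp_bounded)
qed

section \<open>Edges of a triangle and their orientation\<close>

lemma closed_segment_ends_eq:
  fixes a b c d :: "'a::euclidean_space"
  assumes "closed_segment a b = closed_segment c d" shows "{a, b} = {c, d}"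
  using assms by simp

lemma edge_ends_segment: "\<exists>p q. e = closed_segment p q \<Longrightarrow> e = closed_segment (fst (edge_ends e)) (snd (edge_ends e))"
  unfolding edge_ends_def by (rule someI_ex[of "\<lambda>p. e = closed_segment (fst p) (snd p)"]) auto

text \<open>Here a is the vertex opposite to e, and b, c come in the order fixed by
  \<open>edge_ends\<close>. Two elements sharing e therefore share b and c in the same order, which
  makes their orientations comparable.\<close>

definition tri_edge :: "(real^2) set \<Rightarrow> (real^2) set \<Rightarrow> real^2 \<Rightarrow> real^2 \<Rightarrow> real^2 \<Rightarrow> bool" where
  "tri_edge T e a b c \<longleftrightarrow> edge_ends e = (b, c) \<and> e = closed_segment b c \<and> T = convex hull {a, b, c} \<and>
     crossp (b - a) (c - b) \<noteq> 0 \<and> \<not> affine_dependent {a, b, c}"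

text \<open>Faces of a simplex are hulls of vertex subsets; dimension one leaves two vertices, and a
  is the remaining one.\<close>

lemma simplex2_edge:
  assumes T: "2 simplex T" and e: "e edge_of T"
  obtains a b c where "tri_edge T e a b c"
proof -
  obtain p q r where C: "T = convex hull {p, q, r}" "\<not> affine_dependent {p, q, r}" "p \<noteq> q" "q \<noteq> r" "p \<noteq> r"
    using simplex2_vertices[OF T] by metis
  obtain c' where c': "c' \<subseteq> {p, q, r}" "e = convex hull c'"
    using e face_of_convex_hull_affine_independent[OF C(2)] by (auto simp: edge_of_def C(1))
  have ind: "\<not> affine_dependent c'" using C(2) c'(1) affine_independent_subset by blast
  have "aff_dim c' = 1" using e c'(2) by (simp add: edge_of_def aff_dim_convex_hull)
  then have "card c' = 2" using aff_dim_affine_independent[OF ind] by simp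
  then obtain x y where xy: "c' = {x, y}" "x \<noteq> y" by (auto simp: card_2_iff)
  have e1: "e = closed_segment x y" using c'(2) xy(1) by (simp add: segment_convex_hull)
  define b c where "b = fst (edge_ends e)" and "c = snd (edge_ends e)"
  have e2: "e = closed_segment b c" unfolding b_def c_def by (rule edge_ends_segment) (use e1 in blast)
  have bc: "{b, c} = c'" using closed_segment_ends_eq[of b c x y] e1 e2 xy(1) by simp
  have "b \<noteq> c" using bc xy by auto
  have "card {p, q, r} = 3" using C(3-5) by simp
  then have "card ({p, q, r} - c') = 1" using c'(1) \<open>card c' = 2\<close> by (subst card_Diff_subset) (auto intro: finite_subset)
  then obtain a where a: "{p, q, r} - c' = {a}" by (auto simp: card_1_singleton_iff)
  have abc: "{p, q, r} = {a, b, c}" using a bc c'(1) by blast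
  have "a \<noteq> b" "a \<noteq> c" using a bc by auto
  then have "crossp (b - a) (c - b) \<noteq> 0"
    using simplex2_crossp[of a b c] C(2) abc \<open>b \<noteq> c\<close> by simp
  moreover have "edge_ends e = (b, c)" by (simp add: b_def c_def)
  ultimately have "tri_edge T e a b c" unfolding tri_edge_def using e2 C(1,2)[unfolded abc] by (intro conjI)
  then show ?thesis by (rule that)
qed

lemma tri_edge_D:
  assumes "tri_edge T e a b c"
  shows "edge_ends e = (b, c)" "e = closed_segment b c" "T = convex hull {a, b, c}" "crossp (b - a) (c - b) \<noteq> 0"
    "\<not> affine_dependent {a, b, c}" "b \<noteq> c"
  using assms by (auto simp: tri_edge_def crossp_def)

lemma tri_edge_simplex:
  assumes "tri_edge T e a b c" shows "2 simplex T" "e edge_of T"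
proof -
  note D = tri_edge_D[OF assms]
  have "a \<noteq> b" "a \<noteq> c" using D(4) by (auto simp: crossp_def algebra_simps)
  then have c3: "card {a, b, c} = 3" using D(6) by simp
  then show "2 simplex T" unfolding simplex_def using D by (intro exI[of _ "{a, b, c}"]) simp
  have "e = convex hull {b, c}" using D(2) by (simp add: segment_convex_hull)
  then have "e face_of T" unfolding D(3) face_of_convex_hull_affine_independent[OF D(5)] by blast
  moreover have "aff_dim e = 1" using \<open>e = convex hull {b, c}\<close> D(6) by (simp add: aff_dim_convex_hull aff_dim_2)
  ultimately show "e edge_of T" by (simp add: edge_of_def)
qed

text \<open>The sign of the tangent rotated by \<open>-90\<close> degrees that makes it an outward normal of \<open>T\<close>.\<close>

definition orient :: "(real^2) set \<Rightarrow> (real^2) set \<Rightarrow> real" where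
  "orient T e = (case edge_ends e of (b, c) \<Rightarrow> if \<exists>x\<in>T. crossp (b - x) (c - b) > 0 then 1 else -1)"

text \<open>The barycentric coordinate of a is nonnegative on T, so the cross product in
  \<open>orient\<close> has the sign of its value at a wherever it does not vanish.\<close>

lemma orient_eq:
  assumes "tri_edge T e a b c" shows "orient T e = sgn (crossp (b - a) (c - b))"
proof -
  note D = tri_edge_D[OF assms]
  have aT: "a \<in> T" unfolding D(3) by (rule hull_inc) simp
  show ?thesis
  proof (cases "crossp (b - a) (c - b) > 0")
    case True
    then show ?thesis using aT by (auto simp: orient_def D(1))
  next
    case False
    then have neg: "crossp (b - a) (c - b) < 0" using D(4) by simp
    have "\<not> crossp (b - x) (c - b) > 0" if "x \<in> T" for x
    proof -
      have "0 \<le> bary a b c x" using that triangle_mem_iff[OF D(4)] D(3) by simp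
      then show ?thesis using neg by (simp add: bary_def zero_le_divide_iff)
    qed
    then show ?thesis using neg by (auto simp: orient_def D(1))
  qed
qed

section \<open>Two elements at a common edge\<close>

definition compatible :: "(real^2) set \<Rightarrow> (real^2) set \<Rightarrow> bool" where
  "compatible T T' \<longleftrightarrow> (T \<inter> T') face_of T \<and> (T \<inter> T') face_of T'"

lemma compatible_interior_eq:
  assumes "compatible T T'" "x \<in> interior T" "x \<in> interior T'" shows "T = T'"
proof -
  have x: "x \<in> T \<inter> T'" using assms interior_subset by blast
  have "T \<inter> T' = T" "T \<inter> T' = T'"
    using assms x face_of_disjoint_interior[of "T \<inter> T'" T] face_of_disjoint_interior[of "T \<inter> T'" T'] by (auto simp: compatible_def)
  then show ?thesis by simp
qed

text \<open>If a' lies on the same side of the edge as a, then moving slightly from the midpoint of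
  the edge towards a' leads into both interiors, which a face-to-face pair of distinct elements
  forbids.\<close>

lemma edge_same_side:
  assumes T: "tri_edge T e a b c" and T': "tri_edge T' e a' b c" and comp: "compatible T T'"
    and s: "0 < bary a b c a'"
  shows "T = T'"
proof -
  note D = tri_edge_D[OF T] and D' = tri_edge_D[OF T']
  define u v w where "u = bary a b c a'" and "v = bary b c a a'" and "w = bary c a b a'"
  have sum: "u + v + w = 1" and a': "a' = u *\<^sub>R a + v *\<^sub>R b + w *\<^sub>R c"
    using bary_repr[OF D(4), of a'] by (auto simp: u_def v_def w_def)
  \<comment> \<open>t is so small that the coordinates of b and c, at least 3/8 before the
    correction, change by at most 1/4.\<close>
  define t where "t = 1 / (4 * (1 + \<bar>v\<bar> + \<bar>w\<bar>))"
  have t: "0 < t" "t \<le> 1/4" "t * \<bar>v\<bar> \<le> 1/4" "t * \<bar>w\<bar> \<le> 1/4" by (auto simp: t_def field_simps)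
  have tv: "- (1/4) \<le> t * v" "- (1/4) \<le> t * w" using t abs_mult[of t v] abs_mult[of t w] by (auto simp: abs_le_iff)
  define x where "x = t *\<^sub>R a' + ((1 - t) / 2) *\<^sub>R b + ((1 - t) / 2) *\<^sub>R c"
  have x1: "x = (t * u) *\<^sub>R a + ((1 - t) / 2 + t * v) *\<^sub>R b + ((1 - t) / 2 + t * w) *\<^sub>R c"
    unfolding x_def a' by (simp add: algebra_simps)
  have s1: "t * u + ((1 - t) / 2 + t * v) + ((1 - t) / 2 + t * w) = 1"
  proof -
    have "t * u + ((1 - t) / 2 + t * v) + ((1 - t) / 2 + t * w) = t * (u + v + w) + (1 - t)" by (simp add: algebra_simps)
    then show ?thesis using sum by simp
  qed
  have B: "bary a b c x = t * u" "bary b c a x = (1 - t) / 2 + t * v" "bary c a b x = (1 - t) / 2 + t * w"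
    unfolding x1 by (rule bary_comb[OF D(4) s1])+
  have s2: "t + (1 - t) / 2 + (1 - t) / 2 = 1" by simp
  have B': "bary a' b c x = t" "bary b c a' x = (1 - t) / 2" "bary c a' b x = (1 - t) / 2"
    unfolding x_def by (rule bary_comb[OF D'(4) s2])+
  have t1: "0 < t * u" using s t(1) by (simp add: u_def)
  have aux: "0 < (1 - t) / 2 + y" if "- (1/4) \<le> y" for y :: real
    using that t(2) by (simp add: field_simps)
  have t2: "0 < (1 - t) / 2 + t * v" by (rule aux[OF tv(1)])
  have t3: "0 < (1 - t) / 2 + t * w" by (rule aux[OF tv(2)])
  note t13 = t1 t2 t3
  have "x \<in> interior T" unfolding D(3) using t13 by (intro triangle_interior[OF D(4)]) (simp_all only: B)
  moreover have "x \<in> interior T'" unfolding D'(3) using t by (intro triangle_interior[OF D'(4)]) (simp_all add: B')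
  ultimately show ?thesis by (rule compatible_interior_eq[OF comp])
qed

lemma orient_opposite:
  assumes T: "tri_edge T e a b c" and T': "tri_edge T' e a' b c" and comp: "compatible T T'" and ne: "T \<noteq> T'"
  shows "orient T' e = - orient T e" "bary a b c a' < 0"
proof -
  note D = tri_edge_D[OF T] and D' = tri_edge_D[OF T']
  have "\<not> 0 < bary a b c a'" using edge_same_side[OF T T' comp] ne by blast
  moreover have "bary a b c a' \<noteq> 0" using D D' by (simp add: bary_def)
  ultimately show neg: "bary a b c a' < 0" by simp
  have "crossp (b - a') (c - b) * crossp (b - a) (c - b) < 0"
    using neg by (simp add: bary_def divide_less_0_iff mult_less_0_iff)
  then show "orient T' e = - orient T e"
    unfolding orient_eq[OF T] orient_eq[OF T'] by (auto simp: sgn_if mult_less_0_iff)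
qed

lemma tri_edge_same_ends: "tri_edge T e a b c \<Longrightarrow> tri_edge T' e a' b' c' \<Longrightarrow> b' = b \<and> c' = c"
  by (auto simp: tri_edge_def)

text \<open>Near the midpoint the coordinates of b and c are positive in both triangles, so only the
  side of the edge decides, and each side belongs to one of the two triangles.\<close>

lemma edge_midpoint_interior:
  assumes T: "tri_edge T e a b c" and T': "tri_edge T' e a' b c" and comp: "compatible T T'" and ne: "T \<noteq> T'"
  shows "(1/2) *\<^sub>R b + (1/2) *\<^sub>R c \<in> interior (T \<union> T')"
proof (rule interiorI)
  note D = tri_edge_D[OF T] and D' = tri_edge_D[OF T']
  let ?S = "{x. 0 < bary b c a x} \<inter> {x. 0 < bary c a b x} \<inter> ({x. 0 < bary b c a' x} \<inter> {x. 0 < bary c a' b x})"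
  let ?m = "0 *\<^sub>R a + (1/2) *\<^sub>R b + (1/2) *\<^sub>R c"
  let ?m' = "0 *\<^sub>R a' + (1/2) *\<^sub>R b + (1/2) *\<^sub>R c"
  show "open ?S" by (intro open_Int open_Collect_less continuous_bary continuous_on_const)
  have "?m \<in> {x. 0 < bary b c a x} \<inter> {x. 0 < bary c a b x}" using bary_comb[OF D(4), of 0 "1/2" "1/2"] by simp
  moreover have "?m' \<in> {x. 0 < bary b c a' x} \<inter> {x. 0 < bary c a' b x}" using bary_comb[OF D'(4), of 0 "1/2" "1/2"] by simp
  ultimately show "(1/2) *\<^sub>R b + (1/2) *\<^sub>R c \<in> ?S" by simp
  show "?S \<subseteq> T \<union> T'"
  proof
    fix x assume x: "x \<in> ?S"
    \<comment> \<open>Both coordinates measure the signed distance to the same line, hence they are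
      proportional; the factor is negative because a and a' lie on opposite sides.\<close>
    have r: "bary a b c x = bary a b c a' * bary a' b c x" using D'(4) by (simp add: bary_def)
    show "x \<in> T \<union> T'"
    proof (cases "0 \<le> bary a b c x")
      case True
      then have "x \<in> T" unfolding D(3) triangle_mem_iff[OF D(4)] using x by auto
      then show ?thesis by simp
    next
      case False
      then have "0 \<le> bary a' b c x" using r orient_opposite(2)[OF T T' comp ne] by (simp add: mult_less_0_iff not_le)
      then have "x \<in> T'" unfolding D'(3) triangle_mem_iff[OF D'(4)] using x by auto
      then show ?thesis by simp
    qed
  qed
qed

text \<open>A face that contains a relative interior point of a segment of T contains the end
  points, so the common face contains e. It cannot contain a, for then T would lie inside T' and the
  two would coincide.\<close>

lemma compatible_shared_edge:
  assumes T: "tri_edge T e a b c" and T': "2 simplex T'" and comp: "compatible T T'" and ne: "T \<noteq> T'"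
    and y: "y \<in> T'" "y \<in> open_segment b c"
  shows "e edge_of T'"
proof -
  note D = tri_edge_D[OF T]
  have f: "T \<inter> T' face_of T" "T \<inter> T' face_of T'" using comp by (auto simp: compatible_def)
  have bT: "b \<in> T" "c \<in> T" unfolding D(3) by (rule hull_inc, simp)+
  have yT: "y \<in> T" using y(2) bT simplex2_facts(1)[OF tri_edge_simplex(1)[OF T]]
    by (meson closed_segment_subset open_closed_segment subsetD)
  have bc: "b \<in> T \<inter> T'" "c \<in> T \<inter> T'" using f(1) bT y yT unfolding face_of_def by blast+
  obtain s where s: "s \<subseteq> {a, b, c}" "T \<inter> T' = convex hull s"
    using f(1) face_of_convex_hull_affine_independent[OF D(5)] D(3) by auto
  have aT: "a \<in> T" unfolding D(3) by (rule hull_inc) simp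
  have "a \<notin> T'"
  proof
    assume "a \<in> T'"
    then have "T \<subseteq> T'" using bc unfolding D(3) by (intro hull_minimal) (auto simp: simplex2_facts(1)[OF T'])
    then have TT: "T \<inter> T' = T" by blast
    obtain x where x: "x \<in> interior T" using simplex2_facts(3)[OF tri_edge_simplex(1)[OF T]] by blast
    then have "x \<in> interior T'" using interior_mono[OF \<open>T \<subseteq> T'\<close>] by blast
    then show False using compatible_interior_eq[OF comp x] ne by simp
  qed
  then have "s \<subseteq> {b, c}" using s hull_inc[of a s convex] by (metis IntD2 insertE subset_iff subset_insert)
  then have "T \<inter> T' \<subseteq> e" unfolding s(2) D(2) segment_convex_hull by (rule hull_mono)
  moreover have "e \<subseteq> T \<inter> T'" unfolding D(2) by (rule closed_segment_subset[OF bc face_of_imp_convex[OF f(1)]])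
  ultimately have "T \<inter> T' = e" by blast
  then show ?thesis using f(2) tri_edge_simplex(2)[OF T] by (simp add: edge_of_def)
qed

section \<open>Metric consequences of shape regularity\<close>

lemma diameter_segment:
  fixes b c :: "'a::euclidean_space"
  shows "diameter (closed_segment b c) = dist b c"
proof (rule antisym)
  show "diameter (closed_segment b c) \<le> dist b c"
  proof (rule diameter_le)
    fix x y assume "x \<in> closed_segment b c" "y \<in> closed_segment b c"
    then show "norm (x - y) \<le> dist b c"
      using segment_furthest_le[of x b c y] segment_bound(1)[of y b c] segment_bound(2)[of y b c]
      by (auto simp: dist_norm norm_minus_commute)
  qed auto
  show "dist b c \<le> diameter (closed_segment b c)"
    by (rule diameter_bounded_bound[OF bounded_closed_segment]) auto
qed

text \<open>Lagrange's identity, with the squared inner product dropped.\<close>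

lemma abs_crossp_le: "\<bar>crossp x y\<bar> \<le> norm x * norm y"
proof -
  have "(crossp x y)\<^sup>2 + (x \<bullet> y)\<^sup>2 = (x \<bullet> x) * (y \<bullet> y)"
    by (simp add: crossp_def inner_vec_def sum_2 power2_eq_square algebra_simps)
  then have "(crossp x y)\<^sup>2 \<le> (norm x * norm y)\<^sup>2"
    by (simp add: power_mult_distrib power2_norm_eq_inner) (metis le_add_same_cancel1 zero_le_power2)
  then show ?thesis using abs_le_square_iff[of "crossp x y" "norm x * norm y"] by simp
qed

text \<open>A ball inside the triangle is no thicker than the height over the edge: along its
  diameter normal to the edge, the barycentric coordinate of a changes by 2 r |b - c| / |det| and
  stays in the unit interval.\<close>

lemma cball_height:
  assumes D: "crossp (b - a) (c - b) \<noteq> 0" and r: "0 \<le> r" "cball x r \<subseteq> convex hull {a, b, c}"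
  shows "2 * r * dist b c \<le> \<bar>crossp (b - a) (c - b)\<bar>"
proof -
  define d where "d = c - b"
  have d0: "norm d > 0" using D by (auto simp: d_def crossp_def)
  define n :: "real^2" where "n = (1 / norm d) *\<^sub>R vector [d $ 2, - d $ 1]"
  have nn: "norm (vector [d $ 2, - d $ 1] :: real^2) = norm d"
    by (simp add: norm_vec_def L2_set_def sum_2 add.commute)
  have n1: "norm n = 1" using d0 by (simp add: n_def nn)
  have cn: "crossp n d = norm d"
  proof -
    have "crossp n d = (1 / norm d) * (norm d)\<^sup>2"
      by (simp add: n_def crossp_def power2_norm_eq_inner inner_vec_def sum_2 algebra_simps)
    then show ?thesis using d0 by (simp add: power2_eq_square)
  qed
  have in01: "0 \<le> bary a b c y \<and> bary a b c y \<le> 1" if "y \<in> cball x r" for y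
  proof -
    have "y \<in> convex hull {a, b, c}" using that r by blast
    then show ?thesis using triangle_mem_iff[OF D, of y] bary_repr(1)[OF D, of y] by linarith
  qed
  have mem: "x + r *\<^sub>R n \<in> cball x r" "x - r *\<^sub>R n \<in> cball x r"
    using r n1 by (simp_all add: dist_norm)
  have eq: "bary a b c (x - r *\<^sub>R n) - bary a b c (x + r *\<^sub>R n) = (2 * r * crossp n d) / crossp (b - a) (c - b)"
    by (simp add: bary_def d_def diff_divide_distrib[symmetric]) (simp add: crossp_def algebra_simps)
  have "\<bar>bary a b c (x - r *\<^sub>R n) - bary a b c (x + r *\<^sub>R n)\<bar> \<le> 1"
    using in01[OF mem(1)] in01[OF mem(2)] by linarith
  then have "\<bar>(2 * r * norm d) / crossp (b - a) (c - b)\<bar> \<le> 1" unfolding eq cn .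
  then have "2 * r * norm d \<le> \<bar>crossp (b - a) (c - b)\<bar>"
    using D r by (simp add: abs_mult divide_le_eq)
  then show ?thesis by (simp add: d_def dist_norm norm_minus_commute)
qed

text \<open>The form in which shape regularity is used: every edge is comparable to the diameter,
  and diameter times edge length is bounded by twice the area up to \<sigma>.\<close>

lemma tri_edge_shape:
  assumes T: "tri_edge T e a b c" and s: "diameter T \<le> \<sigma> * inball_diameter T"
  shows "diameter e = dist b c" "0 < dist b c" "dist b c \<le> diameter T" "0 < \<sigma>" "diameter T \<le> \<sigma> * dist b c"
    "diameter T * dist b c \<le> \<sigma> * \<bar>crossp (b - a) (c - b)\<bar>"
proof -
  note D = tri_edge_D[OF T]
  show "diameter e = dist b c" unfolding D(2) by (rule diameter_segment)
  show bc: "0 < dist b c" using D(6) by simp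
  have bT: "b \<in> T" "c \<in> T" unfolding D(3) by (rule hull_inc, simp)+
  have bd: "bounded T" using simplex2_facts(2)[OF tri_edge_simplex(1)[OF T]] compact_imp_bounded by blast
  show dT: "dist b c \<le> diameter T" by (rule diameter_bounded_bound[OF bd bT])
  define S where "S = {2 * r | r x. 0 \<le> r \<and> cball x r \<subseteq> T}"
  have "0 \<in> S" unfolding S_def using bT by (intro CollectI exI[of _ 0] exI[of _ b]) auto
  then have ne: "S \<noteq> {}" by blast
  have D2: "crossp (c - b) (a - c) \<noteq> 0" using D(4) crossp_cyclic[of c b a] by simp
  have T2: "T = convex hull {b, c, a}" unfolding D(3) by (simp add: insert_commute)
  have 1: "y * dist b c \<le> \<bar>crossp (b - a) (c - b)\<bar>" if "y \<in> S" for y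
    using that cball_height[OF D(4)] unfolding S_def D(3) by auto
  \<comment> \<open>The height over the edge from c to a is at most |b - c|, so each inscribed ball
    has diameter at most |b - c|.\<close>
  have 2: "y \<le> dist b c" if y: "y \<in> S" for y
  proof -
    have "y * dist c a \<le> \<bar>crossp (c - b) (a - c)\<bar>"
      using y cball_height[OF D2] unfolding S_def T2 by auto
    also have "\<dots> \<le> dist b c * dist c a"
      using abs_crossp_le[of "c - b" "a - c"] by (simp add: dist_norm norm_minus_commute)
    finally show ?thesis using D2 by (auto simp: crossp_def mult_le_cancel_right)
  qed
  have id: "inball_diameter T = Sup S" by (simp add: inball_diameter_def S_def)
  have S2: "Sup S \<le> dist b c" by (rule cSup_least[OF ne 2])
  have S1: "Sup S * dist b c \<le> \<bar>crossp (b - a) (c - b)\<bar>"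
  proof -
    have "Sup S \<le> \<bar>crossp (b - a) (c - b)\<bar> / dist b c"
      by (rule cSup_least[OF ne]) (use 1 bc in \<open>simp add: le_divide_eq\<close>)
    then show ?thesis using bc by (simp add: le_divide_eq)
  qed
  have S0: "0 \<le> Sup S" by (rule cSup_upper[OF \<open>0 \<in> S\<close>]) (use 2 in \<open>auto intro!: bdd_aboveI\<close>)
  show sp: "0 < \<sigma>"
  proof (rule ccontr)
    assume "\<not> 0 < \<sigma>"
    then have "\<sigma> * Sup S \<le> 0" using S0 by (simp add: mult_nonpos_nonneg)
    then show False using s dT bc id by simp
  qed
  show "diameter T \<le> \<sigma> * dist b c"
    using order_trans[OF s[unfolded id] mult_left_mono[OF S2 less_imp_le[OF sp]]] .
  have "diameter T * dist b c \<le> (\<sigma> * Sup S) * dist b c" using s id bc by (simp add: mult_right_mono)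
  also have "\<dots> \<le> \<sigma> * \<bar>crossp (b - a) (c - b)\<bar>" using S1 sp by (simp add: mult.assoc mult_left_mono)
  finally show "diameter T * dist b c \<le> \<sigma> * \<bar>crossp (b - a) (c - b)\<bar>" .
qed

section \<open>Boundary and interior edges of a triangulation\<close>

lemma triangulation_of_D:
  assumes "triangulation_of \<Omega> \<T>"
  shows "finite \<T>" "T \<in> \<T> \<Longrightarrow> 2 simplex T" "T \<in> \<T> \<Longrightarrow> T' \<in> \<T> \<Longrightarrow> compatible T T'" "\<Union>\<T> = closure \<Omega>"
proof -
  show "finite \<T>" "T \<in> \<T> \<Longrightarrow> 2 simplex T" "\<Union>\<T> = closure \<Omega>"
    using assms by (auto simp: triangulation_of_def triangulation_def)
  assume "T \<in> \<T>" "T' \<in> \<T>"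
  moreover have "(A \<inter> B) face_of A" if "A \<in> \<T>" "B \<in> \<T>" for A B
    using assms that by (auto simp: triangulation_of_def triangulation_def)
  ultimately show "compatible T T'" unfolding compatible_def by (metis Int_commute)
qed

lemma polygon_D:
  assumes "bounded_polygon \<Omega>"
  shows "open \<Omega>" "bounded \<Omega>" "interior (closure \<Omega>) = \<Omega>" "\<Omega> \<noteq> {}"
  using assms by (auto simp: bounded_polygon_def)

text \<open>Two elements would surround the midpoint of e, placing it in the interior of the closure
  of \<Omega>. As slits are excluded, this interior is \<Omega> itself, which misses the
  frontier.\<close>

lemma boundary_edge_unique:
  assumes P: "bounded_polygon \<Omega>" and tr: "triangulation_of \<Omega> \<T>" and e: "e \<subseteq> frontier \<Omega>"
    and T: "T \<in> \<T>" "e edge_of T" and T': "T' \<in> \<T>" "e edge_of T'"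
  shows "T' = T"
proof (rule ccontr)
  assume ne: "T' \<noteq> T"
  note R = triangulation_of_D[OF tr]
  obtain a b c where E: "tri_edge T e a b c" using simplex2_edge[OF R(2)[OF T(1)] T(2)] by blast
  obtain a' b' c' where E'': "tri_edge T' e a' b' c'" using simplex2_edge[OF R(2)[OF T'(1)] T'(2)] by blast
  then have E': "tri_edge T' e a' b c" using tri_edge_same_ends[OF E E''] by simp
  let ?m = "(1/2) *\<^sub>R b + (1/2) *\<^sub>R c"
  have "?m \<in> interior (T \<union> T')" by (rule edge_midpoint_interior[OF E E' R(3)[OF T(1) T'(1)]]) (use ne in simp)
  moreover have "T \<union> T' \<subseteq> closure \<Omega>" using R(4) T(1) T'(1) by blast
  ultimately have "?m \<in> \<Omega>" using interior_mono polygon_D(3)[OF P] by blast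
  moreover have "?m \<in> e" unfolding tri_edge_D(2)[OF E] in_segment by (intro exI[of _ "1/2"]) simp
  ultimately show False using e polygon_D(1)[OF P] by (auto simp: frontier_def interior_open)
qed

text \<open>Existence of the neighbour comes from approaching an inner point of e from outside T;
  uniqueness from the fact that three apexes cannot lie pairwise on opposite sides of a
  line.\<close>

lemma interior_edge_pair:
  assumes P: "bounded_polygon \<Omega>" and tr: "triangulation_of \<Omega> \<T>" and e: "\<not> e \<subseteq> frontier \<Omega>"
    and T: "T \<in> \<T>" "e edge_of T"
  obtains T' where "T' \<in> \<T>" "T' \<noteq> T" "{S \<in> \<T>. e edge_of S} = {T, T'}"
proof -
  note R = triangulation_of_D[OF tr] and PD = polygon_D[OF P]
  obtain a b c where E: "tri_edge T e a b c" using simplex2_edge[OF R(2)[OF T(1)] T(2)] by blast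
  note D = tri_edge_D[OF E]
  have eT: "e \<subseteq> closure \<Omega>" using T edge_of_imp_subset R(4) by blast
  then obtain x where x: "x \<in> e" "x \<in> \<Omega>" using e PD(1) by (auto simp: frontier_def interior_open)
  have "x \<in> closure (open_segment b c)" using x(1) D(2,6) by simp
  then obtain y where y: "y \<in> open_segment b c" "y \<in> \<Omega>"
    using x(2) PD(1) by (metis closure_iff_nhds_not_empty disjoint_iff interior_open open_Int_closure_eq_empty)
  define K where "K = \<Union>(\<T> - {T})"
  have cK: "closed K" unfolding K_def
    using R(1,2) simplex2_facts(2) by (intro closed_Union) (auto intro: compact_imp_closed)
  \<comment> \<open>Points just beyond the edge as seen from a: they avoid T, so the other elements
    must cover them.\<close>
  define z where "z n = y + (1 / real (Suc n)) *\<^sub>R (y - a)" for n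
  have zl: "z \<longlonglongrightarrow> y"
  proof -
    have "(\<lambda>n. 1 / real (Suc n)) \<longlonglongrightarrow> 0" by (rule LIMSEQ_Suc[OF lim_1_over_n])
    then have "(\<lambda>n. y + (1 / real (Suc n)) *\<^sub>R (y - a)) \<longlonglongrightarrow> y + 0 *\<^sub>R (y - a)" by (intro tendsto_intros)
    then show ?thesis by (simp add: z_def[abs_def])
  qed
  have yb: "bary a b c y = 0"
  proof -
    have "y \<in> closed_segment b c" using y(1) open_closed_segment by blast
    then obtain u where "y = (1 - u) *\<^sub>R b + u *\<^sub>R c" by (auto simp: in_segment)
    then show ?thesis using bary_comb(1)[OF D(4), of 0 "1 - u" u] by simp
  qed
  have "bary a b c (z n) < 0" for n
  proof -
    define k where "k = 1 / real (Suc n)"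
    have k: "0 < k" by (simp add: k_def)
    have "crossp (b - z n) (c - b) = crossp (b - y) (c - b) + k * (crossp (b - y) (c - b) - crossp (b - a) (c - b))"
      unfolding z_def k_def[symmetric] by (simp add: crossp_def algebra_simps)
    then have "bary a b c (z n) = bary a b c y + k * (bary a b c y - 1)"
      using D(4) by (simp add: bary_def field_simps)
    then show ?thesis using yb k by simp
  qed
  then have zT: "z n \<notin> T" for n using triangle_mem_iff[OF D(4)] D(3) not_le by metis
  have "\<forall>\<^sub>F n in sequentially. z n \<in> \<Omega>" by (rule topological_tendstoD[OF zl PD(1) y(2)])
  then have "\<forall>\<^sub>F n in sequentially. z n \<in> K"
  proof eventually_elim
    case (elim n)
    then have "z n \<in> \<Union>\<T>" using R(4) closure_subset by blast
    then show ?case using zT[of n] by (auto simp: K_def)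
  qed
  \<comment> \<open>The finite union of the other elements is closed and hence contains the
    limit.\<close>
  then have "y \<in> K" using Lim_in_closed_set[OF cK _ _ zl] by simp
  then obtain T' where T': "T' \<in> \<T>" "T' \<noteq> T" "y \<in> T'" by (auto simp: K_def)
  have e': "e edge_of T'"
    by (rule compatible_shared_edge[OF E R(2)[OF T'(1)] R(3)[OF T(1) T'(1)] _ T'(3) y(1)]) (use T' in simp)
  have "S \<in> {T, T'}" if S: "S \<in> \<T>" "e edge_of S" for S
  proof (rule ccontr)
    assume "S \<notin> {T, T'}"
    then have n: "T \<noteq> S" "T' \<noteq> S" by auto
    obtain a' b' c' where E1: "tri_edge T' e a' b' c'" using simplex2_edge[OF R(2)[OF T'(1)] e'] by blast
    then have E1: "tri_edge T' e a' b c" using tri_edge_same_ends[OF E E1] by simp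
    obtain a'' b'' c'' where E2: "tri_edge S e a'' b'' c''" using simplex2_edge[OF R(2)[OF S(1)] S(2)] by blast
    then have E2: "tri_edge S e a'' b c" using tri_edge_same_ends[OF E E2] by simp
    have "bary a b c a' < 0" using orient_opposite(2)[OF E E1 R(3)[OF T(1) T'(1)]] T'(2) by simp
    moreover have "bary a b c a'' < 0" by (rule orient_opposite(2)[OF E E2 R(3)[OF T(1) S(1)] n(1)])
    moreover have "bary a' b c a'' < 0" by (rule orient_opposite(2)[OF E1 E2 R(3)[OF T'(1) S(1)] n(2)])
    \<comment> \<open>Relative sides multiply, so a'' would be on the same side as a: the product of
      two negative factors is positive.\<close>
    moreover have "bary a b c a'' = bary a b c a' * bary a' b c a''"
      using tri_edge_D(4)[OF E1] by (simp add: bary_def)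
    ultimately show False using mult_neg_neg[of "bary a b c a'" "bary a' b c a''"] by simp
  qed
  then have "{S \<in> \<T>. e edge_of S} = {T, T'}" using T T' e' by blast
  then show ?thesis by (rule that[OF T'(1,2)])
qed

section \<open>Estimates for smooth functions on a triangle\<close>

lemma scale_measure_density: "scale_measure r M = density M (\<lambda>_. r)"
  by (rule measure_eqI) (simp_all add: emeasure_density nn_integral_cmult_indicator)

lemma edge_measure_eq:
  assumes "edge_ends e = (b, c)"
  shows "edge_measure e = density (distr (restrict_space lborel {0..1}) (restrict_space borel e) (\<lambda>s. b + s *\<^sub>R (c - b))) (\<lambda>_. ennreal (dist b c))"
  using assms by (simp add: edge_measure_def scale_measure_density)

lemma space_edge_measure [simp]: "space (edge_measure e) = e"
  by (simp add: edge_measure_def space_scale_measure space_restrict_space split: prod.split)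

lemma sets_edge_measure: "sets (edge_measure e) = sets (restrict_space borel e)"
  by (simp add: edge_measure_def split: prod.split)

lemma edge_integral:
  fixes f :: "real^2 \<Rightarrow> real"
  assumes e: "edge_ends e = (b, c)" "e = closed_segment b c" and f: "f \<in> borel_measurable (edge_measure e)"
  shows "integral\<^sup>L (edge_measure e) f = dist b c * (\<integral>s. indicator {0..1} s *\<^sub>R f (b + s *\<^sub>R (c - b)) \<partial>lborel)"
    "b \<noteq> c \<Longrightarrow> integrable (edge_measure e) f \<longleftrightarrow> integrable lborel (\<lambda>s. indicator {0..1} s *\<^sub>R f (b + s *\<^sub>R (c - b)))"
proof -
  define p where "p s = b + s *\<^sub>R (c - b)" for s :: real
  define N where "N = distr (restrict_space lborel {0..1}) (restrict_space borel e) p"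
  have fm: "f \<in> borel_measurable (restrict_space borel e)"
    using f measurable_cong_sets[OF sets_edge_measure refl] by blast
  then have fN: "f \<in> borel_measurable N" by (simp add: N_def)
  have pm: "p \<in> measurable (restrict_space lborel {0..1}) (restrict_space borel e)"
  proof (rule measurable_restrict_space2)
    show "p \<in> space (restrict_space lborel {0..1}) \<rightarrow> e"
    proof
      fix s assume "s \<in> space (restrict_space lborel {0..1::real})"
      then have "0 \<le> s" "s \<le> 1" by (auto simp: space_restrict_space)
      moreover have "p s = (1 - s) *\<^sub>R b + s *\<^sub>R c" by (simp add: p_def algebra_simps)
      ultimately show "p s \<in> e" unfolding e(2) in_segment by blast
    qed
    show "p \<in> measurable (restrict_space lborel {0..1}) borel"
      unfolding p_def by (intro measurable_restrict_space1) measurable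
  qed
  have E: "edge_measure e = density N (\<lambda>_. ennreal (dist b c))"
    unfolding edge_measure_eq[OF e(1)] N_def p_def[abs_def] ..
  have "integral\<^sup>L (edge_measure e) f = dist b c * integral\<^sup>L N f"
    unfolding E by (subst integral_density[OF fN]) auto
  also have "integral\<^sup>L N f = (\<integral>s. f (p s) \<partial>restrict_space lborel {0..1})"
    unfolding N_def by (rule integral_distr[OF pm fm])
  also have "\<dots> = (\<integral>s. indicator {0..1} s *\<^sub>R f (p s) \<partial>lborel)"
    by (rule integral_restrict_space) simp
  finally show "integral\<^sup>L (edge_measure e) f = dist b c * (\<integral>s. indicator {0..1} s *\<^sub>R f (b + s *\<^sub>R (c - b)) \<partial>lborel)"
    by (simp add: p_def)
  assume "b \<noteq> c"
  then have "integrable (edge_measure e) f \<longleftrightarrow> integrable N f"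
    unfolding E by (subst integrable_density[OF fN]) auto
  also have "\<dots> \<longleftrightarrow> integrable (restrict_space lborel {0..1}) (\<lambda>s. f (p s))"
    unfolding N_def by (rule integrable_distr_eq[OF pm fm])
  also have "\<dots> \<longleftrightarrow> integrable lborel (\<lambda>s. indicator {0..1} s *\<^sub>R f (p s))"
    by (rule integrable_restrict_space) simp
  finally show "integrable (edge_measure e) f \<longleftrightarrow> integrable lborel (\<lambda>s. indicator {0..1} s *\<^sub>R f (b + s *\<^sub>R (c - b)))"
    by (simp add: p_def)
qed

lemma continuous_edge_measurable:
  fixes f :: "real^2 \<Rightarrow> 'b::euclidean_space"
  assumes "continuous_on UNIV f" shows "f \<in> borel_measurable (edge_measure e)"
  unfolding measurable_cong_sets[OF sets_edge_measure refl]
  by (intro measurable_restrict_space1 borel_measurable_continuous_onI assms)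

lemma continuous_on_segment_param:
  assumes "continuous_on UNIV (f :: 'c::real_normed_vector \<Rightarrow> 'b::topological_space)" shows "continuous_on S (\<lambda>s. f (b + s *\<^sub>R (c - b)))"
  by (rule continuous_on_compose2[OF assms]) (auto intro!: continuous_intros)

lemma continuous_edge_L2:
  fixes f :: "real^2 \<Rightarrow> 'b::euclidean_space"
  assumes e: "tri_edge T e a b c" and f: "continuous_on UNIV f"
  shows "f \<in> L2 (edge_measure e)"
proof -
  note D = tri_edge_D[OF e]
  have c: "continuous_on UNIV (\<lambda>x. (norm (f x))\<^sup>2)" by (intro continuous_intros f)
  have "integrable (edge_measure e) (\<lambda>x. (norm (f x))\<^sup>2)"
    unfolding edge_integral(2)[OF D(1,2) continuous_edge_measurable[OF c] D(6)]
    by (rule compact_integrable(1)[OF compact_Icc continuous_on_segment_param[OF c]])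
  then show ?thesis using continuous_edge_measurable[OF f] by (simp add: L2_def)
qed

section \<open>The trace inequality\<close>

lemma Ck1_inner:
  fixes u w :: "real^2 \<Rightarrow> 'b::euclidean_space"
  assumes u: "Ck 1 u" and w: "Ck 1 w"
  shows "Ck 1 (\<lambda>x. u x \<bullet> w x)" "cpartial j (\<lambda>x. u x \<bullet> w x) x = u x \<bullet> cpartial j w x + cpartial j u x \<bullet> w x"
proof -
  have d: "\<And>x. u differentiable at x" "\<And>x. w differentiable at x" "\<And>i. continuous_on UNIV (cpartial i u)" "\<And>i. continuous_on UNIV (cpartial i w)"
    using u w by auto
  have hd: "((\<lambda>x. u x \<bullet> w x) has_derivative (\<lambda>h. u x \<bullet> (\<Sum>i\<in>UNIV. h $ i *\<^sub>R cpartial i w x) + (\<Sum>i\<in>UNIV. h $ i *\<^sub>R cpartial i u x) \<bullet> w x)) (at x)" for x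
    by (rule has_derivative_inner[OF differentiable_cpartial[OF d(1)] differentiable_cpartial[OF d(2)]])
  have cp: "cpartial j (\<lambda>x. u x \<bullet> w x) x = u x \<bullet> cpartial j w x + cpartial j u x \<bullet> w x" for j x
    by (subst cpartial_eq[OF hd]) (simp add: axis_def if_distrib[of "\<lambda>a. a *\<^sub>R _"] cong: if_cong)
  then show "cpartial j (\<lambda>x. u x \<bullet> w x) x = u x \<bullet> cpartial j w x + cpartial j u x \<bullet> w x" .
  have "continuous_on UNIV (\<lambda>x. u x \<bullet> cpartial j w x + cpartial j u x \<bullet> w x)" for j
    by (intro continuous_intros d Ck_continuous[OF u] Ck_continuous[OF w])
  then have "continuous_on UNIV (cpartial j (\<lambda>x. u x \<bullet> w x))" for j unfolding cp[abs_def] .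
  then show "Ck 1 (\<lambda>x. u x \<bullet> w x)" using hd by (auto simp: differentiable_def)
qed

lemma smooth_Ck: "smooth f \<Longrightarrow> Ck k f"
  by (simp add: smooth_def)

lemma abs_sum2_inner_le:
  fixes z :: "real^2" and y :: "'b::real_inner" and g :: "2 \<Rightarrow> 'b"
  shows "norm (\<Sum>j\<in>UNIV. z $ j *\<^sub>R g j) \<le> norm z * sqrt (\<Sum>j\<in>UNIV. (norm (g j))\<^sup>2)"
proof -
  have "norm (\<Sum>j\<in>UNIV. z $ j *\<^sub>R g j) \<le> (\<Sum>j\<in>UNIV. \<bar>z $ j\<bar> * norm (g j))"
    by (rule order_trans[OF norm_sum]) simp
  also have "\<dots> \<le> L2_set (\<lambda>j. z $ j) UNIV * L2_set (\<lambda>j. norm (g j)) UNIV"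
    using L2_set_mult_ineq[of "\<lambda>j. z $ j" "\<lambda>j. norm (g j)" UNIV] by simp
  finally show ?thesis by (simp add: norm_vec_def L2_set_def)
qed

lemma norm_sum2_sq_le:
  fixes z :: "real^2" and g :: "2 \<Rightarrow> 'b::real_inner"
  assumes "norm z \<le> h"
  shows "(norm (\<Sum>j\<in>UNIV. z $ j *\<^sub>R g j))\<^sup>2 \<le> h\<^sup>2 * (\<Sum>j\<in>UNIV. (norm (g j))\<^sup>2)"
proof -
  have s: "0 \<le> (\<Sum>j\<in>UNIV. (norm (g j))\<^sup>2)" by (intro sum_nonneg) auto
  have h: "(norm z)\<^sup>2 \<le> h\<^sup>2" using assms by (intro power_mono) auto
  have "(norm (\<Sum>j\<in>UNIV. z $ j *\<^sub>R g j))\<^sup>2 \<le> (norm z * sqrt (\<Sum>j\<in>UNIV. (norm (g j))\<^sup>2))\<^sup>2"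
    by (rule power_mono[OF abs_sum2_inner_le]) simp
  also have "\<dots> = (norm z)\<^sup>2 * (\<Sum>j\<in>UNIV. (norm (g j))\<^sup>2)" using s by (simp add: power_mult_distrib)
  also have "\<dots> \<le> h\<^sup>2 * (\<Sum>j\<in>UNIV. (norm (g j))\<^sup>2)" using h s by (rule mult_right_mono)
  finally show ?thesis .
qed

definition triM :: "(real^2) set \<Rightarrow> (real^2) measure" where "triM T = lebesgue_on (interior T)"

lemma space_triM: "space (triM T) = interior T" by (simp add: triM_def)

lemma triM_L2:
  fixes f :: "real^2 \<Rightarrow> 'b::euclidean_space"
  assumes "2 simplex T" "continuous_on UNIV f" shows "f \<in> L2 (triM T)"
  unfolding triM_def using simplex2_facts[OF assms(1)] assms(2) by (intro continuous_L2) auto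

lemma triM_integrable:
  fixes f :: "real^2 \<Rightarrow> 'b::euclidean_space"
  assumes "2 simplex T" "continuous_on UNIV f" shows "integrable (triM T) f"
  using L2_integrable[OF finite_measure_lebesgue_on triM_L2[OF assms, unfolded triM_def]] simplex2_facts[OF assms(1)]
  by (simp add: triM_def)

text \<open>\<open>triangle_edge_identity\<close> for f = |u|^2. The derivative term 2 u . ((x - a)
  . \<nabla>) u is at most |u|^2 + h^2 |\<nabla> u|^2, and 2 + 1 gives the factor 3. Shape
  regularity converts the determinant into h times the edge length.\<close>

lemma trace_inequality:
  fixes u :: "real^2 \<Rightarrow> 'b::euclidean_space"
  assumes e: "tri_edge T e a b c" and u: "Ck 1 u" and sh: "diameter T \<le> \<sigma> * inball_diameter T"
  shows "diameter T * (l2norm (edge_measure e) u)\<^sup>2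
    \<le> \<sigma> * (3 * (l2norm (triM T) u)\<^sup>2 + (diameter T)\<^sup>2 * (\<Sum>j\<in>UNIV. (l2norm (triM T) (cpartial j u))\<^sup>2))"
proof -
  note D = tri_edge_D[OF e] and S = tri_edge_shape[OF e sh]
  have T2: "2 simplex T" by (rule tri_edge_simplex[OF e])
  define h where "h = diameter T"
  define f where "f x = u x \<bullet> u x" for x
  have fC: "Ck 1 f" and fp: "cpartial j f x = 2 * (u x \<bullet> cpartial j u x)" for j x
    unfolding f_def using Ck1_inner[OF u u] by (simp_all add: inner_commute)
  have cu: "continuous_on UNIV u" by (rule Ck_continuous[OF u])
  have cp: "\<And>j. continuous_on UNIV (cpartial j u)" using u by simp
  have cf: "continuous_on UNIV f" by (rule Ck_continuous[OF fC])
  have eq: "(l2norm (edge_measure e) u)\<^sup>2 = dist b c * (\<integral>s. indicator {0..1} s *\<^sub>R f (b + s *\<^sub>R (c - b)) \<partial>lborel)"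
    unfolding l2norm_sq f_def[symmetric] power2_norm_eq_inner
    by (rule edge_integral(1)[OF D(1,2) continuous_edge_measurable[OF cf]])
  have "\<bar>crossp (b - a) (c - b)\<bar> * (\<integral>s. indicator {0..1} s *\<^sub>R f (b + s *\<^sub>R (c - b)) \<partial>lborel)
    = (\<integral>x. 2 * f x + (\<Sum>j\<in>UNIV. (x - a) $ j * cpartial j f x) \<partial>triM T)"
    unfolding triM_def by (rule triangle_edge_identity[OF fC D(4,3)])
  also have "\<dots> \<le> (\<integral>x. 3 * (norm (u x))\<^sup>2 + h\<^sup>2 * (\<Sum>j\<in>UNIV. (norm (cpartial j u x))\<^sup>2) \<partial>triM T)"
  proof (rule integral_mono)
    show "integrable (triM T) (\<lambda>x. 2 * f x + (\<Sum>j\<in>UNIV. (x - a) $ j * cpartial j f x))"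
      unfolding fp f_def by (intro triM_integrable[OF T2] continuous_intros cu cp)
    show "integrable (triM T) (\<lambda>x. 3 * (norm (u x))\<^sup>2 + h\<^sup>2 * (\<Sum>j\<in>UNIV. (norm (cpartial j u x))\<^sup>2))"
      by (intro triM_integrable[OF T2] continuous_intros cu cp)
    fix x assume "x \<in> space (triM T)"
    then have xT: "x \<in> T" using interior_subset by (auto simp: space_triM)
    have aT: "a \<in> T" unfolding D(3) by (rule hull_inc) simp
    have "norm (x - a) \<le> h" unfolding h_def
      using diameter_bounded_bound[OF compact_imp_bounded[OF simplex2_facts(2)[OF T2]] xT aT] by (simp add: dist_norm)
    from norm_sum2_sq_le[OF this, of "\<lambda>j. cpartial j u x"]
    have 1: "(norm (\<Sum>j\<in>UNIV. (x - a) $ j *\<^sub>R cpartial j u x))\<^sup>2 \<le> h\<^sup>2 * (\<Sum>j\<in>UNIV. (norm (cpartial j u x))\<^sup>2)" .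
    have "(\<Sum>j\<in>UNIV. (x - a) $ j * cpartial j f x) = 2 * (u x \<bullet> (\<Sum>j\<in>UNIV. (x - a) $ j *\<^sub>R cpartial j u x))"
      unfolding fp by (simp add: inner_sum_right sum_distrib_left mult_ac)
    also have "\<dots> \<le> (norm (u x))\<^sup>2 + (norm (\<Sum>j\<in>UNIV. (x - a) $ j *\<^sub>R cpartial j u x))\<^sup>2"
      using norm_cauchy_schwarz[of "u x" "\<Sum>j\<in>UNIV. (x - a) $ j *\<^sub>R cpartial j u x"]
        sum_squares_bound[of "norm (u x)" "norm (\<Sum>j\<in>UNIV. (x - a) $ j *\<^sub>R cpartial j u x)"] by linarith
    finally show "2 * f x + (\<Sum>j\<in>UNIV. (x - a) $ j * cpartial j f x) \<le> 3 * (norm (u x))\<^sup>2 + h\<^sup>2 * (\<Sum>j\<in>UNIV. (norm (cpartial j u x))\<^sup>2)"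
      using 1 unfolding f_def power2_norm_eq_inner by linarith
  qed
  also have "\<dots> = 3 * (l2norm (triM T) u)\<^sup>2 + h\<^sup>2 * (\<Sum>j\<in>UNIV. (l2norm (triM T) (cpartial j u))\<^sup>2)"
    using triM_L2[OF T2 cu] triM_L2[OF T2 cp]
    by (simp add: l2norm_sq L2_def Bochner_Integration.integral_sum)
  finally have K: "\<bar>crossp (b - a) (c - b)\<bar> * (\<integral>s. indicator {0..1} s *\<^sub>R f (b + s *\<^sub>R (c - b)) \<partial>lborel)
    \<le> 3 * (l2norm (triM T) u)\<^sup>2 + h\<^sup>2 * (\<Sum>j\<in>UNIV. (l2norm (triM T) (cpartial j u))\<^sup>2)" .
  have I0: "0 \<le> (\<integral>s. indicator {0..1} s *\<^sub>R f (b + s *\<^sub>R (c - b)) \<partial>lborel)"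
    by (rule integral_nonneg_AE) (simp add: f_def)
  have "h * (l2norm (edge_measure e) u)\<^sup>2 = (h * dist b c) * (\<integral>s. indicator {0..1} s *\<^sub>R f (b + s *\<^sub>R (c - b)) \<partial>lborel)"
    unfolding eq by simp
  also have "\<dots> \<le> (\<sigma> * \<bar>crossp (b - a) (c - b)\<bar>) * (\<integral>s. indicator {0..1} s *\<^sub>R f (b + s *\<^sub>R (c - b)) \<partial>lborel)"
    unfolding h_def by (rule mult_right_mono[OF S(6) I0])
  also have "\<dots> \<le> \<sigma> * (3 * (l2norm (triM T) u)\<^sup>2 + h\<^sup>2 * (\<Sum>j\<in>UNIV. (l2norm (triM T) (cpartial j u))\<^sup>2))"
    using K S(4) unfolding mult.assoc by (intro mult_left_mono) auto
  finally show ?thesis by (simp add: h_def)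
qed

subsection \<open>The divergence theorem on a triangle\<close>

lemma tri_edge_vertex:
  fixes p q r :: "real^2"
  assumes ind: "\<not> affine_dependent {p, q, r}" "p \<noteq> q" "q \<noteq> r" "p \<noteq> r" and T: "T = convex hull {p, q, r}" and e: "e = closed_segment q r"
  shows "tri_edge T e p q r \<or> tri_edge T e p r q"
proof -
  obtain b c where bc: "edge_ends e = (b, c)" by (cases "edge_ends e")
  have "e = closed_segment b c" using edge_ends_segment[of e] e bc by auto
  then have "{b, c} = {q, r}" using closed_segment_ends_eq e by blast
  then consider "b = q" "c = r" | "b = r" "c = q" by (auto simp: doubleton_eq_iff)
  then show ?thesis
  proof cases
    case 1
    then show ?thesis using bc e T ind simplex2_crossp[OF ind(1,2,3,4)] by (auto simp: tri_edge_def)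
  next
    case 2
    have "crossp (r - p) (q - r) \<noteq> 0" using simplex2_crossp[OF ind(1,2,3,4)] crossp_swap[of r p q] by simp
    then show ?thesis using 2 bc e T ind by (auto simp: tri_edge_def insert_commute closed_segment_commute)
  qed
qed

lemma triangle_edges:
  fixes p q r :: "real^2"
  assumes ind: "\<not> affine_dependent {p, q, r}" "p \<noteq> q" "q \<noteq> r" "p \<noteq> r" and T: "T = convex hull {p, q, r}"
  shows "{e. e edge_of T} = {closed_segment q r, closed_segment r p, closed_segment p q}"
proof
  show "{closed_segment q r, closed_segment r p, closed_segment p q} \<subseteq> {e. e edge_of T}"
  proof -
    have i2: "\<not> affine_dependent {q, r, p}" "\<not> affine_dependent {r, p, q}" using ind(1) by (simp_all add: insert_commute)
    have T2: "T = convex hull {q, r, p}" "T = convex hull {r, p, q}" unfolding T by (simp_all add: insert_commute)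
    have "closed_segment q r edge_of T" using tri_edge_vertex[OF ind T refl] tri_edge_simplex(2) by blast
    moreover have "closed_segment r p edge_of T" using tri_edge_vertex[OF i2(1) _ _ _ T2(1) refl] ind tri_edge_simplex(2) by blast
    moreover have "closed_segment p q edge_of T" using tri_edge_vertex[OF i2(2) _ _ _ T2(2) refl] ind tri_edge_simplex(2) by blast
    ultimately show ?thesis by blast
  qed
  show "{e. e edge_of T} \<subseteq> {closed_segment q r, closed_segment r p, closed_segment p q}"
  proof
    fix e assume "e \<in> {e. e edge_of T}"
    then have e: "e edge_of T" by simp
    obtain c' where c': "c' \<subseteq> {p, q, r}" "e = convex hull c'"
      using e face_of_convex_hull_affine_independent[OF ind(1)] by (auto simp: edge_of_def T)
    have i: "\<not> affine_dependent c'" using ind(1) c'(1) affine_independent_subset by blast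
    have "aff_dim c' = 1" using e c'(2) by (simp add: edge_of_def aff_dim_convex_hull)
    then have "card c' = 2" using aff_dim_affine_independent[OF i] by simp
    then obtain x y where xy: "c' = {x, y}" "x \<noteq> y" by (auto simp: card_2_iff)
    have "e = closed_segment x y" using c'(2) xy(1) by (simp add: segment_convex_hull)
    then show "e \<in> {closed_segment q r, closed_segment r p, closed_segment p q}"
      using c'(1) xy by (auto simp: closed_segment_commute)
  qed
qed

definition nu :: "(real^2) set \<Rightarrow> real^2" where
  "nu e = vector [tangent e $ 2, - tangent e $ 1]"

definition rot :: "real^2 \<Rightarrow> real^2" where "rot z = vector [z $ 2, - z $ 1]"

text \<open>The flux through an edge depends on the edge only through its rotated vector and on the
  opposite vertex a only through a linear term. Summation over the three edges thereby becomes
  vector algebra.\<close>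

lemma edge_flux:
  fixes f :: "real^2 \<Rightarrow> real"
  assumes e: "tri_edge T e a b c" and f: "Ck 1 f"
  shows "orient T e * nu e $ i * (\<integral>x. f x \<partial>edge_measure e) = rot (c - b) $ i / crossp (b - a) (c - b) *
    ((\<integral>x. 2 * f x + (\<Sum>j\<in>UNIV. x $ j * cpartial j f x) \<partial>triM T) - (\<Sum>j\<in>UNIV. a $ j * (\<integral>x. cpartial j f x \<partial>triM T)))"
proof -
  note D = tri_edge_D[OF e]
  have T2: "2 simplex T" by (rule tri_edge_simplex[OF e])
  define d where "d = crossp (b - a) (c - b)"
  define A where "A = (\<integral>s. indicator {0..1} s *\<^sub>R f (b + s *\<^sub>R (c - b)) \<partial>lborel)"
  have cf: "continuous_on UNIV f" by (rule Ck_continuous[OF f])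
  have cp: "\<And>j. continuous_on UNIV (cpartial j f)" using f by simp
  have "(\<integral>x. f x \<partial>edge_measure e) = dist b c * A"
    unfolding A_def by (rule edge_integral(1)[OF D(1,2) continuous_edge_measurable[OF cf]])
  moreover have "\<bar>d\<bar> * A = (\<integral>x. 2 * f x + (\<Sum>j\<in>UNIV. (x - a) $ j * cpartial j f x) \<partial>triM T)"
    unfolding triM_def A_def d_def by (rule triangle_edge_identity[OF f D(4,3)])
  moreover have "\<dots> = (\<integral>x. (2 * f x + (\<Sum>j\<in>UNIV. x $ j * cpartial j f x)) - (\<Sum>j\<in>UNIV. a $ j * cpartial j f x) \<partial>triM T)"
    by (simp add: left_diff_distrib sum_subtractf algebra_simps)
  moreover have "\<dots> = (\<integral>x. 2 * f x + (\<Sum>j\<in>UNIV. x $ j * cpartial j f x) \<partial>triM T) - (\<integral>x. (\<Sum>j\<in>UNIV. a $ j * cpartial j f x) \<partial>triM T)"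
    by (intro Bochner_Integration.integral_diff triM_integrable[OF T2] continuous_intros cf cp)
  moreover have "(\<integral>x. (\<Sum>j\<in>UNIV. a $ j * cpartial j f x) \<partial>triM T) = (\<Sum>j\<in>UNIV. a $ j * (\<integral>x. cpartial j f x \<partial>triM T))"
    using triM_integrable[OF T2 cp] by (simp add: Bochner_Integration.integral_sum)
  moreover have "nu e $ i * dist b c = rot (c - b) $ i"
  proof -
    have "dist b c \<noteq> 0" using D(6) by simp
    then have n: "norm (c - b) \<noteq> 0" by (simp add: dist_norm norm_minus_commute)
    have t: "tangent e = (c - b) /\<^sub>R norm (c - b)" by (simp add: tangent_def D(1))
    have "\<forall>i. nu e $ i * norm (c - b) = rot (c - b) $ i"
      using n by (simp add: nu_def rot_def t forall_2 field_simps)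
    then show ?thesis by (simp add: dist_norm norm_minus_commute)
  qed
  moreover have "orient T e = d / \<bar>d\<bar>" unfolding orient_eq[OF e] d_def by (simp add: sgn_if)
  moreover have "d \<noteq> 0" using D(4) by (simp add: d_def)
  ultimately have 1: "(\<integral>x. f x \<partial>edge_measure e) = dist b c * A" "orient T e = d / \<bar>d\<bar>"
    and *: "\<bar>d\<bar> * A = (\<integral>x. 2 * f x + (\<Sum>j\<in>UNIV. x $ j * cpartial j f x) \<partial>triM T) - (\<Sum>j\<in>UNIV. a $ j * (\<integral>x. cpartial j f x \<partial>triM T))"
    and 3: "nu e $ i * dist b c = rot (c - b) $ i" and 4: "d \<noteq> 0" by simp_all
  have "orient T e * nu e $ i * (\<integral>x. f x \<partial>edge_measure e) = (d / \<bar>d\<bar>) * (nu e $ i * dist b c) * A"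
    unfolding 1 by (simp only: mult_ac)
  also have "\<dots> = rot (c - b) $ i / d * (\<bar>d\<bar> * A)"
    unfolding 3 using 4 by (cases "d < 0") (simp_all add: field_simps)
  finally have "orient T e * nu e $ i * (\<integral>x. f x \<partial>edge_measure e) = rot (c - b) $ i / d * (\<bar>d\<bar> * A)" .
  then show ?thesis unfolding d_def[symmetric] * .
qed

text \<open>The rotated edge vectors add up to zero, which removes the common integral M; paired
  with the opposite vertices they reproduce the determinant times the i-th mean derivative.\<close>

lemma gauss_green:
  fixes f :: "real^2 \<Rightarrow> real"
  assumes T2: "2 simplex T" and f: "Ck 1 f"
  shows "(\<Sum>e\<in>{e. e edge_of T}. orient T e * nu e $ i * (\<integral>x. f x \<partial>edge_measure e)) = (\<integral>x. cpartial i f x \<partial>triM T)"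
proof -
  obtain p q r where V: "T = convex hull {p, q, r}" "\<not> affine_dependent {p, q, r}" "p \<noteq> q" "q \<noteq> r" "p \<noteq> r" "crossp (q - p) (r - q) \<noteq> 0"
    using simplex2_vertices[OF T2] by metis
  define d where "d = crossp (q - p) (r - q)"
  define M where "M = (\<integral>x. 2 * f x + (\<Sum>j\<in>UNIV. x $ j * cpartial j f x) \<partial>triM T)"
  define G where "G j = (\<integral>x. cpartial j f x \<partial>triM T)" for j
  define X where "X e = orient T e * nu e $ i * (\<integral>x. f x \<partial>edge_measure e)" for e
  have fl: "X e = rot (c - b) $ i / crossp (b - a) (c - b) * (M - (\<Sum>j\<in>UNIV. a $ j * G j))" if "tri_edge T e a b c" for e a b c
    unfolding X_def M_def G_def by (rule edge_flux[OF that f])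
  \<comment> \<open>Exchanging b and c changes both signs, so the order chosen by
    \<open>edge_ends\<close> does not matter.\<close>
  have sw: "rot (b - c) $ i / crossp (c - a) (b - c) = rot (c - b) $ i / crossp (b - a) (c - b)" for a b c
  proof -
    have "\<forall>i. rot (b - c) $ i = - rot (c - b) $ i" by (simp add: rot_def forall_2)
    then show ?thesis by (simp add: crossp_swap[of c a b])
  qed
  have fl2: "X (closed_segment b c) = rot (c - b) $ i / crossp (b - a) (c - b) * (M - (\<Sum>j\<in>UNIV. a $ j * G j))"
    if "\<not> affine_dependent {a, b, c}" "a \<noteq> b" "b \<noteq> c" "a \<noteq> c" "T = convex hull {a, b, c}" for a b c
    using tri_edge_vertex[OF that refl] fl[of "closed_segment b c" a b c] fl[of "closed_segment b c" a c b] sw[of b c a] by auto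
  have i2: "\<not> affine_dependent {q, r, p}" "\<not> affine_dependent {r, p, q}" using V(2) by (simp_all add: insert_commute)
  have T3: "T = convex hull {q, r, p}" "T = convex hull {r, p, q}" unfolding V(1) by (simp_all add: insert_commute)
  have d2: "crossp (r - q) (p - r) = d" "crossp (p - r) (q - p) = d"
    using crossp_cyclic[of r q p] crossp_cyclic[of p r q] by (simp_all add: d_def)
  have dist: "closed_segment q r \<noteq> closed_segment r p" "closed_segment q r \<noteq> closed_segment p q" "closed_segment r p \<noteq> closed_segment p q"
    using V(3-5) closed_segment_ends_eq[of q r r p] closed_segment_ends_eq[of q r p q] closed_segment_ends_eq[of r p p q]
    by (auto simp: doubleton_eq_iff)
  have "(\<Sum>e\<in>{e. e edge_of T}. X e) = X (closed_segment q r) + X (closed_segment r p) + X (closed_segment p q)"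
    unfolding triangle_edges[OF V(2-5,1)] using dist by simp
  also have "\<dots> = rot (r - q) $ i / d * (M - (\<Sum>j\<in>UNIV. p $ j * G j)) + rot (p - r) $ i / d * (M - (\<Sum>j\<in>UNIV. q $ j * G j))
      + rot (q - p) $ i / d * (M - (\<Sum>j\<in>UNIV. r $ j * G j))"
    using fl2[OF V(2-5,1)] fl2[OF i2(1) _ _ _ T3(1)] fl2[OF i2(2) _ _ _ T3(2)] V(3-5) d2 by (simp add: d_def)
  also have "\<dots> = (rot (r - q) $ i * (M - (\<Sum>j\<in>UNIV. p $ j * G j)) + rot (p - r) $ i * (M - (\<Sum>j\<in>UNIV. q $ j * G j))
      + rot (q - p) $ i * (M - (\<Sum>j\<in>UNIV. r $ j * G j))) / d"
    by (simp add: add_divide_distrib)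
  also have "\<dots> = (d * G i) / d"
  proof -
    have "\<forall>i. rot (r - q) $ i * (M - (\<Sum>j\<in>UNIV. p $ j * G j)) + rot (p - r) $ i * (M - (\<Sum>j\<in>UNIV. q $ j * G j))
      + rot (q - p) $ i * (M - (\<Sum>j\<in>UNIV. r $ j * G j)) = d * G i"
      by (simp add: forall_2 rot_def sum_2 d_def crossp_def algebra_simps)
    then show ?thesis by simp
  qed
  also have "\<dots> = G i" using V(6) by (simp add: d_def)
  finally show ?thesis by (simp add: X_def G_def)
qed

subsection \<open>A Poincare inequality\<close>

text \<open>The fundamental theorem of calculus combined with Cauchy-Schwarz, obtained by testing
  the increment e against itself.\<close>

lemma increment_sq_le:
  fixes p :: "real \<Rightarrow> 'b::euclidean_space"
  assumes d: "\<And>t. (p has_vector_derivative p' t) (at t)" and c: "continuous_on UNIV p'" and xy: "x \<le> y"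
  shows "(norm (p y - p x))\<^sup>2 \<le> (y - x) * (\<integral>t. indicator {x..y} t *\<^sub>R (norm (p' t))\<^sup>2 \<partial>lborel)"
proof (cases "x = y")
  case False
  define L where "L = y - x"
  have L: "0 < L" using False xy by (simp add: L_def)
  define e where "e = p y - p x"
  define I where "I = (\<integral>t. indicator {x..y} t *\<^sub>R (norm (p' t))\<^sup>2 \<partial>lborel)"
  have i1: "integrable lborel (\<lambda>t. indicator {x..y} t *\<^sub>R p' t)" by (rule compact_integrable(1)[OF compact_Icc c])
  have cn: "continuous_on UNIV (\<lambda>t. (norm (p' t))\<^sup>2)" by (intro continuous_intros c)
  have i2: "integrable lborel (\<lambda>t. indicator {x..y} t *\<^sub>R (norm (p' t))\<^sup>2)" by (rule compact_integrable(1)[OF compact_Icc cn])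
  have i3: "integrable lborel (\<lambda>t. indicator {x..y} t *\<^sub>R (1::real))"
    by (rule compact_integrable(1)[OF compact_Icc continuous_on_const])
  have i4: "integrable lborel (\<lambda>t. (indicator {x..y} t *\<^sub>R p' t) \<bullet> e)" by (rule integrable_inner_left) (rule i1)
  have m: "(\<integral>t. indicator {x..y} t *\<^sub>R (1::real) \<partial>lborel) = L" using xy by (simp add: L_def)
  have "e = (\<integral>t. indicator {x..y} t *\<^sub>R p' t \<partial>lborel)"
    unfolding e_def by (rule integral_FTC_atLeastAtMost[symmetric, OF xy])
      (use d c in \<open>auto intro: has_vector_derivative_at_within continuous_on_subset\<close>)
  then have "e \<bullet> e = (\<integral>t. (indicator {x..y} t *\<^sub>R p' t) \<bullet> e \<partial>lborel)"
    by (metis i1 integral_inner_left)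
  also have "\<dots> \<le> (\<integral>t. ((norm e)\<^sup>2 / (2 * L)) * (indicator {x..y} t *\<^sub>R 1) + (L / 2) * (indicator {x..y} t *\<^sub>R (norm (p' t))\<^sup>2) \<partial>lborel)"
  proof (rule integral_mono[OF i4])
    show "integrable lborel (\<lambda>t. ((norm e)\<^sup>2 / (2 * L)) * (indicator {x..y} t *\<^sub>R 1) + (L / 2) * (indicator {x..y} t *\<^sub>R (norm (p' t))\<^sup>2))"
      using i2 i3 by (intro Bochner_Integration.integrable_add integrable_mult_right) auto
    fix t
    \<comment> \<open>Young's inequality weighted by the length L: after integration half of |e|^2
      appears on the right and is absorbed.\<close>
    have "0 \<le> (norm e - L * norm (p' t))\<^sup>2" by simp
    then have "2 * L * (norm (p' t) * norm e) \<le> (norm e)\<^sup>2 + L\<^sup>2 * (norm (p' t))\<^sup>2"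
      by (simp add: power2_diff power_mult_distrib mult_ac)
    then have "norm (p' t) * norm e \<le> (norm e)\<^sup>2 / (2 * L) + (L / 2) * (norm (p' t))\<^sup>2"
      using L by (simp add: field_simps power2_eq_square)
    then have "p' t \<bullet> e \<le> (norm e)\<^sup>2 / (2 * L) + (L / 2) * (norm (p' t))\<^sup>2"
      using norm_cauchy_schwarz[of "p' t" e] by linarith
    then show "(indicator {x..y} t *\<^sub>R p' t) \<bullet> e \<le> ((norm e)\<^sup>2 / (2 * L)) * (indicator {x..y} t *\<^sub>R 1) + (L / 2) * (indicator {x..y} t *\<^sub>R (norm (p' t))\<^sup>2)"
      by (cases "t \<in> {x..y}") simp_all
  qed
  also have "\<dots> = ((norm e)\<^sup>2 / (2 * L)) * L + (L / 2) * I"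
    using i2 i3 m unfolding I_def by (subst Bochner_Integration.integral_add) simp_all
  finally have "(norm e)\<^sup>2 \<le> (norm e)\<^sup>2 / 2 + (L / 2) * I" using L by (simp add: power2_norm_eq_inner)
  then show ?thesis unfolding e_def I_def L_def by (simp add: field_simps)
qed simp

lemma norm_add3_sq_le: "(norm (x + y + z))\<^sup>2 \<le> 3 * ((norm x)\<^sup>2 + (norm y)\<^sup>2 + (norm (z::'a::real_normed_vector))\<^sup>2)"
proof -
  have "(norm (x + y + z))\<^sup>2 \<le> (norm x + norm y + norm z)\<^sup>2"
    by (rule power_mono) (use norm_triangle_ineq[of "x + y" z] norm_triangle_ineq[of x y] in linarith, simp)
  also have "\<dots> \<le> 3 * ((norm x)\<^sup>2 + (norm y)\<^sup>2 + (norm z)\<^sup>2)"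
    using sum_squares_bound[of "norm x" "norm y"] sum_squares_bound[of "norm x" "norm z"] sum_squares_bound[of "norm y" "norm z"]
    by (simp add: power2_eq_square algebra_simps)
  finally show ?thesis .
qed

text \<open>Two points \<open>(s, t)\<close>, \<open>(s', t')\<close> of the reference triangle are joined by the axis-parallel
  path through \<open>(max s s', t)\<close> and \<open>(max s s', t')\<close>, which stays inside the triangle.\<close>

lemma reftri_poincare:
  fixes F :: "real^2 \<Rightarrow> 'b::euclidean_space"
  assumes F: "Ck 1 F"
  shows "\<exists>d. (\<integral>x. indicator reftri x *\<^sub>R (norm (F x - d))\<^sup>2 \<partial>lborel)
    \<le> 6 * (\<integral>x. indicator reftri x *\<^sub>R ((norm (cpartial 1 F x))\<^sup>2 + (norm (cpartial 2 F x))\<^sup>2) \<partial>lborel)"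
proof -
  have dF: "\<And>x. F differentiable at x" and cp: "\<And>i. continuous_on UNIV (cpartial i F)" using F by auto
  have cF: "continuous_on UNIV F" by (rule Ck_continuous[OF F])
  define g where "g i x = (norm (cpartial i F x))\<^sup>2" for i x
  have cg: "continuous_on UNIV (g i)" for i unfolding g_def by (intro continuous_intros cp)
  have g0: "0 \<le> g i x" for i x by (simp add: g_def)
  note ig = compact_integrable(1)[OF compact_reftri cg]
  \<comment> \<open>\<open>G1 t\<close> and \<open>G2 s\<close> collect the squared derivative along
    the full horizontal and vertical sections; they dominate the squared increment over any part of
    a section, since sections have length at most 1.\<close>
  define G1 where "G1 t = (\<integral>s. indicator {t..1} s *\<^sub>R g 1 (pt s t) \<partial>lborel)" for t
  define G2 where "G2 s = (\<integral>t. indicator {0..s} t *\<^sub>R g 2 (pt s t) \<partial>lborel)" for s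
  have G0: "0 \<le> G1 t" "0 \<le> G2 t" for t
    unfolding G1_def G2_def by (rule integral_nonneg_AE, simp add: g0)+
  have mono: "(\<integral>s. indicator {x..y} s *\<^sub>R h s \<partial>lborel) \<le> (\<integral>s. indicator {x'..y'} s *\<^sub>R h s \<partial>lborel)"
    if "continuous_on UNIV h" "\<And>s. 0 \<le> h s" "x' \<le> x" "y \<le> y'" for h :: "real \<Rightarrow> real" and x y x' y'
    by (rule integral_mono[OF compact_integrable(1)[OF compact_Icc that(1)] compact_integrable(1)[OF compact_Icc that(1)]])
      (use that(2-4) in \<open>auto simp: indicator_def\<close>)
  have hstep: "(norm (F (pt y t) - F (pt x t)))\<^sup>2 \<le> G1 t" if "t \<le> x" "x \<le> y" "y \<le> 1" "0 \<le> t" for x y t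
  proof -
    let ?I = "\<integral>s. indicator {x..y} s *\<^sub>R g 1 (pt s t) \<partial>lborel"
    have "(norm (F (pt y t) - F (pt x t)))\<^sup>2 \<le> (y - x) * ?I"
      unfolding g_def by (rule increment_sq_le[OF has_vector_derivative_pt(1)[OF dF] continuous_pt_comp(1)[OF cp] that(2)])
    also have "\<dots> \<le> 1 * ?I" by (rule mult_right_mono) (use that g0 in \<open>auto intro!: integral_nonneg_AE\<close>)
    also have "\<dots> \<le> G1 t" unfolding G1_def mult_1 by (rule mono) (use that continuous_pt_comp(1)[OF cg] g0 in auto)
    finally show ?thesis .
  qed
  have vstep': "(norm (F (pt s y) - F (pt s x)))\<^sup>2 \<le> G2 s" if "0 \<le> x" "x \<le> y" "y \<le> s" "s \<le> 1" for x y s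
  proof -
    let ?I = "\<integral>t. indicator {x..y} t *\<^sub>R g 2 (pt s t) \<partial>lborel"
    have "(norm (F (pt s y) - F (pt s x)))\<^sup>2 \<le> (y - x) * ?I"
      unfolding g_def by (rule increment_sq_le[OF has_vector_derivative_pt(2)[OF dF] continuous_pt_comp(2)[OF cp] that(2)])
    also have "\<dots> \<le> 1 * ?I" by (rule mult_right_mono) (use that g0 in \<open>auto intro!: integral_nonneg_AE\<close>)
    also have "\<dots> \<le> G2 s" unfolding G2_def mult_1 by (rule mono) (use that continuous_pt_comp(2)[OF cg] g0 in auto)
    finally show ?thesis .
  qed
  have vstep: "(norm (F (pt s y) - F (pt s x)))\<^sup>2 \<le> G2 s" if "0 \<le> x" "0 \<le> y" "x \<le> s" "y \<le> s" "s \<le> 1" for x y s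
    using vstep'[of x y s] vstep'[of y x s] that norm_minus_commute[of "F (pt s y)"] by (cases "x \<le> y") auto
  have ptx: "pt (x $ 1) (x $ 2) = x" for x by (simp add: vec_eq_iff forall_2)
  have path: "(norm (F x - F x'))\<^sup>2 \<le> 3 * (G1 (x $ 2) + G2 (x $ 1) + (G1 (x' $ 2) + G2 (x' $ 1)))" if "x \<in> reftri" "x' \<in> reftri" for x x'
  proof -
    define s t s' t' S where "s = x $ 1" and "t = x $ 2" and "s' = x' $ 1" and "t' = x' $ 2" and "S = max s s'"
    have b: "0 \<le> t" "t \<le> s" "s \<le> 1" "0 \<le> t'" "t' \<le> s'" "s' \<le> 1" using that by (auto simp: reftri_def s_def t_def s'_def t'_def)
    have S: "s \<le> S" "s' \<le> S" "S \<le> 1" "t \<le> S" "t' \<le> S" using b by (auto simp: S_def)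
    have 1: "(norm (F (pt s t) - F (pt S t)))\<^sup>2 \<le> G1 t" using hstep[of t s S] b S by (simp add: norm_minus_commute)
    have 2: "(norm (F (pt S t) - F (pt S t')))\<^sup>2 \<le> G2 S" using vstep[of t' t S] b S by simp
    have 3: "(norm (F (pt S t') - F (pt s' t')))\<^sup>2 \<le> G1 t'" using hstep[of t' s' S] b S by simp
    \<comment> \<open>The corner abscissa S is one of s and s', so its vertical section is already
      among the two given ones.\<close>
    have 4: "G2 S \<le> G2 s + G2 s'" using G0 by (simp add: S_def max_def)
    have "F (pt s t) - F (pt s' t') = (F (pt s t) - F (pt S t)) + (F (pt S t) - F (pt S t')) + (F (pt S t') - F (pt s' t'))" by simp
    then have "(norm (F (pt s t) - F (pt s' t')))\<^sup>2 \<le> 3 * ((norm (F (pt s t) - F (pt S t)))\<^sup>2 + (norm (F (pt S t) - F (pt S t')))\<^sup>2 + (norm (F (pt S t') - F (pt s' t')))\<^sup>2)"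
      using norm_add3_sq_le by metis
    also have "\<dots> \<le> 3 * (G1 t + G2 s + (G1 t' + G2 s'))" using 1 2 3 4 by simp
    finally show ?thesis by (simp add: s_def t_def s'_def t'_def ptx)
  qed
  define W where "W x = (indicator {0..1} (x $ 2) *\<^sub>R G1 (x $ 2)) + (indicator {0..1} (x $ 1) *\<^sub>R G2 (x $ 1))" for x :: "real^2"
  define h1 where "h1 x = indicator {0..1} (x $ 2) *\<^sub>R G1 (x $ 2)" for x :: "real^2"
  define h2 where "h2 x = indicator {0..1} (x $ 1) *\<^sub>R G2 (x $ 1)" for x :: "real^2"
  note Fub1 = reftri_Fubini[OF ig[of 1]] and Fub2 = reftri_Fubini[OF ig[of 2]]
  \<comment> \<open>This bound provides integrability of \<open>h1\<close> and \<open>h2\<close> on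
    the triangle and does not enter the constant.\<close>
  obtain B where B: "\<And>i x. x \<in> reftri \<Longrightarrow> g i x \<le> B" "0 \<le> B"
  proof -
    have "\<forall>i. \<exists>B. \<forall>x\<in>reftri. g i x \<le> B"
      using compact_imp_bounded[OF compact_continuous_image[OF continuous_on_subset[OF cg] compact_reftri]]
      by (auto simp: bounded_iff) (meson abs_le_D1)
    then obtain B' where B': "\<And>i x. x \<in> reftri \<Longrightarrow> g i x \<le> B' i" by metis
    show ?thesis
    proof (rule that[of "\<bar>B' 1\<bar> + \<bar>B' 2\<bar>"])
      fix i x assume "x \<in> reftri"
      then show "g i x \<le> \<bar>B' 1\<bar> + \<bar>B' 2\<bar>" using B'[of x i] exhaust_2[of i] by auto
    qed simp
  qed
  have Gb: "G1 t \<le> B" "G2 t \<le> B" if "t \<in> {0..1}" for t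
  proof -
    have i1: "integrable lborel (\<lambda>t::real. indicator {0..1} t *\<^sub>R B)" by (rule compact_integrable(1)[OF compact_Icc continuous_on_const])
    have "G1 t \<le> (\<integral>t. indicator {0..1} t *\<^sub>R B \<partial>(lborel :: real measure))"
      unfolding G1_def
    proof (rule integral_mono[OF compact_integrable(1)[OF compact_Icc continuous_pt_comp(1)[OF cg]] i1])
      fix s :: real
      show "indicator {t..1} s *\<^sub>R g 1 (pt s t) \<le> indicator {0..1} s *\<^sub>R B"
        using B(1)[of "pt s t" 1] B(2) that by (auto simp: indicator_def reftri_def)
    qed
    moreover have "G2 t \<le> (\<integral>t. indicator {0..1} t *\<^sub>R B \<partial>(lborel :: real measure))"
      unfolding G2_def
    proof (rule integral_mono[OF compact_integrable(1)[OF compact_Icc continuous_pt_comp(2)[OF cg]] i1])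
      fix s :: real
      show "indicator {0..t} s *\<^sub>R g 2 (pt t s) \<le> indicator {0..1} s *\<^sub>R B"
        using B(1)[of "pt t s" 2] B(2) that by (auto simp: indicator_def reftri_def)
    qed
    ultimately show "G1 t \<le> B" "G2 t \<le> B" by simp_all
  qed
  have m1: "h1 \<in> borel_measurable borel" "h2 \<in> borel_measurable borel"
  proof -
    have c: "(\<lambda>t. indicator {0..1} t *\<^sub>R G1 t) \<in> borel_measurable borel" "(\<lambda>t. indicator {0..1} t *\<^sub>R G2 t) \<in> borel_measurable borel"
      using borel_measurable_integrable[OF Fub1(3)] borel_measurable_integrable[OF Fub2(4)] by (simp_all add: G1_def G2_def)
    have n: "(\<lambda>x::real^2. x $ i) \<in> borel_measurable borel" for i by (intro borel_measurable_continuous_onI continuous_intros)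
    show "h1 \<in> borel_measurable borel" "h2 \<in> borel_measurable borel"
      unfolding h1_def h2_def using measurable_compose[OF n c(1)] measurable_compose[OF n c(2)] by simp_all
  qed
  have iB: "integrable lborel (\<lambda>x. indicator reftri x *\<^sub>R B)" by (rule compact_integrable(1)[OF compact_reftri continuous_on_const])
  have rm: "reftri \<in> sets borel" using compact_reftri by (simp add: borel_compact)
  have ih: "integrable lborel (\<lambda>x. indicator reftri x *\<^sub>R h1 x)" "integrable lborel (\<lambda>x. indicator reftri x *\<^sub>R h2 x)"
  proof -
    have mm: "(\<lambda>x. indicator reftri x *\<^sub>R h1 x) \<in> borel_measurable lborel" "(\<lambda>x. indicator reftri x *\<^sub>R h2 x) \<in> borel_measurable lborel"
      using m1 rm by simp_all
    have b: "norm (indicator reftri x *\<^sub>R h1 x) \<le> norm (indicator reftri x *\<^sub>R B)" "norm (indicator reftri x *\<^sub>R h2 x) \<le> norm (indicator reftri x *\<^sub>R B)" for x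
      using Gb[of "x $ 2"] Gb[of "x $ 1"] G0 B(2) by (auto simp: indicator_def h1_def h2_def)
    show "integrable lborel (\<lambda>x. indicator reftri x *\<^sub>R h1 x)" "integrable lborel (\<lambda>x. indicator reftri x *\<^sub>R h2 x)"
      by (rule Bochner_Integration.integrable_bound[OF iB mm(1) AE_I2[OF b(1)]])
        (rule Bochner_Integration.integrable_bound[OF iB mm(2) AE_I2[OF b(2)]])
  qed
  \<comment> \<open>\<open>h1\<close> is constant on horizontal sections, whose length is 1 - t
    \<le> 1.\<close>
  have H1: "(\<integral>x. indicator reftri x *\<^sub>R h1 x \<partial>lborel) \<le> (\<integral>x. indicator reftri x *\<^sub>R g 1 x \<partial>lborel)"
    unfolding reftri_Fubini(1)[OF ih(1)] Fub1(1) G1_def[symmetric]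
  proof (rule integral_mono[OF reftri_Fubini(3)[OF ih(1)] Fub1(3)[folded G1_def]])
    fix t :: real
    show "indicator {0..1} t *\<^sub>R (\<integral>s. indicator {t..1} s *\<^sub>R h1 (pt s t) \<partial>lborel) \<le> indicator {0..1} t *\<^sub>R G1 t"
      using mult_right_mono[of "1 - t" 1 "G1 t"] G0 by (auto simp: h1_def indicator_def[of "{0..1}"])
  qed
  have H2: "(\<integral>x. indicator reftri x *\<^sub>R h2 x \<partial>lborel) \<le> (\<integral>x. indicator reftri x *\<^sub>R g 2 x \<partial>lborel)"
    unfolding reftri_Fubini(2)[OF ih(2)] Fub2(2) G2_def[symmetric]
  proof (rule integral_mono[OF reftri_Fubini(4)[OF ih(2)] Fub2(4)[folded G2_def]])
    fix s :: real
    show "indicator {0..1} s *\<^sub>R (\<integral>t. indicator {0..s} t *\<^sub>R h2 (pt s t) \<partial>lborel) \<le> indicator {0..1} s *\<^sub>R G2 s"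
      using mult_right_mono[of s 1 "G2 s"] G0 by (auto simp: h2_def indicator_def[of "{0..1}"])
  qed
  define G where "G = (\<integral>x. indicator reftri x *\<^sub>R (g 1 x + g 2 x) \<partial>lborel)"
  have Geq: "G = (\<integral>x. indicator reftri x *\<^sub>R g 1 x \<partial>lborel) + (\<integral>x. indicator reftri x *\<^sub>R g 2 x \<partial>lborel)"
    unfolding G_def using ig by (simp add: distrib_left)
  have We: "indicator reftri x *\<^sub>R W x = indicator reftri x *\<^sub>R h1 x + indicator reftri x *\<^sub>R h2 x" for x
    by (simp add: W_def h1_def h2_def distrib_left)
  have iW: "integrable lborel (\<lambda>x. indicator reftri x *\<^sub>R W x)" unfolding We using ih by simp
  have W: "(\<integral>x. indicator reftri x *\<^sub>R W x \<partial>lborel) \<le> G" unfolding We Geq using H1 H2 ih by simp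
  \<comment> \<open>For a constant, \<open>reftri_identity\<close> computes the area 1/2 of the
    triangle.\<close>
  have half: "(\<integral>x. indicator reftri x *\<^sub>R k \<partial>lborel) = k / 2" for k :: real
    using reftri_identity[OF Ck_const, of k] by (simp add: cpartial_def)
  have ik: "integrable lborel (\<lambda>x. indicator reftri x *\<^sub>R k)" for k :: real by (rule compact_integrable(1)[OF compact_reftri continuous_on_const])
  \<comment> \<open>A point where W does not exceed its mean, which is at most 2 G as the area is
    1/2. Taking the value F p as the constant avoids a double integral over pairs of points.\<close>
  obtain p where p: "p \<in> reftri" "W p \<le> 2 * G"
  proof (rule ccontr)
    assume "\<not> thesis"
    then have gt: "2 * G < W x" if "x \<in> reftri" for x using \<open>(\<And>p. p \<in> reftri \<Longrightarrow> W p \<le> 2 * G \<Longrightarrow> thesis)\<close> that by fastforce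
    let ?H = "\<lambda>x. indicator reftri x *\<^sub>R W x - indicator reftri x *\<^sub>R (2 * G)"
    have iH: "integrable lborel ?H" using iW ik by (rule Bochner_Integration.integrable_diff)
    have nH: "AE x in lborel. 0 \<le> ?H x" by (rule AE_I2) (use gt in \<open>auto simp: indicator_def less_imp_le\<close>)
    have "(\<integral>x. ?H x \<partial>lborel) \<le> 0" unfolding Bochner_Integration.integral_diff[OF iW ik] half using W by simp
    then have "(\<integral>x. ?H x \<partial>lborel) = 0" using integral_nonneg_AE[OF nH] by linarith
    then have "AE x in lborel. ?H x = 0" using integral_nonneg_eq_0_iff_AE[OF iH nH] by simp
    then have "AE x in lborel. indicator reftri x *\<^sub>R (1::real) = 0"
      by eventually_elim (use gt in \<open>fastforce simp: indicator_def split: if_splits\<close>)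
    then have "(\<integral>x. indicator reftri x *\<^sub>R (1::real) \<partial>lborel) = 0" by (rule integral_eq_zero_AE)
    then show False unfolding half by simp
  qed
  have cd: "continuous_on UNIV (\<lambda>x. (norm (F x - F p))\<^sup>2)" by (intro continuous_intros cF)
  \<comment> \<open>The part 3 W(x) integrates to at most 3 G, and 3 W(p) \<le> 6 G over the area
    1/2 to another 3 G.\<close>
  have "(\<integral>x. indicator reftri x *\<^sub>R (norm (F x - F p))\<^sup>2 \<partial>lborel) \<le> (\<integral>x. 3 * (indicator reftri x *\<^sub>R W x) + indicator reftri x *\<^sub>R (6 * G) \<partial>lborel)"
  proof (rule integral_mono[OF compact_integrable(1)[OF compact_reftri cd]])
    show "integrable lborel (\<lambda>x. 3 * (indicator reftri x *\<^sub>R W x) + indicator reftri x *\<^sub>R (6 * G))"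
      using iW ik by (intro Bochner_Integration.integrable_add integrable_mult_right)
    fix x
    have "W y = G1 (y $ 2) + G2 (y $ 1)" if "y \<in> reftri" for y using that by (auto simp: W_def reftri_def indicator_def)
    then show "indicator reftri x *\<^sub>R (norm (F x - F p))\<^sup>2 \<le> 3 * (indicator reftri x *\<^sub>R W x) + indicator reftri x *\<^sub>R (6 * G)"
      using path[of x p] p by (cases "x \<in> reftri") auto
  qed
  also have "\<dots> = 3 * (\<integral>x. indicator reftri x *\<^sub>R W x \<partial>lborel) + 3 * G"
    unfolding Bochner_Integration.integral_add[OF integrable_mult_right[OF iW] ik] half by simp
  also have "\<dots> \<le> 6 * G" using W by simp
  finally show ?thesis unfolding G_def g_def by blast
qed

text \<open>Affine pullback to the reference triangle. The two columns of the linear map have length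
  at most h, so 6 becomes 6 * 2 h^2; the Jacobian occurs on both sides and cancels, whence the
  constant does not see the shape of T.\<close>

lemma triangle_poincare:
  fixes w :: "real^2 \<Rightarrow> 'b::euclidean_space"
  assumes e: "tri_edge T e a b c" and w: "Ck 1 w"
  shows "\<exists>d. (l2norm (triM T) (\<lambda>x. w x - d))\<^sup>2 \<le> 12 * (diameter T)\<^sup>2 * (\<Sum>j\<in>UNIV. (l2norm (triM T) (cpartial j w))\<^sup>2)"
proof -
  note D = tri_edge_D[OF e]
  have T2: "2 simplex T" by (rule tri_edge_simplex[OF e])
  define h where "h = diameter T"
  define g where "g x = x $ 1 *\<^sub>R (b - a) + x $ 2 *\<^sub>R (c - b)" for x :: "real^2"
  define J where "J = \<bar>crossp (b - a) (c - b)\<bar>"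
  have dw: "\<And>x. w differentiable at x" and cp: "\<And>i. continuous_on UNIV (cpartial i w)" using w by auto
  have cw: "continuous_on UNIV w" by (rule Ck_continuous[OF w])
  have agd: "((\<lambda>x. a + g x) has_derivative g) (at x)" for x
    unfolding g_def by (auto intro!: derivative_eq_intros bounded_linear_imp_has_derivative bounded_linear_vec_nth)
  have cag: "continuous_on UNIV (\<lambda>x. a + g x)" unfolding g_def by (intro continuous_intros)
  define F where "F x = w (a + g x)" for x
  have Fd: "(F has_derivative (\<lambda>k. \<Sum>j\<in>UNIV. (g k) $ j *\<^sub>R cpartial j w (a + g x))) (at x)" for x
    unfolding F_def by (rule has_derivative_compose[OF agd differentiable_cpartial[OF dw]])
  have cpF: "cpartial 1 F x = (\<Sum>j\<in>UNIV. (b - a) $ j *\<^sub>R cpartial j w (a + g x))"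
    "cpartial 2 F x = (\<Sum>j\<in>UNIV. (c - b) $ j *\<^sub>R cpartial j w (a + g x))" for x
    unfolding cpartial_eq[OF Fd] by (simp_all add: g_def axis_def)
  have cc: "continuous_on UNIV (\<lambda>x. \<Sum>j\<in>UNIV. q $ j *\<^sub>R cpartial j w (a + g x))" for q :: "real^2"
    by (intro continuous_intros continuous_on_compose2[OF cp cag]) simp
  have cF: "continuous_on UNIV (cpartial 1 F)" "continuous_on UNIV (cpartial 2 F)"
    using cc[of "b - a"] cc[of "c - b"] unfolding cpF[symmetric] .
  then have FC: "Ck 1 F" using Fd by (auto simp: forall_2 differentiable_def)
  obtain d where d: "(\<integral>x. indicator reftri x *\<^sub>R (norm (F x - d))\<^sup>2 \<partial>lborel)
    \<le> 6 * (\<integral>x. indicator reftri x *\<^sub>R ((norm (cpartial 1 F x))\<^sup>2 + (norm (cpartial 2 F x))\<^sup>2) \<partial>lborel)"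
    using reftri_poincare[OF FC] by blast
  have V: "a \<in> T" "b \<in> T" "c \<in> T" unfolding D(3) by (rule hull_inc, simp)+
  note db = diameter_bounded_bound[OF compact_imp_bounded[OF simplex2_facts(2)[OF T2]]]
  have n: "norm (b - a) \<le> h" "norm (c - b) \<le> h"
    using db[OF V(2,1)] db[OF V(3,2)] by (simp_all add: h_def dist_norm)
  define S where "S x = (\<Sum>j\<in>UNIV. (norm (cpartial j w x))\<^sup>2)" for x
  have cS: "continuous_on UNIV S" unfolding S_def by (intro continuous_intros cp)
  have cd: "continuous_on UNIV (\<lambda>x. (norm (w x - d))\<^sup>2)" by (intro continuous_intros cw)
  have "(\<integral>x. indicator reftri x *\<^sub>R ((norm (cpartial 1 F x))\<^sup>2 + (norm (cpartial 2 F x))\<^sup>2) \<partial>lborel)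
    \<le> (\<integral>x. (2 * h\<^sup>2) * (indicator reftri x *\<^sub>R S (a + g x)) \<partial>lborel)"
  proof (rule integral_mono)
    show "integrable lborel (\<lambda>x. indicator reftri x *\<^sub>R ((norm (cpartial 1 F x))\<^sup>2 + (norm (cpartial 2 F x))\<^sup>2))"
      by (intro compact_integrable(1)[OF compact_reftri] continuous_intros cF)
    show "integrable lborel (\<lambda>x. (2 * h\<^sup>2) * (indicator reftri x *\<^sub>R S (a + g x)))"
      by (intro integrable_mult_right compact_integrable(1)[OF compact_reftri] continuous_on_compose2[OF cS cag]) simp
    fix x
    have "(norm (cpartial 1 F x))\<^sup>2 \<le> h\<^sup>2 * S (a + g x)" "(norm (cpartial 2 F x))\<^sup>2 \<le> h\<^sup>2 * S (a + g x)"
      unfolding cpF S_def by (rule norm_sum2_sq_le[OF n(1)], rule norm_sum2_sq_le[OF n(2)])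
    then show "indicator reftri x *\<^sub>R ((norm (cpartial 1 F x))\<^sup>2 + (norm (cpartial 2 F x))\<^sup>2) \<le> (2 * h\<^sup>2) * (indicator reftri x *\<^sub>R S (a + g x))"
      by (cases "x \<in> reftri") auto
  qed
  then have 1: "(\<integral>x. indicator reftri x *\<^sub>R (norm (F x - d))\<^sup>2 \<partial>lborel) \<le> 12 * h\<^sup>2 * (\<integral>x. indicator reftri x *\<^sub>R S (a + g x) \<partial>lborel)"
    using d by simp
  have "(l2norm (triM T) (\<lambda>x. w x - d))\<^sup>2 = J * (\<integral>x. indicator reftri x *\<^sub>R (norm (F x - d))\<^sup>2 \<partial>lborel)"
    unfolding l2norm_sq triM_def triangle_integral[OF cd D(4,3)] J_def F_def g_def ..
  also have "\<dots> \<le> J * (12 * h\<^sup>2 * (\<integral>x. indicator reftri x *\<^sub>R S (a + g x) \<partial>lborel))"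
    using 1 by (rule mult_left_mono) (simp add: J_def)
  also have "\<dots> = 12 * h\<^sup>2 * (J * (\<integral>x. indicator reftri x *\<^sub>R S (a + g x) \<partial>lborel))" by simp
  also have "J * (\<integral>x. indicator reftri x *\<^sub>R S (a + g x) \<partial>lborel) = (\<integral>x. S x \<partial>triM T)"
    unfolding triM_def triangle_integral[OF cS D(4,3)] J_def g_def ..
  also have "\<dots> = (\<Sum>j\<in>UNIV. (l2norm (triM T) (cpartial j w))\<^sup>2)"
    using triM_L2[OF T2 cp] by (simp add: S_def l2norm_sq L2_def Bochner_Integration.integral_sum)
  finally show ?thesis unfolding h_def by blast
qed

subsection \<open>Approximation on edges\<close>

text \<open>The trace inequality for u minus its Poincare constant: 3 * 12 + 1 = 37.\<close>

lemma trace_poincare: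
  fixes u :: "real^2 \<Rightarrow> 'b::euclidean_space"
  assumes e: "tri_edge T e a b c" and u: "smooth u" and sh: "diameter T \<le> \<sigma> * inball_diameter T"
  shows "\<exists>d. (l2norm (edge_measure e) (\<lambda>x. u x - d))\<^sup>2
    \<le> 37 * \<sigma> * diameter T * (\<Sum>j\<in>UNIV. (l2norm (triM T) (cpartial j u))\<^sup>2)"
proof -
  note S = tri_edge_shape[OF e sh]
  define h where "h = diameter T"
  have h: "0 < h" using less_le_trans[OF S(2,3)] by (simp add: h_def)
  define N where "N = (\<Sum>j\<in>UNIV. (l2norm (triM T) (cpartial j u))\<^sup>2)"
  obtain d where d: "(l2norm (triM T) (\<lambda>x. u x - d))\<^sup>2 \<le> 12 * h\<^sup>2 * N"
    using triangle_poincare[OF e smooth_Ck[OF u]] unfolding h_def N_def by blast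
  have sm: "smooth (\<lambda>x. u x - d)" by (rule smooth_diff[OF u smooth_const])
  have cp: "cpartial j (\<lambda>x. u x - d) = cpartial j u" for j
  proof
    fix x
    have "cpartial j (\<lambda>x. u x + (- d)) x = cpartial j u x + cpartial j (\<lambda>x. - d) x"
      by (rule cpartial_add[OF smooth_differentiable[OF u] smooth_differentiable[OF smooth_const]])
    then show "cpartial j (\<lambda>x. u x - d) x = cpartial j u x" by (simp add: cpartial_def[of j "\<lambda>x. - d"])
  qed
  have "h * (l2norm (edge_measure e) (\<lambda>x. u x - d))\<^sup>2 \<le> \<sigma> * (3 * (l2norm (triM T) (\<lambda>x. u x - d))\<^sup>2 + h\<^sup>2 * N)"
    using trace_inequality[OF e smooth_Ck[OF sm] sh] unfolding cp h_def N_def .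
  also have "\<dots> \<le> \<sigma> * (3 * (12 * h\<^sup>2 * N) + h\<^sup>2 * N)"
    by (rule mult_left_mono[OF add_right_mono[OF mult_left_mono[OF d]]]) (use S(4) in simp_all)
  also have "\<dots> = h * (37 * \<sigma> * h * N)" by (simp add: power2_eq_square algebra_simps)
  finally have "(l2norm (edge_measure e) (\<lambda>x. u x - d))\<^sup>2 \<le> 37 * \<sigma> * h * N" using h by simp
  then show ?thesis unfolding h_def N_def by blast
qed

section \<open>Symmetric gradients and the rigid approximation on an edge\<close>

definition symm :: "real^2^2 \<Rightarrow> real^2^2" where
  "symm A = (1/2) *\<^sub>R (A + transpose A)"

lemma symm_nth: "symm A $ i $ j = (A $ i $ j + A $ j $ i) / 2"
  by (simp add: symm_def transpose_def)

lemma bounded_linear_symm: "bounded_linear symm"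
  by (rule linear_conv_bounded_linear[THEN iffD1])
    (auto simp: linear_iff vec_eq_iff symm_nth algebra_simps add_divide_distrib)

lemma norm_symm_le: "norm (symm A) \<le> norm A"
proof (rule power2_le_imp_le)
  have "(A $ 1 $ 2 + A $ 2 $ 1)\<^sup>2 / 2 \<le> (A $ 1 $ 2)\<^sup>2 + (A $ 2 $ 1)\<^sup>2"
    using sum_squares_bound[of "A $ 1 $ 2" "A $ 2 $ 1"] by (simp add: power2_sum)
  then show "(norm (symm A))\<^sup>2 \<le> (norm A)\<^sup>2"
    by (simp add: norm_sq_vec sum_2 symm_nth power_divide add.commute)
qed simp

definition inj2 :: "2 \<Rightarrow> 'b::euclidean_space \<Rightarrow> 'b^2" where "inj2 i y = (\<chi> k. if k = i then y else 0)"

lemma bounded_linear_inj2: "bounded_linear (inj2 i)"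
  by (rule linear_conv_bounded_linear[THEN iffD1]) (auto simp: linear_iff vec_eq_iff inj2_def)

lemma vec2_inj2: "(\<chi> i. f i) = inj2 1 (f 1) + inj2 2 (f 2)" for f :: "2 \<Rightarrow> 'b::euclidean_space"
  by (simp add: vec_eq_iff forall_2 inj2_def)

lemma smooth_vec: "(\<And>i. smooth (f i)) \<Longrightarrow> smooth (\<lambda>x. \<chi> i. f i x)" for f :: "2 \<Rightarrow> real^2 \<Rightarrow> 'b::euclidean_space"
  unfolding vec2_inj2 by (intro smooth_add smooth_linear[OF bounded_linear_inj2])

lemma cpartial_vec:
  fixes f :: "2 \<Rightarrow> real^2 \<Rightarrow> 'b::euclidean_space"
  assumes "\<And>i. smooth (f i)"
  shows "cpartial j (\<lambda>x. \<chi> i. f i x) x = (\<chi> i. cpartial j (f i) x)"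
proof -
  note s = smooth_differentiable[OF smooth_linear[OF bounded_linear_inj2 assms]]
  show ?thesis unfolding vec2_inj2
    by (subst cpartial_add[OF s s]) (simp add: cpartial_linear[OF smooth_differentiable[OF assms] bounded_linear_inj2])
qed

definition sgrad :: "(real^2 \<Rightarrow> 'b::euclidean_space) \<Rightarrow> real^2 \<Rightarrow> 'b^2" where
  "sgrad \<phi> x = (\<chi> j. cpartial j \<phi> x)"

lemma smooth_sgrad: "smooth \<phi> \<Longrightarrow> smooth (sgrad \<phi>)"
  unfolding sgrad_def[abs_def] by (intro smooth_vec smooth_cpartial)

lemma cpartial_sgrad: "smooth \<phi> \<Longrightarrow> cpartial j (sgrad \<phi>) x = (\<chi> i. cpartial j (cpartial i \<phi>) x)"
  unfolding sgrad_def[abs_def] by (rule cpartial_vec) (rule smooth_cpartial)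

lemma norm_tangent: "tri_edge T e a b c \<Longrightarrow> norm (tangent e) = 1"
  using tri_edge_D[of T e a b c] by (simp add: tangent_def)

lemma nu_props:
  assumes "tri_edge T e a b c"
  shows "norm (nu e) = 1" "nu e \<bullet> tangent e = 0" "z = (z \<bullet> tangent e) *\<^sub>R tangent e + (z \<bullet> nu e) *\<^sub>R nu e"
    "(norm z)\<^sup>2 = (z \<bullet> tangent e)\<^sup>2 + (z \<bullet> nu e)\<^sup>2"
proof -
  define t where "t = tangent e"
  have t: "(t $ 1)\<^sup>2 + (t $ 2)\<^sup>2 = 1"
    using norm_tangent[OF assms] norm_sq_vec[of t] by (simp add: t_def sum_2)
  show n1: "norm (nu e) = 1"
    using t norm_sq_vec[of "nu e"] by (simp add: nu_def t_def[symmetric] sum_2 add.commute power2_eq_1_iff) (metis norm_ge_zero not_one_le_zero neg_0_le_iff_le)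
  show z0: "nu e \<bullet> tangent e = 0" by (simp add: nu_def inner_vec_def sum_2)
  have "z $ 1 = (z $ 1 * t $ 1 + z $ 2 * t $ 2) * t $ 1 + (z $ 1 * t $ 2 - z $ 2 * t $ 1) * t $ 2"
  proof -
    have "(z $ 1 * t $ 1 + z $ 2 * t $ 2) * t $ 1 + (z $ 1 * t $ 2 - z $ 2 * t $ 1) * t $ 2 = z $ 1 * ((t $ 1)\<^sup>2 + (t $ 2)\<^sup>2)"
      by (simp add: power2_eq_square algebra_simps)
    then show ?thesis using t by simp
  qed
  moreover have "z $ 2 = (z $ 1 * t $ 1 + z $ 2 * t $ 2) * t $ 2 - (z $ 1 * t $ 2 - z $ 2 * t $ 1) * t $ 1"
  proof -
    have "(z $ 1 * t $ 1 + z $ 2 * t $ 2) * t $ 2 - (z $ 1 * t $ 2 - z $ 2 * t $ 1) * t $ 1 = z $ 2 * ((t $ 1)\<^sup>2 + (t $ 2)\<^sup>2)"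
      by (simp add: power2_eq_square algebra_simps)
    then show ?thesis using t by simp
  qed
  ultimately show zz: "z = (z \<bullet> tangent e) *\<^sub>R tangent e + (z \<bullet> nu e) *\<^sub>R nu e"
    unfolding t_def[symmetric] by (simp add: vec_eq_iff forall_2 nu_def t_def[symmetric] inner_vec_def sum_2)
  have "z \<bullet> z = z \<bullet> ((z \<bullet> tangent e) *\<^sub>R tangent e + (z \<bullet> nu e) *\<^sub>R nu e)" using zz by simp
  then show "(norm z)\<^sup>2 = (z \<bullet> tangent e)\<^sup>2 + (z \<bullet> nu e)\<^sup>2"
    unfolding power2_norm_eq_inner by (simp add: inner_add_right power2_eq_square)
qed

text \<open>The tangential derivative of the tangential component only involves the symmetric gradient.\<close>

lemma tangential_symm:
  fixes t :: "real^2"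
  assumes "norm t = 1"
  shows "\<bar>(\<Sum>j\<in>UNIV. t $ j *\<^sub>R A $ j) \<bullet> t\<bar> \<le> norm (symm A)"
proof -
  have "(\<Sum>j\<in>UNIV. t $ j *\<^sub>R A $ j) \<bullet> t = (\<Sum>j\<in>UNIV. t $ j *\<^sub>R symm A $ j) \<bullet> t"
    by (simp add: sum_2 inner_vec_def symm_nth algebra_simps)
  moreover have "\<bar>(\<Sum>j\<in>UNIV. t $ j *\<^sub>R symm A $ j) \<bullet> t\<bar> \<le> norm (\<Sum>j\<in>UNIV. t $ j *\<^sub>R symm A $ j) * norm t"
    by (rule Cauchy_Schwarz_ineq2)
  moreover have "norm (\<Sum>j\<in>UNIV. t $ j *\<^sub>R symm A $ j) \<le> norm t * sqrt (\<Sum>j\<in>UNIV. (norm (symm A $ j))\<^sup>2)"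
    by (rule abs_sum2_inner_le)
  moreover have "sqrt (\<Sum>j\<in>UNIV. (norm (symm A $ j))\<^sup>2) = norm (symm A)" by (simp add: norm_vec_def L2_set_def)
  ultimately show ?thesis using assms by simp
qed

text \<open>On e the difference \<phi> - q vanishes at b and is controlled by its derivative along
  e. The tangential part of that derivative is t . \<epsilon>(\<phi>) t, the normal part is an
  oscillation of first derivatives about constants. The former is estimated by
  \<open>trace_inequality\<close>, the latter by \<open>trace_poincare\<close>.\<close>

lemma edge_rigid_approx:
  fixes \<phi> :: "real^2 \<Rightarrow> real^2"
  assumes e: "tri_edge T e a b c" and s: "smooth \<phi>" and sh: "diameter T \<le> \<sigma> * inball_diameter T"
  shows "\<exists>q\<in>P1_minus e. (l2norm (edge_measure e) (\<lambda>x. \<phi> x - q x))\<^sup>2 \<le> \<sigma> * diameter T *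
    (3 * (l2norm (triM T) (\<lambda>x. symm (sgrad \<phi> x)))\<^sup>2
      + 38 * (diameter T)\<^sup>2 * (\<Sum>i\<in>UNIV. \<Sum>j\<in>UNIV. (l2norm (triM T) (cpartial j (cpartial i \<phi>)))\<^sup>2)) \<and> continuous_on UNIV q"
proof -
  note D = tri_edge_D[OF e] and S = tri_edge_shape[OF e sh]
  have T2: "2 simplex T" by (rule tri_edge_simplex[OF e])
  define h where "h = diameter T"
  define L where "L = dist b c"
  have hL: "0 < L" "L \<le> h" "0 < \<sigma>" using S(2,3,4) by (simp_all add: h_def L_def)
  define D2 where "D2 = (\<Sum>i\<in>UNIV. \<Sum>j\<in>UNIV. (l2norm (triM T) (cpartial j (cpartial i \<phi>)))\<^sup>2)"
  define t where "t = tangent e"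
  define n where "n = nu e"
  have t1: "norm t = 1" unfolding t_def by (rule norm_tangent[OF e])
  have n1: "norm n = 1" "n \<bullet> t = 0" unfolding n_def t_def by (rule nu_props[OF e])+
  have cb: "c - b = L *\<^sub>R t" using hL by (simp add: t_def tangent_def D(1) L_def dist_norm norm_minus_commute)
  have "\<forall>j. \<exists>d. (l2norm (edge_measure e) (\<lambda>x. cpartial j \<phi> x - d))\<^sup>2
    \<le> 37 * \<sigma> * h * (\<Sum>i\<in>UNIV. (l2norm (triM T) (cpartial i (cpartial j \<phi>)))\<^sup>2)"
    unfolding h_def using trace_poincare[OF e smooth_cpartial[OF s] sh] by blast
  then obtain d where d: "\<And>j. (l2norm (edge_measure e) (\<lambda>x. cpartial j \<phi> x - d j))\<^sup>2
    \<le> 37 * \<sigma> * h * (\<Sum>i\<in>UNIV. (l2norm (triM T) (cpartial i (cpartial j \<phi>)))\<^sup>2)" by metis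
  \<comment> \<open>k is the normal component of the tangential derivative, with \<partial>_j \<phi>
    replaced by the constants d j. A slope in normal direction is exactly the freedom that
    \<open>P1_minus\<close> has beyond constants.\<close>
  define k where "k = (\<Sum>j\<in>UNIV. t $ j *\<^sub>R d j) \<bullet> n"
  define q where "q x = \<phi> b + (k * ((x - b) \<bullet> t)) *\<^sub>R n" for x
  have qP: "q \<in> P1_minus e"
  proof -
    have "linear (\<lambda>x. (k * (x \<bullet> t)) *\<^sub>R n)" by (simp add: linear_iff inner_add_left algebra_simps)
    moreover have "q x = (k * (x \<bullet> t)) *\<^sub>R n + (\<phi> b - (k * (b \<bullet> t)) *\<^sub>R n)" for x
      by (simp add: q_def inner_diff_left algebra_simps)
    ultimately have "q \<in> P1 e" unfolding P1_def by blast
    moreover have "(\<lambda>x. q x \<bullet> tangent e) \<in> P0 e"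
      unfolding P0_def by (auto simp: q_def inner_add_left n1(2)[unfolded t_def])
    ultimately show ?thesis by (simp add: P1_minus_def)
  qed
  have cq: "continuous_on UNIV q" unfolding q_def by (intro continuous_intros)
  define E where "E x = symm (sgrad \<phi> x)" for x
  have sE: "smooth E" unfolding E_def by (intro smooth_linear[OF bounded_linear_symm] smooth_sgrad s)
  define R where "R x = (norm (E x))\<^sup>2 + (\<Sum>j\<in>UNIV. (norm (cpartial j \<phi> x - d j))\<^sup>2)" for x
  have ccp: "\<And>j. continuous_on UNIV (cpartial j \<phi>)" by (rule smooth_continuous[OF smooth_cpartial[OF s]])
  have cphi: "continuous_on UNIV \<phi>" by (rule smooth_continuous[OF s])
  have cE: "continuous_on UNIV E" by (rule smooth_continuous[OF sE])
  have cR: "continuous_on UNIV R" unfolding R_def by (intro continuous_intros cE ccp)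
  define y where "y r = b + r *\<^sub>R (c - b)" for r :: real
  define p where "p r = \<phi> (y r) - q (y r)" for r
  define p' where "p' r = L *\<^sub>R ((\<Sum>j\<in>UNIV. t $ j *\<^sub>R cpartial j \<phi> (y r)) - k *\<^sub>R n)" for r
  have qy: "q (y r) = \<phi> b + r *\<^sub>R ((L * k) *\<^sub>R n)" for r
  proof -
    have "(y r - b) \<bullet> t = r * L" unfolding y_def cb using t1 by (simp add: norm_eq_1)
    then show ?thesis by (simp add: q_def mult_ac)
  qed
  have pd: "(p has_vector_derivative p' r) (at r)" for r
  proof -
    have 1: "((\<lambda>r. \<phi> (b + r *\<^sub>R (c - b))) has_vector_derivative (\<Sum>j\<in>UNIV. (c - b) $ j *\<^sub>R cpartial j \<phi> (b + r *\<^sub>R (c - b)))) (at r)"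
      by (rule has_vector_derivative_line[OF smooth_differentiable[OF s]])
    have 2: "(\<Sum>j\<in>UNIV. (c - b) $ j *\<^sub>R cpartial j \<phi> z) = L *\<^sub>R (\<Sum>j\<in>UNIV. t $ j *\<^sub>R cpartial j \<phi> z)" for z
      unfolding cb by (simp add: scaleR_sum_right)
    have 3: "((\<lambda>r. \<phi> b + r *\<^sub>R ((L * k) *\<^sub>R n)) has_vector_derivative (L * k) *\<^sub>R n) (at r)"
      by (auto intro!: derivative_eq_intros)
    from has_vector_derivative_diff[OF 1 3] show ?thesis
      unfolding p_def[abs_def] qy p'_def 2 y_def[symmetric] by (simp add: y_def scaleR_diff_right)
  qed
  have cy: "continuous_on UNIV y" unfolding y_def by (intro continuous_intros)
  have cp': "continuous_on UNIV p'" unfolding p'_def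
    by (intro continuous_intros continuous_on_compose2[OF ccp cy]) simp
  have p0: "p 0 = 0" by (simp add: p_def y_def q_def)
  have p'R: "(norm (p' r))\<^sup>2 \<le> L\<^sup>2 * R (y r)" for r
  proof -
    define z where "z = (\<Sum>j\<in>UNIV. t $ j *\<^sub>R cpartial j \<phi> (y r))"
    have zs: "z = (\<Sum>j\<in>UNIV. t $ j *\<^sub>R sgrad \<phi> (y r) $ j)" by (simp add: z_def sgrad_def)
    have a1: "\<bar>z \<bullet> t\<bar> \<le> norm (E (y r))" unfolding zs E_def by (rule tangential_symm[OF t1])
    have "z \<bullet> n - k = (\<Sum>j\<in>UNIV. t $ j *\<^sub>R (cpartial j \<phi> (y r) - d j)) \<bullet> n"
      by (simp add: z_def k_def inner_diff_left[symmetric] sum_subtractf[symmetric] scaleR_diff_right)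
    also have "\<bar>\<dots>\<bar> \<le> norm (\<Sum>j\<in>UNIV. t $ j *\<^sub>R (cpartial j \<phi> (y r) - d j))"
      using Cauchy_Schwarz_ineq2[of _ n] n1(1) by simp
    finally have a2: "\<bar>z \<bullet> n - k\<bar> \<le> norm (\<Sum>j\<in>UNIV. t $ j *\<^sub>R (cpartial j \<phi> (y r) - d j))" .
    have a3: "(norm (\<Sum>j\<in>UNIV. t $ j *\<^sub>R (cpartial j \<phi> (y r) - d j)))\<^sup>2 \<le> 1\<^sup>2 * (\<Sum>j\<in>UNIV. (norm (cpartial j \<phi> (y r) - d j))\<^sup>2)"
      by (rule norm_sum2_sq_le) (simp add: t1)
    have "(norm (z - k *\<^sub>R n))\<^sup>2 = ((z - k *\<^sub>R n) \<bullet> t)\<^sup>2 + ((z - k *\<^sub>R n) \<bullet> n)\<^sup>2"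
      unfolding t_def n_def by (rule nu_props(4)[OF e])
    also have "(z - k *\<^sub>R n) \<bullet> t = z \<bullet> t" using n1(2) by (simp add: inner_diff_left)
    also have "(z - k *\<^sub>R n) \<bullet> n = z \<bullet> n - k" using n1(1) by (simp add: inner_diff_left norm_eq_1)
    also have "(z \<bullet> t)\<^sup>2 + (z \<bullet> n - k)\<^sup>2 \<le> R (y r)"
    proof -
      have "(z \<bullet> t)\<^sup>2 \<le> (norm (E (y r)))\<^sup>2" using power_mono[OF a1, of 2] by simp
      moreover have "(z \<bullet> n - k)\<^sup>2 \<le> (norm (\<Sum>j\<in>UNIV. t $ j *\<^sub>R (cpartial j \<phi> (y r) - d j)))\<^sup>2"
        using power_mono[OF a2, of 2] by simp
      ultimately show ?thesis using a3 unfolding R_def by simp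
    qed
    finally have "L\<^sup>2 * (norm (z - k *\<^sub>R n))\<^sup>2 \<le> L\<^sup>2 * R (y r)" by (rule mult_left_mono) simp
    then show ?thesis by (simp add: p'_def z_def[symmetric] power_mult_distrib)
  qed
  define I where "I = (\<integral>r. indicator {0..1} r *\<^sub>R R (y r) \<partial>lborel)"
  have cRy: "continuous_on UNIV (\<lambda>r. R (y r))" by (rule continuous_on_compose2[OF cR cy]) simp
  have R0: "0 \<le> R x" for x unfolding R_def by (intro add_nonneg_nonneg sum_nonneg) auto
  have pb: "(norm (p r))\<^sup>2 \<le> L\<^sup>2 * I" if r: "r \<in> {0..1}" for r
  proof -
    let ?J = "\<integral>z. indicator {0..r} z *\<^sub>R (norm (p' z))\<^sup>2 \<partial>lborel"
    have J0: "0 \<le> ?J" by (rule integral_nonneg_AE) simp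
    have "(norm (p r - p 0))\<^sup>2 \<le> (r - 0) * ?J" by (rule increment_sq_le[OF pd cp']) (use r in simp)
    also have "\<dots> \<le> 1 * ?J" using r J0 by (intro mult_right_mono) auto
    also have "?J \<le> (\<integral>z. L\<^sup>2 * (indicator {0..1} z *\<^sub>R R (y z)) \<partial>lborel)"
    proof (rule integral_mono)
      have c2: "continuous_on UNIV (\<lambda>z. (norm (p' z))\<^sup>2)" by (intro continuous_intros cp')
      show "integrable lborel (\<lambda>z. indicator {0..r} z *\<^sub>R (norm (p' z))\<^sup>2)" by (rule compact_integrable(1)[OF compact_Icc c2])
      show "integrable lborel (\<lambda>z. L\<^sup>2 * (indicator {0..1} z *\<^sub>R R (y z)))"
        by (intro integrable_mult_right compact_integrable(1)[OF compact_Icc cRy])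
      show "indicator {0..r} z *\<^sub>R (norm (p' z))\<^sup>2 \<le> L\<^sup>2 * (indicator {0..1} z *\<^sub>R R (y z))" for z
        using p'R[of z] R0[of "y z"] r by (auto simp: indicator_def)
    qed
    also have "\<dots> = L\<^sup>2 * I" by (simp add: I_def)
    finally show ?thesis using p0 by simp
  qed
  have cpq: "continuous_on UNIV (\<lambda>x. (norm (\<phi> x - q x))\<^sup>2)" by (intro continuous_intros cphi cq)
  have "(l2norm (edge_measure e) (\<lambda>x. \<phi> x - q x))\<^sup>2 = L * (\<integral>r. indicator {0..1} r *\<^sub>R (norm (p r))\<^sup>2 \<partial>lborel)"
    unfolding l2norm_sq p_def y_def L_def by (rule edge_integral(1)[OF D(1,2) continuous_edge_measurable[OF cpq]])
  also have "\<dots> \<le> L * (L\<^sup>2 * I)"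
  proof (rule mult_left_mono)
    have cpy: "continuous_on UNIV (\<lambda>r. (norm (p r))\<^sup>2)"
      using continuous_on_compose2[OF cpq cy] by (simp add: p_def)
    have "(\<integral>r. indicator {0..1} r *\<^sub>R (norm (p r))\<^sup>2 \<partial>lborel) \<le> (\<integral>r. indicator {0..1} r *\<^sub>R (L\<^sup>2 * I) \<partial>(lborel :: real measure))"
    proof (rule integral_mono[OF compact_integrable(1)[OF compact_Icc cpy] compact_integrable(1)[OF compact_Icc continuous_on_const]])
      show "indicator {0..1} r *\<^sub>R (norm (p r))\<^sup>2 \<le> indicator {0..1} r *\<^sub>R (L\<^sup>2 * I)" for r
        using pb[of r] by (auto simp: indicator_def)
    qed
    then show "(\<integral>r. indicator {0..1} r *\<^sub>R (norm (p r))\<^sup>2 \<partial>lborel) \<le> L\<^sup>2 * I" by simp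
  qed (use hL in simp)
  also have "\<dots> = L\<^sup>2 * (L * I)" by simp
  also have "L * I = (\<integral>x. R x \<partial>edge_measure e)"
    unfolding I_def y_def L_def by (rule edge_integral(1)[OF D(1,2) continuous_edge_measurable[OF cR], symmetric])
  also have "\<dots> = (l2norm (edge_measure e) E)\<^sup>2 + (\<Sum>j\<in>UNIV. (l2norm (edge_measure e) (\<lambda>x. cpartial j \<phi> x - d j))\<^sup>2)"
  proof -
    have "E \<in> L2 (edge_measure e)" by (rule continuous_edge_L2[OF e cE])
    moreover have "(\<lambda>x. cpartial j \<phi> x - d j) \<in> L2 (edge_measure e)" for j
      by (rule continuous_edge_L2[OF e]) (intro continuous_intros ccp)
    ultimately show ?thesis by (simp add: R_def l2norm_sq L2_def Bochner_Integration.integral_sum)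
  qed
  also have "\<dots> \<le> (\<sigma> / h) * (3 * (l2norm (triM T) E)\<^sup>2 + h\<^sup>2 * D2) + 37 * \<sigma> * h * D2"
  proof (rule add_mono)
    \<comment> \<open>\<open>symm\<close> does not increase the Frobenius norm, so derivatives of
      the strain are bounded by second derivatives of \<phi>.\<close>
    have "(\<Sum>j\<in>UNIV. (l2norm (triM T) (cpartial j E))\<^sup>2) \<le> D2"
    proof -
      have "(l2norm (triM T) (cpartial j E))\<^sup>2 \<le> (\<Sum>i\<in>UNIV. (l2norm (triM T) (cpartial j (cpartial i \<phi>)))\<^sup>2)" for j
      proof -
        have L: "cpartial j (cpartial i \<phi>) \<in> L2 (triM T)" for i
          by (intro triM_L2[OF T2] smooth_continuous smooth_cpartial s)
        have "cpartial j E x = symm (\<chi> i. cpartial j (cpartial i \<phi>) x)" for x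
          unfolding E_def by (simp add: cpartial_linear[OF smooth_differentiable[OF smooth_sgrad[OF s]] bounded_linear_symm] cpartial_sgrad[OF s])
        moreover have "(\<lambda>x. \<chi> i. cpartial j (cpartial i \<phi>) x) \<in> L2 (triM T)"
          by (rule L2_vec) (unfold vec_lambda_beta, rule L)
        ultimately have "l2norm (triM T) (cpartial j E) \<le> l2norm (triM T) (\<lambda>x. \<chi> i. cpartial j (cpartial i \<phi>) x)"
          by (intro l2norm_mono) (simp_all add: norm_symm_le)
        then have "(l2norm (triM T) (cpartial j E))\<^sup>2 \<le> (l2norm (triM T) (\<lambda>x. \<chi> i. cpartial j (cpartial i \<phi>) x))\<^sup>2"
          by (rule power_mono) simp
        also have "\<dots> = (\<Sum>i\<in>UNIV. (l2norm (triM T) (cpartial j (cpartial i \<phi>)))\<^sup>2)"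
          using L by (simp add: l2norm_sq norm_sq_vec L2_def Bochner_Integration.integral_sum)
        finally show ?thesis .
      qed
      then have "(\<Sum>j\<in>UNIV. (l2norm (triM T) (cpartial j E))\<^sup>2) \<le> (\<Sum>j\<in>UNIV. \<Sum>i\<in>UNIV. (l2norm (triM T) (cpartial j (cpartial i \<phi>)))\<^sup>2)"
        by (rule sum_mono)
      also have "\<dots> = D2" unfolding D2_def by (rule sum.swap)
      finally show ?thesis .
    qed
    then have "\<sigma> * (3 * (l2norm (triM T) E)\<^sup>2 + h\<^sup>2 * (\<Sum>j\<in>UNIV. (l2norm (triM T) (cpartial j E))\<^sup>2)) \<le> \<sigma> * (3 * (l2norm (triM T) E)\<^sup>2 + h\<^sup>2 * D2)"
      using hL by (intro mult_left_mono add_left_mono) auto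
    then have "h * (l2norm (edge_measure e) E)\<^sup>2 \<le> \<sigma> * (3 * (l2norm (triM T) E)\<^sup>2 + h\<^sup>2 * D2)"
      using trace_inequality[OF e smooth_Ck[OF sE] sh] unfolding h_def by linarith
    then show "(l2norm (edge_measure e) E)\<^sup>2 \<le> (\<sigma> / h) * (3 * (l2norm (triM T) E)\<^sup>2 + h\<^sup>2 * D2)"
      using hL by (simp add: field_simps)
    show "(\<Sum>j\<in>UNIV. (l2norm (edge_measure e) (\<lambda>x. cpartial j \<phi> x - d j))\<^sup>2) \<le> 37 * \<sigma> * h * D2"
      unfolding D2_def sum_distrib_left[of "37 * \<sigma> * h"] using d by (intro sum_mono) (simp add: sum_distrib_left)
  qed
  also have "L\<^sup>2 * ((\<sigma> / h) * (3 * (l2norm (triM T) E)\<^sup>2 + h\<^sup>2 * D2) + 37 * \<sigma> * h * D2)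
      \<le> h\<^sup>2 * ((\<sigma> / h) * (3 * (l2norm (triM T) E)\<^sup>2 + h\<^sup>2 * D2) + 37 * \<sigma> * h * D2)"
  proof (rule mult_right_mono)
    have "0 \<le> D2" unfolding D2_def by (intro sum_nonneg) auto
    then show "0 \<le> (\<sigma> / h) * (3 * (l2norm (triM T) E)\<^sup>2 + h\<^sup>2 * D2) + 37 * \<sigma> * h * D2" using hL by auto
    show "L\<^sup>2 \<le> h\<^sup>2" using hL by (intro power_mono) auto
  qed
  \<comment> \<open>38 = 1 + 37, from the derivatives of the strain and from the oscillation of the
    gradient.\<close>
  also have "\<dots> = \<sigma> * h * (3 * (l2norm (triM T) E)\<^sup>2 + 38 * h\<^sup>2 * D2)"
    using hL by (simp add: power2_eq_square field_simps)
  finally have "(l2norm (edge_measure e) (\<lambda>x. \<phi> x - q x))\<^sup>2 \<le> \<sigma> * h * (3 * (l2norm (triM T) E)\<^sup>2 + 38 * h\<^sup>2 * D2)"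
    using hL by (simp add: mult_left_mono)
  then show ?thesis using qP cq unfolding h_def D2_def E_def by blast
qed

section \<open>Sobolev functions on a triangle\<close>

lemma L2lim_scale:
  assumes f: "L2lim M f u" and c: "c \<longlonglongrightarrow> k" shows "L2lim M (\<lambda>n x. c n *\<^sub>R f n x) (\<lambda>x. k *\<^sub>R u x)"
proof -
  note D = L2lim_D[OF f]
  have b: "norm (l2norm M (\<lambda>x. c n *\<^sub>R f n x - k *\<^sub>R u x)) \<le> \<bar>c n\<bar> * l2norm M (\<lambda>x. f n x - u x) + \<bar>c n - k\<bar> * l2norm M u" for n
  proof -
    have "l2norm M (\<lambda>x. c n *\<^sub>R (f n x - u x) + (c n - k) *\<^sub>R u x) \<le> l2norm M (\<lambda>x. c n *\<^sub>R (f n x - u x)) + l2norm M (\<lambda>x. (c n - k) *\<^sub>R u x)"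
      by (intro l2norm_triangle L2_scaleR L2_diff D)
    moreover have "(\<lambda>x. c n *\<^sub>R f n x - k *\<^sub>R u x) = (\<lambda>x. c n *\<^sub>R (f n x - u x) + (c n - k) *\<^sub>R u x)"
      by (simp add: fun_eq_iff scaleR_diff_right scaleR_diff_left)
    ultimately show ?thesis by (simp add: l2norm_scaleR)
  qed
  have "(\<lambda>n. \<bar>c n\<bar> * l2norm M (\<lambda>x. f n x - u x) + \<bar>c n - k\<bar> * l2norm M u) \<longlonglongrightarrow> \<bar>k\<bar> * 0 + \<bar>k - k\<bar> * l2norm M u"
    by (intro tendsto_intros c D)
  then have z: "(\<lambda>n. \<bar>c n\<bar> * l2norm M (\<lambda>x. f n x - u x) + \<bar>c n - k\<bar> * l2norm M u) \<longlonglongrightarrow> 0" by simp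
  have "(\<lambda>n. l2norm M (\<lambda>x. c n *\<^sub>R f n x - k *\<^sub>R u x)) \<longlonglongrightarrow> 0"
    by (rule Lim_null_comparison[OF always_eventually[OF allI[OF b]] z])
  then show ?thesis using D by (simp add: L2lim_def L2_scaleR)
qed

section \<open>Weak derivatives and smooth approximation in H1 and H2\<close>

lemma weak_partial_cong: "(\<And>x. x \<in> U \<Longrightarrow> u x = w x) \<Longrightarrow> is_weak_partial U i u g \<longleftrightarrow> is_weak_partial U i w g"
proof -
  assume e: "\<And>x. x \<in> U \<Longrightarrow> u x = w x"
  have "(\<integral>x. cpartial i \<phi> x *\<^sub>R u x \<partial>lebesgue_on U) = (\<integral>x. cpartial i \<phi> x *\<^sub>R w x \<partial>lebesgue_on U)" for \<phi>
    by (rule Bochner_Integration.integral_cong) (use e in auto)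
  then show ?thesis by (simp add: is_weak_partial_def)
qed

lemma weak_partial_fun_cong: "(\<And>x. x \<in> U \<Longrightarrow> u x = w x) \<Longrightarrow> weak_partial U i u = weak_partial U i w"
  unfolding weak_partial_def using weak_partial_cong[of U u w i] by simp

lemma weak_partial_spec:
  assumes "g \<in> L2 (lebesgue_on U)" "is_weak_partial U i u g"
  shows "weak_partial U i u \<in> L2 (lebesgue_on U)" "is_weak_partial U i u (weak_partial U i u)"
  using someI[of "\<lambda>g. g \<in> L2 (lebesgue_on U) \<and> is_weak_partial U i u g" g] assms
  by (auto simp: weak_partial_def)

lemma test_function_L2: "test_function U \<phi> \<Longrightarrow> bounded V \<Longrightarrow> V \<in> sets borel \<Longrightarrow> \<phi> \<in> L2 (lebesgue_on V)"
  by (rule smooth_L2[OF test_function_smooth])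

lemma is_weak_partial_linear:
  fixes L :: "'b::euclidean_space \<Rightarrow> 'c::euclidean_space"
  assumes U: "bounded U" "U \<in> sets borel" and u: "u \<in> L2 (lebesgue_on U)" "g \<in> L2 (lebesgue_on U)"
    and w: "is_weak_partial U i u g" and L: "bounded_linear L"
  shows "is_weak_partial U i (\<lambda>x. L (u x)) (\<lambda>x. L (g x))"
  unfolding is_weak_partial_def
proof (intro allI impI)
  fix \<phi> assume t: "test_function U \<phi>"
  interpret L: bounded_linear L by (rule L)
  have i: "integrable (lebesgue_on U) (\<lambda>x. cpartial i \<phi> x *\<^sub>R u x)" "integrable (lebesgue_on U) (\<lambda>x. \<phi> x *\<^sub>R g x)"
    by (intro L2_scaleR_integrable test_function_L2[OF test_function_cpartial[OF t] U] test_function_L2[OF t U] u)+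
  have "(\<integral>x. cpartial i \<phi> x *\<^sub>R L (u x) \<partial>lebesgue_on U) = (\<integral>x. L (cpartial i \<phi> x *\<^sub>R u x) \<partial>lebesgue_on U)" by (simp add: L.scaleR)
  also have "\<dots> = L (\<integral>x. cpartial i \<phi> x *\<^sub>R u x \<partial>lebesgue_on U)" by (rule integral_bounded_linear[OF L i(1)])
  also have "(\<integral>x. cpartial i \<phi> x *\<^sub>R u x \<partial>lebesgue_on U) = - (\<integral>x. \<phi> x *\<^sub>R g x \<partial>lebesgue_on U)"
    using w t unfolding is_weak_partial_def by blast
  also have "L (- (\<integral>x. \<phi> x *\<^sub>R g x \<partial>lebesgue_on U)) = - L (\<integral>x. \<phi> x *\<^sub>R g x \<partial>lebesgue_on U)" by (rule linear_neg[OF bounded_linear.linear[OF L]])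
  also have "L (\<integral>x. \<phi> x *\<^sub>R g x \<partial>lebesgue_on U) = (\<integral>x. L (\<phi> x *\<^sub>R g x) \<partial>lebesgue_on U)" by (rule integral_bounded_linear[OF L i(2), symmetric])
  finally show "(\<integral>x. cpartial i \<phi> x *\<^sub>R L (u x) \<partial>lebesgue_on U) = - (\<integral>x. \<phi> x *\<^sub>R L (g x) \<partial>lebesgue_on U)" by (simp add: L.scaleR)
qed

text \<open>The conclusion of \<open>mollification\<close> on one triangle as a predicate, so that
  the operators can be obtained from an existential statement.\<close>

definition mollifying :: "(real^2) set \<Rightarrow> (nat \<Rightarrow> (real^2 \<Rightarrow> 'b::euclidean_space) \<Rightarrow> real^2 \<Rightarrow> 'b) \<Rightarrow> (nat \<Rightarrow> real) \<Rightarrow> bool" where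
  "mollifying T A c \<longleftrightarrow> c \<longlonglongrightarrow> 1 \<and>
    (\<forall>u\<in>L2 (triM T). L2lim (triM T) (\<lambda>n. A n u) u \<and>
      (\<forall>n. smooth (A n u) \<and> (\<forall>i j x. cpartial i (cpartial j (A n u)) x = cpartial j (cpartial i (A n u)) x) \<and>
        (\<forall>g i. is_weak_partial (interior T) i u g \<longrightarrow> (\<forall>x\<in>interior T. cpartial i (A n u) x = c n *\<^sub>R A n g x))))"

lemma mollifying_D:
  assumes "mollifying T A c"
  shows "c \<longlonglongrightarrow> 1"
    "\<And>n u. u \<in> L2 (triM T) \<Longrightarrow> smooth (A n u)"
    "\<And>u. u \<in> L2 (triM T) \<Longrightarrow> L2lim (triM T) (\<lambda>n. A n u) u"
    "\<And>n u i j x. u \<in> L2 (triM T) \<Longrightarrow> cpartial i (cpartial j (A n u)) x = cpartial j (cpartial i (A n u)) x"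
    "\<And>n u g i x. u \<in> L2 (triM T) \<Longrightarrow> is_weak_partial (interior T) i u g \<Longrightarrow> x \<in> interior T \<Longrightarrow> cpartial i (A n u) x = c n *\<^sub>R A n g x"
  using assms unfolding mollifying_def by blast+

lemma mollification_ex:
  assumes T: "2 simplex T"
  shows "\<exists>(A :: nat \<Rightarrow> (real^2 \<Rightarrow> 'b::euclidean_space) \<Rightarrow> real^2 \<Rightarrow> 'b) c. mollifying T A c"
proof (rule mollification[OF simplex2_facts(4,5,6,3)[OF T], folded triM_def, where 'b='b])
  fix A :: "nat \<Rightarrow> (real^2 \<Rightarrow> 'b) \<Rightarrow> real^2 \<Rightarrow> 'b" and c
  assume "c \<longlonglongrightarrow> 1"
    "\<And>n u. u \<in> L2 (triM T) \<Longrightarrow> smooth (A n u)"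
    "\<And>u. u \<in> L2 (triM T) \<Longrightarrow> L2lim (triM T) (\<lambda>n. A n u) u"
    "\<And>n u i j x. u \<in> L2 (triM T) \<Longrightarrow> cpartial i (cpartial j (A n u)) x = cpartial j (cpartial i (A n u)) x"
    "\<And>n u g i x. u \<in> L2 (triM T) \<Longrightarrow> is_weak_partial (interior T) i u g \<Longrightarrow> x \<in> interior T \<Longrightarrow> cpartial i (A n u) x = c n *\<^sub>R A n g x"
  then have "mollifying T A c" unfolding mollifying_def by (intro conjI ballI allI impI)
  then show ?thesis by blast
qed

text \<open>The derivatives of the mollified u form one sequence, and it converges in L2 to every
  weak derivative of u.\<close>

lemma weak_partial_unique:
  fixes u :: "real^2 \<Rightarrow> 'b::euclidean_space"
  assumes T: "2 simplex T" and u: "u \<in> L2 (triM T)" "g \<in> L2 (triM T)" "g' \<in> L2 (triM T)"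
    and w: "is_weak_partial (interior T) i u g" "is_weak_partial (interior T) i u g'"
  shows "AE x in triM T. g x = g' x"
proof -
  note S = simplex2_facts[OF T]
  obtain A :: "nat \<Rightarrow> (real^2 \<Rightarrow> 'b) \<Rightarrow> real^2 \<Rightarrow> 'b" and c where m: "mollifying T A c"
    using mollification_ex[OF T] by blast
  note A = mollifying_D[OF m]
  have "L2lim (triM T) (\<lambda>n. cpartial i (A n u)) f" if "f \<in> L2 (triM T)" "is_weak_partial (interior T) i u f" for f
  proof -
    have "L2lim (triM T) (\<lambda>n x. c n *\<^sub>R A n f x) (\<lambda>x. 1 *\<^sub>R f x)" by (rule L2lim_scale[OF A(3)[OF that(1)] A(1)])
    moreover have "L2lim (triM T) (\<lambda>n x. c n *\<^sub>R A n f x) (\<lambda>x. 1 *\<^sub>R f x) = L2lim (triM T) (\<lambda>n. cpartial i (A n u)) f"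
      by (rule L2lim_cong) (simp_all add: space_triM A(5)[OF u(1) that(2)])
    ultimately show ?thesis by simp
  qed
  from L2lim_unique_AE[OF this[OF u(2) w(1)] this[OF u(3) w(2)]] show ?thesis .
qed

definition H1_approx :: "(real^2) set \<Rightarrow> (nat \<Rightarrow> real^2 \<Rightarrow> 'b::euclidean_space) \<Rightarrow> (real^2 \<Rightarrow> 'b) \<Rightarrow> (2 \<Rightarrow> real^2 \<Rightarrow> 'b) \<Rightarrow> bool" where
  "H1_approx T \<phi> w g \<longleftrightarrow> (\<forall>n. smooth (\<phi> n)) \<and> L2lim (triM T) \<phi> w \<and> (\<forall>i. L2lim (triM T) (\<lambda>n. cpartial i (\<phi> n)) (g i))"

text \<open>A single sequence converges together with its first and second derivatives, with the
  factors c and c^2 tending to 1. Its derivatives therefore also approximate the weak derivatives in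
  H1, which is what traces of \<partial>_i v require.\<close>

lemma H2_approx:
  fixes v :: "real^2 \<Rightarrow> 'b::euclidean_space"
  assumes T: "2 simplex T" and v: "v \<in> L2 (triM T)" and g: "\<And>i. g i \<in> L2 (triM T)" "\<And>i. is_weak_partial (interior T) i v (g i)"
    and gg: "\<And>i j. gg j i \<in> L2 (triM T)" "\<And>i j. is_weak_partial (interior T) j (g i) (gg j i)"
  obtains \<phi> where "H1_approx T \<phi> v g" "\<And>i. H1_approx T (\<lambda>n. cpartial i (\<phi> n)) (g i) (\<lambda>j. gg j i)"
    "\<And>n i j x. cpartial i (cpartial j (\<phi> n)) x = cpartial j (cpartial i (\<phi> n)) x"
proof -
  note S = simplex2_facts[OF T]
  obtain A :: "nat \<Rightarrow> (real^2 \<Rightarrow> 'b) \<Rightarrow> real^2 \<Rightarrow> 'b" and c where m: "mollifying T A c"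
    using mollification_ex[OF T] by blast
  note A = mollifying_D[OF m]
  have l1: "L2lim (triM T) (\<lambda>n. cpartial i (A n v)) (g i)" for i
  proof -
    have "L2lim (triM T) (\<lambda>n x. c n *\<^sub>R A n (g i) x) (\<lambda>x. 1 *\<^sub>R g i x)" by (rule L2lim_scale[OF A(3)[OF g(1)] A(1)])
    moreover have "L2lim (triM T) (\<lambda>n x. c n *\<^sub>R A n (g i) x) (\<lambda>x. 1 *\<^sub>R g i x) = L2lim (triM T) (\<lambda>n. cpartial i (A n v)) (g i)"
      by (rule L2lim_cong) (simp_all add: space_triM A(5)[OF v g(2)])
    ultimately show ?thesis by simp
  qed
  have l2: "L2lim (triM T) (\<lambda>n. cpartial j (cpartial i (A n v))) (gg j i)" for i j
  proof -
    have "cpartial j (cpartial i (A n v)) x = (c n * c n) *\<^sub>R A n (gg j i) x" if x: "x \<in> interior T" for n x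
    proof -
      \<comment> \<open>The first-order relation holds only inside T; the interior being open, it
        may be differentiated there once more.\<close>
      have "cpartial j (cpartial i (A n v)) x = cpartial j (\<lambda>x. c n *\<^sub>R A n (g i) x) x"
        by (rule cpartial_local[OF S(4) x]) (rule A(5)[OF v g(2)])
      also have "\<dots> = c n *\<^sub>R cpartial j (A n (g i)) x"
        by (rule cpartial_linear[OF smooth_differentiable[OF A(2)[OF g(1)]] bounded_linear_scaleR_right])
      finally show ?thesis using A(5)[OF g(1) gg(2) x] by simp
    qed
    note eq = this
    have "(\<lambda>n. c n * c n) \<longlonglongrightarrow> 1 * 1" by (intro tendsto_mult A)
    then have "L2lim (triM T) (\<lambda>n x. (c n * c n) *\<^sub>R A n (gg j i) x) (\<lambda>x. (1 * 1) *\<^sub>R gg j i x)" by (rule L2lim_scale[OF A(3)[OF gg(1)]])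
    moreover have "L2lim (triM T) (\<lambda>n x. (c n * c n) *\<^sub>R A n (gg j i) x) (\<lambda>x. (1 * 1) *\<^sub>R gg j i x) = L2lim (triM T) (\<lambda>n. cpartial j (cpartial i (A n v))) (gg j i)"
      by (rule L2lim_cong) (simp_all add: space_triM eq)
    ultimately show ?thesis by simp
  qed
  show ?thesis
  proof (rule that[of "\<lambda>n. A n v"])
    show "H1_approx T (\<lambda>n. A n v) v g" unfolding H1_approx_def using A(2,3)[OF v] l1 by blast
    show "H1_approx T (\<lambda>n. cpartial i (A n v)) (g i) (\<lambda>j. gg j i)" for i
      unfolding H1_approx_def using l1 l2 smooth_cpartial[OF A(2)[OF v]] by blast
  qed (rule A(4)[OF v])
qed

subsection \<open>Traces\<close>

text \<open>The trace inequality with its dependence on T hidden in K. It serves to compare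
  approximating sequences on one fixed triangle, so K may depend on T in any way.\<close>

lemma trace_linear:
  fixes T :: "(real^2) set"
  assumes e: "tri_edge T e a b c" and sh: "diameter T \<le> \<sigma> * inball_diameter T"
  obtains K where "0 \<le> K" "\<And>u :: real^2 \<Rightarrow> 'b::euclidean_space. smooth u \<Longrightarrow>
    l2norm (edge_measure e) u \<le> K * (l2norm (triM T) u + (\<Sum>j\<in>UNIV. l2norm (triM T) (cpartial j u)))"
proof
  note S = tri_edge_shape[OF e sh]
  define h where "h = diameter T"
  have h: "0 < h" using less_le_trans[OF S(2,3)] by (simp add: h_def)
  define K where "K = sqrt (\<sigma> / h * (3 + h\<^sup>2))"
  show K0: "0 \<le> K" using h S(4) by (simp add: K_def)
  fix u :: "real^2 \<Rightarrow> 'b" assume u: "smooth u"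
  define A where "A = l2norm (triM T) u"
  define B where "B j = l2norm (triM T) (cpartial j u)" for j
  have AB: "0 \<le> A" "0 \<le> B j" for j by (simp_all add: A_def B_def)
  have "3 * A\<^sup>2 + h\<^sup>2 * (\<Sum>j\<in>UNIV. (B j)\<^sup>2) \<le> (3 + h\<^sup>2) * (A + (\<Sum>j\<in>UNIV. B j))\<^sup>2"
  proof -
    have "A\<^sup>2 \<le> (A + (\<Sum>j\<in>UNIV. B j))\<^sup>2" by (rule power_mono) (use AB in \<open>simp_all add: sum_nonneg\<close>)
    moreover have "(\<Sum>j\<in>UNIV. (B j)\<^sup>2) \<le> (A + (\<Sum>j\<in>UNIV. B j))\<^sup>2"
      using AB(1) AB(2)[of 1] AB(2)[of 2] by (simp add: sum_2 power2_eq_square algebra_simps)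
    ultimately have "3 * A\<^sup>2 + h\<^sup>2 * (\<Sum>j\<in>UNIV. (B j)\<^sup>2) \<le> 3 * (A + (\<Sum>j\<in>UNIV. B j))\<^sup>2 + h\<^sup>2 * (A + (\<Sum>j\<in>UNIV. B j))\<^sup>2"
      by (intro add_mono mult_left_mono) auto
    then show ?thesis by (simp add: distrib_right)
  qed
  then have "\<sigma> * (3 * A\<^sup>2 + h\<^sup>2 * (\<Sum>j\<in>UNIV. (B j)\<^sup>2)) \<le> \<sigma> * ((3 + h\<^sup>2) * (A + (\<Sum>j\<in>UNIV. B j))\<^sup>2)"
    using S(4) by (intro mult_left_mono) auto
  then have "h * (l2norm (edge_measure e) u)\<^sup>2 \<le> \<sigma> * ((3 + h\<^sup>2) * (A + (\<Sum>j\<in>UNIV. B j))\<^sup>2)"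
    using trace_inequality[OF e smooth_Ck[OF u] sh] unfolding A_def B_def h_def by linarith
  then have "(l2norm (edge_measure e) u)\<^sup>2 \<le> \<sigma> / h * (3 + h\<^sup>2) * (A + (\<Sum>j\<in>UNIV. B j))\<^sup>2"
    using h by (simp add: field_simps)
  also have "\<dots> = (K * (A + (\<Sum>j\<in>UNIV. B j)))\<^sup>2"
    using h S(4) by (simp add: K_def power_mult_distrib)
  finally have "l2norm (edge_measure e) u \<le> K * (A + (\<Sum>j\<in>UNIV. B j))"
    by (rule power2_le_imp_le) (use K0 AB in \<open>simp add: sum_nonneg\<close>)
  then show "l2norm (edge_measure e) u \<le> K * (l2norm (triM T) u + (\<Sum>j\<in>UNIV. l2norm (triM T) (cpartial j u)))"
    by (simp add: A_def B_def)
qed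

lemma cpartial_diff:
  assumes "smooth f" "smooth g" shows "cpartial j (\<lambda>x. f x - g x) x = cpartial j f x - cpartial j g x"
proof -
  have "cpartial j (\<lambda>x. f x + (- g x)) x = cpartial j f x + cpartial j (\<lambda>x. - g x) x"
    by (rule cpartial_add[OF smooth_differentiable[OF assms(1)]])
      (rule smooth_differentiable[OF smooth_linear[OF bounded_linear_minus[OF bounded_linear_ident] assms(2)]])
  then show ?thesis
    using cpartial_linear[OF smooth_differentiable[OF assms(2)] bounded_linear_minus[OF bounded_linear_ident], of j x] by simp
qed

text \<open>Makes the choice in \<open>edge_trace\<close> harmless: boundary values of any
  H1-convergent smooth sequence are Cauchy on the edge, completeness supplies a trace, and any two
  such sequences have the same limit there.\<close>

lemma edge_trace_limit:
  fixes w :: "real^2 \<Rightarrow> 'b::euclidean_space"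
  assumes e: "tri_edge T e a b c" and sh: "diameter T \<le> \<sigma> * inball_diameter T"
    and ap: "H1_approx T \<phi> w (\<lambda>i. weak_partial (interior T) i w)"
  shows "L2lim (edge_measure e) \<phi> (edge_trace T e w)"
proof -
  have T2: "2 simplex T" by (rule tri_edge_simplex[OF e])
  define G where "G i = weak_partial (interior T) i w" for i
  obtain K where K: "0 \<le> K" "\<And>u :: real^2 \<Rightarrow> 'b. smooth u \<Longrightarrow>
    l2norm (edge_measure e) u \<le> K * (l2norm (triM T) u + (\<Sum>j\<in>UNIV. l2norm (triM T) (cpartial j u)))"
    using trace_linear[OF e sh] by blast
  define dst where "dst u = l2norm (triM T) (\<lambda>x. u x - w x) + (\<Sum>j\<in>UNIV. l2norm (triM T) (\<lambda>x. cpartial j u x - G j x))" for u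
  have wL: "w \<in> L2 (triM T)" "G i \<in> L2 (triM T)" for i using ap by (auto simp: H1_approx_def L2lim_def G_def)
  have sL: "u \<in> L2 (triM T)" if "smooth u" for u :: "real^2 \<Rightarrow> 'b" by (rule triM_L2[OF T2 smooth_continuous[OF that]])
  have close: "l2norm (edge_measure e) (\<lambda>x. u x - u' x) \<le> K * (dst u + dst u')" if "smooth u" "smooth u'" for u u'
  proof -
    have 1: "l2norm (triM T) (\<lambda>x. u x - u' x) \<le> l2norm (triM T) (\<lambda>x. u x - w x) + l2norm (triM T) (\<lambda>x. u' x - w x)"
      using l2norm_triangle_diff[OF sL[OF that(1)] wL(1) sL[OF that(2)]] l2norm_minus_commute[of "triM T" u' w] by simp
    have 2: "l2norm (triM T) (cpartial j (\<lambda>x. u x - u' x)) \<le> l2norm (triM T) (\<lambda>x. cpartial j u x - G j x) + l2norm (triM T) (\<lambda>x. cpartial j u' x - G j x)" for j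
      unfolding cpartial_diff[OF that, abs_def]
      using l2norm_triangle_diff[OF sL[OF smooth_cpartial[OF that(1)]] wL(2) sL[OF smooth_cpartial[OF that(2)]], of j j j]
        l2norm_minus_commute[of "triM T" "cpartial j u'" "G j"] by simp
    have "(\<Sum>j\<in>UNIV. l2norm (triM T) (cpartial j (\<lambda>x. u x - u' x))) \<le> (\<Sum>j\<in>UNIV. l2norm (triM T) (\<lambda>x. cpartial j u x - G j x) + l2norm (triM T) (\<lambda>x. cpartial j u' x - G j x))"
      by (rule sum_mono) (rule 2)
    then have "l2norm (triM T) (\<lambda>x. u x - u' x) + (\<Sum>j\<in>UNIV. l2norm (triM T) (cpartial j (\<lambda>x. u x - u' x))) \<le> dst u + dst u'"
      using 1 by (simp add: dst_def sum.distrib)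
    then show ?thesis using K(2)[OF smooth_diff[OF that]] mult_left_mono[OF _ K(1)] by (meson order_trans)
  qed
  have sphi: "\<And>n. smooth (\<phi> n)" using ap by (simp add: H1_approx_def)
  have "(\<lambda>n. dst (\<phi> n)) \<longlonglongrightarrow> 0 + (\<Sum>j::2\<in>UNIV. 0)"
    unfolding dst_def using ap by (intro tendsto_add tendsto_sum) (auto simp: H1_approx_def L2lim_def G_def)
  then have dphi: "(\<lambda>n. dst (\<phi> n)) \<longlonglongrightarrow> 0" by simp
  have eL: "u \<in> L2 (edge_measure e)" if "smooth u" for u :: "real^2 \<Rightarrow> 'b" by (rule continuous_edge_L2[OF e smooth_continuous[OF that]])
  have "\<exists>g. L2lim (edge_measure e) \<phi> g"
  proof (rule L2_complete[OF eL[OF sphi]])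
    fix \<epsilon> :: real assume \<epsilon>: "0 < \<epsilon>"
    have "(\<lambda>n. K * dst (\<phi> n)) \<longlonglongrightarrow> K * 0" by (intro tendsto_mult_left dphi)
    then have "\<forall>\<^sub>F n in sequentially. K * dst (\<phi> n) < \<epsilon> / 2" using \<epsilon> by (intro order_tendstoD(2)) auto
    then obtain N where N: "\<And>n. n \<ge> N \<Longrightarrow> K * dst (\<phi> n) < \<epsilon> / 2" by (auto simp: eventually_sequentially)
    have "l2norm (edge_measure e) (\<lambda>x. \<phi> m x - \<phi> n x) < \<epsilon>" if "m \<ge> N" "n \<ge> N" for m n
      using close[OF sphi sphi, of m n] N[OF that(1)] N[OF that(2)] unfolding distrib_left by linarith
    then show "\<exists>N. \<forall>m\<ge>N. \<forall>n\<ge>N. l2norm (edge_measure e) (\<lambda>x. \<phi> m x - \<phi> n x) < \<epsilon>" by blast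
  qed
  then obtain g where g: "L2lim (edge_measure e) \<phi> g" by blast
  have "is_trace T e w g"
    unfolding is_trace_def triM_def[symmetric]
    using g sphi ap by (intro conjI exI[of _ \<phi>]) (auto simp: L2lim_def H1_approx_def)
  then have "is_trace T e w (edge_trace T e w)" unfolding edge_trace_def by (rule someI[of "is_trace T e w"])
  \<comment> \<open>The chosen trace has its own approximating sequence \<psi>, which need not be
    \<phi>; \<open>close\<close> shows that both have the same boundary values in the limit.\<close>
  then obtain \<psi> where tr: "edge_trace T e w \<in> L2 (edge_measure e)" and \<psi>: "\<And>n. smooth (\<psi> n)"
    "(\<lambda>n. l2norm (triM T) (\<lambda>x. \<psi> n x - w x)) \<longlonglongrightarrow> 0"
    "\<And>i. (\<lambda>n. l2norm (triM T) (\<lambda>x. cpartial i (\<psi> n) x - G i x)) \<longlonglongrightarrow> 0"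
    "(\<lambda>n. l2norm (edge_measure e) (\<lambda>x. \<psi> n x - edge_trace T e w x)) \<longlonglongrightarrow> 0"
    unfolding is_trace_def triM_def[symmetric] G_def by blast
  have "(\<lambda>n. dst (\<psi> n)) \<longlonglongrightarrow> 0 + (\<Sum>j::2\<in>UNIV. 0)"
    unfolding dst_def by (intro tendsto_add tendsto_sum \<psi>)
  then have dpsi: "(\<lambda>n. dst (\<psi> n)) \<longlonglongrightarrow> 0" by simp
  have "(\<lambda>n. K * (dst (\<phi> n) + dst (\<psi> n)) + l2norm (edge_measure e) (\<lambda>x. \<psi> n x - edge_trace T e w x)) \<longlonglongrightarrow> K * (0 + 0) + 0"
    by (intro tendsto_intros dphi dpsi \<psi>)
  then have z: "(\<lambda>n. K * (dst (\<phi> n) + dst (\<psi> n)) + l2norm (edge_measure e) (\<lambda>x. \<psi> n x - edge_trace T e w x)) \<longlonglongrightarrow> 0" by simp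
  have b: "norm (l2norm (edge_measure e) (\<lambda>x. \<phi> n x - edge_trace T e w x)) \<le> K * (dst (\<phi> n) + dst (\<psi> n)) + l2norm (edge_measure e) (\<lambda>x. \<psi> n x - edge_trace T e w x)" for n
    using l2norm_triangle_diff[OF eL[OF sphi, of n] eL[OF \<psi>(1), of n] tr] close[OF sphi \<psi>(1), of n n] by simp
  have "(\<lambda>n. l2norm (edge_measure e) (\<lambda>x. \<phi> n x - edge_trace T e w x)) \<longlonglongrightarrow> 0"
    by (rule Lim_null_comparison[OF always_eventually[OF allI[OF b]] z])
  then show ?thesis using eL[OF sphi] tr by (simp add: L2lim_def)
qed

subsection \<open>The projection onto rigid motions and normal affine functions\<close>

text \<open>Along e only the image A t of the tangent counts. It is orthogonal to t because the
  tangential component is constant, hence a multiple of the normal.\<close>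

lemma P1_minus_form:
  assumes e: "tri_edge T e a b c" and q: "q \<in> P1_minus e"
  obtains \<alpha> k where "\<And>x. x \<in> e \<Longrightarrow> q x = \<alpha> + (k * ((x - b) \<bullet> tangent e)) *\<^sub>R nu e"
proof -
  note D = tri_edge_D[OF e]
  define t where "t = tangent e"
  have t1: "norm t = 1" unfolding t_def by (rule norm_tangent[OF e])
  obtain A d where A: "linear A" "\<And>x. x \<in> e \<Longrightarrow> q x = A x + d" using q by (auto simp: P1_minus_def P1_def)
  obtain k0 where k0: "\<And>x. x \<in> e \<Longrightarrow> q x \<bullet> t = k0" using q by (auto simp: P1_minus_def P0_def t_def)
  define L where "L = norm (c - b)"
  have L: "0 < L" using D(6) by (simp add: L_def)
  have cb: "c - b = L *\<^sub>R t" using L by (simp add: t_def tangent_def D(1) L_def)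
  have be: "b \<in> e" "c \<in> e" by (simp_all add: D(2))
  have "A (c - b) \<bullet> t = 0"
    using k0[OF be(1)] k0[OF be(2)] A(2)[OF be(1)] A(2)[OF be(2)] by (simp add: linear_diff[OF A(1)] inner_diff_left inner_add_left)
  then have "A t \<bullet> t = 0" using L unfolding cb by (simp add: linear_cmul[OF A(1)])
  then have At: "A t = (A t \<bullet> nu e) *\<^sub>R nu e" using nu_props(3)[OF e, of "A t"] by (simp add: t_def)
  have "q x = (A b + d) + ((A t \<bullet> nu e) * ((x - b) \<bullet> t)) *\<^sub>R nu e" if x: "x \<in> e" for x
  proof -
    obtain r where "x = (1 - r) *\<^sub>R b + r *\<^sub>R c" using x by (auto simp: D(2) in_segment)
    then have "x = b + r *\<^sub>R (c - b)" by (simp add: algebra_simps)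
    then have xb: "x = b + (r * L) *\<^sub>R t" unfolding cb by simp
    then have rl: "(x - b) \<bullet> t = r * L" using t1 by (simp add: norm_eq_1)
    have "q x = A b + (r * L) *\<^sub>R A t + d" using A(2)[OF x] by (simp add: xb linear_add[OF A(1)] linear_cmul[OF A(1)])
    also have "(r * L) *\<^sub>R A t = ((A t \<bullet> nu e) * (r * L)) *\<^sub>R nu e" by (subst At) (simp add: mult.commute)
    finally show ?thesis unfolding rl by simp
  qed
  then show ?thesis unfolding t_def by (rule that)
qed

lemma P1_minus_intro:
  assumes e: "tri_edge T e a b c"
  shows "(\<lambda>x. \<alpha> + (k * ((x - b) \<bullet> tangent e)) *\<^sub>R nu e) \<in> P1_minus e"
proof -
  have "linear (\<lambda>x. (k * (x \<bullet> tangent e)) *\<^sub>R nu e)" by (simp add: linear_iff inner_add_left algebra_simps)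
  moreover have "\<alpha> + (k * ((x - b) \<bullet> tangent e)) *\<^sub>R nu e = (k * (x \<bullet> tangent e)) *\<^sub>R nu e + (\<alpha> - (k * (b \<bullet> tangent e)) *\<^sub>R nu e)" for x
    by (simp add: inner_diff_left algebra_simps)
  ultimately have "(\<lambda>x. \<alpha> + (k * ((x - b) \<bullet> tangent e)) *\<^sub>R nu e) \<in> P1 e" unfolding P1_def by blast
  moreover have "(\<lambda>x. (\<alpha> + (k * ((x - b) \<bullet> tangent e)) *\<^sub>R nu e) \<bullet> tangent e) \<in> P0 e"
    unfolding P0_def by (auto simp: inner_add_left nu_props(2)[OF e])
  ultimately show ?thesis by (simp add: P1_minus_def)
qed

lemma P1_minus_L2:
  assumes e: "tri_edge T e a b c" and q: "q \<in> P1_minus e"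
  shows "q \<in> L2 (edge_measure e)"
proof -
  obtain \<alpha> k where q: "\<And>x. x \<in> e \<Longrightarrow> q x = \<alpha> + (k * ((x - b) \<bullet> tangent e)) *\<^sub>R nu e"
    using P1_minus_form[OF e q] by metis
  have "(\<lambda>x. \<alpha> + (k * ((x - b) \<bullet> tangent e)) *\<^sub>R nu e) \<in> L2 (edge_measure e)"
    by (rule continuous_edge_L2[OF e]) (intro continuous_intros)
  moreover have "q \<in> L2 (edge_measure e) \<longleftrightarrow> (\<lambda>x. \<alpha> + (k * ((x - b) \<bullet> tangent e)) *\<^sub>R nu e) \<in> L2 (edge_measure e)"
    by (rule L2_cong) (simp add: q)
  ultimately show ?thesis by simp
qed

lemma P1_minus_const: "(\<lambda>x. d) \<in> P1_minus e"
  unfolding P1_minus_def P1_def P0_def by (auto intro!: exI[of _ "\<lambda>x. 0"] exI[of _ d] module_hom_zero)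

lemma P1_minus_diff: "p \<in> P1_minus e \<Longrightarrow> q \<in> P1_minus e \<Longrightarrow> (\<lambda>x. p x - q x) \<in> P1_minus e"
proof -
  assume p: "p \<in> P1_minus e" and q: "q \<in> P1_minus e"
  obtain A d B d' where A: "linear A" "\<And>x. x \<in> e \<Longrightarrow> p x = A x + d" "linear B" "\<And>x. x \<in> e \<Longrightarrow> q x = B x + d'"
    using p q unfolding P1_minus_def P1_def by auto
  have "linear (\<lambda>x. A x - B x)" by (rule linear_compose_sub[OF A(1,3)])
  moreover have "\<forall>x\<in>e. p x - q x = (A x - B x) + (d - d')" using A by simp
  ultimately have "(\<lambda>x. p x - q x) \<in> P1 e" unfolding P1_def by blast
  moreover have "(\<lambda>x. (p x - q x) \<bullet> tangent e) \<in> P0 e"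
    using p q unfolding P1_minus_def P0_def by (auto simp: inner_diff_left)
  ultimately show ?thesis by (simp add: P1_minus_def)
qed

text \<open>The choice in \<open>edge_proj\<close> is meaningful only if the orthogonality relations
  can be satisfied. An explicit solution is built from constant vectors and the field \<tau> n,
  which are orthogonal on e.\<close>

lemma edge_proj:
  assumes e: "tri_edge T e a b c" and w: "w \<in> L2 (edge_measure e)"
  shows "edge_proj e w \<in> P1_minus e" "q \<in> P1_minus e \<Longrightarrow> (\<integral>x. (w x - edge_proj e w x) \<bullet> q x \<partial>edge_measure e) = 0"
proof -
  note D = tri_edge_D[OF e]
  let ?M = "edge_measure e"
  define t where "t = tangent e"
  define n where "n = nu e"
  have t1: "norm t = 1" unfolding t_def by (rule norm_tangent[OF e])
  have n1: "n \<bullet> n = 1" using nu_props(1)[OF e] by (simp add: n_def norm_eq_1)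
  define L where "L = norm (c - b)"
  have L: "0 < L" using D(6) by (simp add: L_def)
  have cb: "c - b = L *\<^sub>R t" using L by (simp add: t_def tangent_def D(1) L_def)
  \<comment> \<open>Subtracting L/2 centres the arc length parameter at the midpoint, so that \<tau>
    is orthogonal to constants.\<close>
  define \<tau> where "\<tau> x = (x - b) \<bullet> t - L / 2" for x
  have \<tau>r: "\<tau> (b + r *\<^sub>R (c - b)) = L * (r - 1/2)" for r
    unfolding \<tau>_def cb using t1 by (simp add: norm_eq_1 algebra_simps)
  have c\<tau>: "continuous_on UNIV \<tau>" unfolding \<tau>_def by (intro continuous_intros)
  have dL: "dist b c = L" by (simp add: L_def dist_norm norm_minus_commute)
  have I1: "(\<integral>x. 1 \<partial>?M) = L"
    by (subst edge_integral(1)[OF D(1,2)]) (simp_all add: dL)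
  have I2: "(\<integral>x. \<tau> x \<partial>?M) = 0"
  proof -
    have "(\<integral>r. indicator {0..1} r *\<^sub>R (L * (r - 1/2)) \<partial>lborel) = L * (1\<^sup>2 / 2 - 1 / 2) - L * (0\<^sup>2 / 2 - 0 / 2)"
      by (rule integral_FTC_atLeastAtMost[of 0 1 "\<lambda>r. L * (r\<^sup>2 / 2 - r / 2)"])
        (auto intro!: derivative_eq_intros continuous_intros simp: has_real_derivative_iff_has_vector_derivative[symmetric])
    then show ?thesis by (subst edge_integral(1)[OF D(1,2) continuous_edge_measurable[OF c\<tau>]]) (simp add: \<tau>r)
  qed
  \<comment> \<open>The squared norm of \<tau> n on e; its value L^3 / 12 is positive, which allows
    the division in \<kappa>.\<close>
  define I3 where "I3 = (\<integral>x. \<tau> x * \<tau> x \<partial>?M)"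
  have I3: "I3 = L * (L\<^sup>2 / 12)"
  proof -
    have "(\<integral>r. indicator {0..1} r *\<^sub>R (L\<^sup>2 * (r - 1/2)\<^sup>2) \<partial>lborel) = L\<^sup>2 * ((1 - 1/2)^3 / 3) - L\<^sup>2 * ((0 - 1/2)^3 / 3)"
      by (rule integral_FTC_atLeastAtMost[of 0 1 "\<lambda>r. L\<^sup>2 * ((r - 1/2)^3 / 3)"])
        (auto intro!: derivative_eq_intros continuous_intros simp: has_real_derivative_iff_has_vector_derivative[symmetric])
    moreover have "continuous_on UNIV (\<lambda>x. \<tau> x * \<tau> x)" by (intro continuous_intros c\<tau>)
    note edge_integral(1)[OF D(1,2) continuous_edge_measurable[OF this]]
    ultimately show ?thesis unfolding I3_def by (simp add: \<tau>r dL power2_eq_square power3_eq_cube mult_ac)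
  qed
  have I3p: "0 < I3" unfolding I3 using L by simp
  have \<tau>L: "(\<lambda>x. \<tau> x) \<in> L2 ?M" by (rule continuous_edge_L2[OF e c\<tau>])
  have oL: "(\<lambda>x. 1::real) \<in> L2 ?M" by (rule continuous_edge_L2[OF e]) simp
  \<comment> \<open>Fourier coefficients of w: its mean value, and with \<kappa> its component along
    \<tau> n.\<close>
  define \<alpha>0 where "\<alpha>0 = (1 / L) *\<^sub>R (\<integral>x. w x \<partial>?M)"
  define \<kappa> where "\<kappa> = ((\<integral>x. \<tau> x *\<^sub>R w x \<partial>?M) \<bullet> n) / I3"
  define p where "p x = \<alpha>0 + (\<kappa> * \<tau> x) *\<^sub>R n" for x
  have pe: "p = (\<lambda>x. (\<alpha>0 - (\<kappa> * L / 2) *\<^sub>R n) + (\<kappa> * ((x - b) \<bullet> tangent e)) *\<^sub>R nu e)"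
    by (simp add: p_def \<tau>_def t_def[symmetric] n_def[symmetric] fun_eq_iff algebra_simps)
  have pP: "p \<in> P1_minus e" unfolding pe by (rule P1_minus_intro[OF e])
  have iw: "integrable ?M w" using L2_scaleR_integrable[OF oL w] by simp
  have i\<tau>w: "integrable ?M (\<lambda>x. \<tau> x *\<^sub>R w x)" by (rule L2_scaleR_integrable[OF \<tau>L w])
  have i\<tau>: "integrable ?M \<tau>" using L2_scaleR_integrable[OF oL \<tau>L] by simp
  have i1: "integrable ?M (\<lambda>x. 1::real)" using L2_scaleR_integrable[OF oL oL] by simp
  have i\<tau>\<tau>: "integrable ?M (\<lambda>x. \<tau> x * \<tau> x)" using L2_scaleR_integrable[OF \<tau>L \<tau>L] by simp
  have orth: "(\<integral>x. (w x - p x) \<bullet> q x \<partial>?M) = 0" if q: "q \<in> P1_minus e" for q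
  proof -
    obtain \<beta> k where qf: "\<And>x. x \<in> e \<Longrightarrow> q x = \<beta> + (k * ((x - b) \<bullet> tangent e)) *\<^sub>R nu e" using P1_minus_form[OF e q] by metis
    define \<beta>' where "\<beta>' = \<beta> + (k * L / 2) *\<^sub>R n"
    have qf': "q x = \<beta>' + (k * \<tau> x) *\<^sub>R n" if "x \<in> e" for x
      using qf[OF that] by (simp add: \<beta>'_def \<tau>_def t_def n_def algebra_simps)
    have "(\<integral>x. (w x - p x) \<bullet> q x \<partial>?M) = (\<integral>x. w x \<bullet> \<beta>' + k * ((\<tau> x *\<^sub>R w x) \<bullet> n) - (\<alpha>0 \<bullet> \<beta>') * 1
        - (k * (\<alpha>0 \<bullet> n) + \<kappa> * (n \<bullet> \<beta>')) * \<tau> x - (\<kappa> * k) * (\<tau> x * \<tau> x) \<partial>?M)"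
      by (rule Bochner_Integration.integral_cong)
        (simp_all add: qf' p_def inner_diff_left inner_add_left inner_add_right n1 algebra_simps)
    also have "\<dots> = (\<integral>x. w x \<partial>?M) \<bullet> \<beta>' + k * ((\<integral>x. \<tau> x *\<^sub>R w x \<partial>?M) \<bullet> n) - (\<alpha>0 \<bullet> \<beta>') * L
        - (k * (\<alpha>0 \<bullet> n) + \<kappa> * (n \<bullet> \<beta>')) * 0 - (\<kappa> * k) * I3"
    proof -
      have a: "(\<integral>x. w x \<bullet> \<beta>' \<partial>?M) = (\<integral>x. w x \<partial>?M) \<bullet> \<beta>'" "integrable ?M (\<lambda>x. w x \<bullet> \<beta>')"
        by (rule integral_inner_left, rule iw) (rule integrable_inner_left, rule iw)
      have b: "(\<integral>x. (\<tau> x *\<^sub>R w x) \<bullet> n \<partial>?M) = (\<integral>x. \<tau> x *\<^sub>R w x \<partial>?M) \<bullet> n" "integrable ?M (\<lambda>x. (\<tau> x *\<^sub>R w x) \<bullet> n)"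
        by (rule integral_inner_left, rule i\<tau>w) (rule integrable_inner_left, rule i\<tau>w)
      show ?thesis
        unfolding I3_def a(1)[symmetric] b(1)[symmetric] I1[symmetric] I2[symmetric]
        by (simp only: Bochner_Integration.integral_diff Bochner_Integration.integral_add Bochner_Integration.integrable_diff
          Bochner_Integration.integrable_add integrable_mult_right integral_mult_right_zero a(2) b(2) i1 i\<tau> i\<tau>\<tau>)
    qed
    also have "\<dots> = 0" using L I3p by (simp add: \<alpha>0_def \<kappa>_def inner_scaleR_left)
    finally show ?thesis .
  qed
  have ex: "p \<in> P1_minus e \<and> (\<forall>q\<in>P1_minus e. (\<integral>x. (w x - p x) \<bullet> q x \<partial>?M) = 0)" using pP orth by blast
  note sp = someI[of "\<lambda>p. p \<in> P1_minus e \<and> (\<forall>q\<in>P1_minus e. (\<integral>x. (w x - p x) \<bullet> q x \<partial>?M) = 0)", OF ex, folded edge_proj_def]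
  show "edge_proj e w \<in> P1_minus e" using sp by blast
  show "q \<in> P1_minus e \<Longrightarrow> (\<integral>x. (w x - edge_proj e w x) \<bullet> q x \<partial>?M) = 0" using sp by blast
qed

text \<open>Pythagoras: w minus its projection is orthogonal to every difference of elements of
  \<open>P1_minus\<close>.\<close>

lemma edge_proj_best:
  assumes e: "tri_edge T e a b c" and w: "w \<in> L2 (edge_measure e)" and q: "q \<in> P1_minus e"
  shows "l2norm (edge_measure e) (\<lambda>x. w x - edge_proj e w x) \<le> l2norm (edge_measure e) (\<lambda>x. w x - q x)"
proof (rule power2_le_imp_le)
  note P = edge_proj[OF e w]
  let ?p = "edge_proj e w"
  have d: "(\<lambda>x. ?p x - q x) \<in> P1_minus e" by (rule P1_minus_diff[OF P(1) q])
  have "(l2norm (edge_measure e) (\<lambda>x. (w x - ?p x) + (?p x - q x)))\<^sup>2 = (l2norm (edge_measure e) (\<lambda>x. w x - ?p x))\<^sup>2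
      + 2 * (\<integral>x. (w x - ?p x) \<bullet> (?p x - q x) \<partial>edge_measure e) + (l2norm (edge_measure e) (\<lambda>x. ?p x - q x))\<^sup>2"
    by (rule l2norm_add_sq[OF L2_diff[OF w P1_minus_L2[OF e P(1)]] P1_minus_L2[OF e d]])
  then show "(l2norm (edge_measure e) (\<lambda>x. w x - ?p x))\<^sup>2 \<le> (l2norm (edge_measure e) (\<lambda>x. w x - q x))\<^sup>2"
    using P(2)[OF d] by simp
qed simp

subsection \<open>Estimates on one element\<close>

text \<open>The norms and weak derivatives in \<open>is_trace\<close> see only the interior of T.
  This identifies traces of \<open>broken_partial\<close> with traces of elementwise
  derivatives.\<close>

lemma edge_trace_cong:
  assumes "\<And>x. x \<in> interior T \<Longrightarrow> u x = w x" shows "edge_trace T e u = edge_trace T e w"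
proof -
  have wp: "weak_partial (interior T) i u = weak_partial (interior T) i w" for i by (rule weak_partial_fun_cong[OF assms])
  have n: "l2norm (lebesgue_on (interior T)) (\<lambda>x. \<phi> x - u x) = l2norm (lebesgue_on (interior T)) (\<lambda>x. \<phi> x - w x)" for \<phi>
    by (rule l2norm_cong) (simp add: assms)
  have "is_trace T e u = is_trace T e w" by (rule ext) (simp add: is_trace_def wp n)
  then show ?thesis by (simp add: edge_trace_def)
qed

definition wgrad :: "(real^2) set \<Rightarrow> (real^2 \<Rightarrow> 'b::euclidean_space) \<Rightarrow> 2 \<Rightarrow> real^2 \<Rightarrow> 'b" where
  "wgrad T w i = weak_partial (interior T) i w"

lemma H1_approx_D:
  assumes "H1_approx T \<phi> w g"
  shows "smooth (\<phi> n)" "L2lim (triM T) \<phi> w" "L2lim (triM T) (\<lambda>n. cpartial i (\<phi> n)) (g i)"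
  using assms by (auto simp: H1_approx_def)

lemma trace_bound:
  fixes w :: "real^2 \<Rightarrow> 'b::euclidean_space"
  assumes e: "tri_edge T e a b c" and sh: "diameter T \<le> \<sigma> * inball_diameter T" and ap: "H1_approx T \<phi> w (wgrad T w)"
  shows "diameter T * (l2norm (edge_measure e) (edge_trace T e w))\<^sup>2
    \<le> \<sigma> * (3 * (l2norm (triM T) w)\<^sup>2 + (diameter T)\<^sup>2 * (\<Sum>j\<in>UNIV. (l2norm (triM T) (wgrad T w j))\<^sup>2))"
proof (rule LIMSEQ_le)
  note A = H1_approx_D[OF ap]
  have tl: "L2lim (edge_measure e) \<phi> (edge_trace T e w)"
    by (rule edge_trace_limit[OF e sh ap[unfolded wgrad_def[abs_def]]])
  show "(\<lambda>n. diameter T * (l2norm (edge_measure e) (\<phi> n))\<^sup>2) \<longlonglongrightarrow> diameter T * (l2norm (edge_measure e) (edge_trace T e w))\<^sup>2"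
    by (intro tendsto_intros L2lim_norm tl)
  show "(\<lambda>n. \<sigma> * (3 * (l2norm (triM T) (\<phi> n))\<^sup>2 + (diameter T)\<^sup>2 * (\<Sum>j\<in>UNIV. (l2norm (triM T) (cpartial j (\<phi> n)))\<^sup>2)))
    \<longlonglongrightarrow> \<sigma> * (3 * (l2norm (triM T) w)\<^sup>2 + (diameter T)\<^sup>2 * (\<Sum>j\<in>UNIV. (l2norm (triM T) (wgrad T w j))\<^sup>2))"
    by (intro tendsto_intros L2lim_norm A)
  show "\<exists>N. \<forall>n\<ge>N. diameter T * (l2norm (edge_measure e) (\<phi> n))\<^sup>2 \<le> \<sigma> * (3 * (l2norm (triM T) (\<phi> n))\<^sup>2 + (diameter T)\<^sup>2 * (\<Sum>j\<in>UNIV. (l2norm (triM T) (cpartial j (\<phi> n)))\<^sup>2))"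
    using trace_inequality[OF e smooth_Ck[OF A(1)] sh] by blast
qed

text \<open>By best approximation, any q close to \<phi> n also competes for the limit trace; the
  extra error is the distance between \<phi> n and that trace, which vanishes.\<close>

lemma proj_error_limit:
  fixes w :: "real^2 \<Rightarrow> real^2"
  assumes e: "tri_edge T e a b c" and tl: "L2lim (edge_measure e) \<phi> tr"
    and q: "\<And>n. \<exists>q\<in>P1_minus e. (l2norm (edge_measure e) (\<lambda>x. \<phi> n x - q x))\<^sup>2 \<le> Q n" and Q: "Q \<longlonglongrightarrow> Q0"
  shows "(l2norm (edge_measure e) (\<lambda>x. tr x - edge_proj e tr x))\<^sup>2 \<le> Q0"
proof -
  note D = L2lim_D[OF tl]
  let ?l = "l2norm (edge_measure e) (\<lambda>x. tr x - edge_proj e tr x)"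
  have Q0: "0 \<le> Q n" for n using q[of n] by (meson order_trans zero_le_power2)
  have b: "?l \<le> l2norm (edge_measure e) (\<lambda>x. \<phi> n x - tr x) + sqrt (Q n)" for n
  proof -
    obtain q where q': "q \<in> P1_minus e" "(l2norm (edge_measure e) (\<lambda>x. \<phi> n x - q x))\<^sup>2 \<le> Q n" using q by blast
    have "?l \<le> l2norm (edge_measure e) (\<lambda>x. tr x - q x)" by (rule edge_proj_best[OF e D(2) q'(1)])
    also have "\<dots> \<le> l2norm (edge_measure e) (\<lambda>x. tr x - \<phi> n x) + l2norm (edge_measure e) (\<lambda>x. \<phi> n x - q x)"
      by (rule l2norm_triangle_diff[OF D(2) D(1) P1_minus_L2[OF e q'(1)]])
    also have "l2norm (edge_measure e) (\<lambda>x. \<phi> n x - q x) \<le> sqrt (Q n)" by (rule real_le_rsqrt[OF q'(2)])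
    finally show ?thesis by (simp add: l2norm_minus_commute[of _ tr])
  qed
  have "(\<lambda>n. l2norm (edge_measure e) (\<lambda>x. \<phi> n x - tr x) + sqrt (Q n)) \<longlonglongrightarrow> 0 + sqrt Q0"
    by (intro tendsto_intros D Q)
  then have "?l \<le> 0 + sqrt Q0" by (rule LIMSEQ_le_const) (use b in blast)
  then have "?l\<^sup>2 \<le> (sqrt Q0)\<^sup>2" by (intro power_mono) auto
  also have "\<dots> = Q0" using LIMSEQ_le_const[OF Q, of 0] Q0 by simp
  finally show ?thesis .
qed

lemma proj_error_const:
  fixes w :: "real^2 \<Rightarrow> real^2"
  assumes e: "tri_edge T e a b c" and sh: "diameter T \<le> \<sigma> * inball_diameter T" and ap: "H1_approx T \<phi> w (wgrad T w)"
  shows "(l2norm (edge_measure e) (\<lambda>x. edge_trace T e w x - edge_proj e (edge_trace T e w) x))\<^sup>2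
    \<le> 37 * \<sigma> * diameter T * (\<Sum>j\<in>UNIV. (l2norm (triM T) (wgrad T w j))\<^sup>2)"
proof (rule proj_error_limit[OF e])
  note A = H1_approx_D[OF ap]
  show "L2lim (edge_measure e) \<phi> (edge_trace T e w)"
    by (rule edge_trace_limit[OF e sh ap[unfolded wgrad_def[abs_def]]])
  show "\<exists>q\<in>P1_minus e. (l2norm (edge_measure e) (\<lambda>x. \<phi> n x - q x))\<^sup>2 \<le> 37 * \<sigma> * diameter T * (\<Sum>j\<in>UNIV. (l2norm (triM T) (cpartial j (\<phi> n)))\<^sup>2)" for n
  proof -
    obtain d where "(l2norm (edge_measure e) (\<lambda>x. \<phi> n x - d))\<^sup>2 \<le> 37 * \<sigma> * diameter T * (\<Sum>j\<in>UNIV. (l2norm (triM T) (cpartial j (\<phi> n)))\<^sup>2)"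
      using trace_poincare[OF e A(1) sh, of n] by blast
    then show ?thesis by (intro bexI[of _ "\<lambda>x. d"] P1_minus_const)
  qed
  show "(\<lambda>n. 37 * \<sigma> * diameter T * (\<Sum>j\<in>UNIV. (l2norm (triM T) (cpartial j (\<phi> n)))\<^sup>2)) \<longlonglongrightarrow> 37 * \<sigma> * diameter T * (\<Sum>j\<in>UNIV. (l2norm (triM T) (wgrad T w j))\<^sup>2)"
    by (intro tendsto_intros L2lim_norm A)
qed

text \<open>Unlike \<open>Hm\<close>, this speaks about the chosen derivatives \<open>wgrad\<close>
  and their chosen derivatives, which are the ones the broken operators are made of.\<close>

definition H2_on :: "(real^2) set \<Rightarrow> (real^2 \<Rightarrow> 'b::euclidean_space) \<Rightarrow> bool" where
  "H2_on T v \<longleftrightarrow> v \<in> L2 (triM T) \<and> (\<forall>i. wgrad T v i \<in> L2 (triM T) \<and> is_weak_partial (interior T) i v (wgrad T v i)) \<and>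
    (\<forall>i j. wgrad T (wgrad T v i) j \<in> L2 (triM T) \<and> is_weak_partial (interior T) j (wgrad T v i) (wgrad T (wgrad T v i) j))"

lemma H2_on_approx:
  fixes v :: "real^2 \<Rightarrow> 'b::euclidean_space"
  assumes T: "2 simplex T" and v: "H2_on T v"
  obtains \<phi> where "H1_approx T \<phi> v (wgrad T v)" "\<And>i. H1_approx T (\<lambda>n. cpartial i (\<phi> n)) (wgrad T v i) (wgrad T (wgrad T v i))"
    "\<And>n i j x. cpartial i (cpartial j (\<phi> n)) x = cpartial j (cpartial i (\<phi> n)) x"
proof -
  have v': "v \<in> L2 (triM T)" "\<And>i. wgrad T v i \<in> L2 (triM T)" "\<And>i. is_weak_partial (interior T) i v (wgrad T v i)"
    "\<And>i j. wgrad T (wgrad T v i) j \<in> L2 (triM T)" "\<And>i j. is_weak_partial (interior T) j (wgrad T v i) (wgrad T (wgrad T v i) j)"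
    using v unfolding H2_on_def by blast+
  obtain \<phi> where \<phi>: "H1_approx T \<phi> v (wgrad T v)" "\<And>i. H1_approx T (\<lambda>n. cpartial i (\<phi> n)) (wgrad T v i) (\<lambda>j. wgrad T (wgrad T v i) j)"
    "\<And>n i j x. cpartial i (cpartial j (\<phi> n)) x = cpartial j (cpartial i (\<phi> n)) x"
    using H2_approx[OF T v'(1), of "wgrad T v" "\<lambda>j i. wgrad T (wgrad T v i) j"] v'(2-5) by metis
  show ?thesis by (rule that[of \<phi>]) (use \<phi> in auto)
qed

text \<open>The witness g in \<open>Hm\<close> may differ from the chosen derivative. By uniqueness
  they agree almost everywhere, so a weak derivative of g is also one of the chosen
  function.\<close>

lemma Hm2_H2_on:
  fixes v :: "real^2 \<Rightarrow> 'b::euclidean_space"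
  assumes T: "2 simplex T" and v: "v \<in> Hm 2 (interior T)"
  shows "H2_on T v"
proof -
  note S = simplex2_facts[OF T]
  have v1: "v \<in> L2 (triM T)" and v2: "\<And>i. \<exists>g\<in>Hm 1 (interior T). is_weak_partial (interior T) i v g"
    using v by (auto simp: numeral_2_eq_2 triM_def)
  have "wgrad T v i \<in> L2 (triM T) \<and> is_weak_partial (interior T) i v (wgrad T v i) \<and>
     (\<forall>j. wgrad T (wgrad T v i) j \<in> L2 (triM T) \<and> is_weak_partial (interior T) j (wgrad T v i) (wgrad T (wgrad T v i) j))" for i
  proof -
    obtain g where g: "g \<in> Hm 1 (interior T)" "is_weak_partial (interior T) i v g" using v2 by blast
    have g1: "g \<in> L2 (triM T)" and g2: "\<And>j. \<exists>k\<in>L2 (triM T). is_weak_partial (interior T) j g k"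
      using g(1) by (auto simp: triM_def)
    have w: "wgrad T v i \<in> L2 (triM T)" "is_weak_partial (interior T) i v (wgrad T v i)"
      using weak_partial_spec[OF g1[unfolded triM_def] g(2)] by (simp_all add: wgrad_def triM_def)
    have ae: "AE x in triM T. g x = wgrad T v i x"
      by (rule weak_partial_unique[OF T v1 g1 w(1) g(2) w(2)])
    have "wgrad T (wgrad T v i) j \<in> L2 (triM T) \<and> is_weak_partial (interior T) j (wgrad T v i) (wgrad T (wgrad T v i) j)" for j
    proof -
      obtain k where k: "k \<in> L2 (triM T)" "is_weak_partial (interior T) j g k" using g2 by blast
      have "is_weak_partial (interior T) j (wgrad T v i) k"
        unfolding is_weak_partial_def
      proof (intro allI impI)
        fix \<phi> assume t: "test_function (interior T) \<phi>"
        have m: "cpartial j \<phi> \<in> borel_measurable (lebesgue_on (interior T))"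
          by (rule L2_D(1)[OF test_function_L2[OF test_function_cpartial[OF t] S(5,7)]])
        have "(\<integral>x. cpartial j \<phi> x *\<^sub>R wgrad T v i x \<partial>lebesgue_on (interior T)) = (\<integral>x. cpartial j \<phi> x *\<^sub>R g x \<partial>lebesgue_on (interior T))"
        proof (rule integral_cong_AE)
          show "AE x in lebesgue_on (interior T). cpartial j \<phi> x *\<^sub>R wgrad T v i x = cpartial j \<phi> x *\<^sub>R g x"
            using ae[unfolded triM_def] by (rule eventually_mono) simp
        qed (intro borel_measurable_scaleR m L2_D(1)[OF w(1), unfolded triM_def] L2_D(1)[OF g1, unfolded triM_def])+
        then show "(\<integral>x. cpartial j \<phi> x *\<^sub>R wgrad T v i x \<partial>lebesgue_on (interior T)) = - (\<integral>x. \<phi> x *\<^sub>R k x \<partial>lebesgue_on (interior T))"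
          using k(2) t unfolding is_weak_partial_def by simp
      qed
      from weak_partial_spec[OF k(1)[unfolded triM_def] this] show ?thesis by (simp add: wgrad_def[of T "wgrad T v i"] triM_def)
    qed
    then show ?thesis using w by blast
  qed
  then show ?thesis unfolding H2_on_def using v1 by blast
qed

definition hess_sq :: "(real^2) set \<Rightarrow> (real^2 \<Rightarrow> 'b::euclidean_space) \<Rightarrow> real" where
  "hess_sq T v = (\<Sum>i\<in>UNIV. \<Sum>j\<in>UNIV. (l2norm (triM T) (wgrad T (wgrad T v i) j))\<^sup>2)"

definition grad_sq :: "(real^2) set \<Rightarrow> (real^2 \<Rightarrow> 'b::euclidean_space) \<Rightarrow> real" where
  "grad_sq T v = (\<Sum>i\<in>UNIV. (l2norm (triM T) (wgrad T v i))\<^sup>2)"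

definition eps_sq :: "(real^2) set \<Rightarrow> (real^2 \<Rightarrow> real^2) \<Rightarrow> real" where
  "eps_sq T v = (l2norm (triM T) (\<lambda>x. symm (\<chi> j. wgrad T v j x)))\<^sup>2"

lemma proj_error_rigid:
  fixes v :: "real^2 \<Rightarrow> real^2"
  assumes e: "tri_edge T e a b c" and sh: "diameter T \<le> \<sigma> * inball_diameter T" and v: "H2_on T v"
  shows "(l2norm (edge_measure e) (\<lambda>x. edge_trace T e v x - edge_proj e (edge_trace T e v) x))\<^sup>2
    \<le> \<sigma> * diameter T * (3 * eps_sq T v + 38 * (diameter T)\<^sup>2 * hess_sq T v)"
proof -
  have T2: "2 simplex T" by (rule tri_edge_simplex[OF e])
  obtain \<phi> where \<phi>: "H1_approx T \<phi> v (wgrad T v)" "\<And>i. H1_approx T (\<lambda>n. cpartial i (\<phi> n)) (wgrad T v i) (wgrad T (wgrad T v i))"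
    using H2_on_approx[OF T2 v] by metis
  note A = H1_approx_D[OF \<phi>(1)] and A2 = H1_approx_D[OF \<phi>(2)]
  have sg: "L2lim (triM T) (\<lambda>n. sgrad (\<phi> n)) (\<lambda>x. \<chi> j. wgrad T v j x)"
    by (rule L2lim_vec) (unfold sgrad_def vec_lambda_beta, rule A(3))
  show ?thesis
  proof (rule proj_error_limit[OF e])
    show "L2lim (edge_measure e) \<phi> (edge_trace T e v)"
      by (rule edge_trace_limit[OF e sh \<phi>(1)[unfolded wgrad_def[abs_def]]])
    show "\<exists>q\<in>P1_minus e. (l2norm (edge_measure e) (\<lambda>x. \<phi> n x - q x))\<^sup>2 \<le> \<sigma> * diameter T *
      (3 * (l2norm (triM T) (\<lambda>x. symm (sgrad (\<phi> n) x)))\<^sup>2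
        + 38 * (diameter T)\<^sup>2 * (\<Sum>i\<in>UNIV. \<Sum>j\<in>UNIV. (l2norm (triM T) (cpartial j (cpartial i (\<phi> n))))\<^sup>2))" for n
      using edge_rigid_approx[OF e A(1) sh, of n] by blast
    show "(\<lambda>n. \<sigma> * diameter T * (3 * (l2norm (triM T) (\<lambda>x. symm (sgrad (\<phi> n) x)))\<^sup>2
        + 38 * (diameter T)\<^sup>2 * (\<Sum>i\<in>UNIV. \<Sum>j\<in>UNIV. (l2norm (triM T) (cpartial j (cpartial i (\<phi> n))))\<^sup>2)))
      \<longlonglongrightarrow> \<sigma> * diameter T * (3 * eps_sq T v + 38 * (diameter T)\<^sup>2 * hess_sq T v)"
      unfolding eps_sq_def hess_sq_def by (intro tendsto_intros L2lim_norm A2 L2lim_linear[OF sg bounded_linear_symm])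
  qed
qed

text \<open>The divergence theorem for \<phi> . \<partial>_i \<phi>, summed over i. Every term is an
  inner product of two sequences that converge in L2, on T or on an edge, so the identity passes to
  the limit.\<close>

lemma element_identity:
  fixes v :: "real^2 \<Rightarrow> real^2"
  assumes T: "2 simplex T" and sh: "diameter T \<le> \<sigma> * inball_diameter T" and v: "H2_on T v"
  shows "grad_sq T v = - (\<Sum>i\<in>UNIV. \<integral>x. v x \<bullet> wgrad T (wgrad T v i) i x \<partial>triM T)
    + (\<Sum>e\<in>{e. e edge_of T}. orient T e * (\<Sum>i\<in>UNIV. nu e $ i * (\<integral>x. edge_trace T e v x \<bullet> edge_trace T e (wgrad T v i) x \<partial>edge_measure e)))"
proof -
  obtain \<phi> where \<phi>: "H1_approx T \<phi> v (wgrad T v)" "\<And>i. H1_approx T (\<lambda>n. cpartial i (\<phi> n)) (wgrad T v i) (wgrad T (wgrad T v i))"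
    using H2_on_approx[OF T v] by metis
  note A = H1_approx_D[OF \<phi>(1)] and A2 = H1_approx_D[OF \<phi>(2)]
  define l where "l n i = (\<Sum>e\<in>{e. e edge_of T}. orient T e * nu e $ i * (\<integral>x. \<phi> n x \<bullet> cpartial i (\<phi> n) x \<partial>edge_measure e))" for n i
  define r where "r n i = (\<integral>x. \<phi> n x \<bullet> cpartial i (cpartial i (\<phi> n)) x \<partial>triM T) + (\<integral>x. cpartial i (\<phi> n) x \<bullet> cpartial i (\<phi> n) x \<partial>triM T)" for n i
  have lr: "l n i = r n i" for n i
  proof -
    note C = Ck1_inner[OF smooth_Ck[OF A(1)[of n]] smooth_Ck[OF A2(1)[of i n]]]
    have "l n i = (\<integral>x. cpartial i (\<lambda>x. \<phi> n x \<bullet> cpartial i (\<phi> n) x) x \<partial>triM T)"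
      unfolding l_def by (rule gauss_green[OF T C(1)])
    also have "\<dots> = (\<integral>x. \<phi> n x \<bullet> cpartial i (cpartial i (\<phi> n)) x + cpartial i (\<phi> n) x \<bullet> cpartial i (\<phi> n) x \<partial>triM T)"
      unfolding C(2) ..
    also have "\<dots> = r n i" unfolding r_def
      by (intro Bochner_Integration.integral_add L2_inner_integrable triM_L2[OF T] smooth_continuous A(1) A2(1) smooth_cpartial)
    finally show ?thesis .
  qed
  have "(\<lambda>n. l n i) \<longlonglongrightarrow> (\<Sum>e\<in>{e. e edge_of T}. orient T e * nu e $ i * (\<integral>x. edge_trace T e v x \<bullet> edge_trace T e (wgrad T v i) x \<partial>edge_measure e))" for i
    unfolding l_def
  proof (intro tendsto_sum tendsto_mult tendsto_const L2lim_inner)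
    fix e assume "e \<in> {e. e edge_of T}"
    then obtain a b c where e: "tri_edge T e a b c" using simplex2_edge[OF T] by blast
    show "L2lim (edge_measure e) \<phi> (edge_trace T e v)"
      by (rule edge_trace_limit[OF e sh \<phi>(1)[unfolded wgrad_def[abs_def]]])
    show "L2lim (edge_measure e) (\<lambda>n. cpartial i (\<phi> n)) (edge_trace T e (wgrad T v i))"
      by (rule edge_trace_limit[OF e sh \<phi>(2)[of i, unfolded wgrad_def[of T "wgrad T v i", abs_def]]])
  qed
  moreover have "(\<lambda>n. r n i) \<longlonglongrightarrow> (\<integral>x. v x \<bullet> wgrad T (wgrad T v i) i x \<partial>triM T) + (\<integral>x. wgrad T v i x \<bullet> wgrad T v i x \<partial>triM T)" for i
    unfolding r_def by (intro tendsto_add L2lim_inner A A2)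
  ultimately have eq: "(\<Sum>e\<in>{e. e edge_of T}. orient T e * nu e $ i * (\<integral>x. edge_trace T e v x \<bullet> edge_trace T e (wgrad T v i) x \<partial>edge_measure e))
    = (\<integral>x. v x \<bullet> wgrad T (wgrad T v i) i x \<partial>triM T) + (\<integral>x. wgrad T v i x \<bullet> wgrad T v i x \<partial>triM T)" for i
    unfolding lr by (rule LIMSEQ_unique)
  have "(\<Sum>e\<in>{e. e edge_of T}. orient T e * (\<Sum>i\<in>UNIV. nu e $ i * (\<integral>x. edge_trace T e v x \<bullet> edge_trace T e (wgrad T v i) x \<partial>edge_measure e)))
    = (\<Sum>i\<in>UNIV. \<Sum>e\<in>{e. e edge_of T}. orient T e * nu e $ i * (\<integral>x. edge_trace T e v x \<bullet> edge_trace T e (wgrad T v i) x \<partial>edge_measure e))"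
    by (subst sum.swap) (simp add: sum_distrib_left mult.assoc)
  also have "\<dots> = (\<Sum>i\<in>UNIV. \<integral>x. v x \<bullet> wgrad T (wgrad T v i) i x \<partial>triM T) + (\<Sum>i\<in>UNIV. \<integral>x. wgrad T v i x \<bullet> wgrad T v i x \<partial>triM T)"
    unfolding eq by (rule sum.distrib)
  finally show ?thesis by (simp add: grad_sq_def l2norm_sq power2_norm_eq_inner)
qed

text \<open>Componentwise, \<open>\<partial>\<^sub>j\<partial>\<^sub>i v\<^sub>k = \<partial>\<^sub>j \<epsilon>\<^sub>i\<^sub>k + \<partial>\<^sub>i \<epsilon>\<^sub>j\<^sub>k - \<partial>\<^sub>k \<epsilon>\<^sub>i\<^sub>j\<close>.\<close>

lemma second_gradient_le_symm:
  fixes a :: "2 \<Rightarrow> 2 \<Rightarrow> real^2"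
  assumes "\<And>i j. a i j = a j i"
  shows "(\<Sum>i\<in>UNIV. \<Sum>j\<in>UNIV. (norm (a j i))\<^sup>2) \<le> 9 * (\<Sum>j\<in>UNIV. (norm (symm (\<chi> i. a j i)))\<^sup>2)"
proof -
  define s where "s j i k = symm (\<chi> i. a j i) $ i $ k" for j i k
  \<comment> \<open>With a j i = \<partial>_j \<partial>_i v the quantity s j i k is \<partial>_j
    \<epsilon>_ik, and the symmetry of a cancels the surplus terms.\<close>
  have sx: "a j i $ k = s j i k + s i j k - s k i j" for j i k
    using assms[of i j] assms[of j k] assms[of i k] by (simp add: s_def symm_nth field_simps)
  have "(a j i $ k)\<^sup>2 \<le> 3 * ((s j i k)\<^sup>2 + (s i j k)\<^sup>2 + (s k i j)\<^sup>2)" for j i k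
    using norm_add3_sq_le[of "s j i k" "s i j k" "- s k i j"] by (simp add: sx)
  then have "(\<Sum>i\<in>UNIV. \<Sum>j\<in>UNIV. \<Sum>k\<in>UNIV. (a j i $ k)\<^sup>2) \<le> (\<Sum>i\<in>UNIV. \<Sum>j\<in>UNIV. \<Sum>k\<in>UNIV. 3 * ((s j i k)\<^sup>2 + (s i j k)\<^sup>2 + (s k i j)\<^sup>2))"
    by (intro sum_mono)
  \<comment> \<open>The three sums coincide after renaming indices, hence 3 * 3 = 9.\<close>
  also have "\<dots> = 9 * (\<Sum>j\<in>UNIV. \<Sum>i\<in>UNIV. \<Sum>k\<in>UNIV. (s j i k)\<^sup>2)"
    by (simp add: sum_2)
  finally show ?thesis by (simp add: norm_sq_vec s_def)
qed

section \<open>Broken operators\<close>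

lemma broken_partial_on:
  assumes tr: "triangulation_of \<Omega> \<T>" and T: "T \<in> \<T>" and x: "x \<in> interior T"
  shows "broken_partial \<T> i v x = wgrad T v i x"
proof -
  note R = triangulation_of_D[OF tr]
  have "broken_partial \<T> i v x = (\<Sum>S\<in>\<T>. if S = T then wgrad T v i x else 0)"
    unfolding broken_partial_def wgrad_def
  proof (rule sum.cong[OF refl])
    fix S assume S: "S \<in> \<T>"
    show "(if x \<in> interior S then weak_partial (interior S) i v x else 0) = (if S = T then weak_partial (interior T) i v x else 0)"
    proof (cases "S = T")
      case False
      then have "x \<notin> interior S" using compatible_interior_eq[OF R(3)[OF S T] _ x] by blast
      then show ?thesis using False by (simp only: if_False)
    next
      case True
      then show ?thesis using x by simp
    qed
  qed
  then show ?thesis using R(1) T by (simp add: sum.delta)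
qed

lemma broken_grad_on:
  assumes "triangulation_of \<Omega> \<T>" "T \<in> \<T>" "x \<in> interior T"
  shows "broken_grad \<T> v x = (\<chi> j. wgrad T v j x)"
  unfolding broken_grad_def broken_partial_on[OF assms] ..

lemma broken_eps_symm: "broken_eps \<T> v x = symm (broken_grad \<T> v x)"
  by (simp add: broken_eps_def symm_def)

lemma edge_trace_broken:
  assumes "triangulation_of \<Omega> \<T>" "T \<in> \<T>"
  shows "edge_trace T e (broken_partial \<T> i v) = edge_trace T e (wgrad T v i)"
  by (rule edge_trace_cong) (rule broken_partial_on[OF assms])

lemma broken_l2norm_sq: "(broken_l2norm \<T> w)\<^sup>2 = (\<Sum>T\<in>\<T>. (l2norm (triM T) w)\<^sup>2)"
  by (simp add: broken_l2norm_def triM_def sum_nonneg)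

lemma l2norm_vec_sq:
  fixes u :: "'n::finite \<Rightarrow> 'a \<Rightarrow> 'b::euclidean_space"
  assumes "\<And>j. u j \<in> L2 M"
  shows "(l2norm M (\<lambda>x. \<chi> j. u j x))\<^sup>2 = (\<Sum>j\<in>UNIV. (l2norm M (u j))\<^sup>2)"
  using L2_D(2)[OF assms] by (simp add: l2norm_sq norm_sq_vec)

lemma is_weak_partial_vec:
  fixes u :: "2 \<Rightarrow> real^2 \<Rightarrow> 'b::euclidean_space"
  assumes U: "bounded U" "U \<in> sets borel" and u: "\<And>i. u i \<in> L2 (lebesgue_on U)" "\<And>i. g i \<in> L2 (lebesgue_on U)"
    and w: "\<And>i. is_weak_partial U j (u i) (g i)"
  shows "is_weak_partial U j (\<lambda>x. \<chi> i. u i x) (\<lambda>x. \<chi> i. g i x)"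
  unfolding is_weak_partial_def
proof (intro allI impI)
  fix \<phi> assume t: "test_function U \<phi>"
  have uL: "(\<lambda>x. \<chi> i. u i x) \<in> L2 (lebesgue_on U)" "(\<lambda>x. \<chi> i. g i x) \<in> L2 (lebesgue_on U)"
    by (rule L2_vec, simp add: u)+
  have i: "integrable (lebesgue_on U) (\<lambda>x. cpartial j \<phi> x *\<^sub>R (\<chi> i. u i x))" "integrable (lebesgue_on U) (\<lambda>x. \<phi> x *\<^sub>R (\<chi> i. g i x))"
    by (rule L2_scaleR_integrable[OF test_function_L2[OF test_function_cpartial[OF t] U] uL(1)])
      (rule L2_scaleR_integrable[OF test_function_L2[OF t U] uL(2)])
  show "(\<integral>x. cpartial j \<phi> x *\<^sub>R (\<chi> i. u i x) \<partial>lebesgue_on U) = - (\<integral>x. \<phi> x *\<^sub>R (\<chi> i. g i x) \<partial>lebesgue_on U)"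
  proof (rule iffD2[OF vec_eq_iff], rule allI)
    fix k
    have "(\<integral>x. cpartial j \<phi> x *\<^sub>R (\<chi> i. u i x) \<partial>lebesgue_on U) $ k = (\<integral>x. cpartial j \<phi> x *\<^sub>R u k x \<partial>lebesgue_on U)"
      using integral_bounded_linear[OF bounded_linear_vec_nth i(1), of k] by simp
    moreover have "(\<integral>x. \<phi> x *\<^sub>R (\<chi> i. g i x) \<partial>lebesgue_on U) $ k = (\<integral>x. \<phi> x *\<^sub>R g k x \<partial>lebesgue_on U)"
      using integral_bounded_linear[OF bounded_linear_vec_nth i(2), of k] by simp
    moreover have "(\<integral>x. cpartial j \<phi> x *\<^sub>R u k x \<partial>lebesgue_on U) = - (\<integral>x. \<phi> x *\<^sub>R g k x \<partial>lebesgue_on U)"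
      using w t unfolding is_weak_partial_def by blast
    ultimately show "(\<integral>x. cpartial j \<phi> x *\<^sub>R (\<chi> i. u i x) \<partial>lebesgue_on U) $ k = (- (\<integral>x. \<phi> x *\<^sub>R (\<chi> i. g i x) \<partial>lebesgue_on U)) $ k"
      by simp
  qed
qed

lemma wgrad_AE:
  fixes u :: "real^2 \<Rightarrow> 'b::euclidean_space"
  assumes T: "2 simplex T" and w: "\<And>x. x \<in> interior T \<Longrightarrow> w x = u x" and u: "u \<in> L2 (triM T)"
    and g: "g \<in> L2 (triM T)" "is_weak_partial (interior T) j u g"
  shows "wgrad T w j \<in> L2 (triM T)" "AE x in triM T. wgrad T w j x = g x"
proof -
  have e: "wgrad T w j = weak_partial (interior T) j u" unfolding wgrad_def by (rule weak_partial_fun_cong[OF w])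
  note s = weak_partial_spec[OF g(1)[unfolded triM_def] g(2), folded triM_def e]
  show "wgrad T w j \<in> L2 (triM T)" by (rule s(1))
  show "AE x in triM T. wgrad T w j x = g x" by (rule weak_partial_unique[OF T u s(1) g(1) s(2) g(2)])
qed

lemma H2_on_D:
  assumes "H2_on T v"
  shows "v \<in> L2 (triM T)" "wgrad T v i \<in> L2 (triM T)" "is_weak_partial (interior T) i v (wgrad T v i)"
    "wgrad T (wgrad T v i) j \<in> L2 (triM T)" "is_weak_partial (interior T) j (wgrad T v i) (wgrad T (wgrad T v i) j)"
  using assms by (auto simp: H2_on_def)

text \<open>Mixed derivatives of the mollified functions coincide, and L2 limits are unique almost
  everywhere.\<close>

lemma wgrad_commute:
  fixes v :: "real^2 \<Rightarrow> 'b::euclidean_space"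
  assumes T: "2 simplex T" and v: "H2_on T v"
  shows "AE x in triM T. wgrad T (wgrad T v i) j x = wgrad T (wgrad T v j) i x"
proof -
  obtain \<phi> where \<phi>: "\<And>i. H1_approx T (\<lambda>n. cpartial i (\<phi> n)) (wgrad T v i) (wgrad T (wgrad T v i))"
    "\<And>n i j x. cpartial i (cpartial j (\<phi> n)) x = cpartial j (cpartial i (\<phi> n)) x"
    using H2_on_approx[OF T v] by metis
  have "L2lim (triM T) (\<lambda>n. cpartial i (cpartial j (\<phi> n))) (wgrad T (wgrad T v j) i) \<longleftrightarrow> L2lim (triM T) (\<lambda>n. cpartial j (cpartial i (\<phi> n))) (wgrad T (wgrad T v j) i)"
    by (rule L2lim_cong) (rule \<phi>(2), rule refl)
  then have "L2lim (triM T) (\<lambda>n. cpartial j (cpartial i (\<phi> n))) (wgrad T (wgrad T v j) i)"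
    using H1_approx_D(3)[OF \<phi>(1)[of j]] by blast
  from L2lim_unique_AE[OF H1_approx_D(3)[OF \<phi>(1)[of i]] this] show ?thesis .
qed

lemma broken_grad_norm:
  fixes v :: "real^2 \<Rightarrow> real^2"
  assumes tr: "triangulation_of \<Omega> \<T>" and T: "T \<in> \<T>" and v: "H2_on T v"
  shows "(l2norm (triM T) (broken_grad \<T> v))\<^sup>2 = grad_sq T v"
    "(l2norm (triM T) (broken_eps \<T> v))\<^sup>2 = eps_sq T v"
proof -
  note H = H2_on_D[OF v]
  have "l2norm (triM T) (broken_grad \<T> v) = l2norm (triM T) (\<lambda>x. \<chi> j. wgrad T v j x)"
    by (rule l2norm_cong) (simp add: space_triM broken_grad_on[OF tr T])
  then show "(l2norm (triM T) (broken_grad \<T> v))\<^sup>2 = grad_sq T v"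
    using l2norm_vec_sq[OF H(2)] by (simp add: grad_sq_def)
  have "l2norm (triM T) (broken_eps \<T> v) = l2norm (triM T) (\<lambda>x. symm (\<chi> j. wgrad T v j x))"
    by (rule l2norm_cong) (simp add: space_triM broken_eps_symm broken_grad_on[OF tr T])
  then show "(l2norm (triM T) (broken_eps \<T> v))\<^sup>2 = eps_sq T v" by (simp add: eps_sq_def)
qed

text \<open>The linear map L covers two cases at once: the identity for the Hessian and
  \<open>symm\<close> for the gradient of the strain.\<close>

lemma broken_second_gradient_norm:
  fixes v :: "real^2 \<Rightarrow> real^2" and L :: "real^2^2 \<Rightarrow> real^2^2"
  assumes tr: "triangulation_of \<Omega> \<T>" and T: "T \<in> \<T>" and v: "H2_on T v" and L: "bounded_linear L"
  shows "(l2norm (triM T) (broken_grad \<T> (\<lambda>x. L (broken_grad \<T> v x))))\<^sup>2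
    = (\<Sum>j\<in>UNIV. (l2norm (triM T) (\<lambda>x. L (\<chi> i. wgrad T (wgrad T v i) j x)))\<^sup>2)"
proof -
  note H = H2_on_D[OF v] and S = triangulation_of_D(2)[OF tr T]
  note U = simplex2_facts(5,7)[OF S]
  let ?w = "\<lambda>x. L (broken_grad \<T> v x)"
  have gL: "(\<lambda>x. \<chi> i. wgrad T v i x) \<in> L2 (triM T)" by (rule L2_vec) (simp add: H)
  have ggL: "(\<lambda>x. \<chi> i. wgrad T (wgrad T v i) j x) \<in> L2 (triM T)" for j by (rule L2_vec) (simp add: H)
  have wp: "is_weak_partial (interior T) j (\<lambda>x. L (\<chi> i. wgrad T v i x)) (\<lambda>x. L (\<chi> i. wgrad T (wgrad T v i) j x))" for j
    by (rule is_weak_partial_linear[OF U gL[unfolded triM_def] ggL[unfolded triM_def] _ L])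
      (rule is_weak_partial_vec[OF U H(2,4)[unfolded triM_def] H(5)])
  note A = wgrad_AE[OF S, of ?w "\<lambda>x. L (\<chi> i. wgrad T v i x)", OF _ L2_bounded_linear[OF L gL] L2_bounded_linear[OF L ggL] wp]
  have A1: "wgrad T ?w j \<in> L2 (triM T)" for j by (rule A(1)) (simp add: broken_grad_on[OF tr T])
  have A2: "AE x in triM T. wgrad T ?w j x = L (\<chi> i. wgrad T (wgrad T v i) j x)" for j
    by (rule A(2)) (simp add: broken_grad_on[OF tr T])
  have "l2norm (triM T) (broken_grad \<T> ?w) = l2norm (triM T) (\<lambda>x. \<chi> j. wgrad T ?w j x)"
    by (rule l2norm_cong) (simp add: space_triM broken_grad_on[OF tr T])
  then have "(l2norm (triM T) (broken_grad \<T> ?w))\<^sup>2 = (\<Sum>j\<in>UNIV. (l2norm (triM T) (wgrad T ?w j))\<^sup>2)"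
    using l2norm_vec_sq[OF A1] by simp
  also have "\<dots> = (\<Sum>j\<in>UNIV. (l2norm (triM T) (\<lambda>x. L (\<chi> i. wgrad T (wgrad T v i) j x)))\<^sup>2)"
    by (simp add: l2norm_cong_AE[OF A1 L2_bounded_linear[OF L ggL] A2])
  finally show ?thesis .
qed

lemma hessian_norm:
  fixes v :: "real^2 \<Rightarrow> real^2"
  assumes tr: "triangulation_of \<Omega> \<T>" and T: "T \<in> \<T>" and v: "H2_on T v"
  shows "(l2norm (triM T) (broken_grad \<T> (broken_grad \<T> v)))\<^sup>2 = hess_sq T v"
proof -
  have "(l2norm (triM T) (broken_grad \<T> (broken_grad \<T> v)))\<^sup>2 = (\<Sum>j\<in>UNIV. (l2norm (triM T) (\<lambda>x. \<chi> i. wgrad T (wgrad T v i) j x))\<^sup>2)"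
    using broken_second_gradient_norm[OF tr T v bounded_linear_ident] by simp
  also have "\<dots> = (\<Sum>j\<in>UNIV. \<Sum>i\<in>UNIV. (l2norm (triM T) (wgrad T (wgrad T v i) j))\<^sup>2)"
    by (intro sum.cong refl l2norm_vec_sq H2_on_D(4)[OF v])
  also have "\<dots> = hess_sq T v" unfolding hess_sq_def by (rule sum.swap)
  finally show ?thesis .
qed

text \<open>\<open>second_gradient_le_symm\<close> needs symmetric second derivatives at the point
  in question; for the chosen weak derivatives this is available almost everywhere.\<close>

lemma hessian_le_strain_gradient:
  fixes v :: "real^2 \<Rightarrow> real^2"
  assumes tr: "triangulation_of \<Omega> \<T>" and T: "T \<in> \<T>" and v: "H2_on T v"
  shows "hess_sq T v \<le> 9 * (l2norm (triM T) (broken_grad \<T> (broken_eps \<T> v)))\<^sup>2"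
proof -
  note H = H2_on_D[OF v] and S = triangulation_of_D(2)[OF tr T]
  define a where "a x j i = wgrad T (wgrad T v i) j x" for x j i
  have ggL: "(\<lambda>x. \<chi> i. a x j i) \<in> L2 (triM T)" for j unfolding a_def by (rule L2_vec) (simp add: H)
  note sL = L2_bounded_linear[OF bounded_linear_symm ggL]
  have aL: "(\<lambda>x. a x j i) \<in> L2 (triM T)" for j i unfolding a_def by (simp add: H)
  have "AE x in triM T. \<forall>i j. a x i j = a x j i"
    unfolding AE_all_countable a_def using wgrad_commute[OF S v] by blast
  then have le: "AE x in triM T. (\<Sum>i\<in>UNIV. \<Sum>j\<in>UNIV. (norm (a x j i))\<^sup>2) \<le> 9 * (\<Sum>j\<in>UNIV. (norm (symm (\<chi> i. a x j i)))\<^sup>2)"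
    by (rule eventually_mono) (rule second_gradient_le_symm, blast)
  have "hess_sq T v = (\<integral>x. (\<Sum>i\<in>UNIV. \<Sum>j\<in>UNIV. (norm (a x j i))\<^sup>2) \<partial>triM T)"
    using L2_D(2)[OF aL] by (simp add: hess_sq_def l2norm_sq a_def)
  also have "\<dots> \<le> (\<integral>x. 9 * (\<Sum>j\<in>UNIV. (norm (symm (\<chi> i. a x j i)))\<^sup>2) \<partial>triM T)"
    by (rule integral_mono_AE[OF _ _ le]) (intro Bochner_Integration.integrable_sum integrable_mult_right L2_D(2)[OF aL] L2_D(2)[OF sL])+
  also have "\<dots> = 9 * (\<Sum>j\<in>UNIV. (l2norm (triM T) (\<lambda>x. symm (\<chi> i. a x j i)))\<^sup>2)"
    using L2_D(2)[OF sL] by (simp add: l2norm_sq)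
  also have "(\<Sum>j\<in>UNIV. (l2norm (triM T) (\<lambda>x. symm (\<chi> i. a x j i)))\<^sup>2) = (l2norm (triM T) (broken_grad \<T> (broken_eps \<T> v)))\<^sup>2"
    unfolding a_def broken_eps_symm[abs_def] by (rule broken_second_gradient_norm[OF tr T v bounded_linear_symm, symmetric])
  finally show ?thesis .
qed

section \<open>From elements to the whole domain\<close>

lemma L2_extend_zero:
  fixes g :: "'a::euclidean_space \<Rightarrow> 'b::euclidean_space"
  assumes S: "S \<in> sets lebesgue" "V \<in> sets lebesgue" "S \<subseteq> V" and g: "g \<in> L2 (lebesgue_on S)"
  shows "(\<lambda>x. if x \<in> S then g x else 0) \<in> L2 (lebesgue_on V)"
proof -
  have e: "indicator V x *\<^sub>R (if x \<in> S then g x else 0) = indicator S x *\<^sub>R g x"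
    "indicator V x *\<^sub>R (norm (if x \<in> S then g x else 0))\<^sup>2 = indicator S x *\<^sub>R (norm (g x))\<^sup>2" for x
    using S(3) by (auto simp: indicator_def)
  have "(\<lambda>x. if x \<in> S then g x else 0) \<in> borel_measurable (lebesgue_on V)"
    using L2_D(1)[OF g] S(1,2) by (simp add: borel_measurable_restrict_space_iff e(1))
  moreover have "integrable (lebesgue_on V) (\<lambda>x. (norm (if x \<in> S then g x else 0))\<^sup>2)"
  proof (rule iffD2[OF integrable_restrict_space], goal_cases)
    case 2
    have "S \<inter> space lebesgue \<in> sets lebesgue" using S(1) by simp
    from iffD1[OF integrable_restrict_space[OF this] L2_D(2)[OF g]] show ?case by (simp only: e(2))
  qed (use S(2) in simp)
  ultimately show ?thesis by (simp add: L2_def)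
qed

text \<open>The interiors are disjoint subsets of \<Omega>, so the integrands add up to at most the
  integrand on \<Omega>. An inequality suffices, hence the measure of the edges need not be
  discussed.\<close>

lemma sum_l2norm_le:
  fixes w :: "real^2 \<Rightarrow> 'b::euclidean_space"
  assumes tr: "triangulation_of \<Omega> \<T>" and P: "bounded_polygon \<Omega>" and w: "w \<in> L2 (lebesgue_on \<Omega>)"
  shows "(\<Sum>T\<in>\<T>. (l2norm (triM T) w)\<^sup>2) \<le> (l2norm (lebesgue_on \<Omega>) w)\<^sup>2"
proof -
  note R = triangulation_of_D[OF tr] and PD = polygon_D[OF P]
  have sub: "interior T \<subseteq> \<Omega>" if "T \<in> \<T>" for T
    using that R(4) PD(3) by (metis Union_upper interior_mono)
  have ms: "\<Omega> \<inter> space lebesgue \<in> sets lebesgue" "interior T \<inter> space lebesgue \<in> sets lebesgue" for T :: "(real^2) set"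
    using PD(1) by simp_all
  have iO: "integrable lebesgue (\<lambda>x. indicator \<Omega> x *\<^sub>R (norm (w x))\<^sup>2)"
    using L2_D(2)[OF w] integrable_restrict_space[OF ms(1), of "\<lambda>x. (norm (w x))\<^sup>2"] by simp
  have iT: "integrable lebesgue (\<lambda>x. indicator (interior T) x *\<^sub>R (norm (w x))\<^sup>2)" if T: "T \<in> \<T>" for T
  proof -
    have "integrable lebesgue (\<lambda>x. indicator (interior T) x *\<^sub>R (indicator \<Omega> x *\<^sub>R (norm (w x))\<^sup>2))"
      by (rule integrable_mult_indicator[OF _ iO]) simp
    moreover have "indicator (interior T) x *\<^sub>R (indicator \<Omega> x *\<^sub>R (norm (w x))\<^sup>2) = indicator (interior T) x *\<^sub>R (norm (w x))\<^sup>2" for x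
      using sub[OF T] by (auto simp: indicator_def)
    ultimately show ?thesis by (simp only:)
  qed
  have "(\<Sum>T\<in>\<T>. (l2norm (triM T) w)\<^sup>2) = (\<Sum>T\<in>\<T>. \<integral>x. indicator (interior T) x *\<^sub>R (norm (w x))\<^sup>2 \<partial>lebesgue)"
    by (simp only: l2norm_sq triM_def integral_restrict_space[OF ms(2)])
  also have "\<dots> = (\<integral>x. (\<Sum>T\<in>\<T>. indicator (interior T) x *\<^sub>R (norm (w x))\<^sup>2) \<partial>lebesgue)"
    by (rule Bochner_Integration.integral_sum[symmetric]) (rule iT)
  also have "\<dots> \<le> (\<integral>x. indicator \<Omega> x *\<^sub>R (norm (w x))\<^sup>2 \<partial>lebesgue)"
  proof (rule integral_mono[OF Bochner_Integration.integrable_sum[OF iT] iO])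
    fix x
    show "(\<Sum>T\<in>\<T>. indicator (interior T) x *\<^sub>R (norm (w x))\<^sup>2) \<le> indicator \<Omega> x *\<^sub>R (norm (w x))\<^sup>2"
    proof (cases "\<exists>T\<in>\<T>. x \<in> interior T")
      case True
      then obtain T where T: "T \<in> \<T>" "x \<in> interior T" by blast
      have "indicator (interior S) x = (if S = T then 1 else 0 :: real)" if S: "S \<in> \<T>" for S
      proof (cases "S = T")
        case False
        then have "x \<notin> interior S" using compatible_interior_eq[OF R(3)[OF S T(1)] _ T(2)] by blast
        then show ?thesis using False by simp
      next
        case True
        then show ?thesis using T(2) by simp
      qed
      then have "(\<Sum>S\<in>\<T>. indicator (interior S) x *\<^sub>R (norm (w x))\<^sup>2) = (\<Sum>S\<in>\<T>. (if S = T then 1 else 0) *\<^sub>R (norm (w x))\<^sup>2)"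
        by (intro sum.cong) simp_all
      also have "\<dots> = (\<Sum>S\<in>\<T>. if S = T then (norm (w x))\<^sup>2 else 0)" by (intro sum.cong) simp_all
      also have "\<dots> = (norm (w x))\<^sup>2" unfolding sum.delta[OF R(1)] using T(1) by (simp only: if_True)
      also have "\<dots> = indicator \<Omega> x *\<^sub>R (norm (w x))\<^sup>2" using sub[OF T(1)] T(2) by (simp add: subset_iff)
      finally show ?thesis by (simp only: order_refl)
    next
      case False
      then have "(\<Sum>T\<in>\<T>. indicator (interior T) x *\<^sub>R (norm (w x))\<^sup>2) = 0" by (intro sum.neutral) auto
      then show ?thesis by simp
    qed
  qed
  also have "\<dots> = (l2norm (lebesgue_on \<Omega>) w)\<^sup>2" by (simp only: l2norm_sq integral_restrict_space[OF ms(1)])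
  finally show ?thesis .
qed

text \<open>Without this, the norm of the strain on \<Omega> might be the default value 0 and could
  not dominate the elementwise norms.\<close>

lemma broken_eps_L2:
  fixes v :: "real^2 \<Rightarrow> real^2"
  assumes tr: "triangulation_of \<Omega> \<T>" and P: "bounded_polygon \<Omega>" and v: "\<And>T. T \<in> \<T> \<Longrightarrow> H2_on T v"
  shows "broken_eps \<T> v \<in> L2 (lebesgue_on \<Omega>)"
proof -
  note R = triangulation_of_D[OF tr] and PD = polygon_D[OF P]
  have "(\<lambda>x. broken_partial \<T> i v x) \<in> L2 (lebesgue_on \<Omega>)" for i
    unfolding broken_partial_def
  proof (rule L2_sum, rule L2_extend_zero)
    fix T assume T: "T \<in> \<T>"
    show "interior T \<subseteq> \<Omega>" using T R(4) PD(3) by (metis Union_upper interior_mono)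
    show "weak_partial (interior T) i v \<in> L2 (lebesgue_on (interior T))"
      using H2_on_D(2)[OF v[OF T], of i] by (simp add: wgrad_def triM_def)
  qed (use PD(1) in auto)
  then have "broken_grad \<T> v \<in> L2 (lebesgue_on \<Omega>)" using L2_vec[of "broken_grad \<T> v"] by (simp add: broken_grad_def)
  from L2_bounded_linear[OF bounded_linear_symm this] show ?thesis by (simp add: broken_eps_symm[abs_def])
qed

section \<open>Sums over edges\<close>

lemma young: "0 < t \<Longrightarrow> x * y \<le> (t * y\<^sup>2 + inverse t * x\<^sup>2) / 2" for x y t :: real
proof -
  assume t: "0 < t"
  have "0 \<le> inverse t * (t * y - x)\<^sup>2" using t by simp
  also have "\<dots> = (inverse t * t) * (t * y\<^sup>2) - 2 * (inverse t * t) * (x * y) + inverse t * x\<^sup>2"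
    by (simp add: power2_eq_square algebra_simps)
  finally show ?thesis using t by simp
qed

text \<open>From a . g - a' . g' = (a - a') . g + a' . (g - g'): each product contains one
  difference, and Young's inequality puts the small weight t on the factor that is not a
  difference.\<close>

lemma product_difference_bound:
  fixes a a' :: "'a \<Rightarrow> 'b::euclidean_space" and g g' :: "2 \<Rightarrow> 'a \<Rightarrow> 'b"
  assumes L: "a \<in> L2 M" "a' \<in> L2 M" "\<And>i. g i \<in> L2 M" "\<And>i. g' i \<in> L2 M" and n: "\<And>i. \<bar>n i\<bar> \<le> (1::real)" and t: "0 < t"
  shows "\<bar>(\<Sum>i\<in>UNIV. n i * (\<integral>x. a x \<bullet> g i x \<partial>M)) - (\<Sum>i\<in>UNIV. n i * (\<integral>x. a' x \<bullet> g' i x \<partial>M))\<bar>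
    \<le> t * ((\<Sum>i\<in>UNIV. (l2norm M (g i))\<^sup>2) + (l2norm M a')\<^sup>2)
      + inverse t * ((l2norm M (\<lambda>x. a x - a' x))\<^sup>2 + (\<Sum>i\<in>UNIV. (l2norm M (\<lambda>x. g i x - g' i x))\<^sup>2))"
proof -
  have q: "\<bar>n i * (\<integral>x. a x \<bullet> g i x \<partial>M) - n i * (\<integral>x. a' x \<bullet> g' i x \<partial>M)\<bar>
    \<le> (t * (l2norm M (g i))\<^sup>2 + inverse t * (l2norm M (\<lambda>x. a x - a' x))\<^sup>2) / 2
      + (inverse t * (l2norm M (\<lambda>x. g i x - g' i x))\<^sup>2 + t * (l2norm M a')\<^sup>2) / 2" for i
  proof -
    have "(\<integral>x. a x \<bullet> g i x \<partial>M) - (\<integral>x. a' x \<bullet> g' i x \<partial>M) = (\<integral>x. (a x - a' x) \<bullet> g i x \<partial>M) + (\<integral>x. a' x \<bullet> (g i x - g' i x) \<partial>M)"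
      using L by (simp add: inner_diff_left inner_diff_right L2_inner_integrable)
    then have "\<bar>(\<integral>x. a x \<bullet> g i x \<partial>M) - (\<integral>x. a' x \<bullet> g' i x \<partial>M)\<bar> \<le> \<bar>\<integral>x. (a x - a' x) \<bullet> g i x \<partial>M\<bar> + \<bar>\<integral>x. a' x \<bullet> (g i x - g' i x) \<partial>M\<bar>"
      by linarith
    also have "\<dots> \<le> l2norm M (\<lambda>x. a x - a' x) * l2norm M (g i) + l2norm M a' * l2norm M (\<lambda>x. g i x - g' i x)"
      by (intro add_mono l2norm_Cauchy_Schwarz L2_diff L)
    also have "\<dots> \<le> (t * (l2norm M (g i))\<^sup>2 + inverse t * (l2norm M (\<lambda>x. a x - a' x))\<^sup>2) / 2
      + (inverse t * (l2norm M (\<lambda>x. g i x - g' i x))\<^sup>2 + t * (l2norm M a')\<^sup>2) / 2"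
      using young[OF t, of "l2norm M (\<lambda>x. a x - a' x)" "l2norm M (g i)"] young[OF t, of "l2norm M (\<lambda>x. g i x - g' i x)" "l2norm M a'"]
      by (simp add: mult.commute add_mono)
    finally have le: "\<bar>(\<integral>x. a x \<bullet> g i x \<partial>M) - (\<integral>x. a' x \<bullet> g' i x \<partial>M)\<bar> \<le> \<dots>" .
    have "\<bar>n i * (\<integral>x. a x \<bullet> g i x \<partial>M) - n i * (\<integral>x. a' x \<bullet> g' i x \<partial>M)\<bar> = \<bar>n i\<bar> * \<bar>(\<integral>x. a x \<bullet> g i x \<partial>M) - (\<integral>x. a' x \<bullet> g' i x \<partial>M)\<bar>"
      by (simp add: abs_mult[symmetric] right_diff_distrib)
    also have "\<dots> \<le> 1 * \<bar>(\<integral>x. a x \<bullet> g i x \<partial>M) - (\<integral>x. a' x \<bullet> g' i x \<partial>M)\<bar>" by (rule mult_right_mono[OF n]) simp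
    also have "\<dots> = \<bar>(\<integral>x. a x \<bullet> g i x \<partial>M) - (\<integral>x. a' x \<bullet> g' i x \<partial>M)\<bar>" by (rule mult_1)
    also note le
    finally show ?thesis .
  qed
  have s: "0 \<le> t * (\<Sum>i\<in>UNIV. (l2norm M (g i))\<^sup>2)" "0 \<le> inverse t * (\<Sum>i\<in>UNIV. (l2norm M (\<lambda>x. g i x - g' i x))\<^sup>2)"
    using t by (simp_all add: sum_nonneg)
  have "\<bar>(\<Sum>i\<in>UNIV. n i * (\<integral>x. a x \<bullet> g i x \<partial>M)) - (\<Sum>i\<in>UNIV. n i * (\<integral>x. a' x \<bullet> g' i x \<partial>M))\<bar>
    = \<bar>\<Sum>i\<in>UNIV. n i * (\<integral>x. a x \<bullet> g i x \<partial>M) - n i * (\<integral>x. a' x \<bullet> g' i x \<partial>M)\<bar>"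
    by (simp only: sum_subtractf)
  also have "\<dots> \<le> (\<Sum>i\<in>UNIV. \<bar>n i * (\<integral>x. a x \<bullet> g i x \<partial>M) - n i * (\<integral>x. a' x \<bullet> g' i x \<partial>M)\<bar>)"
    by (rule sum_abs)
  also have "\<dots> \<le> (\<Sum>i\<in>UNIV. (t * (l2norm M (g i))\<^sup>2 + inverse t * (l2norm M (\<lambda>x. a x - a' x))\<^sup>2) / 2
      + (inverse t * (l2norm M (\<lambda>x. g i x - g' i x))\<^sup>2 + t * (l2norm M a')\<^sup>2) / 2)"
    by (rule sum_mono) (rule q)
  also have "\<dots> = (t * (\<Sum>i\<in>UNIV. (l2norm M (g i))\<^sup>2)) / 2 + inverse t * (l2norm M (\<lambda>x. a x - a' x))\<^sup>2
      + (inverse t * (\<Sum>i\<in>UNIV. (l2norm M (\<lambda>x. g i x - g' i x))\<^sup>2)) / 2 + t * (l2norm M a')\<^sup>2"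
    unfolding sum_2 by (simp add: algebra_simps add_divide_distrib)
  finally show ?thesis using s unfolding distrib_left by linarith
qed

lemma difference_split:
  assumes "a \<in> L2 M" "a' \<in> L2 M" "p \<in> L2 M" "p' \<in> L2 M"
  shows "(l2norm M (\<lambda>x. a x - a' x))\<^sup>2
    \<le> 3 * ((l2norm M (\<lambda>x. p x - p' x))\<^sup>2 + (l2norm M (\<lambda>x. a x - p x))\<^sup>2 + (l2norm M (\<lambda>x. a' x - p' x))\<^sup>2)"
proof -
  have "l2norm M (\<lambda>x. a x - a' x) \<le> l2norm M (\<lambda>x. a x - p x) + (l2norm M (\<lambda>x. p x - p' x) + l2norm M (\<lambda>x. p' x - a' x))"
    using l2norm_triangle_diff[OF assms(1,3,2)] l2norm_triangle_diff[OF assms(3,4,2)] by linarith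
  then have "(l2norm M (\<lambda>x. a x - a' x))\<^sup>2 \<le> (l2norm M (\<lambda>x. p x - p' x) + l2norm M (\<lambda>x. a x - p x) + l2norm M (\<lambda>x. a' x - p' x))\<^sup>2"
    by (intro power_mono) (simp_all add: l2norm_minus_commute[of M p' a'])
  also have "\<dots> \<le> 3 * ((l2norm M (\<lambda>x. p x - p' x))\<^sup>2 + (l2norm M (\<lambda>x. a x - p x))\<^sup>2 + (l2norm M (\<lambda>x. a' x - p' x))\<^sup>2)"
    using norm_add3_sq_le[of "l2norm M (\<lambda>x. p x - p' x)" "l2norm M (\<lambda>x. a x - p x)" "l2norm M (\<lambda>x. a' x - p' x)"] by simp
  finally show ?thesis .
qed

text \<open>Young's weight is \<delta> L with L the edge length. U and U' bound the scaled traces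
  from the two sides, V and V' the scaled projection errors, so that only the jump of the
  projections stays explicit.\<close>

lemma flux_difference_bound:
  fixes a a' p p' :: "'a \<Rightarrow> 'b::euclidean_space" and g g' q q' :: "2 \<Rightarrow> 'a \<Rightarrow> 'b"
  assumes L2: "a \<in> L2 M" "a' \<in> L2 M" "\<And>i. g i \<in> L2 M" "\<And>i. g' i \<in> L2 M" "p \<in> L2 M" "p' \<in> L2 M" "\<And>i. q i \<in> L2 M" "\<And>i. q' i \<in> L2 M"
    and n: "\<And>i. \<bar>n i\<bar> \<le> (1::real)" and \<delta>: "0 < \<delta>" and L: "0 < L"
    and U: "L * ((\<Sum>i\<in>UNIV. (l2norm M (g i))\<^sup>2) + (l2norm M a)\<^sup>2) \<le> U" "L * ((\<Sum>i\<in>UNIV. (l2norm M (g' i))\<^sup>2) + (l2norm M a')\<^sup>2) \<le> U'"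
    and V: "inverse L * ((l2norm M (\<lambda>x. a x - p x))\<^sup>2 + (\<Sum>i\<in>UNIV. (l2norm M (\<lambda>x. g i x - q i x))\<^sup>2)) \<le> V"
      "inverse L * ((l2norm M (\<lambda>x. a' x - p' x))\<^sup>2 + (\<Sum>i\<in>UNIV. (l2norm M (\<lambda>x. g' i x - q' i x))\<^sup>2)) \<le> V'"
  shows "\<bar>(\<Sum>i\<in>UNIV. n i * (\<integral>x. a x \<bullet> g i x \<partial>M)) - (\<Sum>i\<in>UNIV. n i * (\<integral>x. a' x \<bullet> g' i x \<partial>M))\<bar>
    \<le> \<delta> * (U + U') + 3 / \<delta> * (inverse L * ((l2norm M (\<lambda>x. p x - p' x))\<^sup>2 + (\<Sum>i\<in>UNIV. (l2norm M (\<lambda>x. q i x - q' i x))\<^sup>2)) + (V + V'))"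
proof -
  let ?G = "\<Sum>i\<in>UNIV. (l2norm M (g i))\<^sup>2" and ?G' = "\<Sum>i\<in>UNIV. (l2norm M (g' i))\<^sup>2"
  let ?A = "(l2norm M a)\<^sup>2" and ?A' = "(l2norm M a')\<^sup>2"
  let ?X = "(l2norm M (\<lambda>x. a x - a' x))\<^sup>2 + (\<Sum>i\<in>UNIV. (l2norm M (\<lambda>x. g i x - g' i x))\<^sup>2)"
  let ?Y = "(l2norm M (\<lambda>x. p x - p' x))\<^sup>2 + (\<Sum>i\<in>UNIV. (l2norm M (\<lambda>x. q i x - q' i x))\<^sup>2)"
  let ?Z = "(l2norm M (\<lambda>x. a x - p x))\<^sup>2 + (\<Sum>i\<in>UNIV. (l2norm M (\<lambda>x. g i x - q i x))\<^sup>2)"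
  let ?Z' = "(l2norm M (\<lambda>x. a' x - p' x))\<^sup>2 + (\<Sum>i\<in>UNIV. (l2norm M (\<lambda>x. g' i x - q' i x))\<^sup>2)"
  have "?X \<le> 3 * (?Y + (?Z + ?Z'))"
    using difference_split[OF L2(1,2,5,6)] difference_split[OF L2(3,4,7,8), of 1 1 1 1] difference_split[OF L2(3,4,7,8), of 2 2 2 2]
    unfolding sum_2 by argo
  then have X: "inverse L * ?X \<le> inverse L * (3 * (?Y + (?Z + ?Z')))" using L by (intro mult_left_mono) auto
  also have "\<dots> = 3 * (inverse L * ?Y + (inverse L * ?Z + inverse L * ?Z'))" by (simp add: algebra_simps)
  also have "\<dots> \<le> 3 * (inverse L * ?Y + (V + V'))" by (intro mult_left_mono add_mono V order_refl) simp
  finally have X: "inverse L * ?X \<le> 3 * (inverse L * ?Y + (V + V'))" .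
  \<comment> \<open>The product bound pairs the gradient traces of one side with the function trace
    of the other; adding the two missing nonnegative terms completes them to U + U'.\<close>
  have "0 \<le> L * ?A" "0 \<le> L * ?G'" using L by (simp_all add: sum_nonneg)
  then have W: "L * (?G + ?A') \<le> U + U'" using U unfolding distrib_left by linarith
  have "\<bar>(\<Sum>i\<in>UNIV. n i * (\<integral>x. a x \<bullet> g i x \<partial>M)) - (\<Sum>i\<in>UNIV. n i * (\<integral>x. a' x \<bullet> g' i x \<partial>M))\<bar>
    \<le> (\<delta> * L) * (?G + ?A') + inverse (\<delta> * L) * ?X"
    by (rule product_difference_bound[OF L2(1-4) n]) (use \<delta> L in simp)
  also have "\<dots> = \<delta> * (L * (?G + ?A')) + inverse \<delta> * (inverse L * ?X)" by (simp add: mult.assoc)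
  also have "\<dots> \<le> \<delta> * (U + U') + inverse \<delta> * (3 * (inverse L * ?Y + (V + V')))"
    using W X \<delta> by (intro add_mono mult_left_mono) auto
  finally show ?thesis by (simp add: field_simps)
qed

text \<open>The powers of h balance: traces squared cost 1/h and are multiplied by h_e, projection
  errors squared cost h and are divided by h_e. Both bounds are thus uniform in the mesh size; h0
  only caps positive powers of h.\<close>

lemma element_edge_bounds:
  fixes v :: "real^2 \<Rightarrow> real^2"
  assumes e: "tri_edge T e a b c" and sh: "diameter T \<le> \<sigma> * inball_diameter T" and v: "H2_on T v"
    and h: "diameter T \<le> h0" "1 \<le> h0"
  shows "edge_trace T e v \<in> L2 (edge_measure e)" "edge_trace T e (wgrad T v i) \<in> L2 (edge_measure e)"
    "diameter e * ((\<Sum>i\<in>UNIV. (l2norm (edge_measure e) (edge_trace T e (wgrad T v i)))\<^sup>2) + (l2norm (edge_measure e) (edge_trace T e v))\<^sup>2)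
      \<le> \<sigma> * (3 + h0\<^sup>2) * ((l2norm (triM T) v)\<^sup>2 + grad_sq T v + hess_sq T v)" (is ?claim1)
    "inverse (diameter e) * ((l2norm (edge_measure e) (\<lambda>x. edge_trace T e v x - edge_proj e (edge_trace T e v) x))\<^sup>2
       + (\<Sum>i\<in>UNIV. (l2norm (edge_measure e) (\<lambda>x. edge_trace T e (wgrad T v i) x - edge_proj e (edge_trace T e (wgrad T v i)) x))\<^sup>2))
      \<le> \<sigma>\<^sup>2 * (40 + 38 * h0\<^sup>2) * (eps_sq T v + hess_sq T v)" (is ?claim2)
proof -
  obtain \<phi> where \<phi>: "H1_approx T \<phi> v (wgrad T v)" "\<And>i. H1_approx T (\<lambda>n. cpartial i (\<phi> n)) (wgrad T v i) (wgrad T (wgrad T v i))"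
    using H2_on_approx[OF tri_edge_simplex(1)[OF e] v] by metis
  show "edge_trace T e v \<in> L2 (edge_measure e)"
    by (rule L2lim_D(2)[OF edge_trace_limit[OF e sh \<phi>(1)[unfolded wgrad_def[abs_def]]]])
  show "edge_trace T e (wgrad T v i) \<in> L2 (edge_measure e)"
    by (rule L2lim_D(2)[OF edge_trace_limit[OF e sh \<phi>(2)[of i, unfolded wgrad_def[of T "wgrad T v i", abs_def]]]])
  note S = tri_edge_shape[OF e sh]
  let ?M = "edge_measure e" and ?h = "diameter T" and ?L = "diameter e"
  let ?A = "(l2norm (triM T) v)\<^sup>2" and ?B = "grad_sq T v" and ?D = "hess_sq T v" and ?E = "eps_sq T v"
  let ?a = "(l2norm ?M (edge_trace T e v))\<^sup>2" and ?g = "\<Sum>i\<in>UNIV. (l2norm ?M (edge_trace T e (wgrad T v i)))\<^sup>2"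
  have nn: "0 \<le> ?A" "0 \<le> ?B" "0 \<le> ?D" "0 \<le> ?E" "0 \<le> ?a" "0 \<le> ?g"
    by (simp_all add: grad_sq_def hess_sq_def eps_sq_def sum_nonneg)
  have L: "0 < ?L" "?L \<le> ?h" "?h \<le> \<sigma> * ?L" "0 < ?h" and \<sigma>: "0 < \<sigma>"
    using S(1-5) by (simp_all only: order.strict_trans2[OF S(2,3)])
  have h2: "?h\<^sup>2 \<le> h0\<^sup>2" using h L by (intro power_mono) auto
  have "?h * ?g = (\<Sum>i\<in>UNIV. ?h * (l2norm ?M (edge_trace T e (wgrad T v i)))\<^sup>2)" by (rule sum_distrib_left)
  also have "\<dots> \<le> (\<Sum>i\<in>UNIV. \<sigma> * (3 * (l2norm (triM T) (wgrad T v i))\<^sup>2 + ?h\<^sup>2 * (\<Sum>j\<in>UNIV. (l2norm (triM T) (wgrad T (wgrad T v i) j))\<^sup>2)))"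
    by (rule sum_mono) (rule trace_bound[OF e sh \<phi>(2)])
  also have "\<dots> = \<sigma> * (3 * ?B + ?h\<^sup>2 * ?D)"
    unfolding grad_sq_def hess_sq_def by (simp only: sum_distrib_left[symmetric] sum.distrib)
  finally have g: "?h * ?g \<le> \<sigma> * (3 * ?B + ?h\<^sup>2 * ?D)" .
  have a: "?h * ?a \<le> \<sigma> * (3 * ?A + ?h\<^sup>2 * ?B)" using trace_bound[OF e sh \<phi>(1)] by (simp add: grad_sq_def)
  have "?L * (?g + ?a) \<le> ?h * (?g + ?a)" using L nn by (intro mult_right_mono) auto
  also have "\<dots> \<le> \<sigma> * ((3 * ?B + ?h\<^sup>2 * ?D) + (3 * ?A + ?h\<^sup>2 * ?B))" using a g unfolding distrib_left by linarith
  also have "\<dots> \<le> \<sigma> * ((3 + h0\<^sup>2) * (?A + ?B + ?D))"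
  proof (rule mult_left_mono)
    have "?h\<^sup>2 * ?D \<le> h0\<^sup>2 * ?D" "?h\<^sup>2 * ?B \<le> h0\<^sup>2 * ?B" using h2 nn by (intro mult_right_mono; simp)+
    moreover have "0 \<le> h0\<^sup>2 * ?A" using nn by simp
    ultimately show "(3 * ?B + ?h\<^sup>2 * ?D) + (3 * ?A + ?h\<^sup>2 * ?B) \<le> (3 + h0\<^sup>2) * (?A + ?B + ?D)"
      using nn unfolding distrib_left distrib_right by linarith
  qed (use \<sigma> in simp)
  finally show ?claim1 by (simp add: mult.assoc)
  let ?p = "(l2norm ?M (\<lambda>x. edge_trace T e v x - edge_proj e (edge_trace T e v) x))\<^sup>2"
  let ?q = "\<Sum>i\<in>UNIV. (l2norm ?M (\<lambda>x. edge_trace T e (wgrad T v i) x - edge_proj e (edge_trace T e (wgrad T v i)) x))\<^sup>2"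
  have p: "?p \<le> \<sigma> * ?h * (3 * ?E + 38 * ?h\<^sup>2 * ?D)" by (rule proj_error_rigid[OF e sh v])
  have "?q \<le> (\<Sum>i\<in>UNIV. 37 * \<sigma> * ?h * (\<Sum>j\<in>UNIV. (l2norm (triM T) (wgrad T (wgrad T v i) j))\<^sup>2))"
    by (rule sum_mono) (rule proj_error_const[OF e sh \<phi>(2)])
  also have "\<dots> = \<sigma> * ?h * (37 * ?D)" unfolding hess_sq_def by (simp add: sum_distrib_left[symmetric] mult_ac)
  finally have q: "?q \<le> \<sigma> * ?h * (37 * ?D)" .
  have R: "3 * ?E + 38 * ?h\<^sup>2 * ?D + 37 * ?D \<le> (40 + 38 * h0\<^sup>2) * (?E + ?D)"
  proof -
    have "?h\<^sup>2 * ?D \<le> h0\<^sup>2 * ?D" using h2 nn by (intro mult_right_mono)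
    moreover have "0 \<le> h0\<^sup>2 * ?E" using nn by simp
    ultimately show ?thesis using nn unfolding distrib_left distrib_right mult.assoc by linarith
  qed
  have "?p + ?q \<le> \<sigma> * ?h * (3 * ?E + 38 * ?h\<^sup>2 * ?D + 37 * ?D)" using p q unfolding distrib_left by linarith
  also have "\<dots> \<le> \<sigma> * ?h * ((40 + 38 * h0\<^sup>2) * (?E + ?D))" using R \<sigma> L by (intro mult_left_mono) auto
  \<comment> \<open>The second factor \<sigma> arises here, from h \<le> \<sigma> h_e, so that h_e
    cancels.\<close>
  also have "\<dots> \<le> \<sigma> * (\<sigma> * ?L) * ((40 + 38 * h0\<^sup>2) * (?E + ?D))"
    using L \<sigma> nn by (intro mult_right_mono mult_left_mono) auto
  finally have "inverse ?L * (?p + ?q) \<le> inverse ?L * (\<sigma> * (\<sigma> * ?L) * ((40 + 38 * h0\<^sup>2) * (?E + ?D)))"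
    using L by (intro mult_left_mono) auto
  also have "\<dots> = \<sigma>\<^sup>2 * (40 + 38 * h0\<^sup>2) * (?E + ?D)" using L(1) by (simp add: power2_eq_square)
  finally show ?claim2 .
qed

lemma jump_boundary:
  assumes "e \<subseteq> frontier \<Omega>" "{S \<in> \<T>. e edge_of S} = {T}"
  shows "jump \<Omega> \<T> e \<gamma> = \<gamma> T"
proof -
  have "(THE T. T \<in> \<T> \<and> e edge_of T) = T" using assms(2) by (intro the_equality) auto
  then show ?thesis using assms(1) by (simp add: jump_def)
qed

text \<open>The choice in \<open>jump\<close> may return the two elements in either order; this
  affects the sign only, to which the norm is blind.\<close>

lemma jump_interior:
  assumes "\<not> e \<subseteq> frontier \<Omega>" "{S \<in> \<T>. e edge_of S} = {T, T'}" "T \<noteq> T'"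
  shows "l2norm M (jump \<Omega> \<T> e \<gamma>) = l2norm M (\<lambda>x. \<gamma> T x - \<gamma> T' x)"
proof -
  let ?P = "\<lambda>(T, T'). T \<in> \<T> \<and> T' \<in> \<T> \<and> T \<noteq> T' \<and> e edge_of T \<and> e edge_of T'"
  obtain S S' where S: "Eps ?P = (S, S')" by (rule prod.exhaust)
  have "?P (T, T')" using assms(2,3) by auto
  then have "?P (Eps ?P)" by (rule someI)
  then have "S \<in> {T, T'}" "S' \<in> {T, T'}" "S \<noteq> S'" unfolding S assms(2)[symmetric] by auto
  then have "S = T \<and> S' = T' \<or> S = T' \<and> S' = T" by auto
  moreover have "jump \<Omega> \<T> e \<gamma> = (\<lambda>x. \<gamma> S x - \<gamma> S' x)" using assms(1) S by (simp add: jump_def)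
  ultimately show ?thesis using l2norm_minus_commute[of M "\<gamma> T" "\<gamma> T'"] by auto
qed

definition flux :: "(real^2) set \<Rightarrow> (real^2) set \<Rightarrow> (real^2 \<Rightarrow> real^2) \<Rightarrow> real" where
  "flux T e v = (\<Sum>i\<in>UNIV. nu e $ i * (\<integral>x. edge_trace T e v x \<bullet> edge_trace T e (wgrad T v i) x \<partial>edge_measure e))"

lemma abs_orient: "\<bar>orient T e\<bar> = 1"
  by (simp add: orient_def split: prod.split)

text \<open>At an interior edge the orientations are opposite, so the two signed fluxes form a
  difference, as \<open>flux_difference_bound\<close> requires.\<close>

lemma edge_flux_bound:
  fixes v :: "real^2 \<Rightarrow> real^2"
  assumes P: "bounded_polygon \<Omega>" and tr: "triangulation_of \<Omega> \<T>" and sh: "\<And>T. T \<in> \<T> \<Longrightarrow> diameter T \<le> \<sigma> * inball_diameter T"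
    and v: "\<And>T. T \<in> \<T> \<Longrightarrow> H2_on T v" and h: "\<And>T. T \<in> \<T> \<Longrightarrow> diameter T \<le> h0" "1 \<le> h0"
    and e: "e \<in> edges \<T>" and \<delta>: "0 < \<delta>"
  shows "\<bar>\<Sum>T\<in>{T \<in> \<T>. e edge_of T}. orient T e * flux T e v\<bar>
    \<le> (\<Sum>T\<in>{T \<in> \<T>. e edge_of T}. \<delta> * (\<sigma> * (3 + h0\<^sup>2) * ((l2norm (triM T) v)\<^sup>2 + grad_sq T v + hess_sq T v))
          + 3 / \<delta> * (\<sigma>\<^sup>2 * (40 + 38 * h0\<^sup>2) * (eps_sq T v + hess_sq T v)))
      + 3 / \<delta> * (inverse (diameter e) * ((l2norm (edge_measure e) (jump_proj \<Omega> \<T> e v))\<^sup>2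
          + (\<Sum>i\<in>UNIV. (l2norm (edge_measure e) (jump_proj \<Omega> \<T> e (broken_partial \<T> i v)))\<^sup>2)))"
proof -
  note R = triangulation_of_D[OF tr]
  obtain T where T: "T \<in> \<T>" "e edge_of T" using e by (auto simp: edges_def)
  obtain a b c where E: "tri_edge T e a b c" using simplex2_edge[OF R(2)[OF T(1)] T(2)] by blast
  let ?M = "edge_measure e"
  let ?U = "\<lambda>T. \<sigma> * (3 + h0\<^sup>2) * ((l2norm (triM T) v)\<^sup>2 + grad_sq T v + hess_sq T v)"
  let ?V = "\<lambda>T. \<sigma>\<^sup>2 * (40 + 38 * h0\<^sup>2) * (eps_sq T v + hess_sq T v)"
  note B = element_edge_bounds[OF E sh[OF T(1)] v[OF T(1)] h(1)[OF T(1)] h(2)]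
  have L: "0 < diameter e" using tri_edge_shape(1,2)[OF E sh[OF T(1)]] by simp
  have n1: "\<bar>nu e $ i\<bar> \<le> 1" for i using component_le_norm_cart[of "nu e" i] nu_props(1)[OF E] by simp
  have PL: "edge_proj e w \<in> L2 ?M" if "w \<in> L2 ?M" for w by (rule P1_minus_L2[OF E edge_proj(1)[OF E that]])
  show ?thesis
  proof (cases "e \<subseteq> frontier \<Omega>")
    case True
    have "S = T" if "S \<in> \<T>" "e edge_of S" for S by (rule boundary_edge_unique[OF P tr True T that])
    then have s: "{S \<in> \<T>. e edge_of S} = {T}" using T by blast
    \<comment> \<open>On a boundary edge the neighbour is the zero function, with U' = V' =
      0.\<close>
    have "\<bar>(\<Sum>i\<in>UNIV. nu e $ i * (\<integral>x. edge_trace T e v x \<bullet> edge_trace T e (wgrad T v i) x \<partial>?M)) - (\<Sum>i\<in>UNIV. nu e $ i * (\<integral>x. (\<lambda>x. 0::real^2) x \<bullet> (\<lambda>i x. 0) i x \<partial>?M))\<bar>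
      \<le> \<delta> * (?U T + 0) + 3 / \<delta> * (inverse (diameter e) * ((l2norm ?M (\<lambda>x. edge_proj e (edge_trace T e v) x - (\<lambda>x. 0) x))\<^sup>2
         + (\<Sum>i\<in>UNIV. (l2norm ?M (\<lambda>x. edge_proj e (edge_trace T e (wgrad T v i)) x - (\<lambda>i x. 0) i x))\<^sup>2)) + (?V T + 0))"
      by (rule flux_difference_bound[OF B(1) L2_zero B(2) L2_zero PL[OF B(1)] L2_zero PL[OF B(2)] L2_zero n1 \<delta> L B(3) _ B(4)])
        (simp_all add: l2norm_def)
    then have F: "\<bar>flux T e v\<bar> \<le> \<delta> * ?U T + 3 / \<delta> * (inverse (diameter e) * ((l2norm ?M (edge_proj e (edge_trace T e v)))\<^sup>2
         + (\<Sum>i\<in>UNIV. (l2norm ?M (edge_proj e (edge_trace T e (wgrad T v i))))\<^sup>2)) + ?V T)"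
      by (simp add: flux_def)
    have "jump_proj \<Omega> \<T> e v = edge_proj e (edge_trace T e v)"
      "jump_proj \<Omega> \<T> e (broken_partial \<T> i v) = edge_proj e (edge_trace T e (wgrad T v i))" for i
      unfolding jump_proj_def jump_boundary[OF True s] edge_trace_broken[OF tr T(1)] by (rule refl)+
    with F show ?thesis unfolding s by (simp add: abs_mult abs_orient distrib_left)
  next
    case False
    obtain T' where T': "T' \<in> \<T>" "T' \<noteq> T" and s: "{S \<in> \<T>. e edge_of S} = {T, T'}"
      by (rule interior_edge_pair[OF P tr False T])
    have T'e: "e edge_of T'" using s by blast
    obtain a' b' c' where E0: "tri_edge T' e a' b' c'" using simplex2_edge[OF R(2)[OF T'(1)] T'e] by blast
    then have E': "tri_edge T' e a' b c" using tri_edge_same_ends[OF E E0] by simp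
    have o: "orient T' e = - orient T e"
      by (rule orient_opposite(1)[OF E E' R(3)[OF T(1) T'(1)]]) (use T'(2) in simp)
    note B' = element_edge_bounds[OF E' sh[OF T'(1)] v[OF T'(1)] h(1)[OF T'(1)] h(2)]
    have F: "\<bar>flux T e v - flux T' e v\<bar>
      \<le> \<delta> * (?U T + ?U T') + 3 / \<delta> * (inverse (diameter e) * ((l2norm ?M (\<lambda>x. edge_proj e (edge_trace T e v) x - edge_proj e (edge_trace T' e v) x))\<^sup>2
         + (\<Sum>i\<in>UNIV. (l2norm ?M (\<lambda>x. edge_proj e (edge_trace T e (wgrad T v i)) x - edge_proj e (edge_trace T' e (wgrad T' v i)) x))\<^sup>2)) + (?V T + ?V T'))"
      unfolding flux_def
      by (rule flux_difference_bound[OF B(1) B'(1) B(2) B'(2) PL[OF B(1)] PL[OF B'(1)] PL[OF B(2)] PL[OF B'(2)] n1 \<delta> L B(3) B'(3) B(4) B'(4)])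
    have j: "l2norm ?M (jump_proj \<Omega> \<T> e v) = l2norm ?M (\<lambda>x. edge_proj e (edge_trace T e v) x - edge_proj e (edge_trace T' e v) x)"
      "l2norm ?M (jump_proj \<Omega> \<T> e (broken_partial \<T> i v)) = l2norm ?M (\<lambda>x. edge_proj e (edge_trace T e (wgrad T v i)) x - edge_proj e (edge_trace T' e (wgrad T' v i)) x)" for i
      unfolding jump_proj_def jump_interior[OF False s T'(2)[symmetric]] edge_trace_broken[OF tr T(1)] edge_trace_broken[OF tr T'(1)] by (rule refl)+
    have "(\<Sum>T\<in>{T, T'}. orient T e * flux T e v) = orient T e * (flux T e v - flux T' e v)"
      using T'(2) by (simp add: o algebra_simps)
    then have "\<bar>\<Sum>T\<in>{T, T'}. orient T e * flux T e v\<bar> = \<bar>flux T e v - flux T' e v\<bar>" by (simp add: abs_mult abs_orient)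
    also note F
    also have "\<delta> * (?U T + ?U T') + 3 / \<delta> * (inverse (diameter e) * J + (?V T + ?V T')) = (\<Sum>T\<in>{T, T'}. \<delta> * ?U T + 3 / \<delta> * ?V T) + 3 / \<delta> * (inverse (diameter e) * J)" for J
      using T'(2) by (simp only: sum.insert finite.intros sum.empty distrib_left) simp
    finally show ?thesis unfolding s j .
  qed
qed

section \<open>Summation over elements and absorption of the gradient\<close>

lemma simplex2_edges_card:
  assumes "2 simplex (T :: (real^2) set)"
  shows "finite {e. e edge_of T}" "card {e. e edge_of T} \<le> 3" "{e. e edge_of T} \<noteq> {}"
proof -
  obtain p q r where T: "T = convex hull {p, q, r}" "\<not> affine_dependent {p, q, r}" "p \<noteq> q" "q \<noteq> r" "p \<noteq> r"
    using simplex2_vertices[OF assms] by metis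
  note E = triangle_edges[OF T(2-5) T(1)]
  show "finite {e. e edge_of T}" "{e. e edge_of T} \<noteq> {}" unfolding E by auto
  show "card {e. e edge_of T} \<le> 3" unfolding E by (rule order_trans[OF card_insert_le_m1[of 3]]) (auto intro: order_trans[OF card_insert_le_m1[of 2]])
qed

lemma sum_elements_edges:
  fixes f :: "(real^2) set \<Rightarrow> (real^2) set \<Rightarrow> real"
  assumes tr: "triangulation_of \<Omega> \<T>"
  shows "finite (edges \<T>)" "(\<Sum>T\<in>\<T>. \<Sum>e\<in>{e. e edge_of T}. f T e) = (\<Sum>e\<in>edges \<T>. \<Sum>T\<in>{T \<in> \<T>. e edge_of T}. f T e)"
proof -
  note R = triangulation_of_D[OF tr]
  have "edges \<T> = (\<Union>T\<in>\<T>. {e. e edge_of T})" by (auto simp: edges_def)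
  then show f: "finite (edges \<T>)" using R(1) simplex2_edges_card(1)[OF R(2)] by auto
  have "(\<Sum>T\<in>\<T>. \<Sum>e\<in>{e. e edge_of T}. f T e) = (\<Sum>T\<in>\<T>. \<Sum>e\<in>{e \<in> edges \<T>. e edge_of T}. f T e)"
    by (intro sum.cong refl) (auto simp: edges_def)
  also have "\<dots> = (\<Sum>e\<in>edges \<T>. \<Sum>T\<in>{T \<in> \<T>. e edge_of T}. f T e)" by (rule sum.swap_restrict[OF R(1) f])
  finally show "(\<Sum>T\<in>\<T>. \<Sum>e\<in>{e. e edge_of T}. f T e) = \<dots>" .
qed

text \<open>Only the two diagonal second derivatives occur. Young's inequality with weight 1 uses
  half of |v|^2 for each of them.\<close>

lemma interior_term_bound:
  fixes v :: "real^2 \<Rightarrow> real^2"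
  assumes v: "H2_on T v"
  shows "- (\<Sum>i\<in>UNIV. \<integral>x. v x \<bullet> wgrad T (wgrad T v i) i x \<partial>triM T) \<le> (l2norm (triM T) v)\<^sup>2 + hess_sq T v"
proof -
  note H = H2_on_D[OF v]
  let ?g = "\<lambda>i j. (l2norm (triM T) (wgrad T (wgrad T v i) j))\<^sup>2"
  have "- (\<Sum>i\<in>UNIV. \<integral>x. v x \<bullet> wgrad T (wgrad T v i) i x \<partial>triM T) = (\<Sum>i\<in>UNIV. - (\<integral>x. v x \<bullet> wgrad T (wgrad T v i) i x \<partial>triM T))"
    by (rule sum_negf[symmetric])
  also have "\<dots> \<le> (\<Sum>i\<in>UNIV. (?g i i + (l2norm (triM T) v)\<^sup>2) / 2)"
  proof (rule sum_mono)
    fix i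
    show "- (\<integral>x. v x \<bullet> wgrad T (wgrad T v i) i x \<partial>triM T) \<le> (?g i i + (l2norm (triM T) v)\<^sup>2) / 2"
      using l2norm_Cauchy_Schwarz[OF H(1) H(4)[of i i]] young[of 1 "l2norm (triM T) v" "l2norm (triM T) (wgrad T (wgrad T v i) i)"] by simp
  qed
  also have "\<dots> \<le> (l2norm (triM T) v)\<^sup>2 + hess_sq T v"
  proof -
    have "0 \<le> ?g i j" for i j by simp
    from this[of 1 1] this[of 1 2] this[of 2 1] this[of 2 2] show ?thesis
      unfolding hess_sq_def sum_2 by argo
  qed
  finally show ?thesis .
qed

text \<open>S contains B / 2; after doubling the inequality, one copy of B moves to the left. A, B,
  D stand for the squared norms of v, of its gradient and of its Hessian.\<close>

lemma absorb_half:
  fixes A B D S p q r :: real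
  assumes "B \<le> A + D + (S + 18 * r)" "S = (A + B + D) / 2 + 3 * (p + q)"
  shows "B \<le> 3 * A + 6 * p + (3 * D + 6 * q) + 36 * r"
proof -
  have "2 * B \<le> 2 * (A + D + (S + 18 * r))" using assms(1) by simp
  also have "\<dots> = B + (3 * A + 6 * p + (3 * D + 6 * q) + 36 * r)" unfolding assms(2) by (simp add: field_simps)
  finally show ?thesis by simp
qed

lemma broken_gradient_bound:
  fixes v :: "real^2 \<Rightarrow> real^2"
  assumes P: "bounded_polygon \<Omega>" and tr: "triangulation_of \<Omega> \<T>" and sh: "\<And>T. T \<in> \<T> \<Longrightarrow> diameter T \<le> \<sigma> * inball_diameter T"
    and v: "\<And>T. T \<in> \<T> \<Longrightarrow> H2_on T v" and h: "\<And>T. T \<in> \<T> \<Longrightarrow> diameter T \<le> h0" "1 \<le> h0" and \<sigma>: "0 < \<sigma>"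
  defines "\<kappa> \<equiv> \<sigma> * (3 + h0\<^sup>2)"
  defines "c \<equiv> 18 * \<kappa> * (\<sigma>\<^sup>2 * (40 + 38 * h0\<^sup>2))"
  shows "(\<Sum>T\<in>\<T>. grad_sq T v) \<le> 3 * (\<Sum>T\<in>\<T>. (l2norm (triM T) v)\<^sup>2) + 6 * c * (\<Sum>T\<in>\<T>. eps_sq T v) + (3 + 6 * c) * (\<Sum>T\<in>\<T>. hess_sq T v)
    + 36 * \<kappa> * (\<Sum>e\<in>edges \<T>. inverse (diameter e) * ((l2norm (edge_measure e) (jump_proj \<Omega> \<T> e v))\<^sup>2
          + (\<Sum>i\<in>UNIV. (l2norm (edge_measure e) (jump_proj \<Omega> \<T> e (broken_partial \<T> i v)))\<^sup>2)))"
proof -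
  note R = triangulation_of_D[OF tr]
  have \<kappa>: "0 < \<kappa>" unfolding \<kappa>_def using \<sigma> by (intro mult_pos_pos add_pos_nonneg) auto
  have c: "0 \<le> c" unfolding c_def using \<kappa> by (intro mult_nonneg_nonneg add_nonneg_nonneg) auto
  \<comment> \<open>Each edge then takes \<delta> \<kappa> = 1/6 of the gradient norm of an adjacent
    element, and three edges take one half of it.\<close>
  define \<delta> where "\<delta> = 1 / (6 * \<kappa>)"
  have \<delta>: "0 < \<delta>" "\<delta> * \<kappa> = 1 / 6" "3 / \<delta> = 18 * \<kappa>" using \<kappa> by (simp_all add: \<delta>_def)
  let ?A = "\<lambda>T. (l2norm (triM T) v)\<^sup>2" and ?B = "\<lambda>T. grad_sq T v" and ?D = "\<lambda>T. hess_sq T v" and ?E = "\<lambda>T. eps_sq T v"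
  let ?J = "\<lambda>e. inverse (diameter e) * ((l2norm (edge_measure e) (jump_proj \<Omega> \<T> e v))\<^sup>2
          + (\<Sum>i\<in>UNIV. (l2norm (edge_measure e) (jump_proj \<Omega> \<T> e (broken_partial \<T> i v)))\<^sup>2))"
  define G where "G T = (?A T + ?B T + ?D T) / 6 + c * (?E T + ?D T)" for T
  have G0: "0 \<le> G T" for T using c by (simp add: G_def grad_sq_def hess_sq_def eps_sq_def sum_nonneg)
  have edge: "(\<Sum>T\<in>{T \<in> \<T>. e edge_of T}. orient T e * flux T e v) \<le> (\<Sum>T\<in>{T \<in> \<T>. e edge_of T}. G T) + 18 * \<kappa> * ?J e" if e: "e \<in> edges \<T>" for e
  proof -
    have "\<delta> * (\<sigma> * (3 + h0\<^sup>2) * S) + 3 / \<delta> * (\<sigma>\<^sup>2 * (40 + 38 * h0\<^sup>2) * S') = S / 6 + c * S'" for S S'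
    proof -
      have "\<delta> * (\<sigma> * (3 + h0\<^sup>2) * S) = (\<delta> * \<kappa>) * S" by (simp add: \<kappa>_def)
      moreover have "3 / \<delta> * (\<sigma>\<^sup>2 * (40 + 38 * h0\<^sup>2) * S') = c * S'" unfolding \<delta>(3) by (simp add: c_def)
      ultimately show ?thesis unfolding \<delta>(2) by simp
    qed
    then have "\<bar>\<Sum>T\<in>{T \<in> \<T>. e edge_of T}. orient T e * flux T e v\<bar> \<le> (\<Sum>T\<in>{T \<in> \<T>. e edge_of T}. G T) + 3 / \<delta> * ?J e"
      using edge_flux_bound[OF P tr sh v h e \<delta>(1)] by (simp only: G_def)
    then show ?thesis unfolding \<delta>(3) by linarith
  qed
  have "(\<Sum>T\<in>\<T>. ?B T) = (\<Sum>T\<in>\<T>. - (\<Sum>i\<in>UNIV. \<integral>x. v x \<bullet> wgrad T (wgrad T v i) i x \<partial>triM T) + (\<Sum>e\<in>{e. e edge_of T}. orient T e * flux T e v))"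
    by (rule sum.cong[OF refl]) (use element_identity[OF R(2) sh v] in \<open>simp add: flux_def\<close>)
  also have "\<dots> \<le> (\<Sum>T\<in>\<T>. (?A T + ?D T) + (\<Sum>e\<in>{e. e edge_of T}. orient T e * flux T e v))"
    by (intro sum_mono add_right_mono interior_term_bound v)
  also have "\<dots> = (\<Sum>T\<in>\<T>. ?A T + ?D T) + (\<Sum>e\<in>edges \<T>. \<Sum>T\<in>{T \<in> \<T>. e edge_of T}. orient T e * flux T e v)"
    by (simp only: sum.distrib sum_elements_edges(2)[OF tr])
  also have "(\<Sum>e\<in>edges \<T>. \<Sum>T\<in>{T \<in> \<T>. e edge_of T}. orient T e * flux T e v) \<le> (\<Sum>e\<in>edges \<T>. (\<Sum>T\<in>{T \<in> \<T>. e edge_of T}. G T) + 18 * \<kappa> * ?J e)"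
    by (rule sum_mono) (rule edge)
  also have "\<dots> = (\<Sum>T\<in>\<T>. \<Sum>e\<in>{e. e edge_of T}. G T) + 18 * \<kappa> * (\<Sum>e\<in>edges \<T>. ?J e)"
    by (simp only: sum.distrib sum_elements_edges(2)[OF tr] sum_distrib_left)
  also have "(\<Sum>T\<in>\<T>. \<Sum>e\<in>{e. e edge_of T}. G T) \<le> (\<Sum>T\<in>\<T>. 3 * G T)"
  proof (rule sum_mono)
    fix T assume "T \<in> \<T>"
    then have "real (card {e. e edge_of T}) * G T \<le> 3 * G T"
      using simplex2_edges_card(2)[OF R(2)] G0 by (intro mult_right_mono) auto
    then show "(\<Sum>e\<in>{e. e edge_of T}. G T) \<le> 3 * G T" by simp
  qed
  finally have F1: "(\<Sum>T\<in>\<T>. ?B T) \<le> (\<Sum>T\<in>\<T>. ?A T + ?D T) + ((\<Sum>T\<in>\<T>. 3 * G T) + 18 * \<kappa> * (\<Sum>e\<in>edges \<T>. ?J e))"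
    by simp
  have F2: "(\<Sum>T\<in>\<T>. 3 * G T) = ((\<Sum>T\<in>\<T>. ?A T) + (\<Sum>T\<in>\<T>. ?B T) + (\<Sum>T\<in>\<T>. ?D T)) / 2 + 3 * (c * (\<Sum>T\<in>\<T>. ?E T) + c * (\<Sum>T\<in>\<T>. ?D T))"
    unfolding G_def by (simp add: sum_distrib_left[symmetric] sum.distrib sum_divide_distrib[symmetric] distrib_left)
  from F1 F2 show ?thesis unfolding sum.distrib distrib_right mult.assoc by (rule absorb_half)
qed

text \<open>The constants are the largest coefficients after inserting B and D: 108 = 3 (27 + 9),
  162 = 3 * 54 and 108 = 3 * 36. All other coefficients are raised to these.\<close>

lemma combine_bounds:
  fixes A B D E J K N X c k :: real
  assumes X: "X \<le> 3 * (A + B + D)" and B: "B \<le> 3 * A + 6 * c * E + (3 + 6 * c) * (9 * N) + 36 * k * (J + K)" and D: "D \<le> 9 * N"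
    and nn: "0 \<le> A" "0 \<le> E" "0 \<le> J" "0 \<le> K" "0 \<le> N" "0 \<le> c" "0 \<le> k"
  shows "X \<le> (108 + 162 * c + 108 * k) * (N + E + A + J + K)"
proof -
  have p: "0 \<le> c * A" "0 \<le> c * E" "0 \<le> c * J" "0 \<le> c * K" "0 \<le> k * A" "0 \<le> k * E" "0 \<le> k * N"
    by (intro mult_nonneg_nonneg nn)+
  have "3 * (A + B + D) \<le> 3 * (A + (3 * A + 6 * (c * E) + (27 * N + 54 * (c * N)) + (36 * (k * J) + 36 * (k * K))) + 9 * N)"
    using B D by (simp add: algebra_simps)
  also have "\<dots> = 12 * A + 18 * (c * E) + 108 * N + 162 * (c * N) + 108 * (k * J) + 108 * (k * K)"
    by (simp add: algebra_simps)
  also have "\<dots> \<le> 12 * A + 18 * (c * E) + 108 * N + 162 * (c * N) + 108 * (k * J) + 108 * (k * K)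
      + (108 * E + 96 * A + 108 * J + 108 * K + 144 * (c * E) + 162 * (c * A) + 162 * (c * J) + 162 * (c * K) + 108 * (k * N) + 108 * (k * E) + 108 * (k * A))"
    using nn p by simp
  also have "\<dots> = (108 + 162 * c + 108 * k) * (N + E + A + J + K)" by (simp add: algebra_simps)
  finally show ?thesis using X by (rule order_trans[rotated])
qed

theorem theorem2:
  fixes \<Omega> :: "(real^2) set" and \<sigma> :: real
  assumes "bounded_polygon \<Omega>"
  shows "\<exists>C::real. \<forall>\<T>. triangulation_of \<Omega> \<T> \<and> shape_regular \<sigma> \<T> \<longrightarrow>
    (\<forall>v :: real^2 \<Rightarrow> real^2. v \<in> broken_H 2 \<Omega> \<T> \<longrightarrow>
      (broken_H2_norm \<Omega> \<T> v)\<^sup>2 \<le>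
        C * ((broken_l2norm \<T> (broken_grad \<T> (broken_eps \<T> v)))\<^sup>2
           + (l2norm (lebesgue_on \<Omega>) (broken_eps \<T> v))\<^sup>2
           + (l2norm (lebesgue_on \<Omega>) v)\<^sup>2
           + (\<Sum>e\<in>edges \<T>. inverse (diameter e) *
                (l2norm (edge_measure e) (jump_proj \<Omega> \<T> e v))\<^sup>2)
           + (\<Sum>i\<in>UNIV. \<Sum>e\<in>edges \<T>. inverse (diameter e) *
                (l2norm (edge_measure e) (jump_proj \<Omega> \<T> e (broken_partial \<T> i v)))\<^sup>2)))"
proof -
  note PD = polygon_D[OF assms]
  \<comment> \<open>A bound for all element diameters that depends on \<Omega> alone, which makes
    the constant independent of the mesh.\<close>
  define h0 where "h0 = max 1 (diameter \<Omega>)"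
  define \<kappa> where "\<kappa> = \<sigma> * (3 + h0\<^sup>2)"
  define c where "c = 18 * \<kappa> * (\<sigma>\<^sup>2 * (40 + 38 * h0\<^sup>2))"
  show ?thesis
  proof (intro exI[of _ "108 + 162 * c + 108 * \<kappa>"] allI impI, elim conjE)
    fix \<T> and v :: "real^2 \<Rightarrow> real^2"
    assume tr: "triangulation_of \<Omega> \<T>" and reg: "shape_regular \<sigma> \<T>" and vH: "v \<in> broken_H 2 \<Omega> \<T>"
    note R = triangulation_of_D[OF tr]
    have sh: "diameter T \<le> \<sigma> * inball_diameter T" if "T \<in> \<T>" for T using reg that by (simp add: shape_regular_def)
    have v: "H2_on T v" if "T \<in> \<T>" for T
    proof -
      have "v \<in> Hm 2 (interior T)" using vH that unfolding broken_H_def by blast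
      from Hm2_H2_on[OF R(2)[OF that] this] show ?thesis .
    qed
    have vL: "v \<in> L2 (lebesgue_on \<Omega>)" using vH by (simp add: broken_H_def)
    have h: "diameter T \<le> h0" if "T \<in> \<T>" for T
    proof -
      have "diameter T \<le> diameter (closure \<Omega>)" using R(4) that PD(2) by (intro diameter_subset) auto
      then show ?thesis using diameter_closure[OF PD(2)] by (simp add: h0_def)
    qed
    have h1: "1 \<le> h0" by (simp add: h0_def)
    \<comment> \<open>The constant is fixed before the triangulation and for \<sigma> of any sign;
      the existence of one shape-regular element forces \<sigma> to be positive.\<close>
    have "closure \<Omega> \<noteq> {}" using PD(4) unfolding closure_eq_empty .
    then have "\<T> \<noteq> {}" unfolding R(4)[symmetric] by blast
    then obtain T where T: "T \<in> \<T>" by blast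
    obtain e where "e edge_of T" using simplex2_edges_card(3)[OF R(2)[OF T]] by blast
    then obtain a b c' where "tri_edge T e a b c'" using simplex2_edge[OF R(2)[OF T]] by blast
    then have \<sigma>: "0 < \<sigma>" using tri_edge_shape(4)[OF _ sh[OF T]] by blast
    have \<kappa>: "0 < \<kappa>" unfolding \<kappa>_def using \<sigma> by (intro mult_pos_pos add_pos_nonneg) auto
    have c: "0 \<le> c" unfolding c_def using \<kappa> by (intro mult_nonneg_nonneg add_nonneg_nonneg) auto
    let ?N = "(broken_l2norm \<T> (broken_grad \<T> (broken_eps \<T> v)))\<^sup>2"
    let ?E = "(l2norm (lebesgue_on \<Omega>) (broken_eps \<T> v))\<^sup>2" and ?A = "(l2norm (lebesgue_on \<Omega>) v)\<^sup>2"
    let ?J = "\<Sum>e\<in>edges \<T>. inverse (diameter e) * (l2norm (edge_measure e) (jump_proj \<Omega> \<T> e v))\<^sup>2"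
    let ?K = "\<Sum>i\<in>UNIV. \<Sum>e\<in>edges \<T>. inverse (diameter e) * (l2norm (edge_measure e) (jump_proj \<Omega> \<T> e (broken_partial \<T> i v)))\<^sup>2"
    define B where "B = (\<Sum>T\<in>\<T>. grad_sq T v)"
    define D where "D = (\<Sum>T\<in>\<T>. hess_sq T v)"
    have d0: "0 \<le> diameter e" if "e \<in> edges \<T>" for e
    proof -
      obtain T where T: "T \<in> \<T>" "e edge_of T" using \<open>e \<in> edges \<T>\<close> by (auto simp: edges_def)
      obtain a b c where "tri_edge T e a b c" using simplex2_edge[OF R(2)[OF T(1)] T(2)] by blast
      from tri_edge_shape(1,2)[OF this sh[OF T(1)]] show ?thesis by simp
    qed
    have nn: "0 \<le> ?N" "0 \<le> ?E" "0 \<le> ?A" by simp_all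
    have JK: "0 \<le> ?J" "0 \<le> ?K"
      by (intro sum_nonneg mult_nonneg_nonneg zero_le_power2 iffD2[OF inverse_nonnegative_iff_nonnegative] d0; assumption)+
    have eA: "(\<Sum>T\<in>\<T>. (l2norm (triM T) v)\<^sup>2) \<le> ?A" by (rule sum_l2norm_le[OF tr assms vL])
    have "(\<Sum>T\<in>\<T>. eps_sq T v) = (\<Sum>T\<in>\<T>. (l2norm (triM T) (broken_eps \<T> v))\<^sup>2)"
      by (rule sum.cong[OF refl]) (rule broken_grad_norm(2)[OF tr _ v, symmetric])
    then have eE: "(\<Sum>T\<in>\<T>. eps_sq T v) \<le> ?E" using sum_l2norm_le[OF tr assms broken_eps_L2[OF tr assms v]] by simp
    have "D \<le> (\<Sum>T\<in>\<T>. 9 * (l2norm (triM T) (broken_grad \<T> (broken_eps \<T> v)))\<^sup>2)"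
      unfolding D_def by (rule sum_mono) (rule hessian_le_strain_gradient[OF tr _ v])
    then have eD: "D \<le> 9 * ?N" by (simp add: broken_l2norm_sq sum_distrib_left)
    have "?J + ?K = (\<Sum>e\<in>edges \<T>. inverse (diameter e) * ((l2norm (edge_measure e) (jump_proj \<Omega> \<T> e v))\<^sup>2
        + (\<Sum>i\<in>UNIV. (l2norm (edge_measure e) (jump_proj \<Omega> \<T> e (broken_partial \<T> i v)))\<^sup>2)))"
      by (subst sum.swap[of _ "edges \<T>" UNIV]) (simp add: distrib_left sum.distrib sum_distrib_left)
    then have "B \<le> 3 * (\<Sum>T\<in>\<T>. (l2norm (triM T) v)\<^sup>2) + 6 * c * (\<Sum>T\<in>\<T>. eps_sq T v) + (3 + 6 * c) * D + 36 * \<kappa> * (?J + ?K)"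
      using broken_gradient_bound[OF assms tr sh v h h1 \<sigma>] by (simp add: B_def D_def c_def \<kappa>_def)
    also have "\<dots> \<le> 3 * ?A + 6 * c * ?E + (3 + 6 * c) * (9 * ?N) + 36 * \<kappa> * (?J + ?K)"
      using eA eE eD c by (intro add_mono mult_left_mono order_refl) auto
    finally have B: "B \<le> 3 * ?A + 6 * c * ?E + (3 + 6 * c) * (9 * ?N) + 36 * \<kappa> * (?J + ?K)" .
    have "(broken_H2_norm \<Omega> \<T> v)\<^sup>2 \<le> 3 * (?A + (broken_l2norm \<T> (broken_grad \<T> v))\<^sup>2 + (broken_l2norm \<T> (broken_grad \<T> (broken_grad \<T> v)))\<^sup>2)"
      unfolding broken_H2_norm_def
      using norm_add3_sq_le[of "l2norm (lebesgue_on \<Omega>) v" "broken_l2norm \<T> (broken_grad \<T> v)" "broken_l2norm \<T> (broken_grad \<T> (broken_grad \<T> v))"] by simp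
    also have "(broken_l2norm \<T> (broken_grad \<T> v))\<^sup>2 = B"
      unfolding broken_l2norm_sq B_def by (rule sum.cong[OF refl]) (rule broken_grad_norm(1)[OF tr _ v])
    also have "(broken_l2norm \<T> (broken_grad \<T> (broken_grad \<T> v)))\<^sup>2 = D"
      unfolding broken_l2norm_sq D_def by (rule sum.cong[OF refl]) (rule hessian_norm[OF tr _ v])
    finally have F: "(broken_H2_norm \<Omega> \<T> v)\<^sup>2 \<le> 3 * (?A + B + D)" .
    show "(broken_H2_norm \<Omega> \<T> v)\<^sup>2 \<le> (108 + 162 * c + 108 * \<kappa>) * (?N + ?E + ?A + ?J + ?K)"
      by (rule combine_bounds[OF F B eD nn(3,2) JK nn(1) c less_imp_le[OF \<kappa>]])
  qed
qed

end
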